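(* Let $\alpha>0$, $\kappa>0$, $\mathbf{u}_0\in V\cap H^3(\mathbb{T}^3)$, $\theta_0\in L^2(\mathbb{T}^3)$, and let $T>0$ be arbitrary. Then there exists a solution $(\mathbf{u},\theta)$ on $[0,T]$ of the three-dimensional Boussinesq–Voigt system $$(I+\alpha^2A)\partial_t\mathbf{u}+P_\sigma\big((\mathbf{u}\cdot\nabla)\mathbf{u}\big)=P_\sigma(\theta\mathbf{e}_3),\qquad\partial_t\theta+\nabla\cdot(\mathbf{u}\theta)=\kappa\Delta\theta,\qquad\mathbf{u}(0)=\mathbf{u}_0,\ \theta(0)=\theta_0,$$ in the sense that the first equation holds in $L^2([0,T],V)$, the second in $L^2([0,T],H^{-1})$, and $\mathbf{u}\in C([0,T],V\cap H^3)$, $\partial_t\mathbf{u}\in L^\infty([0,T],\mathcal{D}(A))\cap L^2([0,T],V\cap H^3)$, $\theta\in L^2([0,T],H^1)\cap C_w([0,T],L^2)$, $\partial_t\theta\in L^2([0,T],H^{-1})$. Furthermore, if $\theta_0\in L^p(\mathbb{T}^3)$ for some $p\in[2,\infty]$, then $\theta\in L^\infty([0,T],L^p)$. In the case $\theta_0\in L^\infty(\mathbb{T}^3)$, the solution is unique.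
   Context: $\mathbb{T}^3=[0,1]^3$ with periodic boundary conditions; all functions are periodic with zero spatial average, and $L^p$, $H^s$ denote such mean-zero spaces; $H^{-1}$ is the dual of mean-zero $H^1$. $H$, $V$ are the closures in $L^2$, $H^1$ of mean-zero divergence-free vector trigonometric polynomials on $\mathbb{T}^3$; $P_\sigma$ is the Leray–Helmholtz projection; $A=-P_\sigma\Delta=-\Delta$ with $\mathcal{D}(A)=H^2\cap V$; $\mathbf{e}_3=(0,0,1)$; $C_w$ denotes weak continuity. *)

theory Defs
  imports "HOL-Analysis.Analysis"
begin

text \<open>A (mean-zero, real) scalar field on the torus is represented by its Fourier
coefficients c : Z^3 -> C w.r.t. the basis exp(2 pi i k.x); a vector field by
coefficients in C^3.  The gradient has symbol 2 pi i k, and A = -Delta has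
symbol (2 pi)^2 |k|^2.\<close>

type_synonym wn = "int \<times> int \<times> int"
type_synonym sfield = "wn \<Rightarrow> complex"
type_synonym vfield = "wn \<Rightarrow> complex^3"

definition kvec :: "wn \<Rightarrow> complex^3" where
  "kvec k = (case k of (a,b,c) \<Rightarrow> vector [of_int a, of_int b, of_int c])"

definition kreal :: "wn \<Rightarrow> real^3" where
  "kreal k = (case k of (a,b,c) \<Rightarrow> vector [of_int a, of_int b, of_int c])"

definition ksq :: "wn \<Rightarrow> real" where
  "ksq k = (case k of (a,b,c) \<Rightarrow> of_int (a^2 + b^2 + c^2))"

definition negk :: "wn \<Rightarrow> wn" where
  "negk k = (case k of (a,b,c) \<Rightarrow> (-a,-b,-c))"

definition subk :: "wn \<Rightarrow> wn \<Rightarrow> wn" where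
  "subk k m = (case k of (a,b,c) \<Rightarrow> case m of (a',b',c') \<Rightarrow> (a-a', b-b', c-c'))"

definition cdot :: "complex^3 \<Rightarrow> complex^3 \<Rightarrow> complex" where
  "cdot a b = (\<Sum>i\<in>UNIV. a$i * b$i)"

definition e3 :: "complex^3" where
  "e3 = vector [0, 0, 1]"

definition cconj3 :: "complex^3 \<Rightarrow> complex^3" where
  "cconj3 v = (\<chi> i. cnj (v$i))"

definition real_sf :: "sfield \<Rightarrow> bool" where
  "real_sf c \<longleftrightarrow> (\<forall>k. c (negk k) = cnj (c k))"

definition real_vf :: "vfield \<Rightarrow> bool" where
  "real_vf c \<longleftrightarrow> (\<forall>k. c (negk k) = cconj3 (c k))"

text \<open>squared homogeneous H^s norm  sum_k |k|^(2s) |c_k|^2  (equivalent to the H^s norm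
on mean-zero functions)\<close>
definition hs_sq :: "real \<Rightarrow> sfield \<Rightarrow> ennreal" where
  "hs_sq s c = (\<integral>\<^sup>+ k. ennreal (ksq k powr s * (cmod (c k))\<^sup>2) \<partial>count_space UNIV)"

definition hsv_sq :: "real \<Rightarrow> vfield \<Rightarrow> ennreal" where
  "hsv_sq s c = (\<integral>\<^sup>+ k. ennreal (ksq k powr s * (norm (c k))\<^sup>2) \<partial>count_space UNIV)"

text \<open>mean-zero real H^s(T^3) (s = 0: L^2, s = -1: H^{-1}, the dual of mean-zero H^1)\<close>
definition Hs :: "real \<Rightarrow> sfield set" where
  "Hs s = {c. c (0,0,0) = 0 \<and> real_sf c \<and> hs_sq s c < \<infinity>}"

definition Hsv :: "real \<Rightarrow> vfield set" where
  "Hsv s = {c. c (0,0,0) = 0 \<and> real_vf c \<and> hsv_sq s c < \<infinity>}"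

definition divfree :: "vfield set" where
  "divfree = {c. \<forall>k. cdot (kvec k) (c k) = 0}"

definition Vsp :: "vfield set" where "Vsp = Hsv 1 \<inter> divfree"
definition DA :: "vfield set" where "DA = Hsv 2 \<inter> divfree"
definition VH3 :: "vfield set" where "VH3 = Hsv 3 \<inter> divfree"

definition cube :: "(real^3) set" where
  "cube = cbox 0 (\<chi> i. 1)"

definition fourier_coeff :: "(real^3 \<Rightarrow> real) \<Rightarrow> sfield" where
  "fourier_coeff f k = (LINT x:cube|lborel. complex_of_real (f x) *
       exp (- (2 * pi * \<i>) * complex_of_real (inner (kreal k) x)))"

definition Lp_bound :: "real \<Rightarrow> sfield \<Rightarrow> real \<Rightarrow> bool" where
  "Lp_bound p c C \<longleftrightarrow> (\<exists>f. f \<in> borel_measurable lborel \<and>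
      (\<integral>\<^sup>+ x\<in>cube. ennreal (\<bar>f x\<bar> powr p) \<partial>lborel) \<le> ennreal C \<and>
      (\<forall>k. c k = fourier_coeff f k))"

definition Linf_bound :: "sfield \<Rightarrow> real \<Rightarrow> bool" where
  "Linf_bound c C \<longleftrightarrow> (\<exists>f. f \<in> borel_measurable lborel \<and>
      (AE x in lborel. x \<in> cube \<longrightarrow> \<bar>f x\<bar> \<le> C) \<and>
      (\<forall>k. c k = fourier_coeff f k))"

definition in_Lp :: "real \<Rightarrow> sfield \<Rightarrow> bool" where
  "in_Lp p c \<longleftrightarrow> (\<exists>C. Lp_bound p c C)"

definition in_Linf :: "sfield \<Rightarrow> bool" where
  "in_Linf c \<longleftrightarrow> (\<exists>C. Linf_bound c C)"

text \<open>Strong measurability into a separable Hilbert space of sequences is (Pettis)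
measurability of every Fourier coefficient.\<close>
definition meas_s :: "real \<Rightarrow> (real \<Rightarrow> sfield) \<Rightarrow> bool" where
  "meas_s T f \<longleftrightarrow> (\<forall>k. (\<lambda>t. f t k) \<in> borel_measurable (restrict_space lborel {0..T}))"

definition meas_v :: "real \<Rightarrow> (real \<Rightarrow> vfield) \<Rightarrow> bool" where
  "meas_v T f \<longleftrightarrow> (\<forall>k. (\<lambda>t. f t k) \<in> borel_measurable (restrict_space lborel {0..T}))"

definition L2T_s :: "real \<Rightarrow> real \<Rightarrow> sfield set \<Rightarrow> (real \<Rightarrow> sfield) \<Rightarrow> bool" where
  "L2T_s T s X f \<longleftrightarrow> meas_s T f \<and> (AE t in lborel. t \<in> {0..T} \<longrightarrow> f t \<in> X) \<and>
      (\<integral>\<^sup>+ t\<in>{0..T}. hs_sq s (f t) \<partial>lborel) < \<infinity>"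

definition L2T_v :: "real \<Rightarrow> real \<Rightarrow> vfield set \<Rightarrow> (real \<Rightarrow> vfield) \<Rightarrow> bool" where
  "L2T_v T s X f \<longleftrightarrow> meas_v T f \<and> (AE t in lborel. t \<in> {0..T} \<longrightarrow> f t \<in> X) \<and>
      (\<integral>\<^sup>+ t\<in>{0..T}. hsv_sq s (f t) \<partial>lborel) < \<infinity>"

definition LinfT_v :: "real \<Rightarrow> real \<Rightarrow> vfield set \<Rightarrow> (real \<Rightarrow> vfield) \<Rightarrow> bool" where
  "LinfT_v T s X f \<longleftrightarrow> meas_v T f \<and>
      (\<exists>C. AE t in lborel. t \<in> {0..T} \<longrightarrow> f t \<in> X \<and> hsv_sq s (f t) \<le> ennreal C)"

definition CT_v :: "real \<Rightarrow> real \<Rightarrow> vfield set \<Rightarrow> (real \<Rightarrow> vfield) \<Rightarrow> bool" where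
  "CT_v T s X f \<longleftrightarrow> (\<forall>t\<in>{0..T}. f t \<in> X \<and>
      ((\<lambda>\<tau>. hsv_sq s (\<lambda>k. f \<tau> k - f t k)) \<longlongrightarrow> 0) (at t within {0..T}))"

definition CwT_L2 :: "real \<Rightarrow> (real \<Rightarrow> sfield) \<Rightarrow> bool" where
  "CwT_L2 T f \<longleftrightarrow> (\<forall>t\<in>{0..T}. f t \<in> Hs 0) \<and>
      (\<forall>\<phi>\<in>Hs 0. continuous_on {0..T} (\<lambda>t. \<Sum>\<^sub>\<infinity>k. f t k * cnj (\<phi> k)))"

definition LinfT_Lp :: "real \<Rightarrow> real \<Rightarrow> (real \<Rightarrow> sfield) \<Rightarrow> bool" where
  "LinfT_Lp T p f \<longleftrightarrow> (\<exists>C. AE t in lborel. t \<in> {0..T} \<longrightarrow> Lp_bound p (f t) C)"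

definition LinfT_Linf :: "real \<Rightarrow> (real \<Rightarrow> sfield) \<Rightarrow> bool" where
  "LinfT_Linf T f \<longleftrightarrow> (\<exists>C. AE t in lborel. t \<in> {0..T} \<longrightarrow> Linf_bound (f t) C)"

text \<open>g is the (weak) time derivative of f on [0,T]: each Fourier coefficient of f is
absolutely continuous with derivative the corresponding coefficient of g\<close>
definition tderiv_s :: "real \<Rightarrow> (real \<Rightarrow> sfield) \<Rightarrow> (real \<Rightarrow> sfield) \<Rightarrow> bool" where
  "tderiv_s T f g \<longleftrightarrow> (\<forall>k. \<forall>t\<in>{0..T}. set_integrable lborel {0..t} (\<lambda>s. g s k) \<and>
      f t k = f 0 k + (LINT s:{0..t}|lborel. g s k))"

definition tderiv_v :: "real \<Rightarrow> (real \<Rightarrow> vfield) \<Rightarrow> (real \<Rightarrow> vfield) \<Rightarrow> bool" where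
  "tderiv_v T f g \<longleftrightarrow> (\<forall>k. \<forall>t\<in>{0..T}. set_integrable lborel {0..t} (\<lambda>s. g s k) \<and>
      f t k = f 0 k + (LINT s:{0..t}|lborel. g s k))"

definition leray :: "vfield \<Rightarrow> vfield" where
  "leray v k = (if k = (0,0,0) then 0
      else v k - (cdot (kvec k) (v k) / of_real (ksq k)) *s kvec k)"

definition advect :: "vfield \<Rightarrow> vfield" where
  "advect u k = (\<Sum>\<^sub>\<infinity>m. cdot (u (subk k m)) ((2 * pi * \<i>) *s kvec m) *s u m)"

definition div_flux :: "vfield \<Rightarrow> sfield \<Rightarrow> sfield" where
  "div_flux u \<theta> k = cdot ((2 * pi * \<i>) *s kvec k) (\<Sum>\<^sub>\<infinity>m. \<theta> m *s u (subk k m))"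

definition symA :: "wn \<Rightarrow> real" where
  "symA k = (2 * pi)\<^sup>2 * ksq k"

definition bv_solution ::
  "real \<Rightarrow> real \<Rightarrow> vfield \<Rightarrow> sfield \<Rightarrow> real \<Rightarrow> (real \<Rightarrow> vfield) \<Rightarrow> (real \<Rightarrow> sfield) \<Rightarrow> bool" where
  "bv_solution \<alpha> \<kappa> u0 \<theta>0 T u \<theta> \<longleftrightarrow>
    (\<exists>ut \<theta>t.
       CT_v T 3 VH3 u \<and>
       tderiv_v T u ut \<and> LinfT_v T 2 DA ut \<and> L2T_v T 3 VH3 ut \<and>
       L2T_s T 1 (Hs 1) \<theta> \<and> CwT_L2 T \<theta> \<and>
       tderiv_s T \<theta> \<theta>t \<and> L2T_s T (-1) (Hs (-1)) \<theta>t \<and>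
       (AE t in lborel. t \<in> {0..T} \<longrightarrow>
          (\<forall>k. (1 + \<alpha>\<^sup>2 * symA k) *\<^sub>R ut t k + leray (advect (u t)) k
                 = leray (\<lambda>m. \<theta> t m *s e3) k)) \<and>
       (AE t in lborel. t \<in> {0..T} \<longrightarrow>
          (\<forall>k. \<theta>t t k + div_flux (u t) (\<theta> t) k = - (\<kappa> * symA k) *\<^sub>R \<theta> t k)) \<and>
       u 0 = u0 \<and> \<theta> 0 = \<theta>0)"

end

theory Submission
  imports Defs
begin

text \<open>The temperature is advanced by an explicit conservative central difference scheme. Its weights are
positive for small time steps, and the discrete divergence of a slightly modified velocity vanishes, so
that every step is a doubly averaging operation: by Jensen's inequality no convex integral of the
temperature grows, which yields all \<open>L\<^sup>p\<close> bounds at once. The velocity is a Galerkin truncation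
advanced by Euler steps; as \<open>I + \<alpha>\<^sup>2A\<close> gains two derivatives, energy and enstrophy stay bounded
uniformly in the truncation. The Fourier coefficients are Lipschitz in time up to the step size, so a
diagonal subsequence converges at every time, and weak lower semicontinuity preserves the convex bounds.

For uniqueness, the difference of two solutions is measured in \<open>H\<^sup>2 \<times> L\<^sup>2\<close>. The Fourier coefficients
of an \<open>H\<^sup>2\<close> field are summable, so the products are controlled by convolutions of \<open>l\<^sup>1\<close> with
\<open>l\<^sup>2\<close>, Young's inequality absorbs the flux into the diffusion mode by mode, and Gronwall's
inequality applies. Uniqueness also identifies the solutions constructed from different representatives of
\<open>\<theta>0\<close>, so that a bound of any one of them passes to the solution.\<close>

section \<open>Sums over wave numbers\<close>

text \<open>The two unknowns live in different pictures on purpose. A Galerkin truncation of the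
  temperature would destroy the maximum principle, so \<theta> stays a function on the cube that is
  only averaged, while the velocity is a finite set of coefficients. They meet through trigonometric
  multipliers, whose product with \<theta> is a finite convolution. Convergence of each single
  coefficient of \<theta> is enough in the limit: every nonlinear term contains a velocity bounded
  in H^2, whose Fourier tails are uniformly small. Mesh and time step are chosen after the
  truncation, hence constants that blow up with the number of modes are harmless if they come with a
  factor h or an extra \<tau>. The H^2 bound must not depend on the truncation; it closes because
  the L^2 norm of (u . grad) u is bounded by H^1 norm times H^2 norm, so that the enstrophy
  inequality is linear once the energy is bounded. Sums over wave numbers take values in the
  extended nonnegative reals, which lets estimates precede any proof of summability.\<close>

abbreviation nns :: "(wn \<Rightarrow> ennreal) \<Rightarrow> ennreal" where
  "nns f \<equiv> (\<integral>\<^sup>+ k. f k \<partial>count_space UNIV)"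

abbreviation mag :: "(wn \<Rightarrow> 'a::real_normed_vector) \<Rightarrow> wn \<Rightarrow> ennreal" where
  "mag a \<equiv> (\<lambda>k. ennreal (norm (a k)))"

abbreviation l2sq :: "(wn \<Rightarrow> 'a::real_normed_vector) \<Rightarrow> ennreal" where
  "l2sq a \<equiv> nns (\<lambda>k. ennreal ((norm (a k))\<^sup>2))"

abbreviation h2sq :: "(wn \<Rightarrow> 'a::real_normed_vector) \<Rightarrow> ennreal" where
  "h2sq a \<equiv> nns (\<lambda>k. ennreal ((ksq k)\<^sup>2 * (norm (a k))\<^sup>2))"

section \<open>Wave numbers as a lattice group and their norms\<close>

lemma zero_wn: "(0,0,0) = (0::wn)"
  by (simp add: zero_prod_def)

lemma subk_eq: "subk k m = k - m"
  by (cases k; cases m) (simp add: subk_def)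

lemma negk_eq: "negk k = - k"
  by (cases k) (simp add: negk_def)

lemma ksq_nonneg [simp]: "ksq k \<ge> 0"
  by (cases k) (simp add: ksq_def)

lemma ksq_0 [simp]: "ksq 0 = 0"
  by (simp add: ksq_def zero_prod_def)

lemma ksq_ge_1: "k \<noteq> 0 \<Longrightarrow> ksq k \<ge> 1"
proof -
  assume k: "k \<noteq> 0"
  obtain a b c where abc: "k = (a,b,c)" by (cases k)
  have "a^2 + b^2 + c^2 \<noteq> 0"
    using k abc by (auto simp: zero_prod_def add_nonneg_eq_0_iff)
  moreover have "a^2 + b^2 + c^2 \<ge> 0" by simp
  ultimately have "a^2 + b^2 + c^2 \<ge> 1" by linarith
  then have "real_of_int (a^2 + b^2 + c^2) \<ge> 1" by (metis of_int_1 of_int_le_iff)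
  then show ?thesis by (simp add: ksq_def abc)
qed

lemma ksq_pos: "k \<noteq> 0 \<Longrightarrow> ksq k > 0"
  using ksq_ge_1[of k] by linarith

lemma ksq_eq_0_iff [simp]: "ksq k = 0 \<longleftrightarrow> k = 0"
  using ksq_pos[of k] ksq_0 by (metis less_irrefl)

lemma ksq_minus [simp]: "ksq (- k) = ksq k"
  by (cases k) (simp add: ksq_def)

lemma kreal_simps [simp]:
  "kreal (k + m) = kreal k + kreal m" "kreal (- k) = - kreal k" "kreal (k - m) = kreal k - kreal m"
  "kreal 0 = 0"
  by (cases k; cases m; simp add: kreal_def vec_eq_iff forall_3 zero_prod_def)+

lemma kvec_nth: "kvec k $ j = of_real (kreal k $ j)"
proof -
  have "\<forall>j. kvec k $ j = of_real (kreal k $ j)"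
    by (cases k) (simp add: kvec_def kreal_def forall_3)
  then show ?thesis ..
qed

lemma kvec_simps [simp]:
  "kvec (k + m) = kvec k + kvec m" "kvec (- k) = - kvec k" "kvec (k - m) = kvec k - kvec m"
  "kvec 0 = 0"
  by (simp_all add: vec_eq_iff kvec_nth)

lemma ksq_norm: "ksq k = (norm (kreal k))\<^sup>2"
  by (cases k) (simp add: ksq_def kreal_def norm_vec_def L2_set_def sum_3)

lemma norm_kvec: "norm (kvec k) = sqrt (ksq k)"
  by (simp add: ksq_norm norm_vec_def L2_set_def kvec_nth sum_nonneg)

lemma abs_kreal_le: "\<bar>kreal k $ j\<bar> \<le> sqrt (ksq k)"
  by (simp add: ksq_norm component_le_norm_cart)

lemma sqrt_ksq_triangle: "sqrt (ksq (k + m)) \<le> sqrt (ksq k) + sqrt (ksq m)"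
  by (simp add: ksq_norm norm_triangle_ineq)

section \<open>Calculus of sums with extended nonnegative values\<close>

lemma nns_reflect: "nns (\<lambda>m. f (k - m)) = nns f"
proof -
  have "bij_betw (\<lambda>m. k - m) (UNIV::wn set) UNIV"
    by (rule bij_betwI[where g="\<lambda>m. k - m"]) auto
  then show ?thesis by (rule nn_integral_bij_count_space)
qed

lemma nns_shift: "nns (\<lambda>m. f (m - k)) = nns f"
proof -
  have "bij_betw (\<lambda>m. m - k) (UNIV::wn set) UNIV"
    by (rule bij_betwI[where g="\<lambda>m. m + k"]) auto
  then show ?thesis by (rule nn_integral_bij_count_space)
qed

lemma nns_swap: "nns (\<lambda>k. nns (\<lambda>m. f k m)) = nns (\<lambda>m. nns (\<lambda>k. f k m))"
  by (subst nn_integral_count_space_nn_integral) auto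

lemma nns_cmult: "nns (\<lambda>k. c * f k) = c * nns f"
  by (rule nn_integral_cmult) simp

lemma nns_multc: "nns (\<lambda>k. f k * c) = nns f * c"
  by (rule nn_integral_multc) simp

lemma nns_add: "nns (\<lambda>k. f k + g k) = nns f + nns g"
  by (rule nn_integral_add) auto

lemma nns_mono: "(\<And>k. f k \<le> g k) \<Longrightarrow> nns f \<le> nns g"
  by (rule nn_integral_mono) auto

lemma nns_ge: "f k \<le> nns f"
proof -
  have "f k = nns (\<lambda>m. f k * indicator {k} m)"
    by (simp add: nn_integral_cmult)
  also have "\<dots> \<le> nns f"
    by (rule nns_mono) (auto split: split_indicator)
  finally show ?thesis .
qed

lemma nns_integral_swap:
  assumes "\<And>k. f k \<in> borel_measurable M"
  shows "(\<integral>\<^sup>+x. nns (\<lambda>k. f k x) \<partial>M) = nns (\<lambda>k. \<integral>\<^sup>+x. f k x \<partial>M)"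
  using assms by (intro nn_integral_count_space_nn_integral) auto

lemma borel_measurable_nns:
  assumes "\<And>k. f k \<in> borel_measurable M"
  shows "(\<lambda>x. nns (\<lambda>k. f k x)) \<in> borel_measurable M"
proof -
  interpret sigma_finite_measure "count_space (UNIV::wn set)"
    by (rule sigma_finite_measure_count_space)
  have "(\<lambda>(k,x). f k x) \<in> borel_measurable (count_space UNIV \<Otimes>\<^sub>M M)"
    by (rule measurable_pair_measure_countable1) (use assms in auto)
  then have "(\<lambda>(x,k). f k x) \<in> borel_measurable (M \<Otimes>\<^sub>M count_space UNIV)"
    using measurable_pair_swap by fastforce
  then show ?thesis
    by (rule borel_measurable_nn_integral)
qed

lemma nns_finite_sum_le: "finite F \<Longrightarrow> (\<Sum>k\<in>F. f k) \<le> nns f"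
proof -
  assume F: "finite F"
  have "(\<Sum>k\<in>F. f k) = nns (\<lambda>k. \<Sum>m\<in>F. f m * indicator {m} k)"
    using F by (subst nn_integral_sum) (auto simp: nn_integral_cmult)
  also have "\<dots> \<le> nns f"
  proof (rule nns_mono)
    fix k
    show "(\<Sum>m\<in>F. f m * indicator {m} k) \<le> f k"
    proof (cases "k \<in> F")
      case True
      have "(\<Sum>m\<in>F. f m * indicator {m} k) = (\<Sum>m\<in>F. if m = k then f k else 0)"
        by (rule sum.cong) (auto split: split_indicator)
      then show ?thesis using F True by simp
    next
      case False
      have "(\<Sum>m\<in>F. f m * indicator {m} k) = 0"
        using False by (intro sum.neutral) (auto split: split_indicator)
      then show ?thesis by simp
    qed
  qed
  finally show ?thesis .
qed

text \<open>Monotone convergence along the finite sets given by the enumeration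
  \<open>to_nat\<close>. In this way bounds on finitely many modes (Bessel's inequality, limits
  taken mode by mode) become bounds on the full sum.\<close>

lemma nns_le_finite_sums:
  assumes "\<And>F. finite F \<Longrightarrow> (\<Sum>k\<in>F. f k) \<le> C"
  shows "nns f \<le> C"
proof -
  have "nns f = (SUP F\<in>{F. finite F}. \<Sum>k\<in>F. f k)"
  proof (rule antisym)
    have inc: "\<And>k. f k = (SUP n. f k * indicator {k. to_nat k < n} k)"
    proof -
      fix k
      show "f k = (SUP n. f k * indicator {k. to_nat k < n} k)"
        by (rule antisym) (auto intro!: SUP_upper2[of "Suc (to_nat k)"] SUP_least split: split_indicator)
    qed
    have fin: "finite {k::wn. to_nat k < n}" for n
      by (rule finite_imageD[of to_nat]) (auto intro: finite_subset[of _ "{..<n}"] inj_onI)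
    have "nns f = nns (\<lambda>k. SUP n. f k * indicator {k. to_nat k < n} k)"
      by (rule nn_integral_cong) (use inc in simp)
    also have "\<dots> = (SUP n. nns (\<lambda>k. f k * indicator {k. to_nat k < n} k))"
      by (rule nn_integral_monotone_convergence_SUP)
        (auto simp: incseq_def le_fun_def split: split_indicator)
    also have "\<dots> \<le> (SUP F\<in>{F. finite F}. \<Sum>k\<in>F. f k)"
    proof (rule SUP_least)
      fix n
      have "nns (\<lambda>k. f k * indicator {k. to_nat k < n} k) = (\<Sum>k\<in>{k. to_nat k < n}. f k)"
        using fin by (subst nn_integral_count_space'[of "{k. to_nat k < n}"]) (auto intro!: sum.cong)
      also have "\<dots> \<le> (SUP F\<in>{F. finite F}. \<Sum>k\<in>F. f k)"
        using fin by (intro SUP_upper) auto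
      finally show "nns (\<lambda>k. f k * indicator {k. to_nat k < n} k) \<le> (SUP F\<in>{F. finite F}. \<Sum>k\<in>F. f k)" .
    qed
    finally show "nns f \<le> (SUP F\<in>{F. finite F}. \<Sum>k\<in>F. f k)" .
  qed (auto intro!: SUP_least nns_finite_sum_le)
  also have "\<dots> \<le> C" using assms by (auto intro!: SUP_least)
  finally show ?thesis .
qed

lemma nns_finite_support:
  assumes "finite F" "\<And>k. k \<notin> F \<Longrightarrow> f k = 0"
  shows "nns f = (\<Sum>k\<in>F. f k)"
  using assms by (intro nn_integral_count_space') auto

text \<open>If every finite set left a tail larger than e, every finite sum would be at most r - e,
  although their supremum is r. Only r = 0 would survive this, and then the empty set has a small
  tail.\<close>

lemma nns_tail:
  assumes "nns f < \<infinity>" "e > 0"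
  shows "\<exists>F. finite F \<and> nns (\<lambda>k. f k * indicator (- F) k) \<le> ennreal e"
proof (rule ccontr)
  assume neg: "\<not> ?thesis"
  obtain r where r: "nns f = ennreal r" "r \<ge> 0"
    using assms(1) by (cases "nns f") auto
  have split: "(\<Sum>k\<in>F. f k) + nns (\<lambda>k. f k * indicator (- F) k) = nns f" if "finite F" for F
  proof -
    have "(\<Sum>k\<in>F. f k) = nns (\<lambda>k. f k * indicator F k)"
      using that by (subst nns_finite_support[of F]) auto
    moreover have "nns f = nns (\<lambda>k. f k * indicator F k + f k * indicator (- F) k)"
      by (rule nn_integral_cong) (auto split: split_indicator)
    ultimately show ?thesis by (simp only: nns_add)
  qed
  have "nns f \<le> ennreal (max 0 (r - e))"
  proof (rule nns_le_finite_sums)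
    fix F :: "wn set" assume F: "finite F"
    have gt: "nns (\<lambda>k. f k * indicator (- F) k) > ennreal e" using neg F by (auto simp: not_le)
    have s: "(\<Sum>k\<in>F. f k) \<le> nns f" using nns_finite_sum_le[OF F] .
    obtain x where x: "(\<Sum>k\<in>F. f k) = ennreal x" "x \<ge> 0"
      using s r by (cases "\<Sum>k\<in>F. f k") (auto simp: top_unique)
    obtain y where y: "nns (\<lambda>k. f k * indicator (- F) k) = ennreal y" "y \<ge> 0"
      using split[OF F] r x by (cases "nns (\<lambda>k. f k * indicator (- F) k)") auto
    have "x + y = r" using split[OF F] r x y by (simp add: ennreal_plus[symmetric] del: ennreal_plus)
    moreover have "y > e" using gt y assms(2) by (simp add: ennreal_less_iff)
    ultimately show "(\<Sum>k\<in>F. f k) \<le> ennreal (max 0 (r - e))" using x by (simp add: ennreal_leI)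
  qed
  then have "r \<le> max 0 (r - e)" using r by (metis ennreal_le_iff max.cobounded1)
  then have "r = 0" using assms(2) r by linarith
  then have "nns (\<lambda>k. f k * indicator (- {}) k) \<le> ennreal e" using r by simp
  then show False using neg by blast
qed

text \<open>The way back from extended sums to \<open>infsum\<close>: a finite extended sum of the
  norms is the certificate of summability used for all series below.\<close>

lemma summable_of_nns:
  fixes f :: "wn \<Rightarrow> 'a::banach"
  assumes "nns (mag f) < \<infinity>"
  shows "(\<lambda>m. norm (f m)) summable_on UNIV" "f summable_on UNIV"
    "ennreal (\<Sum>\<^sub>\<infinity>m. norm (f m)) = nns (mag f)"
proof -
  obtain r where r: "nns (mag f) = ennreal r" "r \<ge> 0"
    using assms by (cases "nns (mag f)") auto
  have b: "(\<Sum>m\<in>F. norm (f m)) \<le> r" if "finite F" for F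
    using nns_finite_sum_le[OF that, of "\<lambda>m. ennreal (norm (f m))"] r by simp
  show 1: "(\<lambda>m. norm (f m)) summable_on UNIV"
    using b by (intro nonneg_bdd_above_summable_on) (auto intro!: bdd_aboveI)
  then show "f summable_on UNIV" by (rule abs_summable_summable)
  show "ennreal (\<Sum>\<^sub>\<infinity>m. norm (f m)) = nns (mag f)"
  proof (rule antisym)
    have "(\<Sum>\<^sub>\<infinity>m. norm (f m)) \<le> r"
      using b by (intro infsum_le_finite_sums[OF 1]) auto
    then show "ennreal (\<Sum>\<^sub>\<infinity>m. norm (f m)) \<le> nns (mag f)"
      using r by (simp add: ennreal_leI)
    show "nns (mag f) \<le> ennreal (\<Sum>\<^sub>\<infinity>m. norm (f m))"
      by (rule nns_le_finite_sums) (auto intro!: ennreal_leI finite_sum_le_infsum 1)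
  qed
qed

lemma norm_infsum_le_nns:
  fixes f :: "wn \<Rightarrow> 'a::banach"
  shows "ennreal (norm (infsum f UNIV)) \<le> nns (mag f)"
proof (cases "nns (mag f) < \<infinity>")
  case True
  show ?thesis
    using norm_infsum_bound[OF summable_of_nns(1)[OF True]] summable_of_nns(3)[OF True]
    by (metis ennreal_leI)
next
  case False
  then show ?thesis by (simp add: not_less top_unique)
qed

lemma ennreal_sq_add_le: "((x::ennreal) + y)\<^sup>2 \<le> 2 * x\<^sup>2 + 2 * y\<^sup>2"
proof (cases "x = top \<or> y = top")
  case False
  then obtain a b where "x = ennreal a" "a \<ge> 0" "y = ennreal b" "b \<ge> 0" by (metis ennreal_cases)
  moreover have "(a + b)\<^sup>2 \<le> 2 * a\<^sup>2 + 2 * b\<^sup>2" using sum_squares_bound[of a b] by (simp add: power2_eq_square algebra_simps)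
  ultimately show ?thesis
    by (simp add: ennreal_plus[symmetric] ennreal_power numeral_mult_ennreal ennreal_leI del: ennreal_plus)
qed (auto simp: power2_eq_square ennreal_mult_top)

lemma nns_weighted_add:
  assumes w: "\<And>k. w k \<ge> 0"
  shows "nns (\<lambda>k. ennreal (w k * (norm (a k + b k))\<^sup>2))
    \<le> 2 * nns (\<lambda>k. ennreal (w k * (norm (a k))\<^sup>2)) + 2 * nns (\<lambda>k. ennreal (w k * (norm (b k))\<^sup>2))"
  unfolding nns_cmult[symmetric] nns_add[symmetric]
proof (rule nns_mono)
  fix k
  have "ennreal (norm (a k + b k)) \<le> ennreal (norm (a k)) + ennreal (norm (b k))"
    by (simp add: ennreal_plus[symmetric] norm_triangle_ineq ennreal_leI del: ennreal_plus)
  then have "(ennreal (norm (a k + b k)))\<^sup>2 \<le> (ennreal (norm (a k)) + ennreal (norm (b k)))\<^sup>2" by (rule power_mono) simp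
  also have "\<dots> \<le> 2 * (ennreal (norm (a k)))\<^sup>2 + 2 * (ennreal (norm (b k)))\<^sup>2" by (rule ennreal_sq_add_le)
  finally have "ennreal (w k) * (ennreal (norm (a k + b k)))\<^sup>2 \<le> ennreal (w k) * (2 * (ennreal (norm (a k)))\<^sup>2 + 2 * (ennreal (norm (b k)))\<^sup>2)"
    by (rule mult_left_mono) simp
  then show "ennreal (w k * (norm (a k + b k))\<^sup>2) \<le> 2 * ennreal (w k * (norm (a k))\<^sup>2) + 2 * ennreal (w k * (norm (b k))\<^sup>2)"
    using w by (simp add: ennreal_mult ennreal_power distrib_left mult.left_commute)
qed

lemma nns_weighted_diff:
  assumes "\<And>k. w k \<ge> 0"
  shows "nns (\<lambda>k. ennreal (w k * (norm (a k - b k))\<^sup>2))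
    \<le> 2 * nns (\<lambda>k. ennreal (w k * (norm (a k))\<^sup>2)) + 2 * nns (\<lambda>k. ennreal (w k * (norm (b k))\<^sup>2))"
  using nns_weighted_add[of w a "\<lambda>k. - b k"] assms by simp

lemma infsum_diff_banach:
  fixes f g :: "wn \<Rightarrow> 'a::banach"
  assumes "f summable_on UNIV" "g summable_on UNIV"
  shows "(\<Sum>\<^sub>\<infinity>m. f m - g m) = infsum f UNIV - infsum g UNIV"
proof -
  have "(\<Sum>\<^sub>\<infinity>m. f m + - g m) = infsum f UNIV + (\<Sum>\<^sub>\<infinity>m. - g m)"
    by (rule infsum_add) (use assms in \<open>auto simp: summable_on_uminus\<close>)
  then show ?thesis by (simp add: infsum_uminus)
qed

lemma CS_nns: "(nns (\<lambda>k. f k * g k))\<^sup>2 \<le> nns (\<lambda>k. (f k)\<^sup>2) * nns (\<lambda>k. (g k)\<^sup>2)"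
  by (rule Cauchy_Schwarz_nn_integral) auto

text \<open>Provides half of a weight: the convolution estimate splits the kernel into two equal
  factors before Cauchy-Schwarz.\<close>

lemma ennreal_sqrt_ex: "\<exists>s::ennreal. s\<^sup>2 = a"
proof (cases a)
  case (real r)
  then show ?thesis by (intro exI[of _ "ennreal (sqrt r)"]) (simp add: ennreal_power)
next
  case top
  then show ?thesis by (intro exI[of _ top]) (simp add: power2_eq_square ennreal_top_mult)
qed

section \<open>Convolutions, which dominate the coefficients of products, and lattice sums\<close>

definition cnv :: "(wn \<Rightarrow> ennreal) \<Rightarrow> (wn \<Rightarrow> ennreal) \<Rightarrow> wn \<Rightarrow> ennreal" where
  "cnv a b k = nns (\<lambda>m. a (k - m) * b m)"

lemma cnv_pointwise: "(cnv a b k)\<^sup>2 \<le> nns (\<lambda>m. (a m)\<^sup>2) * nns (\<lambda>m. (b m)\<^sup>2)"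
proof -
  have "(cnv a b k)\<^sup>2 \<le> nns (\<lambda>m. (a (k - m))\<^sup>2) * nns (\<lambda>m. (b m)\<^sup>2)"
    unfolding cnv_def by (rule CS_nns)
  then show ?thesis by (simp add: nns_reflect[of "\<lambda>m. (a m)\<^sup>2"])
qed

text \<open>Young's convolution inequality. With the kernel written as a square, Cauchy-Schwarz
  leaves the sum of \<open>a (k - m)\<close> over m and a weighted sum of squares of b; summing the
  latter over k, translation invariance yields the second factor \<open>nns a\<close>.\<close>

lemma cnv_l1_l2: "nns (\<lambda>k. (cnv a b k)\<^sup>2) \<le> (nns a)\<^sup>2 * nns (\<lambda>m. (b m)\<^sup>2)"
proof -
  have "\<forall>k. \<exists>s. s\<^sup>2 = a k" using ennreal_sqrt_ex by blast
  then obtain s where s: "\<And>k. (s k)\<^sup>2 = a k" by metis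
  have "(cnv a b k)\<^sup>2 \<le> nns a * nns (\<lambda>m. a (k - m) * (b m)\<^sup>2)" for k
  proof -
    have "cnv a b k = nns (\<lambda>m. s (k - m) * (s (k - m) * b m))"
      unfolding cnv_def s[symmetric] by (simp add: power2_eq_square mult.assoc)
    then have "(cnv a b k)\<^sup>2 \<le> nns (\<lambda>m. (s (k - m))\<^sup>2) * nns (\<lambda>m. (s (k - m) * b m)\<^sup>2)"
      using CS_nns by simp
    then show ?thesis by (simp add: power_mult_distrib s nns_reflect[of a])
  qed
  then have "nns (\<lambda>k. (cnv a b k)\<^sup>2) \<le> nns (\<lambda>k. nns a * nns (\<lambda>m. a (k - m) * (b m)\<^sup>2))"
    by (rule nns_mono)
  also have "\<dots> = nns a * nns (\<lambda>m. nns (\<lambda>k. a (k - m) * (b m)\<^sup>2))"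
    by (subst nns_swap) (simp add: nns_cmult)
  also have "\<dots> = nns a * nns (\<lambda>m. nns a * (b m)\<^sup>2)"
    by (simp add: nns_multc nns_shift[of a])
  finally show ?thesis by (simp add: nns_cmult power2_eq_square mult.assoc)
qed

text \<open>The lattice sum of |k|^(-4), finite in dimension three because 4 > 3. The origin
  contributes nothing, since division by zero gives zero.\<close>

definition SK :: ennreal where "SK = nns (\<lambda>k. ennreal (1 / (ksq k)\<^sup>2))"

text \<open>One third of the three-dimensional decay: the product of three such factors is
  comparable with |k|^(-4), and each factor decays like |a|^(-4/3), which is still summable over the
  integers. The enumeration \<open>int_decode\<close> visits integers of modulus at least n/2 at
  step n.\<close>

lemma summable_int_q: "(\<integral>\<^sup>+ a. ennreal ((1 + (real_of_int a)\<^sup>2) powr (-2/3)) \<partial>count_space UNIV) < \<infinity>"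
proof -
  have bij: "bij_betw int_decode UNIV UNIV" by (rule bij_int_decode)
  have "(\<integral>\<^sup>+ a. ennreal ((1 + (real_of_int a)\<^sup>2) powr (-2/3)) \<partial>count_space UNIV)
      = (\<integral>\<^sup>+ n. ennreal ((1 + (real_of_int (int_decode n))\<^sup>2) powr (-2/3)) \<partial>count_space UNIV)"
    by (rule nn_integral_bij_count_space[OF bij, symmetric])
  also have "\<dots> = (\<Sum>n. ennreal ((1 + (real_of_int (int_decode n))\<^sup>2) powr (-2/3)))"
    by (rule nn_integral_count_space_nat)
  also have "\<dots> \<le> (\<Sum>n. ennreal (8 powr (2/3) * real (Suc n) powr (-4/3)))"
  proof (intro suminf_le allI ennreal_leI)
    fix n
    have "\<bar>real_of_int (int_decode n)\<bar> \<ge> real n / 2"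
    proof (cases "even n")
      case True
      then show ?thesis by (auto simp: int_decode_def sum_decode_def elim!: evenE)
    next
      case False
      then show ?thesis by (auto simp: int_decode_def sum_decode_def elim!: oddE)
    qed
    then have "(real n / 2)\<^sup>2 \<le> (real_of_int (int_decode n))\<^sup>2"
      by (metis abs_ge_zero abs_le_square_iff abs_of_nonneg divide_nonneg_nonneg of_nat_0_le_iff zero_le_numeral)
    moreover have "(1 + real n)\<^sup>2 \<le> 2 + 2 * (real n)\<^sup>2"
      using zero_le_power2[of "1 - real n"] by (simp add: power2_eq_square algebra_simps)
    ultimately have ge: "(real (Suc n))\<^sup>2 / 8 \<le> 1 + (real_of_int (int_decode n))\<^sup>2"
      by (simp add: power_divide)
    have "(1 + (real_of_int (int_decode n))\<^sup>2) powr (-2/3) \<le> ((real (Suc n))\<^sup>2 / 8) powr (-2/3)"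
      using ge by (intro powr_mono2') auto
    also have "\<dots> = 8 powr (2/3) * real (Suc n) powr (-4/3)"
    proof -
      have "((real (Suc n))\<^sup>2 / 8) powr (-2/3) = ((real (Suc n))\<^sup>2) powr (-2/3) / 8 powr (-2/3)"
        by (rule powr_divide)
      also have "((real (Suc n))\<^sup>2) powr (-2/3) = real (Suc n) powr (-4/3)"
        by (simp add: powr_powr flip: powr_numeral)
      also have "8 powr (-2/3) = 1 / (8::real) powr (2/3)"
        by (simp add: powr_minus_divide)
      finally show ?thesis by simp
    qed
    finally show "(1 + (real_of_int (int_decode n))\<^sup>2) powr (-2/3) \<le> 8 powr (2/3) * real (Suc n) powr (-4/3)" .
  qed auto
  also have "\<dots> < \<infinity>"
  proof -
    have "summable (\<lambda>n. real n powr (-4/3))" by (subst summable_real_powr_iff) simp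
    then have "summable (\<lambda>n. real (Suc n) powr (-4/3))" by (subst summable_Suc_iff)
    then have "summable (\<lambda>n. 8 powr (2/3) * real (Suc n) powr (-4/3))" by (rule summable_mult)
    then show ?thesis by (subst suminf_ennreal2) auto
  qed
  finally show ?thesis .
qed

text \<open>For k \<noteq> 0 every factor 1 + a^2 is at most 2 |k|^2. Hence the product of the three
  factors to the power -2/3 dominates |k|^(-4) up to the constant 4, and the sum over triples
  factorizes into three one-dimensional sums.\<close>

lemma SK_finite: "SK < \<infinity>"
proof -
  define q where "q a = ennreal ((1 + (real_of_int a)\<^sup>2) powr (-2/3))" for a
  define Z where "Z = (\<integral>\<^sup>+ a. q a \<partial>count_space UNIV)"
  have "SK \<le> nns (\<lambda>k. 4 * (case k of (a,b,c) \<Rightarrow> q a * (q b * q c)))"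
    unfolding SK_def
  proof (rule nns_mono)
    fix k :: wn
    obtain a b c where k: "k = (a,b,c)" by (cases k)
    let ?s = "ksq k"
    show "ennreal (1 / ?s\<^sup>2) \<le> 4 * (case k of (a,b,c) \<Rightarrow> q a * (q b * q c))"
    proof (cases "k = 0")
      case False
      then have s1: "?s \<ge> 1" by (rule ksq_ge_1)
      let ?P = "(1 + (real_of_int a)\<^sup>2) * ((1 + (real_of_int b)\<^sup>2) * (1 + (real_of_int c)\<^sup>2))"
      have s: "?s = (real_of_int a)\<^sup>2 + (real_of_int b)\<^sup>2 + (real_of_int c)\<^sup>2" by (simp add: ksq_def k)
      have pos: "?P \<ge> 1" by (intro mult_ge1_I[THEN order_trans[rotated]] mult_ge1_I) auto
      have "?P \<le> (1 + ?s) * ((1 + ?s) * (1 + ?s))"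
        unfolding s by (intro mult_mono) auto
      also have "\<dots> \<le> (2 * ?s) * ((2 * ?s) * (2 * ?s))"
        using s1 by (intro mult_mono) auto
      finally have P: "?P \<le> (2 * ?s) ^ 3" by (simp add: power3_eq_cube mult.assoc)
      have "1 / ?s\<^sup>2 = 4 * ((2 * ?s) ^ 3) powr (-2/3)"
      proof -
        have "((2 * ?s) ^ 3) powr (-2/3) = ((2 * ?s) powr 3) powr (-2/3)"
          using s1 by (subst powr_numeral) auto
        also have "\<dots> = (2 * ?s) powr (-2)" by (simp only: powr_powr) simp
        also have "\<dots> = 1 / (2 * ?s)\<^sup>2" using s1 by (simp add: powr_minus_divide)
        finally show ?thesis using s1 by (simp add: field_simps power2_eq_square)
      qed
      also have "\<dots> \<le> 4 * ?P powr (-2/3)"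
        using P pos s1 by (intro mult_left_mono powr_mono2') auto
      also have "?P powr (-2/3) = (1 + (real_of_int a)\<^sup>2) powr (-2/3) * ((1 + (real_of_int b)\<^sup>2) powr (-2/3) * (1 + (real_of_int c)\<^sup>2) powr (-2/3))"
        by (simp add: powr_mult)
      finally have "ennreal (1 / ?s\<^sup>2) \<le> ennreal (4 * \<dots>)" by (rule ennreal_leI)
      then show ?thesis by (simp add: k q_def ennreal_mult)
    qed simp
  qed
  also have "\<dots> = 4 * nns (\<lambda>k. case k of (a,b,c) \<Rightarrow> q a * (q b * q c))"
    by (rule nns_cmult)
  also have "nns (\<lambda>k. case k of (a,b,c) \<Rightarrow> q a * (q b * q c)) = Z * (Z * Z)"
    unfolding Z_def
    by (simp add: nn_integral_fst_count_space[symmetric] nn_integral_cmult nn_integral_multc split_beta)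
  finally have "SK \<le> 4 * (Z * (Z * Z))" .
  moreover have "Z < \<infinity>" using summable_int_q by (simp add: Z_def q_def)
  then have "4 * (Z * (Z * Z)) < \<infinity>" by (simp add: ennreal_mult_less_top)
  ultimately show ?thesis by (rule le_less_trans)
qed

text \<open>The embedding of H^2 into the functions with summable Fourier coefficients:
  Cauchy-Schwarz against the weight |k|^(-2). The vanishing mean lets this weight be inserted at the
  origin.\<close>

lemma l1_H2:
  assumes "a 0 = 0"
  shows "(nns a)\<^sup>2 \<le> SK * nns (\<lambda>k. ennreal ((ksq k)\<^sup>2) * (a k)\<^sup>2)"
proof -
  have "a k = ennreal (1 / ksq k) * (ennreal (ksq k) * a k)" for k
    using assms by (cases "k = 0") (auto simp: mult.assoc[symmetric] ennreal_mult[symmetric])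
  then have "(nns a)\<^sup>2 = (nns (\<lambda>k. ennreal (1 / ksq k) * (ennreal (ksq k) * a k)))\<^sup>2" by presburger
  also have "\<dots> \<le> nns (\<lambda>k. (ennreal (1 / ksq k))\<^sup>2) * nns (\<lambda>k. (ennreal (ksq k) * a k)\<^sup>2)"
    by (rule CS_nns)
  finally show ?thesis by (simp add: SK_def ennreal_power power_divide power_mult_distrib)
qed

text \<open>The product of two H^1 functions lies in L^2. Cauchy-Schwarz with the weights 1/|k - m|
  and 1/|m| leaves the sum of 1/(|k - m|^2 |m|^2), which by the arithmetic-geometric mean is at most
  the average of two copies of \<open>SK\<close>, uniformly in k; the remaining double sum
  factorizes by Tonelli.\<close>

lemma cnv_H1:
  assumes "a 0 = 0" "b 0 = 0"
  shows "nns (\<lambda>k. (cnv a b k)\<^sup>2) \<le> SK * (nns (\<lambda>k. ennreal (ksq k) * (a k)\<^sup>2) * nns (\<lambda>k. ennreal (ksq k) * (b k)\<^sup>2))"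
proof -
  define v where "v k = ennreal (1 / sqrt (ksq k))" for k
  define w where "w k = ennreal (sqrt (ksq k))" for k
  have wv: "w k * v k * a k = a k" "w k * v k * b k = b k" for k
    using assms by (cases "k = 0"; auto simp: w_def v_def mult.assoc[symmetric] ennreal_mult[symmetric])+
  have vs: "nns (\<lambda>m. (v (k - m) * v m)\<^sup>2) \<le> SK" for k
  proof -
    have "(v (k - m) * v m)\<^sup>2 \<le> ennreal (1/2) * ennreal (1 / (ksq (k - m))\<^sup>2) + ennreal (1/2) * ennreal (1 / (ksq m)\<^sup>2)" for m
    proof -
      have "(v (k - m) * v m)\<^sup>2 = ennreal ((1 / ksq (k - m)) * (1 / ksq m))"
        by (simp add: v_def power_mult_distrib ennreal_power power_divide ennreal_mult[symmetric])
      also have "\<dots> \<le> ennreal ((1/2) * (1 / (ksq (k - m)))\<^sup>2 + (1/2) * (1 / (ksq m))\<^sup>2)"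
        using sum_squares_bound[of "1 / ksq (k - m)" "1 / ksq m"] by (intro ennreal_leI) simp
      also have "\<dots> = ennreal (1/2) * ennreal (1 / (ksq (k - m))\<^sup>2) + ennreal (1/2) * ennreal (1 / (ksq m)\<^sup>2)"
        unfolding power_divide power_one by (subst ennreal_plus, simp, simp, subst ennreal_mult, simp, simp, subst ennreal_mult) simp_all
      finally show ?thesis .
    qed
    then have "nns (\<lambda>m. (v (k - m) * v m)\<^sup>2) \<le> ennreal (1/2) * nns (\<lambda>m. ennreal (1 / (ksq (k - m))\<^sup>2)) + ennreal (1/2) * SK"
      unfolding SK_def nns_cmult[symmetric] nns_add[symmetric] by (rule nns_mono)
    also have "\<dots> = ennreal (1/2) * SK + ennreal (1/2) * SK"
      by (simp add: nns_reflect[of "\<lambda>m. ennreal (1 / (ksq m)\<^sup>2)"] SK_def)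
    also have "\<dots> = (ennreal (1/2) + ennreal (1/2)) * SK" by (simp only: distrib_right)
    also have "ennreal (1/2) + ennreal (1/2) = 1" by (subst ennreal_plus[symmetric]) auto
    finally have "nns (\<lambda>m. (v (k - m) * v m)\<^sup>2) \<le> 1 * SK" .
    then have "nns (\<lambda>m. (v (k - m) * v m)\<^sup>2) \<le> SK" by simp
    then show ?thesis .
  qed
  have "(cnv a b k)\<^sup>2 \<le> SK * cnv (\<lambda>k. (w k * a k)\<^sup>2) (\<lambda>k. (w k * b k)\<^sup>2) k" for k
  proof -
    have "cnv a b k = nns (\<lambda>m. (v (k - m) * v m) * ((w (k - m) * a (k - m)) * (w m * b m)))"
      unfolding cnv_def
    proof (intro nn_integral_cong)
      fix m
      show "a (k - m) * b m = v (k - m) * v m * (w (k - m) * a (k - m) * (w m * b m))"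
        using wv(1)[of "k - m"] wv(2)[of m] by (metis (no_types, lifting) mult.assoc mult.commute)
    qed
    then have "(cnv a b k)\<^sup>2 \<le> nns (\<lambda>m. (v (k - m) * v m)\<^sup>2) * nns (\<lambda>m. ((w (k - m) * a (k - m)) * (w m * b m))\<^sup>2)"
      using CS_nns by simp
    also have "\<dots> \<le> SK * nns (\<lambda>m. ((w (k - m) * a (k - m)) * (w m * b m))\<^sup>2)"
      by (intro mult_right_mono vs) simp
    finally show ?thesis by (simp add: cnv_def power_mult_distrib)
  qed
  then have "nns (\<lambda>k. (cnv a b k)\<^sup>2) \<le> nns (\<lambda>k. SK * cnv (\<lambda>k. (w k * a k)\<^sup>2) (\<lambda>k. (w k * b k)\<^sup>2) k)"
    by (rule nns_mono)
  also have "\<dots> = SK * nns (\<lambda>k. cnv (\<lambda>k. (w k * a k)\<^sup>2) (\<lambda>k. (w k * b k)\<^sup>2) k)" by (rule nns_cmult)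
  also have "nns (\<lambda>k. cnv (\<lambda>k. (w k * a k)\<^sup>2) (\<lambda>k. (w k * b k)\<^sup>2) k) = nns (\<lambda>k. (w k * a k)\<^sup>2) * nns (\<lambda>k. (w k * b k)\<^sup>2)"
    unfolding cnv_def by (subst nns_swap) (simp add: nns_multc nns_cmult nns_shift[of "\<lambda>m. (w m * a m)\<^sup>2"])
  finally show ?thesis by (simp add: w_def power_mult_distrib ennreal_power)
qed

section \<open>Fourier coefficients on the torus\<close>

text \<open>The half-open cube is a fundamental domain: it meets each orbit of the integer
  translations once, so a translate of it can be cut and reassembled without overlap. It differs
  from \<open>cube\<close> by a null set.\<close>

definition qube :: "(real^3) set" where
  "qube = {x. \<forall>i. 0 \<le> x$i \<and> x$i < 1}"

abbreviation Q :: "(real^3) measure" where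
  "Q \<equiv> restrict_space lborel qube"

lemma qube_sets [measurable]: "qube \<in> sets borel"
proof -
  have "qube = (\<Inter>i\<in>UNIV. {x. x$i \<ge> 0} \<inter> {x. x$i < 1})" by (auto simp: qube_def)
  moreover have "{x::real^3. x$i \<ge> 0} \<in> sets borel" "{x::real^3. x$i < 1} \<in> sets borel" for i
    by (rule borel_closed[OF closed_halfspace_component_ge_cart])
       (rule borel_open[OF open_halfspace_component_lt_cart])
  ultimately show ?thesis by (metis (no_types, lifting) UNIV_not_empty finite sets.Int sets.finite_INT)
qed

lemma space_Q [simp]: "space Q = qube"
  by (simp add: space_restrict_space)

lemma meas_Q: "f \<in> borel_measurable borel \<Longrightarrow> f \<in> borel_measurable Q"
  by (rule measurable_restrict_space1) simp

lemma AE_cube_qube: "AE x in lborel. x \<in> cube \<longleftrightarrow> x \<in> qube"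
proof -
  let ?o = "(\<chi> i. 1) :: real^3"
  have em1: "emeasure lborel (cbox 0 ?o) = ennreal (\<Prod>b\<in>Basis. (?o - 0) \<bullet> b)"
    by (rule emeasure_lborel_cbox) (auto simp: Basis_vec_def inner_axis)
  have em2: "emeasure lborel (box 0 ?o) = ennreal (\<Prod>b\<in>Basis. (?o - 0) \<bullet> b)"
    by (rule emeasure_lborel_box) (auto simp: Basis_vec_def inner_axis)
  have "emeasure lborel (cbox 0 ?o - box 0 ?o) = emeasure lborel (cbox 0 ?o) - emeasure lborel (box 0 ?o)"
    by (rule emeasure_Diff) (auto simp: em2 box_subset_cbox)
  then have "cbox 0 ?o - box 0 ?o \<in> null_sets lborel" by (simp add: em1 em2 null_sets_def)
  then have "AE x in lborel. x \<notin> cbox 0 ?o - box 0 ?o" by (rule AE_not_in)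
  then show ?thesis
  proof (rule AE_mp, intro AE_I2 impI)
    fix x :: "real^3" assume "x \<notin> cbox 0 ?o - box 0 ?o"
    then show "x \<in> cube \<longleftrightarrow> x \<in> qube"
      unfolding cube_def qube_def by (auto simp: mem_box_cart order_less_imp_le)
  qed
qed

lemma emeasure_Q: "emeasure Q qube = 1"
proof -
  have "emeasure Q qube = emeasure lborel qube"
    by (rule emeasure_restrict_space) auto
  also have "\<dots> = emeasure lborel cube"
    using AE_cube_qube by (intro emeasure_eq_AE) (auto simp: cube_def)
  also have "\<dots> = 1"
    unfolding cube_def by (subst emeasure_lborel_cbox) (auto simp: Basis_vec_def inner_axis intro!: prod.neutral)
  finally show ?thesis .
qed

interpretation Q: finite_measure Q
  by (rule finite_measureI) (simp add: emeasure_Q)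

lemma measure_Q [simp]: "measure Q qube = 1"
  by (simp add: measure_def emeasure_Q)

lemma nn_integral_cube:
  assumes [measurable]: "f \<in> borel_measurable borel"
  shows "(\<integral>\<^sup>+x\<in>cube. f x \<partial>lborel) = (\<integral>\<^sup>+x. f x \<partial>Q)"
proof -
  have "(\<integral>\<^sup>+x\<in>cube. f x \<partial>lborel) = (\<integral>\<^sup>+x\<in>qube. f x \<partial>lborel)"
    by (rule nn_integral_cong_AE, rule AE_mp[OF AE_cube_qube], intro AE_I2 impI)
      (auto split: split_indicator)
  then show ?thesis by (simp add: nn_integral_restrict_space)
qed

lemma AE_cube:
  assumes "Measurable.pred borel P"
  shows "(AE x in lborel. x \<in> cube \<longrightarrow> P x) \<longleftrightarrow> (AE x in Q. P x)"
proof -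
  have "(AE x in lborel. x \<in> cube \<longrightarrow> P x) \<longleftrightarrow> (AE x in lborel. x \<in> qube \<longrightarrow> P x)"
    by (rule eventually_subst, rule AE_mp[OF AE_cube_qube]) auto
  then show ?thesis by (simp add: AE_restrict_space_iff)
qed

section \<open>Characters and periodic functions\<close>

definition ek :: "wn \<Rightarrow> real^3 \<Rightarrow> complex" where
  "ek k x = cis (2 * pi * inner (kreal k) x)"

lemma ek_add: "ek (k + m) x = ek k x * ek m x"
  by (simp add: ek_def inner_add_left cis_mult distrib_left)

lemma ek_diff: "ek (k - m) x = ek k x * ek (- m) x"
  using ek_add[of k "- m"] by simp

lemma ek_0 [simp]: "ek 0 x = 1"
  by (simp add: ek_def)

lemma norm_ek [simp]: "cmod (ek k x) = 1"
  by (simp add: ek_def)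

lemma ek_minus: "ek (- k) x = cnj (ek k x)"
  by (simp add: ek_def cis_cnj)

lemma continuous_ek: "continuous_on S (ek k)"
  unfolding ek_def cis_conv_exp by (intro continuous_intros)

lemma borel_measurable_ek [measurable]: "ek k \<in> borel_measurable borel"
  by (rule borel_measurable_continuous_onI[OF continuous_ek])

lemma ek_axis: "ek k (x + axis j h) = cis (2 * pi * h * kreal k $ j) * ek k x"
  by (simp add: ek_def inner_add_right inner_axis cis_mult algebra_simps)

definition periodic :: "(real^3 \<Rightarrow> 'a) \<Rightarrow> bool" where
  "periodic g \<longleftrightarrow> (\<forall>x j. g (x + axis j 1) = g x)"

lemma kreal_int: "kreal k $ j \<in> \<int>"
proof -
  have "\<forall>j. kreal k $ j \<in> \<int>" by (cases k) (simp add: kreal_def forall_3)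
  then show ?thesis ..
qed

lemma periodic_ek: "periodic (ek k)"
  unfolding periodic_def by (auto simp: ek_axis cis_multiple_2pi kreal_int)

lemma periodic_shift: "periodic g \<Longrightarrow> periodic (\<lambda>x. g (x + y))"
  unfolding periodic_def by (simp add: add.assoc add.commute[of "axis _ _"]) (simp add: add.assoc[symmetric])

lemma fourier_coeff_Q:
  assumes [measurable]: "f \<in> borel_measurable borel"
  shows "fourier_coeff f k = (\<integral>x. complex_of_real (f x) * ek (- k) x \<partial>Q)"
proof -
  have "fourier_coeff f k = (LINT x:cube|lborel. complex_of_real (f x) * ek (- k) x)"
    unfolding fourier_coeff_def
    by (intro set_lebesgue_integral_cong) (auto simp: cube_def ek_def cis_conv_exp algebra_simps)
  also have "\<dots> = (LINT x:qube|lborel. complex_of_real (f x) * ek (- k) x)"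
    unfolding set_lebesgue_integral_def
  proof (rule integral_cong_AE)
    show "AE x in lborel. indicator cube x *\<^sub>R (complex_of_real (f x) * ek (- k) x)
        = indicator qube x *\<^sub>R (complex_of_real (f x) * ek (- k) x)"
      by (rule AE_mp[OF AE_cube_qube]) (auto split: split_indicator)
  qed (auto simp: cube_def)
  also have "\<dots> = (\<integral>x. complex_of_real (f x) * ek (- k) x \<partial>Q)"
    unfolding set_lebesgue_integral_def by (rule integral_restrict_space[symmetric]) simp
  finally show ?thesis .
qed

definition fcc :: "(real^3 \<Rightarrow> complex) \<Rightarrow> sfield" where
  "fcc g k = (\<integral>x. g x * ek (- k) x \<partial>Q)"

lemma fourier_coeff_fcc:
  "f \<in> borel_measurable borel \<Longrightarrow> fourier_coeff f = fcc (\<lambda>x. complex_of_real (f x))"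
  by (rule ext) (simp add: fcc_def fourier_coeff_Q)

text \<open>Cut and paste: the cube shifted by h along axis j consists of a part A inside the
  original cube and of the slice C moved by a full period. Periodicity moves that slice back, and A
  and C together fill the cube.\<close>

lemma nn_integral_translate_pos:
  assumes g [measurable]: "g \<in> borel_measurable borel" and p: "periodic g" and h: "0 \<le> h" "h \<le> 1"
  shows "(\<integral>\<^sup>+x. g (x + axis j h) \<partial>Q) = (\<integral>\<^sup>+x. g x \<partial>(Q::(real^3) measure))"
proof -
  let ?e = "axis j h :: real^3" and ?u = "axis j 1 :: real^3"
  define A where "A = {x \<in> qube. h \<le> x $ j}"
  define C where "C = {x \<in> qube. x $ j < h}"
  have jm: "{x::real^3. h \<le> x $ j} \<in> sets borel" "{x::real^3. x $ j < h} \<in> sets borel"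
    by (auto intro!: closed_halfspace_component_ge_cart open_halfspace_component_lt_cart borel_closed borel_open)
  have [measurable]: "A \<in> sets borel" "C \<in> sets borel"
    using jm qube_sets unfolding A_def C_def by (auto simp: Collect_conj_eq intro!: sets.Int)
  have transl: "(\<integral>\<^sup>+x. f (c + x) \<partial>lborel) = (\<integral>\<^sup>+x. f x \<partial>lborel)" if "f \<in> borel_measurable borel"
    for f :: "real^3 \<Rightarrow> ennreal" and c
    using nn_integral_distr[of "(+) c" lborel borel f] that by (simp add: lborel_distr_plus)
  have ind: "indicator qube (x - ?e) = (indicator A x + indicator C (x - ?u) :: ennreal)" for x
  proof -
    have nth: "(x - axis j r) $ i = (if i = j then x $ i - r else x $ i)" for i r
      by (simp add: axis_def)
    let ?P = "\<forall>i. i \<noteq> j \<longrightarrow> 0 \<le> x $ i \<and> x $ i < 1"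
    have all: "(\<forall>i. R i) \<longleftrightarrow> R j \<and> (\<forall>i. i \<noteq> j \<longrightarrow> R i)" for R by metis
    have "x - ?e \<in> qube \<longleftrightarrow> ?P \<and> h \<le> x $ j \<and> x $ j < 1 + h"
      unfolding qube_def mem_Collect_eq nth by (subst all) auto
    moreover have "x \<in> A \<longleftrightarrow> ?P \<and> h \<le> x $ j \<and> x $ j < 1"
      unfolding A_def qube_def mem_Collect_eq using h by (subst all) auto
    moreover have "x - ?u \<in> C \<longleftrightarrow> ?P \<and> 1 \<le> x $ j \<and> x $ j < 1 + h"
      unfolding C_def qube_def mem_Collect_eq nth using h by (subst all) auto
    ultimately show ?thesis using h by (simp add: indicator_def)
  qed
  have gu: "g (?u + x) = g x" for x using p by (simp add: periodic_def add.commute)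
  have "(\<integral>\<^sup>+x. g (x + ?e) \<partial>Q) = (\<integral>\<^sup>+x. g (x + ?e) * indicator qube x \<partial>lborel)"
    by (simp add: nn_integral_restrict_space)
  also have "\<dots> = (\<integral>\<^sup>+x. (\<lambda>y. g y * indicator qube (y - ?e)) (?e + x) \<partial>lborel)"
    by (simp add: add.commute)
  also have "\<dots> = (\<integral>\<^sup>+y. g y * indicator qube (y - ?e) \<partial>lborel)"
    by (rule transl) measurable
  also have "\<dots> = (\<integral>\<^sup>+y. g y * indicator A y \<partial>lborel) + (\<integral>\<^sup>+y. g y * indicator C (y - ?u) \<partial>lborel)"
    unfolding ind distrib_left by (rule nn_integral_add) measurable
  also have "(\<integral>\<^sup>+y. g y * indicator C (y - ?u) \<partial>lborel) = (\<integral>\<^sup>+x. (\<lambda>y. g y * indicator C (y - ?u)) (?u + x) \<partial>lborel)"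
    by (rule transl[symmetric]) measurable
  also have "\<dots> = (\<integral>\<^sup>+x. g x * indicator C x \<partial>lborel)"
    by (simp add: gu)
  also have "(\<integral>\<^sup>+y. g y * indicator A y \<partial>lborel) + (\<integral>\<^sup>+x. g x * indicator C x \<partial>lborel)
      = (\<integral>\<^sup>+x. g x * indicator A x + g x * indicator C x \<partial>lborel)"
    by (rule nn_integral_add[symmetric]) measurable
  also have "\<dots> = (\<integral>\<^sup>+x. g x * indicator qube x \<partial>lborel)"
    by (rule nn_integral_cong) (auto simp: A_def C_def split: split_indicator)
  finally show ?thesis by (simp add: nn_integral_restrict_space)
qed

lemma nn_integral_translate:
  assumes g: "g \<in> borel_measurable borel" and p: "periodic g" and h: "\<bar>h\<bar> \<le> 1"
  shows "(\<integral>\<^sup>+x. g (x + axis j h) \<partial>Q) = (\<integral>\<^sup>+x. g x \<partial>(Q::(real^3) measure))"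
proof (cases "h \<ge> 0")
  case True
  then show ?thesis using assms by (intro nn_integral_translate_pos) auto
next
  case False
  have [measurable]: "g \<in> borel_measurable borel" by fact
  have ax: "axis j h + axis j (- h) = (0::real^3)" by (simp add: vec_eq_iff axis_def)
  have "(\<integral>\<^sup>+x. (\<lambda>y. g (y + axis j h)) (x + axis j (- h)) \<partial>Q) = (\<integral>\<^sup>+x. g (x + axis j h) \<partial>Q)"
    using False h by (intro nn_integral_translate_pos periodic_shift p) auto
  then show ?thesis using ax by (simp add: add.assoc add.commute[of "axis j (- h)"])
qed

definition wrap :: "real^3 \<Rightarrow> real^3" where
  "wrap x = (\<chi> i. frac (x $ i))"

lemma wrap_id: "x \<in> qube \<Longrightarrow> wrap x = x"
  by (simp add: wrap_def qube_def vec_eq_iff frac_eq)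

lemma periodic_wrap: "periodic wrap"
  by (auto simp: periodic_def wrap_def vec_eq_iff axis_def frac_1_eq)

lemma borel_measurable_wrap [measurable]: "wrap \<in> borel_measurable borel"
proof (rule borel_measurable_euclidean_space[THEN iffD2], rule ballI)
  fix b :: "real^3" assume "b \<in> Basis"
  then obtain i where b: "b = axis i 1" by (auto simp: Basis_vec_def)
  have "(\<lambda>x. wrap x \<bullet> b) = (\<lambda>x. x \<bullet> b - real_of_int \<lfloor>x \<bullet> b\<rfloor>)"
    by (simp add: b wrap_def inner_axis frac_def)
  then show "(\<lambda>x. wrap x \<bullet> b) \<in> borel_measurable borel" by simp
qed

lemma periodic_comp_wrap: "periodic (\<lambda>x. g (wrap x))"
  using periodic_wrap by (simp add: periodic_def)

lemma periodic_axis_int: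
  assumes "periodic g"
  shows "g (x + axis j (of_int n)) = g x"
proof -
  have nat: "g (x + axis j (of_nat n)) = g x" for x n
  proof (induction n)
    case (Suc n)
    have "x + axis j (of_nat (Suc n)) = (x + axis j (of_nat n)) + axis j 1"
      by (simp add: vec_eq_iff axis_def)
    then show ?case using Suc assms by (metis periodic_def)
  next
    case 0
    have "x + axis j 0 = x" by (simp add: vec_eq_iff axis_def)
    then show ?case by (metis of_nat_0)
  qed
  show ?thesis
  proof (cases "n \<ge> 0")
    case True
    then show ?thesis using nat[of x "Int.nat n"] by simp
  next
    case False
    have "(x + axis j (of_int n)) + axis j (of_nat (Int.nat (- n))) = x"
      using False by (simp add: vec_eq_iff axis_def)
    then show ?thesis using nat[of "x + axis j (of_int n)"] by metis
  qed
qed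

lemma periodic_eq_wrap:
  assumes "periodic g"
  shows "g (wrap x) = g x"
proof -
  have "x = wrap x + axis 1 (of_int \<lfloor>x$1\<rfloor>) + axis 2 (of_int \<lfloor>x$2\<rfloor>) + axis 3 (of_int \<lfloor>x$3\<rfloor>)"
    by (simp add: vec_eq_iff forall_3 axis_def wrap_def frac_def)
  then show ?thesis using periodic_axis_int[OF assms] by metis
qed

lemma integral_translate:
  fixes g :: "real^3 \<Rightarrow> 'a::{banach,second_countable_topology}"
  assumes g: "g \<in> borel_measurable borel" and p: "periodic g" and h: "\<bar>h\<bar> \<le> 1"
  shows "(\<integral>x. g (x + axis j h) \<partial>Q) = (\<integral>x. g x \<partial>Q)"
    and "integrable Q (\<lambda>x. g (x + axis j h)) \<longleftrightarrow> integrable Q g"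
proof -
  have [measurable]: "g \<in> borel_measurable borel" by fact
  let ?T = "\<lambda>x. wrap (x + axis j h)"
  have [measurable]: "?T \<in> measurable Q borel" "wrap \<in> measurable Q borel"
    by (auto intro!: meas_Q)
  \<comment> \<open>Applied to indicators, the nonnegative case says that the shifted and the
    unshifted reduction to the cube have the same distribution. Bochner integrals and integrability
    then transfer together, for values in any Banach space.\<close>
  have eq: "distr Q borel ?T = distr Q borel wrap"
  proof (rule measure_eqI)
    fix A assume "A \<in> sets (distr Q borel ?T)"
    then have [measurable]: "A \<in> sets borel" by simp
    have "emeasure (distr Q borel ?T) A = (\<integral>\<^sup>+x. (\<lambda>y. indicator A (wrap y)) (x + axis j h) \<partial>Q)"
      by (subst nn_integral_indicator[symmetric], simp, subst nn_integral_distr) auto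
    also have "\<dots> = (\<integral>\<^sup>+x. indicator A (wrap x) \<partial>Q)"
      by (rule nn_integral_translate[OF _ _ h]) (auto intro!: periodic_comp_wrap)
    also have "\<dots> = emeasure (distr Q borel wrap) A"
      by (subst nn_integral_indicator[symmetric], simp, subst nn_integral_distr) auto
    finally show "emeasure (distr Q borel ?T) A = emeasure (distr Q borel wrap) A" .
  qed simp
  have "(\<integral>x. g (x + axis j h) \<partial>Q) = (\<integral>x. g (?T x) \<partial>Q)"
    by (simp add: periodic_eq_wrap[OF p])
  also have "\<dots> = (\<integral>x. g x \<partial>distr Q borel ?T)" by (rule integral_distr[symmetric]) auto
  also have "\<dots> = (\<integral>x. g (wrap x) \<partial>Q)" unfolding eq by (rule integral_distr) auto
  finally show "(\<integral>x. g (x + axis j h) \<partial>Q) = (\<integral>x. g x \<partial>Q)" by (simp add: periodic_eq_wrap[OF p])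
  have "integrable Q (\<lambda>x. g (x + axis j h)) \<longleftrightarrow> integrable Q (\<lambda>x. g (?T x))"
    by (simp add: periodic_eq_wrap[OF p])
  also have "\<dots> \<longleftrightarrow> integrable (distr Q borel ?T) g" by (rule integrable_distr_eq[symmetric]) auto
  also have "\<dots> \<longleftrightarrow> integrable Q (\<lambda>x. g (wrap x))" unfolding eq by (rule integrable_distr_eq) auto
  finally show "integrable Q (\<lambda>x. g (x + axis j h)) \<longleftrightarrow> integrable Q g" by (simp add: periodic_eq_wrap[OF p])
qed

lemma fcc_translate:
  assumes g [measurable]: "g \<in> borel_measurable borel" and p: "periodic g" and h: "\<bar>h\<bar> \<le> 1"
  shows "fcc (\<lambda>x. g (x + axis j h)) k = cis (2 * pi * h * kreal k $ j) * fcc g k"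
proof -
  let ?c = "cis (2 * pi * h * kreal k $ j)"
  have ek: "ek (- k) x = ?c * ek (- k) (x + axis j h)" for x
    by (simp add: ek_axis cis_mult mult.assoc[symmetric])
  have per: "periodic (\<lambda>x. g x * ek (- k) x)"
    using p periodic_ek[of "- k"] by (simp add: periodic_def)
  have "fcc (\<lambda>x. g (x + axis j h)) k = (\<integral>x. ?c * (g (x + axis j h) * ek (- k) (x + axis j h)) \<partial>Q)"
    unfolding fcc_def by (rule Bochner_Integration.integral_cong[OF refl], subst ek) (simp add: ac_simps)
  also have "\<dots> = ?c * (\<integral>x. g (x + axis j h) * ek (- k) (x + axis j h) \<partial>Q)" by simp
  also have "(\<integral>x. g (x + axis j h) * ek (- k) (x + axis j h) \<partial>Q) = fcc g k"
    unfolding fcc_def by (rule integral_translate(1)[OF _ per h]) measurable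
  finally show ?thesis .
qed

lemma integrable_ek: "integrable Q (ek k)"
  by (rule Q.integrable_const_bound[of _ 1]) (auto intro: meas_Q)

text \<open>For k \<noteq> 0 some component of k is nonzero, and a shift by half a period along that
  axis changes the sign of the character without changing its integral. The component is a nonzero
  integer, which keeps the shift within the admissible range.\<close>

lemma integral_ek: "(\<integral>x. ek k x \<partial>Q) = (if k = 0 then 1 else 0)"
proof (cases "k = 0")
  case True
  then show ?thesis by simp
next
  case False
  have "\<exists>j. kreal k $ j \<noteq> 0"
    using False ksq_pos[of k] by (auto simp: ksq_norm vec_eq_iff)
  then obtain j where j: "kreal k $ j \<noteq> 0" ..
  obtain n where n: "kreal k $ j = of_int n" using kreal_int[of k j] by (metis Ints_cases)
  define h where "h = 1 / (2 * kreal k $ j)"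
  have "\<bar>kreal k $ j\<bar> \<ge> 1" using j n by simp
  then have h: "\<bar>h\<bar> \<le> 1" by (simp add: h_def abs_mult divide_simps)
  have "(\<integral>x. ek k x \<partial>Q) = (\<integral>x. ek k (x + axis j h) \<partial>Q)"
    by (rule integral_translate(1)[symmetric, OF _ periodic_ek h]) measurable
  also have "\<dots> = cis (2 * pi * h * kreal k $ j) * (\<integral>x. ek k x \<partial>Q)"
    by (simp add: ek_axis)
  also have "cis (2 * pi * h * kreal k $ j) = - 1"
  proof -
    have "2 * pi * h * kreal k $ j = pi" using j by (simp add: h_def)
    then show ?thesis by (simp only: cis_pi)
  qed
  finally show ?thesis using False by simp
qed

lemma fcc_mult_ek: "fcc (\<lambda>x. ek m x * g x) k = fcc g (k - m)"
proof -
  have "ek m x * g x * ek (- k) x = g x * ek (- (k - m)) x" for x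
    using ek_add[of m "- k" x] by (simp add: algebra_simps)
  then show ?thesis unfolding fcc_def by presburger
qed

lemma integrable_mult_ek: "integrable Q g \<Longrightarrow> integrable Q (\<lambda>x. g x * ek k x)"
  by (rule Bochner_Integration.integrable_bound[of Q g])
     (auto intro!: borel_measurable_times meas_Q[OF borel_measurable_ek] simp: norm_mult)

lemma fcc_add: "integrable Q f \<Longrightarrow> integrable Q g \<Longrightarrow> fcc (\<lambda>x. f x + g x) k = fcc f k + fcc g k"
  unfolding fcc_def by (simp add: distrib_right integrable_mult_ek)

lemma fcc_diff: "integrable Q f \<Longrightarrow> integrable Q g \<Longrightarrow> fcc (\<lambda>x. f x - g x) k = fcc f k - fcc g k"
  unfolding fcc_def by (simp add: left_diff_distrib integrable_mult_ek)

lemma fcc_cmult: "fcc (\<lambda>x. c * f x) k = c * fcc f k"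
  unfolding fcc_def by (simp add: mult.assoc)

lemma fcc_sum: "(\<And>i. i \<in> I \<Longrightarrow> integrable Q (f i)) \<Longrightarrow> fcc (\<lambda>x. \<Sum>i\<in>I. f i x) k = (\<Sum>i\<in>I. fcc (f i) k)"
  unfolding fcc_def by (simp add: sum_distrib_right integrable_mult_ek)

lemma fcc_trig_mult:
  assumes "integrable Q g"
  shows "fcc (\<lambda>x. (\<Sum>m\<in>K. c m * ek m x) * g x) k = (\<Sum>m\<in>K. c m * fcc g (k - m))"
proof -
  have "fcc (\<lambda>x. (\<Sum>m\<in>K. c m * ek m x) * g x) k = fcc (\<lambda>x. \<Sum>m\<in>K. c m * (ek m x * g x)) k"
    by (simp add: sum_distrib_right mult.assoc)
  also have "\<dots> = (\<Sum>m\<in>K. fcc (\<lambda>x. c m * (ek m x * g x)) k)"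
    using integrable_mult_ek[OF assms] by (intro fcc_sum) (auto simp: mult.commute)
  finally show ?thesis by (simp add: fcc_cmult fcc_mult_ek)
qed

lemma fcc_trig: "finite K \<Longrightarrow> fcc (\<lambda>x. \<Sum>m\<in>K. c m * ek m x) k = (if k \<in> K then c k else 0)"
proof -
  assume K: "finite K"
  have "fcc (\<lambda>x. \<Sum>m\<in>K. c m * ek m x) k = (\<Sum>m\<in>K. c m * fcc (\<lambda>x. 1) (k - m))"
    using fcc_trig_mult[of "\<lambda>x. 1" c K k] by simp
  also have "\<dots> = (\<Sum>m\<in>K. if m = k then c k else 0)"
    by (rule sum.cong) (auto simp: fcc_def integral_ek)
  finally show ?thesis using K by simp
qed

lemma integrable_of_square:
  assumes [measurable]: "g \<in> borel_measurable borel" and "integrable Q (\<lambda>x. (norm (g x))\<^sup>2)"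
  shows "integrable Q (g :: real^3 \<Rightarrow> 'a::{banach,second_countable_topology})"
proof (rule Bochner_Integration.integrable_bound[of Q "\<lambda>x. 1 + (norm (g x))\<^sup>2"])
  show "integrable Q (\<lambda>x. 1 + (norm (g x))\<^sup>2)" using assms(2) by simp
  show "g \<in> borel_measurable Q" by (rule meas_Q) measurable
  have "norm (g x) \<le> 1 + (norm (g x))\<^sup>2" for x
  proof -
    have "2 * norm (g x) \<le> 1 + (norm (g x))\<^sup>2" using sum_squares_bound[of 1 "norm (g x)"] by simp
    moreover have "norm (g x) \<ge> 0" by simp
    ultimately show ?thesis by linarith
  qed
  then show "AE x in Q. norm (g x) \<le> norm (1 + (norm (g x))\<^sup>2)" by (intro AE_I2) simp
qed

text \<open>The integral of |g - p|^2 is nonnegative, where p is the partial Fourier sum over F;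
  expanded, both the mixed and the quadratic term equal the sum of squared coefficients.\<close>

lemma bessel:
  assumes [measurable]: "g \<in> borel_measurable borel" and i2: "integrable Q (\<lambda>x. (cmod (g x))\<^sup>2)"
    and F: "finite F"
  shows "(\<Sum>k\<in>F. (cmod (fcc g k))\<^sup>2) \<le> (\<integral>x. (cmod (g x))\<^sup>2 \<partial>Q)"
proof -
  note [measurable] = meas_Q
  have gi: "integrable Q g"
    using i2 by (rule integrable_of_square[rotated]) simp
  define c where "c = fcc g"
  define p where "p x = (\<Sum>k\<in>F. c k * ek k x)" for x
  have [measurable]: "p \<in> borel_measurable borel" unfolding p_def by measurable
  have cp: "cnj (p x) = (\<Sum>k\<in>F. cnj (c k) * ek (- k) x)" for x by (simp add: p_def ek_minus)
  have gp: "integrable Q (\<lambda>x. g x * cnj (p x))"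
    unfolding cp sum_distrib_left
  proof (intro Bochner_Integration.integrable_sum)
    fix k
    have "integrable Q (\<lambda>x. cnj (c k) * (g x * ek (- k) x))" using integrable_mult_ek[OF gi] by simp
    then show "integrable Q (\<lambda>x. g x * (cnj (c k) * ek (- k) x))" by (simp only: mult.left_commute)
  qed
  have Igp: "(\<integral>x. g x * cnj (p x) \<partial>Q) = of_real (\<Sum>k\<in>F. (cmod (c k))\<^sup>2)"
  proof -
    have "(\<integral>x. g x * cnj (p x) \<partial>Q) = (\<integral>x. (\<Sum>k\<in>F. cnj (c k) * (g x * ek (- k) x)) \<partial>Q)"
      unfolding cp sum_distrib_left by (simp add: algebra_simps)
    also have "\<dots> = (\<Sum>k\<in>F. cnj (c k) * c k)"
      using integrable_mult_ek[OF gi] by (subst Bochner_Integration.integral_sum) (auto simp: c_def fcc_def)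
    also have "\<dots> = of_real (\<Sum>k\<in>F. (cmod (c k))\<^sup>2)"
      unfolding of_real_sum by (intro sum.cong refl) (simp only: complex_norm_square mult.commute)
    finally show ?thesis .
  qed
  have pp: "integrable Q (\<lambda>x. p x * cnj (p x))"
    unfolding cp sum_distrib_left unfolding p_def sum_distrib_right
  proof (intro Bochner_Integration.integrable_sum)
    fix k m
    have "integrable Q (\<lambda>x. c m * cnj (c k) * (ek m x * ek (- k) x))" using integrable_mult_ek[OF integrable_ek] by simp
    then show "integrable Q (\<lambda>x. c m * ek m x * (cnj (c k) * ek (- k) x))" by (simp only: ac_simps)
  qed
  have Ipp: "(\<integral>x. p x * cnj (p x) \<partial>Q) = of_real (\<Sum>k\<in>F. (cmod (c k))\<^sup>2)"
  proof -
    have pint: "integrable Q p" unfolding p_def by (intro Bochner_Integration.integrable_sum integrable_mult_right integrable_ek)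
    have "(\<integral>x. p x * cnj (p x) \<partial>Q) = (\<integral>x. (\<Sum>k\<in>F. cnj (c k) * (p x * ek (- k) x)) \<partial>Q)"
      unfolding cp sum_distrib_left by (simp add: algebra_simps)
    also have "\<dots> = (\<Sum>k\<in>F. cnj (c k) * fcc p k)"
      using integrable_mult_ek[OF pint] by (subst Bochner_Integration.integral_sum) (auto simp: fcc_def)
    also have "\<dots> = (\<Sum>k\<in>F. cnj (c k) * c k)"
      using fcc_trig[OF F, of c] by (intro sum.cong) (auto simp: p_def[abs_def])
    also have "\<dots> = of_real (\<Sum>k\<in>F. (cmod (c k))\<^sup>2)"
      unfolding of_real_sum by (intro sum.cong refl) (simp only: complex_norm_square mult.commute)
    finally show ?thesis .
  qed
  have sq: "(cmod (g x - p x))\<^sup>2 = (cmod (g x))\<^sup>2 - 2 * Re (g x * cnj (p x)) + Re (p x * cnj (p x))" for x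
    unfolding cmod_power2 by (simp add: algebra_simps power2_eq_square)
  have "0 \<le> (\<integral>x. (cmod (g x - p x))\<^sup>2 \<partial>Q)" by simp
  also have "\<dots> = (\<integral>x. (cmod (g x))\<^sup>2 \<partial>Q) - 2 * Re (\<integral>x. g x * cnj (p x) \<partial>Q) + Re (\<integral>x. p x * cnj (p x) \<partial>Q)"
    unfolding sq using i2 gp pp by (simp del: complex_cnj_cancel_iff times_complex.sel)
  also have "\<dots> = (\<integral>x. (cmod (g x))\<^sup>2 \<partial>Q) - (\<Sum>k\<in>F. (cmod (c k))\<^sup>2)"
    unfolding Igp Ipp by simp
  finally show ?thesis by (simp add: c_def)
qed

lemma real_fcc: "real_sf (fcc (\<lambda>x. complex_of_real (f x)))"
proof -
  have "fcc (\<lambda>x. complex_of_real (f x)) (- k) = cnj (fcc (\<lambda>x. complex_of_real (f x)) k)" for k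
  proof -
    have "cnj (fcc (\<lambda>x. complex_of_real (f x)) k) = (\<integral>x. cnj (complex_of_real (f x) * ek (- k) x) \<partial>Q)"
      unfolding fcc_def by (rule Bochner_Integration.integral_cnj[symmetric])
    then show ?thesis by (simp add: fcc_def ek_minus)
  qed
  then show ?thesis by (simp add: real_sf_def negk_eq)
qed

text \<open>Quantifiers over wave numbers have to stay intact; otherwise simplification replaces
  each k by a triple of integers.\<close>

declare split_paired_All [simp del] split_paired_Ex [simp del]

section \<open>Square-integrable functions, completeness and weak limits\<close>

definition sqint :: "(real^3 \<Rightarrow> real) \<Rightarrow> bool" where
  "sqint g \<longleftrightarrow> g \<in> borel_measurable borel \<and> integrable Q (\<lambda>x. (g x)\<^sup>2)"

lemma sqint_integrable: "sqint g \<Longrightarrow> integrable Q g"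
  by (rule integrable_of_square) (auto simp: sqint_def)

lemma sqint_add:
  assumes "sqint f" "sqint g"
  shows "sqint (\<lambda>x. f x + g x)"
proof -
  have [measurable]: "f \<in> borel_measurable borel" "g \<in> borel_measurable borel" using assms by (auto simp: sqint_def)
  have "integrable Q (\<lambda>x. (f x + g x)\<^sup>2)"
  proof (rule Bochner_Integration.integrable_bound[of Q "\<lambda>x. 2 * (f x)\<^sup>2 + 2 * (g x)\<^sup>2"])
    have "(a + b)\<^sup>2 \<le> 2 * a\<^sup>2 + 2 * b\<^sup>2" for a b :: real
      using zero_le_power2[of "a - b"] by (simp add: power2_eq_square algebra_simps)
    then show "AE x in Q. norm ((f x + g x)\<^sup>2) \<le> norm (2 * (f x)\<^sup>2 + 2 * (g x)\<^sup>2)" by (intro AE_I2) simp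
    show "(\<lambda>x. (f x + g x)\<^sup>2) \<in> borel_measurable Q" by (rule meas_Q) measurable
  qed (use assms in \<open>auto simp: sqint_def\<close>)
  then show ?thesis by (auto simp: sqint_def)
qed

lemma sqint_cmult: "sqint f \<Longrightarrow> sqint (\<lambda>x. c * f x)"
  by (auto simp: sqint_def power_mult_distrib)

lemma nn_integral_Q_linear:
  assumes [measurable]: "f \<in> borel_measurable borel" "g \<in> borel_measurable borel"
  shows "(\<integral>\<^sup>+x. a * f x + b * g x \<partial>Q) = a * (\<integral>\<^sup>+x. f x \<partial>Q) + b * (\<integral>\<^sup>+x. g x \<partial>Q)"
  by (simp add: nn_integral_add nn_integral_cmult meas_Q)

lemma nn_integral_lim_le:
  fixes u :: "nat \<Rightarrow> 'a \<Rightarrow> ennreal"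
  assumes m: "\<And>i. u i \<in> borel_measurable M" and ae: "AE x in M. (\<lambda>i. u i x) \<longlonglongrightarrow> v x"
    and b: "\<And>i. i \<ge> start \<Longrightarrow> (\<integral>\<^sup>+x. u i x \<partial>M) \<le> C"
  shows "(\<integral>\<^sup>+x. v x \<partial>M) \<le> C"
proof -
  have "(\<integral>\<^sup>+x. v x \<partial>M) = (\<integral>\<^sup>+x. liminf (\<lambda>i. u i x) \<partial>M)"
    by (rule nn_integral_cong_AE, rule AE_mp[OF ae], intro AE_I2 impI)
       (metis lim_imp_Liminf sequentially_bot)
  also have "\<dots> \<le> liminf (\<lambda>i. \<integral>\<^sup>+x. u i x \<partial>M)" by (rule nn_integral_liminf[OF m])
  also have "\<dots> \<le> C"
  proof (rule order_trans[OF Liminf_le_Limsup Limsup_bounded])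
    show "\<forall>\<^sub>F i in sequentially. (\<integral>\<^sup>+x. u i x \<partial>M) \<le> C"
      by (rule eventually_mono[OF eventually_ge_at_top[of start] b])
  qed simp
  finally show ?thesis .
qed

text \<open>The geometric rate is as fast as needed for the distances of consecutive members to be
  summable in L^1, which gives convergence almost everywhere without a further subsequence; Fatou
  then bounds the distance to the limit. The constant 8 is what the parallelogram argument for weak
  limits delivers.\<close>

lemma sqint_complete:
  assumes h: "\<And>i. sqint (h i)"
    and d: "\<And>i j. i \<le> j \<Longrightarrow> (\<integral>x. (h i x - h j x)\<^sup>2 \<partial>Q) \<le> 8 / 4 ^ i"
  shows "\<exists>f. sqint f \<and> (AE x in Q. (\<lambda>i. h i x) \<longlonglongrightarrow> f x) \<and>
     (\<forall>i. (\<integral>x. \<bar>f x - h i x\<bar> \<partial>Q) \<le> 5 / 2 ^ i)"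
proof -
  have [measurable]: "h i \<in> borel_measurable borel" for i using h by (simp add: sqint_def)
  have diff: "sqint (\<lambda>x. h i x - h j x)" for i j
    using sqint_add[OF h[of i] sqint_cmult[OF h[of j], of "-1"]] by simp
  have nn2: "(\<integral>\<^sup>+x. ennreal ((h i x - h j x)\<^sup>2) \<partial>Q) \<le> ennreal (8 / 4 ^ i)" if "i \<le> j" for i j
    using diff[of i j] d[OF that] by (subst nn_integral_eq_integral) (auto simp: sqint_def intro!: ennreal_leI)
  \<comment> \<open>The weight 2^i balances the two terms: with a squared norm of at most 8/4^i the
    L^1 norm comes out as at most (1/2 + 4)/2^i.\<close>
  have amgm: "\<bar>y\<bar> \<le> 1 / 2 ^ i / 2 + 2 ^ i / 2 * y\<^sup>2" for y :: real and i :: nat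
  proof -
    have "2 * (1 * (2 ^ i * \<bar>y\<bar>)) \<le> 1 + (2 ^ i * \<bar>y\<bar>)\<^sup>2"
      using sum_squares_bound[of 1 "2 ^ i * \<bar>y\<bar>"] by simp
    then show ?thesis by (simp add: field_simps power2_eq_square)
  qed
  have nn1: "(\<integral>\<^sup>+x. ennreal \<bar>w x\<bar> \<partial>Q) \<le> ennreal (5 / 2 ^ i)"
    if [measurable]: "w \<in> borel_measurable borel" and w: "(\<integral>\<^sup>+x. ennreal ((w x)\<^sup>2) \<partial>Q) \<le> ennreal (8 / 4 ^ i)"
    for w :: "real^3 \<Rightarrow> real" and i
  proof -
    have "(\<integral>\<^sup>+x. ennreal \<bar>w x\<bar> \<partial>Q) \<le> (\<integral>\<^sup>+x. ennreal (1 / 2 ^ i / 2) + ennreal (2 ^ i / 2) * ennreal ((w x)\<^sup>2) \<partial>Q)"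
    proof (rule nn_integral_mono)
      fix x
      have "ennreal \<bar>w x\<bar> \<le> ennreal (1 / 2 ^ i / 2 + 2 ^ i / 2 * (w x)\<^sup>2)" by (rule ennreal_leI[OF amgm])
      also have "\<dots> = ennreal (1 / 2 ^ i / 2) + ennreal (2 ^ i / 2) * ennreal ((w x)\<^sup>2)"
        by (subst ennreal_plus, simp, simp, subst ennreal_mult) simp_all
      finally show "ennreal \<bar>w x\<bar> \<le> ennreal (1 / 2 ^ i / 2) + ennreal (2 ^ i / 2) * ennreal ((w x)\<^sup>2)" .
    qed
    also have "\<dots> = ennreal (1 / 2 ^ i / 2) + ennreal (2 ^ i / 2) * (\<integral>\<^sup>+x. ennreal ((w x)\<^sup>2) \<partial>Q)"
      using nn_integral_Q_linear[of "\<lambda>x. 1" "\<lambda>x. ennreal ((w x)\<^sup>2)" "ennreal (1 / 2 ^ i / 2)" "ennreal (2 ^ i / 2)"]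
      by (simp add: emeasure_Q)
    also have "\<dots> \<le> ennreal (1 / 2 ^ i / 2) + ennreal (2 ^ i / 2) * ennreal (8 / 4 ^ i)"
      using w by (intro add_left_mono mult_left_mono) auto
    also have "\<dots> = ennreal (1 / 2 ^ i / 2 + 2 ^ i / 2 * (8 / 4 ^ i))"
      by (simp add: ennreal_mult[symmetric] ennreal_plus[symmetric] del: ennreal_plus)
    also have "1 / 2 ^ i / 2 + 2 ^ i / 2 * (8 / 4 ^ i) = (9/2) / (2::real) ^ i"
    proof -
      have "(4::real) ^ i = 2 ^ i * 2 ^ i" by (simp add: power_mult_distrib[symmetric])
      then show ?thesis by (simp add: field_simps)
    qed
    also have "ennreal ((9/2) / 2 ^ i) \<le> ennreal (5 / 2 ^ i)" by (intro ennreal_leI divide_right_mono) auto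
    finally show ?thesis .
  qed
  have "(\<integral>\<^sup>+x. (\<Sum>i. ennreal \<bar>h i x - h (Suc i) x\<bar>) \<partial>Q) = (\<Sum>i. \<integral>\<^sup>+x. ennreal \<bar>h i x - h (Suc i) x\<bar> \<partial>Q)"
    by (rule nn_integral_suminf) (auto intro!: meas_Q)
  also have "\<dots> \<le> (\<Sum>i. ennreal (5 / 2 ^ i))"
    by (intro suminf_le allI nn1 nn2) auto
  also have "\<dots> < \<infinity>"
  proof -
    have "summable (\<lambda>i. 5 * (1/2::real) ^ i)" by (intro summable_mult summable_geometric) simp
    then show ?thesis by (subst suminf_ennreal2) (auto simp: power_divide)
  qed
  finally have "AE x in Q. (\<Sum>i. ennreal \<bar>h i x - h (Suc i) x\<bar>) \<noteq> \<infinity>"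
    by (intro nn_integral_PInf_AE) (auto intro!: meas_Q)
  then have conv: "AE x in Q. convergent (\<lambda>i. h i x)"
  proof (rule AE_mp, intro AE_I2 impI)
    fix x assume "(\<Sum>i. ennreal \<bar>h i x - h (Suc i) x\<bar>) \<noteq> \<infinity>"
    then have "summable (\<lambda>i. \<bar>h i x - h (Suc i) x\<bar>)"
      by (intro summable_suminf_not_top) auto
    then have "summable (\<lambda>i. h (Suc i) x - h i x)"
      by (intro summable_norm_cancel[of "\<lambda>i. h (Suc i) x - h i x"]) (simp add: abs_minus_commute)
    then have "convergent (\<lambda>n. \<Sum>i<n. h (Suc i) x - h i x)" by (simp add: summable_iff_convergent)
    then have "convergent (\<lambda>n. h n x - h 0 x)" by (simp only: sum_lessThan_telescope[of "\<lambda>i. h i x"])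
    then have "convergent (\<lambda>n. (h n x - h 0 x) + h 0 x)" by (intro convergent_add convergent_const)
    then show "convergent (\<lambda>i. h i x)" by simp
  qed
  define f where "f x = lim (\<lambda>i. h i x)" for x
  have [measurable]: "f \<in> borel_measurable borel" unfolding f_def by measurable
  have lim: "AE x in Q. (\<lambda>i. h i x) \<longlonglongrightarrow> f x"
    by (rule AE_mp[OF conv]) (simp add: f_def convergent_LIMSEQ_iff)
  have f2: "(\<integral>\<^sup>+x. ennreal ((f x - h i x)\<^sup>2) \<partial>Q) \<le> ennreal (8 / 4 ^ i)" for i
  proof (rule nn_integral_lim_le[where u="\<lambda>j x. ennreal ((h j x - h i x)\<^sup>2)" and start=i])
    show "AE x in Q. (\<lambda>j. ennreal ((h j x - h i x)\<^sup>2)) \<longlonglongrightarrow> ennreal ((f x - h i x)\<^sup>2)"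
      using lim by (rule AE_mp) (auto intro!: AE_I2 tendsto_intros)
    show "(\<integral>\<^sup>+x. ennreal ((h j x - h i x)\<^sup>2) \<partial>Q) \<le> ennreal (8 / 4 ^ i)" if "i \<le> j" for j
      using nn2[OF that] by (simp add: power2_commute)
  qed (auto intro!: meas_Q)
  have "sqint (\<lambda>x. f x - h i x)" for i
    using f2[of i] by (auto simp: sqint_def integrable_iff_bounded intro: le_less_trans intro!: meas_Q)
  then have "sqint (\<lambda>x. (f x - h 0 x) + h 0 x)" using h by (intro sqint_add) auto
  then have sf: "sqint f" by simp
  have "(\<integral>x. \<bar>f x - h i x\<bar> \<partial>Q) \<le> 5 / 2 ^ i" for i
  proof -
    have "integrable Q (\<lambda>x. f x - h i x)"
      using sqint_integrable[OF sf] sqint_integrable[OF h[of i]] by simp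
    then have "ennreal (\<integral>x. \<bar>f x - h i x\<bar> \<partial>Q) = (\<integral>\<^sup>+x. ennreal \<bar>f x - h i x\<bar> \<partial>Q)"
      by (intro nn_integral_eq_integral[symmetric]) auto
    also have "\<dots> \<le> ennreal (5 / 2 ^ i)" by (intro nn1 f2) measurable
    finally show ?thesis by (simp add: ennreal_le_iff)
  qed
  then show ?thesis using sf lim by blast
qed

text \<open>Minimising the \<open>L\<^sup>2\<close> norm over the decreasing convex sets of functions whose low modes are
close to the limit coefficients turns the given sequence into a strongly convergent one that
obeys the same convex bound.\<close>

lemma weak_limit:
  fixes g :: "nat \<Rightarrow> real^3 \<Rightarrow> real" and C :: ennreal
  assumes g: "\<And>n. sqint (g n)" and B: "\<And>n. (\<integral>x. (g n x)\<^sup>2 \<partial>Q) \<le> B"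
    and c: "\<And>k. (\<lambda>n. fourier_coeff (g n) k) \<longlonglongrightarrow> c k"
    and cx: "convex_on UNIV \<phi>" and nonneg: "\<And>x. \<phi> x \<ge> 0"
    and C: "\<And>n. (\<integral>\<^sup>+x. ennreal (\<phi> (g n x)) \<partial>Q) \<le> C"
  shows "\<exists>f. sqint f \<and> fourier_coeff f = c \<and> (\<integral>\<^sup>+x. ennreal (\<phi> (f x)) \<partial>Q) \<le> C"
proof -
  have cont: "continuous_on UNIV \<phi>" by (rule convex_on_continuous[OF open_UNIV cx])
  then have [measurable]: "\<phi> \<in> borel_measurable borel" by (rule borel_measurable_continuous_onI)
  define K where "K n = {w. sqint w \<and> (\<integral>\<^sup>+x. ennreal (\<phi> (w x)) \<partial>Q) \<le> C \<and>
      (\<forall>k. to_nat k < n \<longrightarrow> cmod (fourier_coeff w k - c k) \<le> 1 / real (Suc n))}" for n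
  define J where "J n = (\<lambda>w. \<integral>x. (w x)\<^sup>2 \<partial>Q) ` K n" for n
  \<comment> \<open>Membership in \<open>K n\<close> constrains only finitely many modes, so some
    late member of the sequence satisfies all constraints at once.\<close>
  have ex: "\<exists>m. g m \<in> K n" for n
  proof -
    have fin: "finite {k::wn. to_nat k < n}"
      by (rule finite_imageD[of to_nat]) (auto intro: finite_subset[of _ "{..<n}"] inj_onI)
    have "\<forall>k\<in>{k::wn. to_nat k < n}. \<forall>\<^sub>F m in sequentially. cmod (fourier_coeff (g m) k - c k) \<le> 1 / real (Suc n)"
    proof
      fix k :: wn
      have "\<forall>\<^sub>F m in sequentially. dist (fourier_coeff (g m) k) (c k) < 1 / real (Suc n)"
        using c[of k] by (rule tendstoD) simp
      then show "\<forall>\<^sub>F m in sequentially. cmod (fourier_coeff (g m) k - c k) \<le> 1 / real (Suc n)"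
        by (rule eventually_mono) (simp add: dist_norm)
    qed
    then have "\<forall>\<^sub>F m in sequentially. \<forall>k\<in>{k::wn. to_nat k < n}. cmod (fourier_coeff (g m) k - c k) \<le> 1 / real (Suc n)"
      by (rule eventually_ball_finite[OF fin])
    then obtain m where "\<forall>k\<in>{k::wn. to_nat k < n}. cmod (fourier_coeff (g m) k - c k) \<le> 1 / real (Suc n)"
      using eventually_happens'[OF sequentially_bot] by blast
    then show ?thesis using g C by (auto simp: K_def)
  qed
  have Kmono: "K n \<subseteq> K m" if "m \<le> n" for m n
  proof -
    have "1 / real (Suc n) \<le> 1 / real (Suc m)" using that by (intro divide_left_mono) auto
    show ?thesis
    proof
      fix w assume w: "w \<in> K n"
      have "cmod (fourier_coeff w k - c k) \<le> 1 / real (Suc m)" if k: "to_nat k < m" for k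
      proof -
        have "cmod (fourier_coeff w k - c k) \<le> 1 / real (Suc n)"
          using w k \<open>m \<le> n\<close> unfolding K_def by (metis (mono_tags, lifting) mem_Collect_eq order_less_le_trans)
        then show ?thesis using \<open>1 / real (Suc n) \<le> 1 / real (Suc m)\<close> by linarith
      qed
      then show "w \<in> K m" using w by (simp add: K_def)
    qed
  qed
  have Kconv: "(\<lambda>x. (v x + w x) / 2) \<in> K n" if "v \<in> K n" "w \<in> K n" for v w n
  proof -
    have sv: "sqint v" "sqint w" using that by (auto simp: K_def)
    then have [measurable]: "v \<in> borel_measurable borel" "w \<in> borel_measurable borel" by (auto simp: sqint_def)
    have s: "sqint (\<lambda>x. (v x + w x) / 2)"
      using sqint_cmult[OF sqint_add[OF sv], of "1/2"] by simp
    have half: "ennreal (\<phi> ((v x + w x) / 2)) \<le> ennreal (1/2) * ennreal (\<phi> (v x)) + ennreal (1/2) * ennreal (\<phi> (w x))" for x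
    proof -
      have "\<phi> ((1 - 1/2) *\<^sub>R v x + (1/2) *\<^sub>R w x) \<le> (1 - 1/2) * \<phi> (v x) + (1/2) * \<phi> (w x)"
        by (rule convex_onD[OF cx]) auto
      then have "ennreal (\<phi> ((v x + w x) / 2)) \<le> ennreal ((1/2) * \<phi> (v x) + (1/2) * \<phi> (w x))"
        by (intro ennreal_leI) (simp add: add_divide_distrib)
      also have "\<dots> = ennreal (1/2) * ennreal (\<phi> (v x)) + ennreal (1/2) * ennreal (\<phi> (w x))"
        using nonneg by (subst ennreal_plus, simp, simp, subst ennreal_mult, simp, simp, subst ennreal_mult) simp_all
      finally show ?thesis .
    qed
    have "(\<integral>\<^sup>+x. ennreal (\<phi> ((v x + w x) / 2)) \<partial>Q)
        \<le> (\<integral>\<^sup>+x. ennreal (1/2) * ennreal (\<phi> (v x)) + ennreal (1/2) * ennreal (\<phi> (w x)) \<partial>Q)"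
      by (rule nn_integral_mono) (rule half)
    also have "\<dots> = ennreal (1/2) * (\<integral>\<^sup>+x. ennreal (\<phi> (v x)) \<partial>Q) + ennreal (1/2) * (\<integral>\<^sup>+x. ennreal (\<phi> (w x)) \<partial>Q)"
      by (rule nn_integral_Q_linear) measurable
    also have "\<dots> \<le> ennreal (1/2) * C + ennreal (1/2) * C"
      using that by (intro add_mono mult_left_mono) (auto simp: K_def)
    also have "\<dots> = (ennreal (1/2) + ennreal (1/2)) * C" by (simp only: distrib_right)
    also have "ennreal (1/2) + ennreal (1/2) = 1" by (subst ennreal_plus[symmetric]) auto
    finally have p: "(\<integral>\<^sup>+x. ennreal (\<phi> ((v x + w x) / 2)) \<partial>Q) \<le> C" by simp
    have fc: "fourier_coeff (\<lambda>x. (v x + w x) / 2) k = (fourier_coeff v k + fourier_coeff w k) / 2" for k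
    proof -
      have i: "integrable Q (\<lambda>x. complex_of_real (v x))" "integrable Q (\<lambda>x. complex_of_real (w x))"
        using sqint_integrable[OF sv(1)] sqint_integrable[OF sv(2)] by auto
      have "fourier_coeff (\<lambda>x. (v x + w x) / 2) k = fcc (\<lambda>x. (1/2) * (complex_of_real (v x) + complex_of_real (w x))) k"
        by (subst fourier_coeff_fcc) auto
      also have "\<dots> = (1/2) * (fcc (\<lambda>x. complex_of_real (v x)) k + fcc (\<lambda>x. complex_of_real (w x)) k)"
        by (subst fcc_cmult, subst fcc_add[OF i], rule refl)
      finally show ?thesis by (simp add: fourier_coeff_fcc)
    qed
    have "cmod (fourier_coeff (\<lambda>x. (v x + w x) / 2) k - c k) \<le> 1 / real (Suc n)" if k: "to_nat k < n" for k
    proof -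
      have vw: "cmod (fourier_coeff v k - c k) \<le> 1 / real (Suc n)" "cmod (fourier_coeff w k - c k) \<le> 1 / real (Suc n)"
        using \<open>v \<in> K n\<close> \<open>w \<in> K n\<close> k by (auto simp: K_def)
      have "fourier_coeff (\<lambda>x. (v x + w x) / 2) k - c k = ((fourier_coeff v k - c k) + (fourier_coeff w k - c k)) / 2"
        by (simp add: fc field_simps)
      then have "cmod (fourier_coeff (\<lambda>x. (v x + w x) / 2) k - c k) \<le> (cmod (fourier_coeff v k - c k) + cmod (fourier_coeff w k - c k)) / 2"
        using norm_triangle_ineq[of "fourier_coeff v k - c k" "fourier_coeff w k - c k"]
        by (simp only: norm_divide norm_numeral divide_right_mono)
      moreover have "x \<le> (a + b) / 2 \<Longrightarrow> a \<le> e \<Longrightarrow> b \<le> e \<Longrightarrow> x \<le> e" for x a b e :: real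
        by auto
      ultimately show ?thesis using vw by blast
    qed
    then show ?thesis using s p by (auto simp: K_def)
  qed
  have Jb: "bdd_below (J n)" for n by (rule bdd_belowI[of _ 0]) (auto simp: J_def)
  have Jne: "J n \<noteq> {}" for n using ex[of n] by (auto simp: J_def)
  define I where "I n = Inf (J n)" for n
  have IB: "I n \<le> B" for n
  proof -
    obtain m where "g m \<in> K n" using ex by blast
    then have "I n \<le> (\<integral>x. (g m x)\<^sup>2 \<partial>Q)" unfolding I_def by (intro cInf_lower Jb) (auto simp: J_def)
    then show ?thesis using B[of m] by linarith
  qed
  have Imono: "I m \<le> I n" if "m \<le> n" for m n
    unfolding I_def using Kmono[OF that] by (intro cInf_superset_mono Jne Jb) (auto simp: J_def)
  \<comment> \<open>The minimal squared norms increase along the shrinking sets and stay below B, so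
    they have a finite supremum; members that are almost minimal in sets with nearly this value form
    a Cauchy sequence.\<close>
  define L where "L = (SUP n. I n)"
  have bdI: "bdd_above (range I)" using IB by (intro bdd_aboveI[of _ B]) auto
  have IL: "I n \<le> L" for n unfolding L_def by (rule cSUP_upper[OF _ bdI]) simp
  have "\<exists>n\<ge>i. L - 1 / 4 ^ i < I n" for i :: nat
  proof -
    have "L - 1 / 4 ^ i < L" by simp
    then obtain n where "L - 1 / 4 ^ i < I n"
      using less_cSUP_iff[OF UNIV_not_empty bdI, of "L - 1 / 4 ^ i"] by (auto simp: L_def)
    then show ?thesis using Imono[of n "max i n"] by (intro exI[of _ "max i n"]) auto
  qed
  then have "\<forall>i. \<exists>n. i \<le> n \<and> L - 1 / 4 ^ i < I n" by blast
  then obtain N where "\<forall>i. i \<le> N i \<and> L - 1 / 4 ^ i < I (N i)" by (rule choice[THEN exE])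
  then have N: "\<And>i. N i \<ge> i" "\<And>i. L - 1 / 4 ^ i < I (N i)" by blast+
  have "\<exists>w\<in>K (N i). (\<integral>x. (w x)\<^sup>2 \<partial>Q) < L + 1 / 4 ^ i" for i
  proof -
    have "0 < 1 / (4::real) ^ i" by simp
    then have "Inf (J (N i)) < L + 1 / 4 ^ i" using IL[of "N i"] unfolding I_def by linarith
    then obtain y where "y \<in> J (N i)" "y < L + 1 / 4 ^ i" using cInf_lessD[OF Jne] by blast
    then show ?thesis unfolding J_def by blast
  qed
  then have "\<forall>i. \<exists>w. w \<in> K (N i) \<and> (\<integral>x. (w x)\<^sup>2 \<partial>Q) < L + 1 / 4 ^ i" by blast
  then obtain h where "\<forall>i. h i \<in> K (N i) \<and> (\<integral>x. (h i x)\<^sup>2 \<partial>Q) < L + 1 / 4 ^ i" by (rule choice[THEN exE])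
  then have h: "\<And>i. h i \<in> K (N i)" "\<And>i. (\<integral>x. (h i x)\<^sup>2 \<partial>Q) < L + 1 / 4 ^ i" by blast+
  have hs: "sqint (h i)" for i using h(1) by (auto simp: K_def)
  have d: "(\<integral>x. (h i x - h j x)\<^sup>2 \<partial>Q) \<le> 8 / 4 ^ i" if ij: "i \<le> j" for i j
  proof -
    define n where "n = min (N i) (N j)"
    have p4: "1 / (4::real) ^ j \<le> 1 / 4 ^ i" using ij by (intro divide_left_mono power_increasing) auto
    have In: "I n > L - 1 / 4 ^ i" using N(2)[of i] N(2)[of j] p4 by (auto simp: n_def min_def)
    have "(\<lambda>x. (h i x + h j x) / 2) \<in> K n"
      using h(1)[of i] h(1)[of j] Kmono[of n "N i"] Kmono[of n "N j"] by (intro Kconv) (auto simp: n_def)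
    then have avg: "I n \<le> (\<integral>x. ((h i x + h j x) / 2)\<^sup>2 \<partial>Q)" unfolding I_def by (intro cInf_lower Jb) (auto simp: J_def)
    have i: "integrable Q (\<lambda>x. (h i x)\<^sup>2)" "integrable Q (\<lambda>x. (h j x)\<^sup>2)" "integrable Q (\<lambda>x. ((h i x + h j x) / 2)\<^sup>2)"
      using hs[of i] hs[of j] sqint_cmult[OF sqint_add[OF hs[of i] hs[of j]], of "1/2"] by (auto simp: sqint_def)
    \<comment> \<open>Parallelogram identity. The midpoint lies in \<open>K n\<close>, so its
      squared norm exceeds L - 1/4^i, while both functions stay below L + 1/4^i; the sum 2 + 2 + 4
      is the constant 8.\<close>
    have "(h i x - h j x)\<^sup>2 = 2 * (h i x)\<^sup>2 + 2 * (h j x)\<^sup>2 - 4 * ((h i x + h j x) / 2)\<^sup>2" for x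
      by (simp add: power2_eq_square field_simps)
    then have "(\<integral>x. (h i x - h j x)\<^sup>2 \<partial>Q) = 2 * (\<integral>x. (h i x)\<^sup>2 \<partial>Q) + 2 * (\<integral>x. (h j x)\<^sup>2 \<partial>Q) - 4 * (\<integral>x. ((h i x + h j x) / 2)\<^sup>2 \<partial>Q)"
      using i by simp
    then show ?thesis using avg In h(2)[of i] h(2)[of j] p4 by linarith
  qed
  obtain f where f: "sqint f" and lim: "AE x in Q. (\<lambda>i. h i x) \<longlonglongrightarrow> f x"
    and f1: "\<And>i. (\<integral>x. \<bar>f x - h i x\<bar> \<partial>Q) \<le> 5 / 2 ^ i"
    using sqint_complete[OF hs d] by blast
  have [measurable]: "f \<in> borel_measurable borel" "h i \<in> borel_measurable borel" for i
    using f hs by (auto simp: sqint_def)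
  have "(\<integral>\<^sup>+x. ennreal (\<phi> (f x)) \<partial>Q) \<le> C"
  proof (rule nn_integral_lim_le[where u="\<lambda>j x. ennreal (\<phi> (h j x))" and start=0])
    have "isCont \<phi> y" for y using cont by (simp add: continuous_on_eq_continuous_at)
    then show "AE x in Q. (\<lambda>j. ennreal (\<phi> (h j x))) \<longlonglongrightarrow> ennreal (\<phi> (f x))"
      using lim by (elim AE_mp) (auto intro!: AE_I2 tendsto_ennrealI isCont_tendsto_compose[of _ \<phi>])
    show "(\<integral>\<^sup>+x. ennreal (\<phi> (h j x)) \<partial>Q) \<le> C" for j using h(1)[of j] by (auto simp: K_def)
  qed (auto intro!: meas_Q)
  moreover have "fourier_coeff f = c"
  proof
    fix k
    have bound: "cmod (fourier_coeff f k - c k) \<le> 5 * (1/2) ^ i + 1 / real (Suc i)" if i: "i > to_nat k" for i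
    proof -
      have int: "integrable Q (\<lambda>x. complex_of_real (f x))" "integrable Q (\<lambda>x. complex_of_real (h i x))"
        using sqint_integrable[OF f] sqint_integrable[OF hs[of i]] by auto
      have "fourier_coeff f k - fourier_coeff (h i) k = (\<integral>x. (complex_of_real (f x) - complex_of_real (h i x)) * ek (- k) x \<partial>Q)"
        by (simp add: fourier_coeff_fcc fcc_diff[OF int, symmetric]) (simp add: fcc_def)
      then have "cmod (fourier_coeff f k - fourier_coeff (h i) k) \<le> (\<integral>x. \<bar>f x - h i x\<bar> \<partial>Q)"
        using integral_norm_bound[of Q "\<lambda>x. (complex_of_real (f x) - complex_of_real (h i x)) * ek (- k) x"]
        by (simp add: norm_mult flip: of_real_diff)
      then have 1: "cmod (fourier_coeff f k - fourier_coeff (h i) k) \<le> 5 * (1/2) ^ i"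
        using f1[of i] by (simp add: power_divide)
      have "cmod (fourier_coeff (h i) k - c k) \<le> 1 / real (Suc (N i))"
        using h(1)[of i] N(1)[of i] i by (auto simp: K_def)
      also have "\<dots> \<le> 1 / real (Suc i)" using N(1)[of i] by (intro divide_left_mono) auto
      finally have 2: "cmod (fourier_coeff (h i) k - c k) \<le> 1 / real (Suc i)" .
      show ?thesis
        using norm_triangle_ineq[of "fourier_coeff f k - fourier_coeff (h i) k" "fourier_coeff (h i) k - c k"] 1 2 by simp
    qed
    have "(\<lambda>i. 5 * (1/2) ^ i + 1 / real (Suc i)) \<longlonglongrightarrow> 5 * 0 + 0"
      by (intro tendsto_add tendsto_mult tendsto_const LIMSEQ_realpow_zero lim_1_over_n[THEN LIMSEQ_Suc]) auto
    then have "cmod (fourier_coeff f k - c k) \<le> 5 * 0 + 0"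
      by (rule LIMSEQ_le_const) (use bound in \<open>auto intro!: exI[of _ "Suc (to_nat k)"]\<close>)
    then show "fourier_coeff f k = c k" by simp
  qed
  ultimately show ?thesis using f by blast
qed

section \<open>Partial Fourier sums and functions with given coefficients\<close>

definition boxk :: "nat \<Rightarrow> wn set" where
  "boxk N = {- int N..int N} \<times> {- int N..int N} \<times> {- int N..int N}"

lemma finite_boxk [simp]: "finite (boxk N)"
  by (simp add: boxk_def)

lemma boxk_uminus: "- k \<in> boxk N \<longleftrightarrow> k \<in> boxk N"
  by (cases k) (auto simp: boxk_def)

lemma boxk_exhaust: "\<exists>N0. \<forall>N\<ge>N0. k \<in> boxk N"
proof -
  obtain a b c where k: "k = (a,b,c)" by (cases k)
  show ?thesis
    by (rule exI[of _ "Int.nat (\<bar>a\<bar> + \<bar>b\<bar> + \<bar>c\<bar>)"]) (auto simp: k boxk_def)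
qed

lemma abs_kreal_boxk: "k \<in> boxk N \<Longrightarrow> \<bar>kreal k $ j\<bar> \<le> real N"
proof -
  assume k: "k \<in> boxk N"
  have "\<forall>j. \<bar>kreal k $ j\<bar> \<le> real N"
    using k by (cases k) (simp add: boxk_def kreal_def forall_3, linarith)
  then show ?thesis ..
qed

lemma real_trig_sum:
  assumes "finite K" "\<And>k. - k \<in> K \<longleftrightarrow> k \<in> K" "\<And>k. c (- k) = cnj (c k)"
  shows "(\<Sum>k\<in>K. c k * ek k x) = complex_of_real (Re (\<Sum>k\<in>K. c k * ek k x))"
proof -
  have "cnj (\<Sum>k\<in>K. c k * ek k x) = (\<Sum>k\<in>K. c (- k) * ek (- k) x)"
    by (simp add: ek_minus assms(3))
  also have "\<dots> = (\<Sum>k\<in>K. c k * ek k x)"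
    by (rule sum.reindex_bij_witness[where i="uminus" and j="uminus"]) (auto simp: assms(2))
  finally have "cnj (\<Sum>k\<in>K. c k * ek k x) = (\<Sum>k\<in>K. c k * ek k x)" .
  then have "Im (\<Sum>k\<in>K. c k * ek k x) = 0"
    by (metis complex_cnj_cancel_iff complex_is_Real_iff complex_cnj_complex_of_real Reals_cnj_iff)
  then show ?thesis by (simp add: complex_eq_iff)
qed

text \<open>Partial sums are bounded in L^2 and their coefficients are eventually constant, so
  \<open>weak_limit\<close> with the zero convex function produces the representative. The averaging
  scheme acts on functions, hence it has to start from one.\<close>

lemma riesz_fischer:
  assumes "c \<in> Hs 0"
  shows "\<exists>f. sqint f \<and> fourier_coeff f = c"
proof -
  have c0: "c 0 = 0" and creal: "\<And>k. c (- k) = cnj (c k)" and "hs_sq 0 c < \<infinity>"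
    using assms by (auto simp: Hs_def real_sf_def negk_eq zero_wn)
  moreover have "hs_sq 0 c = l2sq c"
    unfolding hs_sq_def using c0 by (intro nn_integral_cong) (auto simp: powr_def)
  ultimately obtain B where B: "l2sq c = ennreal B" "B \<ge> 0"
    by (cases "l2sq c") auto
  define p where "p n x = (\<Sum>k\<in>boxk n. c k * ek k x)" for n x
  define g where "g n x = Re (p n x)" for n x
  have pg: "p n x = complex_of_real (g n x)" for n x
    unfolding p_def g_def by (rule real_trig_sum) (auto simp: boxk_uminus creal)
  have [measurable]: "p n \<in> borel_measurable borel" for n unfolding p_def by measurable
  have [measurable]: "g n \<in> borel_measurable borel" for n unfolding g_def by measurable
  have sq: "complex_of_real ((g n x)\<^sup>2) = (\<Sum>k\<in>boxk n. cnj (c k) * (p n x * ek (- k) x))" for n x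
  proof -
    have "complex_of_real ((g n x)\<^sup>2) = p n x * cnj (p n x)" by (simp add: pg power2_eq_square)
    also have "\<dots> = (\<Sum>k\<in>boxk n. cnj (c k) * (p n x * ek (- k) x))"
      by (simp add: p_def[of n x, THEN arg_cong[where f=cnj]] ek_minus sum_distrib_left mult.left_commute)
    finally show ?thesis .
  qed
  have pint: "integrable Q (p n)" for n
    unfolding p_def by (intro Bochner_Integration.integrable_sum integrable_mult_right integrable_ek)
  have sqi: "integrable Q (\<lambda>x. complex_of_real ((g n x)\<^sup>2))" for n
    unfolding sq by (intro Bochner_Integration.integrable_sum integrable_mult_right integrable_mult_ek pint)
  then have sg: "sqint (g n)" for n
    unfolding sqint_def using complex_of_real_integrable_eq[of Q "\<lambda>x. (g n x)\<^sup>2"] by simp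
  have fc: "fourier_coeff (g n) k = (if k \<in> boxk n then c k else 0)" for n k
    using fcc_trig[of "boxk n" c k] by (simp add: fourier_coeff_fcc pg[symmetric] p_def[abs_def])
  have "(\<integral>x. (g n x)\<^sup>2 \<partial>Q) \<le> B" for n
  proof -
    have "complex_of_real (\<integral>x. (g n x)\<^sup>2 \<partial>Q) = (\<integral>x. complex_of_real ((g n x)\<^sup>2) \<partial>Q)" by (rule integral_complex_of_real[symmetric])
    also have "\<dots> = (\<Sum>k\<in>boxk n. cnj (c k) * fcc (p n) k)"
      unfolding sq using integrable_mult_ek[OF pint] by (subst Bochner_Integration.integral_sum) (auto simp: fcc_def)
    also have "\<dots> = (\<Sum>k\<in>boxk n. complex_of_real ((cmod (c k))\<^sup>2))"
    proof (rule sum.cong[OF refl])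
      fix k assume "k \<in> boxk n"
      then have "fcc (p n) k = c k" using fc[of n k] by (simp add: fourier_coeff_fcc pg[symmetric])
      then show "cnj (c k) * fcc (p n) k = complex_of_real ((cmod (c k))\<^sup>2)"
        by (simp only: complex_norm_square mult.commute)
    qed
    finally have "(\<integral>x. (g n x)\<^sup>2 \<partial>Q) = (\<Sum>k\<in>boxk n. (cmod (c k))\<^sup>2)"
      by (simp only: of_real_sum[symmetric] of_real_eq_iff)
    also have "ennreal \<dots> \<le> ennreal B"
      using nns_finite_sum_le[of "boxk n" "\<lambda>k. ennreal ((cmod (c k))\<^sup>2)"] B by simp
    then have "(\<Sum>k\<in>boxk n. (cmod (c k))\<^sup>2) \<le> B" using B(2) by simp
    finally show ?thesis .
  qed
  moreover have "(\<lambda>n. fourier_coeff (g n) k) \<longlonglongrightarrow> c k" for k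
  proof (rule tendsto_eventually)
    obtain N0 where "\<forall>N\<ge>N0. k \<in> boxk N" using boxk_exhaust by blast
    then show "\<forall>\<^sub>F n in sequentially. fourier_coeff (g n) k = c k"
      by (auto simp: fc eventually_sequentially)
  qed
  ultimately show ?thesis
    using weak_limit[of g B c "\<lambda>x. 0" top] sg by (auto simp: convex_on_def)
qed

section \<open>The discrete scheme\<close>

definition sg :: "bool \<Rightarrow> real" where "sg b = (if b then 1 else - 1)"

lemma sg_simps [simp]: "sg True = 1" "sg False = -1" "\<bar>sg b\<bar> = 1" "sg b * sg b = 1"
  by (auto simp: sg_def)

lemma sum_prod_bool: "(\<Sum>p\<in>(UNIV::(3\<times>bool) set). F p) = (\<Sum>j\<in>UNIV. F (j,True) + F (j,False))"
proof -
  have "(\<Sum>p\<in>(UNIV::(3\<times>bool) set). F p) = (\<Sum>j\<in>UNIV. \<Sum>b\<in>UNIV. F (j,b))"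
    by (simp add: UNIV_Times_UNIV[symmetric] sum.cartesian_product del: UNIV_Times_UNIV)
  then show ?thesis by (simp add: UNIV_bool add.commute)
qed

definition shiftp :: "real \<Rightarrow> 3 \<times> bool \<Rightarrow> real^3" where
  "shiftp h p = axis (fst p) (sg (snd p) * h)"

text \<open>\<open>wgt \<kappa> h \<tau> v p y\<close> is the share of the value at \<open>y\<close> that a step sends to the neighbour
\<open>y - shiftp h p\<close>.\<close>

definition wgt :: "real \<Rightarrow> real \<Rightarrow> real \<Rightarrow> (3 \<Rightarrow> real^3 \<Rightarrow> real) \<Rightarrow> 3 \<times> bool \<Rightarrow> real^3 \<Rightarrow> real" where
  "wgt \<kappa> h \<tau> v p y = \<tau> * (\<kappa> / h\<^sup>2 - sg (snd p) * v (fst p) y / (2 * h))"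

text \<open>The explicit Euler step for \<theta>_t + D(v \<theta>) = \<kappa> Lap \<theta>, where D
  is the central difference divergence and Lap the seven-point Laplacian with mesh h, with the terms
  collected by the point at which \<theta> is evaluated.\<close>

definition thstep :: "real \<Rightarrow> real \<Rightarrow> real \<Rightarrow> (3 \<Rightarrow> real^3 \<Rightarrow> real) \<Rightarrow> (real^3 \<Rightarrow> real) \<Rightarrow> real^3 \<Rightarrow> real" where
  "thstep \<kappa> h \<tau> v \<theta> x = (1 - 6 * \<tau> * \<kappa> / h\<^sup>2) * \<theta> x
     + (\<Sum>p\<in>UNIV. wgt \<kappa> h \<tau> v p (x + shiftp h p) * \<theta> (x + shiftp h p))"

lemma nn_integral_Q_sum:
  assumes [measurable]: "a \<in> borel_measurable borel" "\<And>p. b p \<in> borel_measurable borel"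
  shows "(\<integral>\<^sup>+x. a x + c * (\<Sum>p\<in>I. b p x) \<partial>Q) = (\<integral>\<^sup>+x. a x \<partial>Q) + c * (\<Sum>p\<in>I. \<integral>\<^sup>+x. b p x \<partial>Q)"
proof -
  have 1: "a \<in> borel_measurable Q" "b p \<in> borel_measurable Q" "(\<lambda>x. \<Sum>p\<in>I. b p x) \<in> borel_measurable Q"
    "(\<lambda>x. c * (\<Sum>p\<in>I. b p x)) \<in> borel_measurable Q" for p
    using assms by (auto intro!: meas_Q)
  show ?thesis by (simp only: nn_integral_add[OF 1(1) 1(4)] nn_integral_cmult[OF 1(3)] nn_integral_sum[OF 1(2)])
qed

text \<open>Each condition secures one property of the weights. The parabolic step restriction keeps
  the central weight at least 1/2; the bound on h |v|, a small cell Peclet number, lets diffusion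
  dominate the antisymmetric transport part, so the other weights are positive; the vanishing
  discrete divergence makes the weights that arrive at a point sum to one.\<close>

locale transport_step =
  fixes \<kappa> h \<tau> :: real and v :: "3 \<Rightarrow> real^3 \<Rightarrow> real"
  assumes kappa: "\<kappa> > 0" and h: "0 < h" "h \<le> 1" and tau: "\<tau> > 0" "12 * \<tau> * \<kappa> \<le> h\<^sup>2"
    and v_meas [measurable]: "\<And>j. v j \<in> borel_measurable borel" and v_per: "\<And>j. periodic (v j)"
    and v_small: "\<And>j x. h * \<bar>v j x\<bar> \<le> \<kappa>"
    and v_div: "\<And>x. (\<Sum>j\<in>UNIV. v j (x + axis j h) - v j (x + axis j (- h))) = 0"
begin

definition "w0 = 1 - 6 * \<tau> * \<kappa> / h\<^sup>2"

abbreviation "w \<equiv> wgt \<kappa> h \<tau> v"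

lemma w0_ge: "w0 \<ge> 1/2"
  using tau h by (simp add: w0_def field_simps)

lemma w_ge: "w p y \<ge> \<tau> * \<kappa> / (2 * h\<^sup>2)"
proof -
  have "h * (sg (snd p) * v (fst p) y) \<le> h * \<bar>v (fst p) y\<bar>"
    using h by (intro mult_left_mono) (auto simp: sg_def)
  also have "\<dots> \<le> \<kappa>" by (rule v_small)
  finally have *: "h * (sg (snd p) * v (fst p) y) \<le> \<kappa>" .
  have "\<kappa> / h\<^sup>2 - sg (snd p) * v (fst p) y / (2 * h) = (2 * \<kappa> - h * (sg (snd p) * v (fst p) y)) / (2 * h\<^sup>2)"
    using h by (simp add: field_simps power2_eq_square)
  also have "\<dots> \<ge> \<kappa> / (2 * h\<^sup>2)" using * h by (intro divide_right_mono) auto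
  finally have "\<tau> * (\<kappa> / (2 * h\<^sup>2)) \<le> w p y" unfolding wgt_def using tau by (intro mult_left_mono) auto
  then show ?thesis by simp
qed

lemma w_nonneg: "w p y \<ge> 0"
proof -
  have "0 \<le> \<tau> * \<kappa> / (2 * h\<^sup>2)" using kappa tau by simp
  then show ?thesis using w_ge[of p y] by linarith
qed

lemma shift_le: "\<bar>sg b * h\<bar> \<le> 1"
  using h by (simp add: abs_mult)

text \<open>Conservation of mass: the share sent forward along an axis and the share sent backward
  contain the velocity with opposite signs. This holds for any velocity, in contrast to the sum of
  the arriving weights.\<close>

lemma w_col: "w0 + (\<Sum>p\<in>UNIV. w p y) = 1"
  by (simp add: sum_prod_bool wgt_def w0_def sum.distrib[symmetric] algebra_simps)

text \<open>The arriving weights see the velocity at different points, and what is left of it is the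
  discrete divergence at x. Total weight one is what Jensen's inequality requires.\<close>

lemma w_row: "w0 + (\<Sum>p\<in>UNIV. w p (x + shiftp h p)) = 1"
proof -
  have "(\<Sum>p\<in>UNIV. w p (x + shiftp h p)) = (\<Sum>j\<in>UNIV. 2 * (\<tau> * \<kappa> / h\<^sup>2) - \<tau> / (2 * h) * (v j (x + axis j h) - v j (x + axis j (- h))))"
    by (simp add: sum_prod_bool wgt_def shiftp_def algebra_simps)
  also have "\<dots> = 6 * \<tau> * \<kappa> / h\<^sup>2 - \<tau> / (2 * h) * (\<Sum>j\<in>UNIV. v j (x + axis j h) - v j (x + axis j (- h)))"
    unfolding sum_subtractf sum_distrib_left[symmetric] by simp
  finally show ?thesis using v_div by (simp add: w0_def)
qed

lemma thstep_eq: "thstep \<kappa> h \<tau> v \<theta> x = w0 * \<theta> x + (\<Sum>p\<in>UNIV. w p (x + shiftp h p) * \<theta> (x + shiftp h p))"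
  by (simp add: thstep_def w0_def)

lemma thstep_meas [measurable]:
  assumes [measurable]: "\<theta> \<in> borel_measurable borel"
  shows "thstep \<kappa> h \<tau> v \<theta> \<in> borel_measurable borel"
  unfolding thstep_def[abs_def] wgt_def by measurable

lemma thstep_per:
  assumes "periodic \<theta>"
  shows "periodic (thstep \<kappa> h \<tau> v \<theta>)"
proof -
  have sh: "f ((x + axis j 1) + y) = f (x + y)" if "periodic f" for f :: "real^3 \<Rightarrow> real" and x y j
    using that periodic_shift[OF that, of y] by (simp add: periodic_def)
  have "thstep \<kappa> h \<tau> v \<theta> (x + axis j 1) = thstep \<kappa> h \<tau> v \<theta> x" for x j
    unfolding thstep_def wgt_def sh[OF assms] sh[OF v_per] using assms by (simp add: periodic_def)
  then show ?thesis by (simp add: periodic_def)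
qed

text \<open>Translating every neighbour term back to its point of origin turns arriving weights into
  departing weights, whose total is one by \<open>w_col\<close>.\<close>

lemma wsum_integral:
  assumes [measurable]: "G \<in> borel_measurable borel" and per: "periodic G" and nn: "\<And>x. G x \<ge> 0"
  shows "(\<integral>\<^sup>+x. ennreal (w0 * G x + (\<Sum>p\<in>UNIV. w p (x + shiftp h p) * G (x + shiftp h p))) \<partial>Q) = (\<integral>\<^sup>+x. ennreal (G x) \<partial>Q)"
proof -
  have w0nn: "w0 \<ge> 0" using w0_ge by linarith
  have [measurable]: "w p \<in> borel_measurable borel" for p unfolding wgt_def by measurable
  have tr: "(\<integral>\<^sup>+x. ennreal (w p (x + shiftp h p) * G (x + shiftp h p)) \<partial>Q) = (\<integral>\<^sup>+x. ennreal (w p x * G x) \<partial>Q)" for p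
  proof -
    have "periodic (\<lambda>x. ennreal (w p x * G x))"
      using per v_per unfolding periodic_def wgt_def by simp
    then show ?thesis
      unfolding shiftp_def by (intro nn_integral_translate[OF _ _ shift_le]) measurable
  qed
  have split: "ennreal (w0 * G x + (\<Sum>p\<in>UNIV. a p * b p)) = ennreal (w0 * G x) + (\<Sum>p\<in>UNIV. ennreal (a p * b p))"
    if "\<And>p. a p \<ge> 0" "\<And>p. b p \<ge> 0" for x and a b :: "3 \<times> bool \<Rightarrow> real"
    using that w0nn nn by (subst ennreal_plus) (auto intro!: sum_nonneg simp: sum_ennreal)
  have "(\<integral>\<^sup>+x. ennreal (w0 * G x + (\<Sum>p\<in>UNIV. w p (x + shiftp h p) * G (x + shiftp h p))) \<partial>Q)
    = (\<integral>\<^sup>+x. ennreal (w0 * G x) + (\<Sum>p\<in>UNIV. ennreal (w p (x + shiftp h p) * G (x + shiftp h p))) \<partial>Q)"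
    using w_nonneg nn by (simp add: split)
  also have "\<dots> = (\<integral>\<^sup>+x. ennreal (w0 * G x) \<partial>Q) + (\<Sum>p\<in>UNIV. \<integral>\<^sup>+x. ennreal (w p (x + shiftp h p) * G (x + shiftp h p)) \<partial>Q)"
    using nn_integral_Q_sum[of "\<lambda>x. ennreal (w0 * G x)" "\<lambda>p x. ennreal (w p (x + shiftp h p) * G (x + shiftp h p))" 1 UNIV] by simp
  also have "\<dots> = (\<integral>\<^sup>+x. ennreal (w0 * G x) \<partial>Q) + (\<Sum>p\<in>UNIV. \<integral>\<^sup>+x. ennreal (w p x * G x) \<partial>Q)"
    by (simp add: tr)
  also have "\<dots> = (\<integral>\<^sup>+x. ennreal (w0 * G x) + (\<Sum>p\<in>UNIV. ennreal (w p x * G x)) \<partial>Q)"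
    using nn_integral_Q_sum[of "\<lambda>x. ennreal (w0 * G x)" "\<lambda>p x. ennreal (w p x * G x)" 1 UNIV] by simp
  also have "\<dots> = (\<integral>\<^sup>+x. ennreal (G x) \<partial>Q)"
  proof (rule nn_integral_cong)
    fix x
    have "ennreal (w0 * G x) + (\<Sum>p\<in>UNIV. ennreal (w p x * G x)) = ennreal (w0 * G x + (\<Sum>p\<in>UNIV. w p x * G x))"
      using w_nonneg nn by (simp add: split)
    also have "w0 * G x + (\<Sum>p\<in>UNIV. w p x * G x) = (w0 + (\<Sum>p\<in>UNIV. w p x)) * G x"
      by (simp add: distrib_right sum_distrib_right)
    finally show "ennreal (w0 * G x) + (\<Sum>p\<in>UNIV. ennreal (w p x * G x)) = ennreal (G x)" by (simp add: w_col)
  qed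
  finally show ?thesis .
qed

lemma thstep_convex:
  assumes [measurable]: "\<theta> \<in> borel_measurable borel" and per: "periodic \<theta>"
    and cx: "convex_on UNIV \<phi>" and nn: "\<And>x. \<phi> x \<ge> 0"
  shows "(\<integral>\<^sup>+x. ennreal (\<phi> (thstep \<kappa> h \<tau> v \<theta> x)) \<partial>Q) \<le> (\<integral>\<^sup>+x. ennreal (\<phi> (\<theta> x)) \<partial>Q)"
proof -
  have [measurable]: "\<phi> \<in> borel_measurable borel"
    by (rule borel_measurable_continuous_onI[OF convex_on_continuous[OF open_UNIV cx]])
  have pt: "\<phi> (thstep \<kappa> h \<tau> v \<theta> x) \<le> w0 * \<phi> (\<theta> x) + (\<Sum>p\<in>UNIV. w p (x + shiftp h p) * \<phi> (\<theta> (x + shiftp h p)))" for x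
  proof -
    \<comment> \<open>The convex combination is indexed by an option type: \<open>None\<close>
      stands for the point itself, \<open>Some p\<close> for its neighbours.\<close>
    define a where "a i = (case i of None \<Rightarrow> w0 | Some p \<Rightarrow> w p (x + shiftp h p))" for i
    define y where "y i = (case i of None \<Rightarrow> \<theta> x | Some p \<Rightarrow> \<theta> (x + shiftp h p))" for i
    have opt: "(\<Sum>i\<in>(UNIV :: (3\<times>bool) option set). F i) = F None + (\<Sum>p\<in>UNIV. F (Some p))" for F :: "_ \<Rightarrow> real"
      by (simp add: UNIV_option_conv sum.reindex)
    have "\<phi> (\<Sum>i\<in>UNIV. a i *\<^sub>R y i) \<le> (\<Sum>i\<in>UNIV. a i * \<phi> (y i))"
    proof (rule convex_on_sum[OF _ _ cx])
      show "(\<Sum>i\<in>UNIV. a i) = 1" by (simp add: opt a_def w_row)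
      show "a i \<ge> 0" for i using w0_ge w_nonneg by (cases i) (auto simp: a_def)
    qed auto
    then show ?thesis by (simp add: opt a_def y_def thstep_eq)
  qed
  have "(\<integral>\<^sup>+x. ennreal (\<phi> (thstep \<kappa> h \<tau> v \<theta> x)) \<partial>Q)
      \<le> (\<integral>\<^sup>+x. ennreal (w0 * \<phi> (\<theta> x) + (\<Sum>p\<in>UNIV. w p (x + shiftp h p) * \<phi> (\<theta> (x + shiftp h p)))) \<partial>Q)"
    by (intro nn_integral_mono ennreal_leI pt)
  also have "\<dots> = (\<integral>\<^sup>+x. ennreal (\<phi> (\<theta> x)) \<partial>Q)"
    using per nn by (intro wsum_integral) (auto simp: periodic_def)
  finally show ?thesis .
qed

text \<open>The deficit in Jensen's inequality for the square. With neighbour differences d, their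
  weighted sum D and weighted square sum S, the deficit is S - D^2, and Cauchy-Schwarz gives D^2
  \<le> (1 - w0) S. So at least w0 S, hence S/2, is lost; as each weight is at least \<tau> \<kappa>
  / (2 h^2), the constant becomes \<tau> \<kappa> / (4 h^2).\<close>

lemma thstep_energy:
  assumes [measurable]: "\<theta> \<in> borel_measurable borel" and per: "periodic \<theta>"
  shows "(\<integral>\<^sup>+x. ennreal ((thstep \<kappa> h \<tau> v \<theta> x)\<^sup>2) \<partial>Q)
     + ennreal (\<tau> * \<kappa> / (4 * h\<^sup>2)) * (\<Sum>p\<in>UNIV. \<integral>\<^sup>+x. ennreal ((\<theta> (x + shiftp h p) - \<theta> x)\<^sup>2) \<partial>Q)
     \<le> (\<integral>\<^sup>+x. ennreal ((\<theta> x)\<^sup>2) \<partial>Q)"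
proof -
  let ?c = "\<tau> * \<kappa> / (4 * h\<^sup>2)"
  have cnn: "?c \<ge> 0" using tau kappa by simp
  have pt: "(thstep \<kappa> h \<tau> v \<theta> x)\<^sup>2 + ?c * (\<Sum>p\<in>UNIV. (\<theta> (x + shiftp h p) - \<theta> x)\<^sup>2)
     \<le> w0 * (\<theta> x)\<^sup>2 + (\<Sum>p\<in>UNIV. w p (x + shiftp h p) * (\<theta> (x + shiftp h p))\<^sup>2)" for x
  proof -
    define a where "a p = w p (x + shiftp h p)" for p
    define d where "d p = \<theta> (x + shiftp h p) - \<theta> x" for p
    define D where "D = (\<Sum>p\<in>UNIV. a p * d p)"
    define S where "S = (\<Sum>p\<in>UNIV. a p * (d p)\<^sup>2)"
    have ann: "a p \<ge> 0" for p using w_nonneg by (simp add: a_def)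
    have row: "(\<Sum>p\<in>UNIV. a p) = 1 - w0" using w_row[of x] by (simp add: a_def)
    have th: "\<theta> (x + shiftp h p) = \<theta> x + d p" for p by (simp add: d_def)
    have 1: "thstep \<kappa> h \<tau> v \<theta> x = \<theta> x + D"
    proof -
      have "thstep \<kappa> h \<tau> v \<theta> x = w0 * \<theta> x + (\<Sum>p\<in>UNIV. a p * (\<theta> x + d p))"
        unfolding thstep_eq a_def th by simp
      also have "\<dots> = w0 * \<theta> x + ((\<Sum>p\<in>UNIV. a p) * \<theta> x + D)"
        by (simp add: distrib_left sum.distrib D_def sum_distrib_right)
      finally show ?thesis by (simp add: row algebra_simps)
    qed
    have 2: "w0 * (\<theta> x)\<^sup>2 + (\<Sum>p\<in>UNIV. a p * (\<theta> x + d p)\<^sup>2) = (\<theta> x)\<^sup>2 + 2 * \<theta> x * D + S"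
    proof -
      have "(\<Sum>p\<in>UNIV. a p * (\<theta> x + d p)\<^sup>2) = (\<Sum>p\<in>UNIV. a p * (\<theta> x)\<^sup>2 + 2 * \<theta> x * (a p * d p) + a p * (d p)\<^sup>2)"
        by (rule sum.cong) (auto simp: power2_eq_square algebra_simps)
      also have "\<dots> = (\<Sum>p\<in>UNIV. a p) * (\<theta> x)\<^sup>2 + 2 * \<theta> x * D + S"
        by (simp add: sum.distrib D_def S_def sum_distrib_left sum_distrib_right)
      finally show ?thesis by (simp add: row algebra_simps)
    qed
    have D2: "D\<^sup>2 \<le> (1 - w0) * S"
    proof -
      have "D = (\<Sum>p\<in>UNIV. sqrt (a p) * (sqrt (a p) * d p))"
        using ann by (simp add: D_def mult.assoc[symmetric])
      then have "D\<^sup>2 \<le> (\<Sum>p\<in>UNIV. (sqrt (a p))\<^sup>2) * (\<Sum>p\<in>UNIV. (sqrt (a p) * d p)\<^sup>2)"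
        using Cauchy_Schwarz_ineq_sum[of "\<lambda>p. sqrt (a p)" "\<lambda>p. sqrt (a p) * d p" UNIV] by simp
      then show ?thesis using ann by (simp add: power_mult_distrib S_def row)
    qed
    have "?c * (\<Sum>p\<in>UNIV. (d p)\<^sup>2) \<le> (1/2) * S"
    proof -
      have "(\<tau> * \<kappa> / (2 * h\<^sup>2)) * (\<Sum>p\<in>UNIV. (d p)\<^sup>2) \<le> S"
        unfolding S_def sum_distrib_left using w_ge by (intro sum_mono mult_right_mono) (auto simp: a_def)
      then show ?thesis by (simp add: field_simps)
    qed
    also have "(1/2) * S \<le> w0 * S"
      using w0_ge ann by (intro mult_right_mono) (auto simp: S_def intro!: sum_nonneg)
    finally have "?c * (\<Sum>p\<in>UNIV. (d p)\<^sup>2) \<le> w0 * S" .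
    then have "(\<theta> x + D)\<^sup>2 + ?c * (\<Sum>p\<in>UNIV. (d p)\<^sup>2) \<le> (\<theta> x)\<^sup>2 + 2 * \<theta> x * D + S"
      using D2 by (simp add: power2_eq_square algebra_simps)
    then show ?thesis unfolding 1 2[symmetric] by (simp add: d_def a_def)
  qed
  have "(\<integral>\<^sup>+x. ennreal ((thstep \<kappa> h \<tau> v \<theta> x)\<^sup>2) \<partial>Q)
     + ennreal ?c * (\<Sum>p\<in>UNIV. \<integral>\<^sup>+x. ennreal ((\<theta> (x + shiftp h p) - \<theta> x)\<^sup>2) \<partial>Q)
     = (\<integral>\<^sup>+x. ennreal ((thstep \<kappa> h \<tau> v \<theta> x)\<^sup>2) + ennreal ?c * (\<Sum>p\<in>UNIV. ennreal ((\<theta> (x + shiftp h p) - \<theta> x)\<^sup>2)) \<partial>Q)"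
    by (rule nn_integral_Q_sum[symmetric]) measurable
  also have "\<dots> = (\<integral>\<^sup>+x. ennreal ((thstep \<kappa> h \<tau> v \<theta> x)\<^sup>2 + ?c * (\<Sum>p\<in>UNIV. (\<theta> (x + shiftp h p) - \<theta> x)\<^sup>2)) \<partial>Q)"
  proof (rule nn_integral_cong)
    fix x
    have "ennreal ((thstep \<kappa> h \<tau> v \<theta> x)\<^sup>2 + ?c * (\<Sum>p\<in>UNIV. (\<theta> (x + shiftp h p) - \<theta> x)\<^sup>2))
       = ennreal ((thstep \<kappa> h \<tau> v \<theta> x)\<^sup>2) + ennreal (?c * (\<Sum>p\<in>UNIV. (\<theta> (x + shiftp h p) - \<theta> x)\<^sup>2))"
      using cnn by (intro ennreal_plus mult_nonneg_nonneg sum_nonneg) auto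
    also have "ennreal (?c * (\<Sum>p\<in>UNIV. (\<theta> (x + shiftp h p) - \<theta> x)\<^sup>2)) = ennreal ?c * (\<Sum>p\<in>UNIV. ennreal ((\<theta> (x + shiftp h p) - \<theta> x)\<^sup>2))"
      using cnn by (subst ennreal_mult) (auto intro!: sum_nonneg simp: sum_ennreal)
    finally show "ennreal ((thstep \<kappa> h \<tau> v \<theta> x)\<^sup>2) + ennreal ?c * (\<Sum>p\<in>UNIV. ennreal ((\<theta> (x + shiftp h p) - \<theta> x)\<^sup>2))
      = ennreal ((thstep \<kappa> h \<tau> v \<theta> x)\<^sup>2 + ?c * (\<Sum>p\<in>UNIV. (\<theta> (x + shiftp h p) - \<theta> x)\<^sup>2))" by simp
  qed
  also have "\<dots> \<le> (\<integral>\<^sup>+x. ennreal (w0 * (\<theta> x)\<^sup>2 + (\<Sum>p\<in>UNIV. w p (x + shiftp h p) * (\<theta> (x + shiftp h p))\<^sup>2)) \<partial>Q)"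
    by (intro nn_integral_mono ennreal_leI pt)
  also have "\<dots> = (\<integral>\<^sup>+x. ennreal ((\<theta> x)\<^sup>2) \<partial>Q)"
    using per by (intro wsum_integral) (auto simp: periodic_def)
  finally show ?thesis .
qed

lemma thstep_sqint:
  assumes "sqint \<theta>" and per: "periodic \<theta>"
  shows "sqint (thstep \<kappa> h \<tau> v \<theta>)"
    and "(\<integral>x. (thstep \<kappa> h \<tau> v \<theta> x)\<^sup>2 \<partial>Q) + (\<tau> * \<kappa> / (4 * h\<^sup>2)) * (\<Sum>p\<in>UNIV. \<integral>x. (\<theta> (x + shiftp h p) - \<theta> x)\<^sup>2 \<partial>Q)
        \<le> (\<integral>x. (\<theta> x)\<^sup>2 \<partial>Q)"
    and "\<And>p. sqint (\<lambda>x. \<theta> (x + shiftp h p) - \<theta> x)"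
proof -
  have [measurable]: "\<theta> \<in> borel_measurable borel" and i: "integrable Q (\<lambda>x. (\<theta> x)\<^sup>2)" using assms by (auto simp: sqint_def)
  note en = thstep_energy[OF \<open>\<theta> \<in> borel_measurable borel\<close> per]
  have fin: "(\<integral>\<^sup>+x. ennreal ((\<theta> x)\<^sup>2) \<partial>Q) = ennreal (\<integral>x. (\<theta> x)\<^sup>2 \<partial>Q)"
    using i by (intro nn_integral_eq_integral) auto
  have "(\<integral>\<^sup>+x. ennreal ((thstep \<kappa> h \<tau> v \<theta> x)\<^sup>2) \<partial>Q) \<le> (\<integral>\<^sup>+x. ennreal ((\<theta> x)\<^sup>2) \<partial>Q)"
    using en by (rule order_trans[rotated]) simp
  then have "(\<integral>\<^sup>+x. ennreal ((thstep \<kappa> h \<tau> v \<theta> x)\<^sup>2) \<partial>Q) < \<infinity>" using fin by (simp add: le_less_trans)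
  then show 1: "sqint (thstep \<kappa> h \<tau> v \<theta>)"
    by (auto simp: sqint_def integrable_iff_bounded intro!: meas_Q)
  show 2: "sqint (\<lambda>x. \<theta> (x + shiftp h p) - \<theta> x)" for p
  proof -
    have "periodic (\<lambda>x. (\<theta> x)\<^sup>2)" using per by (simp add: periodic_def)
    then have "integrable Q (\<lambda>x. (\<theta> (x + shiftp h p))\<^sup>2)"
      unfolding shiftp_def using i integral_translate(2)[of "\<lambda>x. (\<theta> x)\<^sup>2", OF _ _ shift_le] by simp
    then have "sqint (\<lambda>x. \<theta> (x + shiftp h p))" by (simp add: sqint_def)
    then show ?thesis using sqint_add[OF _ sqint_cmult[OF assms(1), of "-1"]] by simp
  qed
  have e: "(\<integral>\<^sup>+x. ennreal ((g x)\<^sup>2) \<partial>Q) = ennreal (\<integral>x. (g x)\<^sup>2 \<partial>Q)" if "sqint g" for g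
    using that by (intro nn_integral_eq_integral) (auto simp: sqint_def)
  have "ennreal (\<integral>x. (thstep \<kappa> h \<tau> v \<theta> x)\<^sup>2 \<partial>Q) + ennreal (\<tau> * \<kappa> / (4 * h\<^sup>2)) * (\<Sum>p\<in>UNIV. ennreal (\<integral>x. (\<theta> (x + shiftp h p) - \<theta> x)\<^sup>2 \<partial>Q))
      \<le> ennreal (\<integral>x. (\<theta> x)\<^sup>2 \<partial>Q)"
    using en unfolding e[OF 1] e[OF 2] fin .
  also have "ennreal (\<integral>x. (thstep \<kappa> h \<tau> v \<theta> x)\<^sup>2 \<partial>Q) + ennreal (\<tau> * \<kappa> / (4 * h\<^sup>2)) * (\<Sum>p\<in>UNIV. ennreal (\<integral>x. (\<theta> (x + shiftp h p) - \<theta> x)\<^sup>2 \<partial>Q))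
     = ennreal ((\<integral>x. (thstep \<kappa> h \<tau> v \<theta> x)\<^sup>2 \<partial>Q) + (\<tau> * \<kappa> / (4 * h\<^sup>2)) * (\<Sum>p\<in>UNIV. \<integral>x. (\<theta> (x + shiftp h p) - \<theta> x)\<^sup>2 \<partial>Q))"
  proof -
    have nn: "0 \<le> \<tau> * \<kappa> / (4 * h\<^sup>2)" using tau kappa by simp
    have s: "0 \<le> (\<Sum>p\<in>UNIV. \<integral>x. (\<theta> (x + shiftp h p) - \<theta> x)\<^sup>2 \<partial>Q)" by (intro sum_nonneg) simp
    show ?thesis
      unfolding ennreal_plus[OF Bochner_Integration.integral_nonneg[OF zero_le_power2] mult_nonneg_nonneg[OF nn s]] ennreal_mult[OF nn s]
      by (simp add: sum_ennreal)
  qed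
  finally show "(\<integral>x. (thstep \<kappa> h \<tau> v \<theta> x)\<^sup>2 \<partial>Q) + (\<tau> * \<kappa> / (4 * h\<^sup>2)) * (\<Sum>p\<in>UNIV. \<integral>x. (\<theta> (x + shiftp h p) - \<theta> x)\<^sup>2 \<partial>Q)
        \<le> (\<integral>x. (\<theta> x)\<^sup>2 \<partial>Q)" by (simp add: ennreal_le_iff)
qed

end

text \<open>The Fourier symbol of -\<kappa> times the discrete Laplacian with mesh h.\<close>

definition lam :: "real \<Rightarrow> real \<Rightarrow> wn \<Rightarrow> real" where
  "lam h \<kappa> k = (\<kappa> / h\<^sup>2) * (\<Sum>j\<in>UNIV. 2 - 2 * cos (2 * pi * h * kreal k $ j))"

context transport_step
begin

text \<open>A shift multiplies a coefficient by a phase. Opposite shifts combine to a cosine in the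
  diffusive part, which has equal weights, and to a sine in the transport part, whose weights have
  opposite signs.\<close>

lemma thstep_fourier:
  assumes "sqint \<theta>" and per: "periodic \<theta>"
  shows "fourier_coeff (thstep \<kappa> h \<tau> v \<theta>) k = fourier_coeff \<theta> k - of_real \<tau> * (of_real (lam h \<kappa> k) * fourier_coeff \<theta> k
     + (\<Sum>j\<in>UNIV. \<i> * of_real (sin (2 * pi * h * kreal k $ j) / h) * fcc (\<lambda>x. of_real (v j x) * of_real (\<theta> x)) k))"
proof -
  have [measurable]: "\<theta> \<in> borel_measurable borel" using assms by (auto simp: sqint_def)
  have ti: "integrable Q (\<lambda>x. complex_of_real (\<theta> x))" using sqint_integrable[OF assms(1)] by simp
  have vti: "integrable Q (\<lambda>x. complex_of_real (v j x) * complex_of_real (\<theta> x))" for j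
  proof (rule Bochner_Integration.integrable_bound[of Q "\<lambda>x. (\<kappa> / h) * complex_of_real (\<theta> x)"])
    show "integrable Q (\<lambda>x. (\<kappa> / h) * complex_of_real (\<theta> x))" using ti by simp
    show "(\<lambda>x. complex_of_real (v j x) * complex_of_real (\<theta> x)) \<in> borel_measurable Q" by (rule meas_Q) measurable
    have "\<bar>v j x\<bar> \<le> \<kappa> / h" for x using v_small[of j x] h by (simp add: field_simps)
    then show "AE x in Q. norm (complex_of_real (v j x) * complex_of_real (\<theta> x)) \<le> norm (complex_of_real (\<kappa> / h) * complex_of_real (\<theta> x))"
      using kappa h by (intro AE_I2) (auto simp: norm_mult norm_divide simp del: times_divide_eq_left intro!: mult_right_mono)
  qed
  let ?V = "\<lambda>j. fcc (\<lambda>x. complex_of_real (v j x) * complex_of_real (\<theta> x)) k"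
  let ?W = "\<lambda>p x. complex_of_real (w p x) * complex_of_real (\<theta> x)"
  have W: "?W p x = of_real (\<tau> * \<kappa> / h\<^sup>2) * of_real (\<theta> x) + of_real (- \<tau> * sg (snd p) / (2 * h)) * (of_real (v (fst p) x) * of_real (\<theta> x))" for p x
    by (simp add: wgt_def field_simps)
  have Wi: "integrable Q (?W p)" for p
    unfolding W by (intro Bochner_Integration.integrable_add integrable_mult_right ti vti)
  have Wf: "fcc (?W p) k = of_real (\<tau> * \<kappa> / h\<^sup>2) * fourier_coeff \<theta> k + of_real (- \<tau> * sg (snd p) / (2 * h)) * ?V (fst p)" for p
    unfolding W by (subst fcc_add) (auto simp: fcc_cmult fourier_coeff_fcc intro!: integrable_mult_right ti vti simp del: of_real_mult of_real_divide of_real_minus)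
  have Wper: "periodic (?W p)" for p using per v_per by (simp add: periodic_def wgt_def)
  have Wm: "?W p \<in> borel_measurable borel" for p unfolding wgt_def by measurable
  have Wsi: "integrable Q (\<lambda>x. ?W p (x + shiftp h p))" for p
    unfolding shiftp_def using integral_translate(2)[OF Wm Wper shift_le] Wi by simp
  have Wsf: "fcc (\<lambda>x. ?W p (x + shiftp h p)) k = cis (2 * pi * (sg (snd p) * h) * kreal k $ fst p) * fcc (?W p) k" for p
    unfolding shiftp_def by (rule fcc_translate[OF Wm Wper shift_le])
  have "fourier_coeff (thstep \<kappa> h \<tau> v \<theta>) k = fcc (\<lambda>x. of_real w0 * of_real (\<theta> x) + (\<Sum>p\<in>UNIV. ?W p (x + shiftp h p))) k"
    by (simp add: fourier_coeff_fcc thstep_eq)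
  also have "\<dots> = of_real w0 * fourier_coeff \<theta> k + (\<Sum>p\<in>UNIV. fcc (\<lambda>x. ?W p (x + shiftp h p)) k)"
    using ti Wsi by (subst fcc_add) (auto simp: fcc_cmult fourier_coeff_fcc fcc_sum simp del: of_real_mult)
  also have "(\<Sum>p\<in>UNIV. fcc (\<lambda>x. ?W p (x + shiftp h p)) k)
     = (\<Sum>j\<in>UNIV. of_real (\<tau> * \<kappa> / h\<^sup>2) * (2 * of_real (cos (2 * pi * h * kreal k $ j))) * fourier_coeff \<theta> k
        - of_real \<tau> * (\<i> * of_real (sin (2 * pi * h * kreal k $ j) / h) * ?V j))"
    unfolding Wsf Wf sum_prod_bool
  proof (rule sum.cong[OF refl])
    fix j :: 3
    define a where "a = 2 * pi * h * kreal k $ j"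
    have e: "2 * pi * (sg True * h) * kreal k $ j = a" "2 * pi * (sg False * h) * kreal k $ j = - a" by (auto simp: a_def)
    have c: "cis a + cis (- a) = 2 * of_real (cos a)" "cis a - cis (- a) = 2 * \<i> * of_real (sin a)"
      by (auto simp: complex_eq_iff)
    have gen: "cis a * (C * f + of_real (- \<tau> * 1 / (2 * h)) * V) + cis (- a) * (C * f + of_real (- \<tau> * (- 1) / (2 * h)) * V)
       = C * (2 * of_real (cos a)) * f - of_real \<tau> * (\<i> * of_real (sin a / h) * V)" for C f V
    proof -
      have "cis a * (C * f + of_real (- \<tau> * 1 / (2 * h)) * V) + cis (- a) * (C * f + of_real (- \<tau> * (- 1) / (2 * h)) * V)
        = (cis a + cis (- a)) * (C * f) - of_real (\<tau> / (2 * h)) * ((cis a - cis (- a)) * V)"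
        by (simp add: algebra_simps)
      also have "\<dots> = (2 * of_real (cos a)) * (C * f) - of_real (\<tau> / (2 * h)) * ((2 * \<i> * of_real (sin a)) * V)"
        by (simp only: c)
      also have "\<dots> = C * (2 * of_real (cos a)) * f - of_real \<tau> * (\<i> * of_real (sin a / h) * V)"
        using h by (simp add: field_simps)
      finally show ?thesis .
    qed
    show "cis (2 * pi * (sg (snd (j, True)) * h) * kreal k $ fst (j, True)) *
        (of_real (\<tau> * \<kappa> / h\<^sup>2) * fourier_coeff \<theta> k + of_real (- \<tau> * sg (snd (j, True)) / (2 * h)) * ?V (fst (j, True))) +
        cis (2 * pi * (sg (snd (j, False)) * h) * kreal k $ fst (j, False)) *
        (of_real (\<tau> * \<kappa> / h\<^sup>2) * fourier_coeff \<theta> k + of_real (- \<tau> * sg (snd (j, False)) / (2 * h)) * ?V (fst (j, False)))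
       = of_real (\<tau> * \<kappa> / h\<^sup>2) * (2 * of_real (cos (2 * pi * h * kreal k $ j))) * fourier_coeff \<theta> k
        - of_real \<tau> * (\<i> * of_real (sin (2 * pi * h * kreal k $ j) / h) * ?V j)"
      unfolding fst_conv snd_conv e unfolding sg_simps(1,2) unfolding a_def[symmetric] by (rule gen)
  qed
  also have "of_real w0 * fourier_coeff \<theta> k + \<dots> = fourier_coeff \<theta> k - of_real \<tau> * (of_real (lam h \<kappa> k) * fourier_coeff \<theta> k
     + (\<Sum>j\<in>UNIV. \<i> * of_real (sin (2 * pi * h * kreal k $ j) / h) * ?V j))"
  proof -
    have l: "of_real w0 = 1 - of_real \<tau> * (complex_of_real (lam h \<kappa> k) + of_real (\<kappa> / h\<^sup>2) * (\<Sum>j\<in>(UNIV::3 set). 2 * of_real (cos (2 * pi * h * kreal k $ j))))"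
    proof -
      have "w0 = 1 - \<tau> * (lam h \<kappa> k + (\<kappa> / h\<^sup>2) * (\<Sum>j\<in>(UNIV::3 set). 2 * cos (2 * pi * h * kreal k $ j)))"
        unfolding lam_def w0_def distrib_left[symmetric] sum.distrib[symmetric] by simp
      then show ?thesis by simp
    qed
    show ?thesis unfolding l sum_subtractf sum_distrib_left[symmetric] sum_distrib_right[symmetric]
      by (simp add: algebra_simps)
  qed
  finally show ?thesis .
qed

text \<open>Bessel's inequality applied to each difference of neighbours converts the loss of
  \<open>thstep_energy\<close> into the symbol \<open>lam\<close>. Every axis occurs with both
  signs, whence the factor \<tau>/2.\<close>

lemma thstep_dissipation:
  assumes "sqint \<theta>" and per: "periodic \<theta>" and F: "finite F"
  shows "(\<integral>x. (thstep \<kappa> h \<tau> v \<theta> x)\<^sup>2 \<partial>Q) + (\<tau> / 2) * (\<Sum>k\<in>F. lam h \<kappa> k * (cmod (fourier_coeff \<theta> k))\<^sup>2)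
        \<le> (\<integral>x. (\<theta> x)\<^sup>2 \<partial>Q)"
proof -
  have [measurable]: "\<theta> \<in> borel_measurable borel" using assms by (auto simp: sqint_def)
  have b: "(\<Sum>k\<in>F. (2 - 2 * cos (2 * pi * h * kreal k $ fst p)) * (cmod (fourier_coeff \<theta> k))\<^sup>2) \<le> (\<integral>x. (\<theta> (x + shiftp h p) - \<theta> x)\<^sup>2 \<partial>Q)" for p
  proof -
    note s = thstep_sqint(3)[OF assms(1) per, of p]
    let ?d = "\<lambda>x. complex_of_real (\<theta> (x + shiftp h p) - \<theta> x)"
    have i: "integrable Q (\<lambda>x. complex_of_real (\<theta> x))" using sqint_integrable[OF assms(1)] by simp
    have cper: "periodic (\<lambda>x. complex_of_real (\<theta> x))" using per by (simp add: periodic_def)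
    have i': "integrable Q (\<lambda>x. complex_of_real (\<theta> (x + shiftp h p)))"
      unfolding shiftp_def using i integral_translate(2)[OF _ cper shift_le] by simp
    have "fcc ?d k = (cis (2 * pi * (sg (snd p) * h) * kreal k $ fst p) - 1) * fourier_coeff \<theta> k" for k
    proof -
      have "fcc ?d k = fcc (\<lambda>x. complex_of_real (\<theta> (x + shiftp h p))) k - fourier_coeff \<theta> k"
        using fcc_diff[OF i' i, of k] by (simp add: fourier_coeff_fcc)
      also have "fcc (\<lambda>x. complex_of_real (\<theta> (x + shiftp h p))) k = cis (2 * pi * (sg (snd p) * h) * kreal k $ fst p) * fourier_coeff \<theta> k"
        unfolding shiftp_def by (subst fcc_translate[OF _ cper shift_le]) (auto simp: fourier_coeff_fcc)
      finally show ?thesis by (simp add: algebra_simps)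
    qed
    moreover have "(cmod (cis (2 * pi * (sg (snd p) * h) * kreal k $ fst p) - 1))\<^sup>2 = 2 - 2 * cos (2 * pi * h * kreal k $ fst p)" for k
    proof -
      have c: "(cmod (cis a - 1))\<^sup>2 = 2 - 2 * cos a" for a
        using sin_cos_squared_add[of a] by (simp only: cmod_power2) (simp add: power2_eq_square algebra_simps)
      have "cos (2 * pi * (sg (snd p) * h) * kreal k $ fst p) = cos (2 * pi * h * kreal k $ fst p)"
        by (cases "snd p") auto
      then show ?thesis by (simp only: c)
    qed
    ultimately have "(cmod (fcc ?d k))\<^sup>2 = (2 - 2 * cos (2 * pi * h * kreal k $ fst p)) * (cmod (fourier_coeff \<theta> k))\<^sup>2" for k
      by (simp add: norm_mult power_mult_distrib)
    moreover have "(\<Sum>k\<in>F. (cmod (fcc ?d k))\<^sup>2) \<le> (\<integral>x. (cmod (?d x))\<^sup>2 \<partial>Q)"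
      using s by (intro bessel F) (auto simp: sqint_def simp del: of_real_diff)
    ultimately show ?thesis by (simp del: of_real_diff)
  qed
  have "(\<tau> / 2) * (\<Sum>k\<in>F. lam h \<kappa> k * (cmod (fourier_coeff \<theta> k))\<^sup>2)
     = (\<tau> * \<kappa> / (4 * h\<^sup>2)) * (\<Sum>p\<in>(UNIV::(3\<times>bool) set). \<Sum>k\<in>F. (2 - 2 * cos (2 * pi * h * kreal k $ fst p)) * (cmod (fourier_coeff \<theta> k))\<^sup>2)"
  proof -
    have "(\<Sum>k\<in>F. lam h \<kappa> k * (cmod (fourier_coeff \<theta> k))\<^sup>2) = (\<kappa> / h\<^sup>2) * (\<Sum>k\<in>F. \<Sum>j\<in>UNIV. (2 - 2 * cos (2 * pi * h * kreal k $ j)) * (cmod (fourier_coeff \<theta> k))\<^sup>2)"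
      by (simp add: lam_def sum_distrib_left sum_distrib_right mult.assoc)
    also have "\<dots> = (\<kappa> / h\<^sup>2) * (\<Sum>j\<in>UNIV. \<Sum>k\<in>F. (2 - 2 * cos (2 * pi * h * kreal k $ j)) * (cmod (fourier_coeff \<theta> k))\<^sup>2)"
      by (subst sum.swap) (rule refl)
    finally show ?thesis by (simp add: sum_prod_bool) (simp add: sum_distrib_left[symmetric])
  qed
  also have "\<dots> \<le> (\<tau> * \<kappa> / (4 * h\<^sup>2)) * (\<Sum>p\<in>UNIV. \<integral>x. (\<theta> (x + shiftp h p) - \<theta> x)\<^sup>2 \<partial>Q)"
    using tau kappa by (intro mult_left_mono sum_mono b) auto
  finally show ?thesis using thstep_sqint(2)[OF assms(1) per] by linarith
qed

end

section \<open>The velocity equation\<close>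

lemma cdot_simps:
  "cdot (a + b) c = cdot a c + cdot b c" "cdot a (b + c) = cdot a b + cdot a c"
  "cdot (a - b) c = cdot a c - cdot b c" "cdot a (b - c) = cdot a b - cdot a c"
  "cdot (- a) b = - cdot a b" "cdot a (- b) = - cdot a b"
  "cdot (z *s a) b = z * cdot a b" "cdot a (z *s b) = z * cdot a b"
  "cdot 0 a = 0" "cdot a 0 = 0"
  by (simp_all add: cdot_def sum.distrib sum_subtractf sum_negf sum_distrib_left algebra_simps)

lemma cdot_commute: "cdot a b = cdot b a"
  by (simp add: cdot_def mult.commute)

lemma norm_smult [simp]: "norm (z *s (v :: complex^3)) = cmod z * norm v"
proof -
  have "(norm (z *s v))\<^sup>2 = (cmod z * norm v)\<^sup>2"
    by (simp add: norm_vec_def L2_set_def sum_nonneg norm_mult power_mult_distrib sum_distrib_left)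
  then show ?thesis by (simp add: power2_eq_iff_nonneg)
qed

lemma norm_cdot_le: "cmod (cdot a b) \<le> norm a * norm b"
proof -
  have "cmod (cdot a b) \<le> (\<Sum>i\<in>UNIV. \<bar>cmod (a $ i)\<bar> * \<bar>cmod (b $ i)\<bar>)"
    unfolding cdot_def by (rule order_trans[OF norm_sum]) (simp add: norm_mult)
  also have "\<dots> \<le> L2_set (\<lambda>i. cmod (a $ i)) UNIV * L2_set (\<lambda>i. cmod (b $ i)) UNIV"
    by (rule L2_set_mult_ineq)
  finally show ?thesis by (simp add: norm_vec_def)
qed

lemma cconj3_simps:
  "cconj3 (a + b) = cconj3 a + cconj3 b" "cconj3 (a - b) = cconj3 a - cconj3 b"
  "cconj3 (z *s a) = cnj z *s cconj3 a" "cconj3 0 = 0" "cconj3 (cconj3 a) = a"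
  "cdot (cconj3 a) (cconj3 b) = cnj (cdot a b)" "cconj3 (kvec k) = kvec k" "cconj3 e3 = e3"
  "cconj3 (r *\<^sub>R a) = r *\<^sub>R cconj3 a" "cconj3 (- a) = - cconj3 a"
  by (simp_all add: cconj3_def cdot_def vec_eq_iff kvec_nth e3_def forall_3)

lemma norm_cconj3 [simp]: "norm (cconj3 a) = norm a"
  by (simp add: cconj3_def norm_vec_def)

lemma bounded_linear_cconj3: "bounded_linear cconj3"
  by (rule bounded_linear_intro[of _ 1]) (auto simp: cconj3_simps)

lemma inner_cdot: "inner a b = Re (cdot a (cconj3 b))"
  by (simp add: inner_vec_def cdot_def cconj3_def inner_complex_def)

lemma norm_e3 [simp]: "norm e3 = 1"
  by (simp add: e3_def norm_vec_def L2_set_def sum_3)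

lemma cdot_kvec_kvec: "cdot (kvec k) (kvec k) = of_real (ksq k)"
  by (simp add: cdot_def kvec_nth ksq_norm norm_vec_def L2_set_def sum_nonneg power2_eq_square)

lemma leray_0 [simp]: "leray v 0 = 0"
  by (simp add: leray_def zero_wn)

lemma leray_eq: "k \<noteq> 0 \<Longrightarrow> leray v k = v k - (cdot (kvec k) (v k) / of_real (ksq k)) *s kvec k"
  by (simp add: leray_def zero_wn)

lemma leray_divfree: "cdot (kvec k) (leray v k) = 0"
  by (cases "k = 0") (auto simp: leray_eq cdot_simps cdot_kvec_kvec)

lemma leray_diff: "leray (\<lambda>m. v m - w m) k = leray v k - leray w k"
  by (cases "k = 0") (auto simp: leray_eq cdot_simps vec_eq_iff diff_divide_distrib left_diff_distrib)

text \<open>Orthogonality would give the constant 1; the triangle inequality is shorter, and its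
  factor 2 is the origin of the constant 8 in the force estimates.\<close>

lemma norm_leray: "norm (leray v k) \<le> 2 * norm (v k)"
proof (cases "k = 0")
  case False
  have s: "ksq k > 0" using False by (rule ksq_pos)
  have "cmod (cdot (kvec k) (v k) / of_real (ksq k)) * norm (kvec k) \<le> (norm (kvec k) * norm (v k) / ksq k) * norm (kvec k)"
    using norm_cdot_le[of "kvec k" "v k"] s by (intro mult_right_mono) (auto simp: norm_divide divide_right_mono)
  also have "\<dots> = norm (v k)"
  proof -
    have "a * n / (a * a) * a = n" if "a > 0" for a n :: real using that by simp
    from this[of "sqrt (ksq k)" "norm (v k)"] show ?thesis using s by (simp add: norm_kvec)
  qed
  finally have "norm ((cdot (kvec k) (v k) / of_real (ksq k)) *s kvec k) \<le> norm (v k)" by simp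
  then show ?thesis using False norm_triangle_ineq4[of "v k" "(cdot (kvec k) (v k) / of_real (ksq k)) *s kvec k"]
    by (simp add: leray_eq)
qed simp

text \<open>The removed part is parallel to k, hence invisible to a divergence-free vector. This
  takes the projection out of the energy balance.\<close>

lemma inner_leray:
  assumes "k \<noteq> 0" "cdot (kvec k) w = 0"
  shows "inner (leray v k) w = inner (v k) w"
proof -
  have "cdot (kvec k) (cconj3 w) = 0"
    using assms(2) cconj3_simps(6)[of "kvec k" w] by (simp add: cconj3_simps)
  then show ?thesis using assms(1) by (simp add: inner_cdot leray_eq cdot_simps)
qed

lemma real_vf_iff: "real_vf u \<longleftrightarrow> (\<forall>k. u (- k) = cconj3 (u k))"
  by (simp add: real_vf_def negk_eq)

lemma real_leray:
  assumes "real_vf v"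
  shows "real_vf (leray v)"
proof -
  have "leray v (- k) = cconj3 (leray v k)" for k
  proof (cases "k = 0")
    case False
    have "cdot (kvec k) (cconj3 (v k)) = cnj (cdot (kvec k) (v k))"
      using cconj3_simps(6)[of "kvec k" "v k"] by (simp add: cconj3_simps)
    then show ?thesis using False assms by (simp add: leray_eq real_vf_iff cconj3_simps cdot_simps)
  qed (simp add: cconj3_simps)
  then show ?thesis by (simp add: real_vf_iff)
qed

section \<open>The advection term and the force\<close>

lemma advect_eq: "advect u k = (\<Sum>\<^sub>\<infinity>m. (2 * pi * \<i> * cdot (u (k - m)) (kvec m)) *s u m)"
  unfolding advect_def by (simp add: subk_eq cdot_simps mult.assoc)

lemma real_advect:
  assumes "real_vf u"
  shows "real_vf (advect u)"
proof -
  have "advect u (- k) = cconj3 (advect u k)" for k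
  proof -
    have r: "u (- k) = cconj3 (u k)" for k using assms by (simp add: real_vf_iff)
    define F where "F m = (2 * pi * \<i> * cdot (u (k - m)) (kvec m)) *s u m" for m
    have bij: "bij_betw uminus (UNIV::wn set) UNIV" by (rule bij_betwI[where g=uminus]) auto
    have "advect u (- k) = (\<Sum>\<^sub>\<infinity>m. (2 * pi * \<i> * cdot (u (- k - (- m))) (kvec (- m))) *s u (- m))"
      unfolding advect_eq by (rule infsum_reindex_bij_betw[OF bij, symmetric])
    also have "\<dots> = (\<Sum>\<^sub>\<infinity>m. cconj3 (F m))"
    proof (rule infsum_cong)
      fix m
      have "cdot (cconj3 (u (k - m))) (kvec m) = cnj (cdot (u (k - m)) (kvec m))"
        using cconj3_simps(6)[of "u (k - m)" "kvec m"] by (simp add: cconj3_simps)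
      moreover have "u (- k - (- m)) = cconj3 (u (k - m))" using r[of "k - m"] by simp
      ultimately show "(2 * pi * \<i> * cdot (u (- k - (- m))) (kvec (- m))) *s u (- m) = cconj3 (F m)"
        using r[of m] by (simp add: F_def cconj3_simps cdot_simps)
    qed
    also have "\<dots> = cconj3 (infsum F UNIV)"
      by (rule infsum_bounded_linear_strong[OF summable_on_bounded_linear_iff[OF
            bounded_linear_cconj3 bounded_linear_cconj3 cconj3_simps(5)] bounded_linear_cconj3])
    finally show ?thesis by (simp add: advect_eq F_def[abs_def])
  qed
  then show ?thesis by (simp add: real_vf_iff)
qed

lemma advect_terms_le:
  fixes a b :: vfield
  shows "nns (\<lambda>m. ennreal (norm ((2 * pi * \<i> * cdot (a (k - m)) (kvec m)) *s b m)))
    \<le> ennreal (2 * pi) * cnv (mag a) (\<lambda>k. ennreal (sqrt (ksq k) * norm (b k))) k"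
  unfolding cnv_def nns_cmult[symmetric]
proof (rule nns_mono)
  fix m
  have "norm ((2 * pi * \<i> * cdot (a (k - m)) (kvec m)) *s b m) = 2 * pi * (cmod (cdot (a (k - m)) (kvec m)) * norm (b m))"
    by (simp add: norm_mult)
  also have "\<dots> \<le> 2 * pi * ((norm (a (k - m)) * sqrt (ksq m)) * norm (b m))"
    using norm_cdot_le[of "a (k - m)" "kvec m"] by (intro mult_left_mono mult_right_mono) (auto simp: norm_kvec)
  finally have "ennreal (norm ((2 * pi * \<i> * cdot (a (k - m)) (kvec m)) *s b m)) \<le> ennreal (2 * pi * ((norm (a (k - m)) * sqrt (ksq m)) * norm (b m)))"
    by (rule ennreal_leI)
  also have "\<dots> = ennreal (2 * pi) * (ennreal (norm (a (k - m))) * ennreal (sqrt (ksq m) * norm (b m)))"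
    by (simp add: ennreal_mult mult.assoc)
  finally show "ennreal (norm ((2 * pi * \<i> * cdot (a (k - m)) (kvec m)) *s b m)) \<le> ennreal (2 * pi) * (ennreal (norm (a (k - m))) * ennreal (sqrt (ksq m) * norm (b m)))" .
qed

lemma nns_advect_le: "ennreal (norm (advect u k)) \<le> ennreal (2 * pi) * cnv (mag u) (\<lambda>k. ennreal (sqrt (ksq k) * norm (u k))) k"
  unfolding advect_eq by (rule order_trans[OF norm_infsum_le_nns advect_terms_le])

text \<open>The product estimate is applied to u and its gradient, so one factor costs H^1 and the
  other H^2. A bound quadratic in the H^2 norm would not give a linear enstrophy inequality.\<close>

lemma nns_advect_sq:
  assumes "u 0 = 0"
  shows "l2sq (advect u) \<le> ennreal (4 * pi\<^sup>2) * (SK * (nns (\<lambda>k. ennreal (ksq k * (norm (u k))\<^sup>2)) * h2sq u))"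
proof -
  have "l2sq (advect u) \<le> nns (\<lambda>k. ennreal (4 * pi\<^sup>2) * (cnv (mag u) (\<lambda>k. ennreal (sqrt (ksq k) * norm (u k))) k)\<^sup>2)"
  proof (rule nns_mono)
    fix k
    have "ennreal ((norm (advect u k))\<^sup>2) = (ennreal (norm (advect u k)))\<^sup>2" by (simp add: ennreal_power)
    also have "\<dots> \<le> (ennreal (2 * pi) * cnv (mag u) (\<lambda>k. ennreal (sqrt (ksq k) * norm (u k))) k)\<^sup>2"
      by (intro power_mono nns_advect_le) simp
    finally show "ennreal ((norm (advect u k))\<^sup>2) \<le> ennreal (4 * pi\<^sup>2) * (cnv (mag u) (\<lambda>k. ennreal (sqrt (ksq k) * norm (u k))) k)\<^sup>2"
      by (simp add: power_mult_distrib ennreal_power)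
  qed
  also have "\<dots> = ennreal (4 * pi\<^sup>2) * nns (\<lambda>k. (cnv (mag u) (\<lambda>k. ennreal (sqrt (ksq k) * norm (u k))) k)\<^sup>2)"
    by (rule nns_cmult)
  also have "\<dots> \<le> ennreal (4 * pi\<^sup>2) * (SK * (nns (\<lambda>k. ennreal (ksq k) * (ennreal (norm (u k)))\<^sup>2) * nns (\<lambda>k. ennreal (ksq k) * (ennreal (sqrt (ksq k) * norm (u k)))\<^sup>2)))"
    using assms by (intro mult_left_mono cnv_H1) auto
  finally have le: "l2sq (advect u) \<le> ennreal (4 * pi\<^sup>2) * (SK * (nns (\<lambda>k. ennreal (ksq k) * (ennreal (norm (u k)))\<^sup>2) * nns (\<lambda>k. ennreal (ksq k) * (ennreal (sqrt (ksq k) * norm (u k)))\<^sup>2)))" .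
  have e1: "ennreal (ksq k) * (ennreal (norm (u k)))\<^sup>2 = ennreal (ksq k * (norm (u k))\<^sup>2)" for k
    by (simp add: ennreal_power ennreal_mult)
  have e2: "ennreal (ksq k) * (ennreal (sqrt (ksq k) * norm (u k)))\<^sup>2 = ennreal ((ksq k)\<^sup>2 * (norm (u k))\<^sup>2)" for k
  proof -
    have "ennreal (ksq k) * (ennreal (sqrt (ksq k) * norm (u k)))\<^sup>2 = ennreal (ksq k * (ksq k * (norm (u k))\<^sup>2))"
      by (simp add: ennreal_power power_mult_distrib ennreal_mult)
    then show ?thesis by (simp add: power2_eq_square mult.assoc)
  qed
  show ?thesis using le unfolding e1 e2 .
qed

definition force :: "vfield \<Rightarrow> sfield \<Rightarrow> vfield" where
  "force u c = leray (\<lambda>m. c m *s e3 - advect u m)"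

lemma norm_force_sq: "(norm (force u c k))\<^sup>2 \<le> 8 * (cmod (c k))\<^sup>2 + 8 * (norm (advect u k))\<^sup>2"
proof -
  have "norm (force u c k) \<le> 2 * norm (c k *s e3 - advect u k)" unfolding force_def by (rule norm_leray)
  also have "\<dots> \<le> 2 * (cmod (c k) + norm (advect u k))"
    using norm_triangle_ineq4[of "c k *s e3" "advect u k"] by simp
  finally have "(norm (force u c k))\<^sup>2 \<le> (2 * (cmod (c k) + norm (advect u k)))\<^sup>2" by (intro power_mono) auto
  also have "\<dots> \<le> 8 * (cmod (c k))\<^sup>2 + 8 * (norm (advect u k))\<^sup>2"
    using sum_squares_bound[of "cmod (c k)" "norm (advect u k)"] by (simp add: power2_eq_square algebra_simps)
  finally show ?thesis .
qed

lemma real_force: "real_vf u \<Longrightarrow> real_sf c \<Longrightarrow> real_vf (force u c)"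
  unfolding force_def by (intro real_leray) (use real_advect[of u] in \<open>auto simp: real_vf_iff real_sf_def negk_eq cconj3_simps\<close>)

lemma force_0 [simp]: "force u c 0 = 0"
  by (simp add: force_def)

lemma force_divfree: "cdot (kvec k) (force u c k) = 0"
  by (simp add: force_def leray_divfree)

lemma symA_nonneg [simp]: "symA k \<ge> 0"
  by (simp add: symA_def)

section \<open>Finitely supported velocities and the trilinear form\<close>

definition admissible :: "wn set \<Rightarrow> vfield \<Rightarrow> bool" where
  "admissible K u \<longleftrightarrow> real_vf u \<and> u \<in> divfree \<and> (\<forall>k. k \<notin> K \<longrightarrow> u k = 0)"

lemma advect_finite:
  assumes "finite K" "\<And>k. k \<notin> K \<Longrightarrow> u k = 0"
  shows "advect u k = (\<Sum>m\<in>K. (2 * pi * \<i> * cdot (u (k - m)) (kvec m)) *s u m)"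
  unfolding advect_eq infsum_finite[OF assms(1), symmetric]
  by (rule infsum_cong_neutral) (use assms(2) in auto)

text \<open>The trilinear form changes sign under \<open>(k, m) \<mapsto> (- m, - k)\<close>, because \<open>u (k - m)\<close> is
orthogonal to \<open>k - m\<close>.\<close>

lemma advect_orthogonal:
  assumes K: "finite K" "\<And>k. - k \<in> K \<longleftrightarrow> k \<in> K" and u: "admissible K u"
  shows "(\<Sum>k\<in>K. inner (advect u k) (u k)) = 0"
proof -
  have r: "u (- k) = cconj3 (u k)" and d: "cdot (kvec k) (u k) = 0" and z: "k \<notin> K \<Longrightarrow> u k = 0" for k
    using u by (auto simp: admissible_def real_vf_iff divfree_def)
  define G where "G k m = cdot (u (k - m)) (kvec m) * cdot (u m) (cconj3 (u k))" for k m
  have "inner (advect u k) (u k) = (\<Sum>m\<in>K. Re (2 * pi * \<i> * G k m))" for k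
  proof -
    have "advect u k = (\<Sum>m\<in>K. (2 * pi * \<i> * cdot (u (k - m)) (kvec m)) *s u m)"
      by (rule advect_finite[OF K(1)]) (rule z)
    then have "inner (advect u k) (u k) = (\<Sum>m\<in>K. inner ((2 * pi * \<i> * cdot (u (k - m)) (kvec m)) *s u m) (u k))"
      by (simp only: inner_sum_left)
    then show ?thesis by (simp only: inner_cdot cdot_simps G_def mult.assoc)
  qed
  then have "(\<Sum>k\<in>K. inner (advect u k) (u k)) = Re (2 * pi * \<i> * (\<Sum>(k,m)\<in>K\<times>K. G k m))"
    by (simp add: sum.cartesian_product[symmetric] sum_distrib_left)
  moreover have "(\<Sum>(k,m)\<in>K\<times>K. G k m) = 0"
  proof -
    have anti: "G (- m) (- k) = - G k m" for k m
    proof -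
      have "cdot (u (k - m)) (kvec k) = cdot (u (k - m)) (kvec m)"
        using d[of "k - m"] by (simp add: cdot_simps cdot_commute[of "kvec _"])
      moreover have "- m - (- k) = k - m" by simp
      ultimately show ?thesis by (simp add: G_def r cdot_simps cconj3_simps cdot_commute[of "cconj3 (u k)"])
    qed
    have "(\<Sum>(k,m)\<in>K\<times>K. G k m) = (\<Sum>(k,m)\<in>K\<times>K. G (- m) (- k))"
      by (rule sum.reindex_bij_witness[where i="\<lambda>(k,m). (- m, - k)" and j="\<lambda>(k,m). (- m, - k)"])
         (simp_all add: split_beta mem_Times_iff K(2))
    also have "\<dots> = - (\<Sum>(k,m)\<in>K\<times>K. G k m)" by (simp add: anti sum_negf[symmetric] split_beta)
    finally show ?thesis by simp
  qed
  ultimately show ?thesis by simp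
qed

text \<open>The ratio between the exact symbol of a derivative and that of the central difference,
  as a function of y = h k_j. Multiplying a coefficient by it turns incompressibility into discrete
  incompressibility; the value at 0 is the limit.\<close>

definition rho :: "real \<Rightarrow> real" where
  "rho y = (if y = 0 then 1 else 2 * pi * y / sin (2 * pi * y))"

lemma rho_minus [simp]: "rho (- y) = rho y"
  by (simp add: rho_def)

text \<open>Mean value theorem with cos at least 1/2 up to \<pi>/3.\<close>

lemma sin_ge_half: "0 \<le> z \<Longrightarrow> z \<le> pi / 3 \<Longrightarrow> z / 2 \<le> sin z"
proof (cases "z = 0")
  case False
  assume z: "0 \<le> z" "z \<le> pi / 3"
  have "\<exists>x. 0 < x \<and> x < z \<and> sin z - sin 0 = (z - 0) * cos x"
    using z False by (intro MVT2) (auto intro!: derivative_eq_intros)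
  then obtain x where x: "0 < x" "x < z" "sin z = z * cos x" by auto
  have "cos (pi / 3) \<le> cos x" using x z by (intro cos_monotone_0_pi_le) auto
  then have "z * (1/2) \<le> z * cos x" using z by (intro mult_left_mono) (auto simp: cos_60)
  then show ?thesis using x by simp
qed auto

text \<open>The condition 8 |y| \<le> 1 means 2 \<pi> |y| \<le> \<pi>/4, where the sine is at least
  half its argument. It is the requirement that the mesh resolve the retained modes.\<close>

lemma rho_bound:
  assumes "8 * \<bar>y\<bar> \<le> 1"
  shows "\<bar>rho y\<bar> \<le> 2" "rho y * sin (2 * pi * y) = 2 * pi * y"
proof -
  have *: "\<bar>rho y\<bar> \<le> 2 \<and> rho y * sin (2 * pi * y) = 2 * pi * y" if y: "y > 0" "8 * y \<le> 1" for y
  proof -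
    have "pi * (8 * y) \<le> pi * 1" using y(2) by (intro mult_left_mono) auto
    then have "2 * pi * y \<le> pi / 3" by simp
    moreover have "0 < 2 * pi * y" using y by simp
    ultimately have s: "(2 * pi * y) / 2 \<le> sin (2 * pi * y)" by (intro sin_ge_half) auto
    moreover have "0 < (2 * pi * y) / 2" using y by simp
    ultimately have p: "0 < sin (2 * pi * y)" by linarith
    show ?thesis using y p s unfolding rho_def by (auto simp: divide_simps)
  qed
  have "\<bar>rho y\<bar> \<le> 2 \<and> rho y * sin (2 * pi * y) = 2 * pi * y"
  proof (cases y "0::real" rule: linorder_cases)
    case less
    then show ?thesis using *[of "- y"] assms by simp
  qed (use * assms in \<open>auto simp: rho_def\<close>)
  then show "\<bar>rho y\<bar> \<le> 2" "rho y * sin (2 * pi * y) = 2 * pi * y" by auto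
qed

text \<open>\<open>utc\<close> modifies the velocity so that its central difference divergence vanishes exactly; then
one step of the scheme averages the temperature and cannot increase any convex integral.\<close>

definition utc :: "real \<Rightarrow> vfield \<Rightarrow> 3 \<Rightarrow> sfield" where
  "utc h u j k = of_real (rho (h * kreal k $ j)) * u k $ j"

definition utl :: "real \<Rightarrow> wn set \<Rightarrow> vfield \<Rightarrow> 3 \<Rightarrow> real^3 \<Rightarrow> real" where
  "utl h K u j x = Re (\<Sum>k\<in>K. utc h u j k * ek k x)"

definition ustep :: "real \<Rightarrow> real \<Rightarrow> wn set \<Rightarrow> vfield \<Rightarrow> sfield \<Rightarrow> vfield" where
  "ustep \<alpha> \<tau> K u c k = u k + (if k \<in> K then (\<tau> / (1 + \<alpha>\<^sup>2 * symA k)) *\<^sub>R force u c k else 0)"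

text \<open>The quantity |u|^2 + \<alpha>^2 |grad u|^2 that the unforced Voigt equation conserves;
  it controls H^1. \<open>enstrophy\<close> is its analogue one derivative higher and controls
  H^2.\<close>

definition energy :: "real \<Rightarrow> wn set \<Rightarrow> vfield \<Rightarrow> real" where
  "energy \<alpha> K u = (\<Sum>k\<in>K. (1 + \<alpha>\<^sup>2 * symA k) * (norm (u k))\<^sup>2)"

definition enstrophy :: "real \<Rightarrow> wn set \<Rightarrow> vfield \<Rightarrow> real" where
  "enstrophy \<alpha> K u = (\<Sum>k\<in>K. ksq k * ((1 + \<alpha>\<^sup>2 * symA k) * (norm (u k))\<^sup>2))"

lemma energy_nonneg: "energy \<alpha> K u \<ge> 0"
  unfolding energy_def by (intro sum_nonneg mult_nonneg_nonneg) auto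

lemma enstrophy_nonneg: "enstrophy \<alpha> K u \<ge> 0"
  unfolding enstrophy_def by (intro sum_nonneg mult_nonneg_nonneg) auto

lemma one_plus_symA_pos: "1 + \<alpha>\<^sup>2 * symA k > 0"
  by (simp add: add_pos_nonneg)

text \<open>The Euler step reproduces the energy balance exactly up to a remainder quadratic in
  \<tau>; one factor of the weight cancels in both force terms.\<close>

lemma ustep_norm:
  assumes "k \<in> K"
  shows "(1 + \<alpha>\<^sup>2 * symA k) * (norm (ustep \<alpha> \<tau> K u c k))\<^sup>2 = (1 + \<alpha>\<^sup>2 * symA k) * (norm (u k))\<^sup>2
     + 2 * \<tau> * inner (force u c k) (u k) + \<tau>\<^sup>2 * ((norm (force u c k))\<^sup>2 / (1 + \<alpha>\<^sup>2 * symA k))"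
proof -
  let ?w = "1 + \<alpha>\<^sup>2 * symA k"
  have w: "?w > 0" by (rule one_plus_symA_pos)
  have "(norm (ustep \<alpha> \<tau> K u c k))\<^sup>2 = (norm (u k))\<^sup>2 + 2 * (\<tau> / ?w) * inner (force u c k) (u k) + (\<tau> / ?w)\<^sup>2 * (norm (force u c k))\<^sup>2"
    using assms by (simp add: ustep_def power2_norm_eq_inner inner_simps inner_commute) (simp add: power2_eq_square)
  moreover have "W > 0 \<Longrightarrow> X = n + 2 * (\<tau> / W) * i + (\<tau> / W)\<^sup>2 * F \<Longrightarrow> W * X = W * n + 2 * \<tau> * i + \<tau>\<^sup>2 * (F / W)"
    for W X n i F :: real by (simp add: field_simps power2_eq_square)
  ultimately show ?thesis using w by blast
qed

lemma admissible_ustep: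
  assumes K: "\<And>k. - k \<in> K \<longleftrightarrow> k \<in> K" and u: "admissible K u" and c: "real_sf c"
  shows "admissible K (ustep \<alpha> \<tau> K u c)"
proof -
  have r: "u (- k) = cconj3 (u k)" and d: "cdot (kvec k) (u k) = 0" and z: "k \<notin> K \<Longrightarrow> u k = 0" for k
    using u by (auto simp: admissible_def real_vf_iff divfree_def)
  have rf: "force u c (- k) = cconj3 (force u c k)" for k
    using real_force[OF _ c] u by (auto simp: admissible_def real_vf_iff)
  have "cdot a (s *\<^sub>R b) = of_real s * cdot a b" for a b :: "complex^3" and s :: real
    by (simp add: cdot_def sum_distrib_left) (simp add: scaleR_conv_of_real ac_simps)
  then have "ustep \<alpha> \<tau> K u c \<in> divfree"
    by (simp add: divfree_def ustep_def cdot_simps d force_divfree)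
  moreover have "symA (- k) = symA k" for k by (simp add: symA_def)
  then have "real_vf (ustep \<alpha> \<tau> K u c)"
    by (simp add: real_vf_iff ustep_def K r rf cconj3_simps)
  ultimately show ?thesis using z by (simp add: admissible_def ustep_def)
qed

lemma norm_le_energy:
  assumes "finite K" "admissible K u"
  shows "(norm (u k))\<^sup>2 \<le> energy \<alpha> K u"
proof (cases "k \<in> K")
  case True
  have "1 * (norm (u k))\<^sup>2 \<le> (1 + \<alpha>\<^sup>2 * symA k) * (norm (u k))\<^sup>2" by (intro mult_right_mono) auto
  also have "\<dots> \<le> energy \<alpha> K u" unfolding energy_def
    using assms True by (intro member_le_sum) auto
  finally show ?thesis by simp
qed (use assms energy_nonneg in \<open>auto simp: admissible_def\<close>)

text \<open>A constant that degenerates with the truncation. In the energy inequality it occurs only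
  with \<tau> squared, and the time step is chosen after the set of modes.\<close>

definition crude :: "wn set \<Rightarrow> real" where
  "crude K = 8 * real (card K) * (\<Sum>m\<in>K. 2 * pi * sqrt (ksq m))\<^sup>2"

lemma crude_advect:
  assumes K: "finite K" and u: "admissible K u"
  shows "8 * (\<Sum>k\<in>K. (norm (advect u k))\<^sup>2) \<le> crude K * (energy \<alpha> K u)\<^sup>2"
proof -
  let ?E = "energy \<alpha> K u" and ?A = "\<Sum>m\<in>K. 2 * pi * sqrt (ksq m)"
  have nu: "norm (u k) \<le> sqrt ?E" for k
    using norm_le_energy[OF K u, of k \<alpha>] by (rule real_le_rsqrt)
  have "norm (advect u k) \<le> ?A * ?E" for k
  proof -
    have "norm (advect u k) \<le> (\<Sum>m\<in>K. norm ((2 * pi * \<i> * cdot (u (k - m)) (kvec m)) *s u m))"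
      using u by (subst advect_finite[OF K]) (auto simp: admissible_def simp del: norm_smult intro: norm_sum)
    also have "\<dots> \<le> (\<Sum>m\<in>K. 2 * pi * sqrt (ksq m) * ?E)"
    proof (rule sum_mono)
      fix m
      have "cmod (cdot (u (k - m)) (kvec m)) * norm (u m) \<le> (norm (u (k - m)) * sqrt (ksq m)) * norm (u m)"
        using norm_cdot_le[of "u (k - m)" "kvec m"] by (intro mult_right_mono) (auto simp: norm_kvec)
      also have "\<dots> \<le> (sqrt ?E * sqrt (ksq m)) * sqrt ?E"
        using nu energy_nonneg[of \<alpha> K u] by (intro mult_mono) auto
      also have "\<dots> = sqrt (ksq m) * ?E" using energy_nonneg[of \<alpha> K u] by simp
      finally have "2 * pi * (cmod (cdot (u (k - m)) (kvec m)) * norm (u m)) \<le> 2 * pi * (sqrt (ksq m) * ?E)"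
        by (intro mult_left_mono) auto
      then show "norm ((2 * pi * \<i> * cdot (u (k - m)) (kvec m)) *s u m) \<le> 2 * pi * sqrt (ksq m) * ?E"
        by (simp add: norm_mult mult.assoc)
    qed
    finally show ?thesis by (simp add: sum_distrib_right)
  qed
  then have "(\<Sum>k\<in>K. (norm (advect u k))\<^sup>2) \<le> (\<Sum>k\<in>K. (?A * ?E)\<^sup>2)"
    by (intro sum_mono power_mono) auto
  then show ?thesis by (simp add: crude_def power_mult_distrib)
qed

text \<open>Tested with u, advection drops out and buoyancy is split by Young's inequality into M
  and the energy. Only the Euler remainder contains the full force, and there the crude bound is
  affordable.\<close>

lemma energy_step:
  assumes K: "finite K" "\<And>k. - k \<in> K \<longleftrightarrow> k \<in> K" "0 \<notin> K" and u: "admissible K u"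
    and c: "(\<Sum>k\<in>K. (cmod (c k))\<^sup>2) \<le> M" and tau: "\<tau> \<ge> 0"
  shows "energy \<alpha> K (ustep \<alpha> \<tau> K u c) \<le> (1 + \<tau>) * energy \<alpha> K u + \<tau> * M + \<tau>\<^sup>2 * (8 * M + crude K * (energy \<alpha> K u)\<^sup>2)"
proof -
  have e: "energy \<alpha> K (ustep \<alpha> \<tau> K u c) = energy \<alpha> K u + 2 * \<tau> * (\<Sum>k\<in>K. inner (force u c k) (u k))
      + \<tau>\<^sup>2 * (\<Sum>k\<in>K. (norm (force u c k))\<^sup>2 / (1 + \<alpha>\<^sup>2 * symA k))"
    unfolding energy_def sum_distrib_left sum.distrib[symmetric] by (intro sum.cong) (auto simp: ustep_norm)
  have "(\<Sum>k\<in>K. inner (force u c k) (u k)) = (\<Sum>k\<in>K. inner (c k *s e3) (u k)) - (\<Sum>k\<in>K. inner (advect u k) (u k))"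
    unfolding sum_subtractf[symmetric]
  proof (rule sum.cong[OF refl])
    fix k assume "k \<in> K"
    then have "k \<noteq> 0" "cdot (kvec k) (u k) = 0" using K(3) u by (auto simp: admissible_def divfree_def)
    then show "inner (force u c k) (u k) = inner (c k *s e3) (u k) - inner (advect u k) (u k)"
      unfolding force_def by (subst inner_leray) (auto simp: inner_diff_left)
  qed
  also have "\<dots> = (\<Sum>k\<in>K. inner (c k *s e3) (u k))" using advect_orthogonal[OF K(1,2) u] by simp
  also have "2 * \<dots> \<le> (\<Sum>k\<in>K. (cmod (c k))\<^sup>2 + (1 + \<alpha>\<^sup>2 * symA k) * (norm (u k))\<^sup>2)"
    unfolding sum_distrib_left
  proof (rule sum_mono)
    fix k
    have "2 * inner (c k *s e3) (u k) \<le> 2 * (cmod (c k) * norm (u k))"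
      using norm_cauchy_schwarz[of "c k *s e3" "u k"] by simp
    also have "\<dots> \<le> (cmod (c k))\<^sup>2 + 1 * (norm (u k))\<^sup>2" using sum_squares_bound[of "cmod (c k)" "norm (u k)"] by simp
    also have "\<dots> \<le> (cmod (c k))\<^sup>2 + (1 + \<alpha>\<^sup>2 * symA k) * (norm (u k))\<^sup>2"
      by (intro add_left_mono mult_right_mono) auto
    finally show "2 * inner (c k *s e3) (u k) \<le> (cmod (c k))\<^sup>2 + (1 + \<alpha>\<^sup>2 * symA k) * (norm (u k))\<^sup>2" .
  qed
  also have "\<dots> \<le> M + energy \<alpha> K u" using c by (simp add: sum.distrib energy_def)
  finally have 1: "2 * (\<Sum>k\<in>K. inner (force u c k) (u k)) \<le> M + energy \<alpha> K u" .
  have "(\<Sum>k\<in>K. (norm (force u c k))\<^sup>2 / (1 + \<alpha>\<^sup>2 * symA k)) \<le> (\<Sum>k\<in>K. 8 * (cmod (c k))\<^sup>2 + 8 * (norm (advect u k))\<^sup>2)"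
  proof (rule sum_mono)
    fix k
    have "(norm (force u c k))\<^sup>2 / (1 + \<alpha>\<^sup>2 * symA k) \<le> (norm (force u c k))\<^sup>2 / 1"
      using one_plus_symA_pos[of \<alpha> k] by (intro divide_left_mono) auto
    then show "(norm (force u c k))\<^sup>2 / (1 + \<alpha>\<^sup>2 * symA k) \<le> 8 * (cmod (c k))\<^sup>2 + 8 * (norm (advect u k))\<^sup>2"
      using norm_force_sq[of u c k] by simp
  qed
  also have "\<dots> \<le> 8 * M + crude K * (energy \<alpha> K u)\<^sup>2"
    using c crude_advect[OF K(1) u, of \<alpha>] by (simp add: sum.distrib sum_distrib_left[symmetric])
  finally have 2: "(\<Sum>k\<in>K. (norm (force u c k))\<^sup>2 / (1 + \<alpha>\<^sup>2 * symA k)) \<le> 8 * M + crude K * (energy \<alpha> K u)\<^sup>2" .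
  have "\<tau> * (2 * (\<Sum>k\<in>K. inner (force u c k) (u k))) \<le> \<tau> * (M + energy \<alpha> K u)"
    using 1 tau by (rule mult_left_mono)
  moreover have "\<tau>\<^sup>2 * (\<Sum>k\<in>K. (norm (force u c k))\<^sup>2 / (1 + \<alpha>\<^sup>2 * symA k)) \<le> \<tau>\<^sup>2 * (8 * M + crude K * (energy \<alpha> K u)\<^sup>2)"
    using 2 by (rule mult_left_mono) simp
  ultimately show ?thesis unfolding e by (simp add: algebra_simps)
qed

text \<open>The gain of two derivatives by the inverse of I + \<alpha>^2 A; all occurrences of 1/(4
  \<pi>^2 \<alpha>^2) come from here.\<close>

lemma ksq_le_weight: "\<alpha> \<noteq> 0 \<Longrightarrow> ksq k \<le> (1 + \<alpha>\<^sup>2 * symA k) / (4 * pi\<^sup>2 * \<alpha>\<^sup>2)"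
  by (simp add: symA_def field_simps power_mult_distrib)

lemma H1_le_energy:
  assumes "\<alpha> \<noteq> 0"
  shows "(\<Sum>k\<in>K. ksq k * (norm (u k))\<^sup>2) \<le> energy \<alpha> K u / (4 * pi\<^sup>2 * \<alpha>\<^sup>2)"
    and "(\<Sum>k\<in>K. (ksq k)\<^sup>2 * (norm (u k))\<^sup>2) \<le> enstrophy \<alpha> K u / (4 * pi\<^sup>2 * \<alpha>\<^sup>2)"
proof -
  have p: "ksq k * (norm (u k))\<^sup>2 \<le> (1 + \<alpha>\<^sup>2 * symA k) * (norm (u k))\<^sup>2 / (4 * pi\<^sup>2 * \<alpha>\<^sup>2)" for k
    using mult_right_mono[OF ksq_le_weight[OF assms, of k], of "(norm (u k))\<^sup>2"] by simp
  then show "(\<Sum>k\<in>K. ksq k * (norm (u k))\<^sup>2) \<le> energy \<alpha> K u / (4 * pi\<^sup>2 * \<alpha>\<^sup>2)"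
    unfolding energy_def sum_divide_distrib by (intro sum_mono)
  have "ksq k * (ksq k * (norm (u k))\<^sup>2) \<le> ksq k * ((1 + \<alpha>\<^sup>2 * symA k) * (norm (u k))\<^sup>2 / (4 * pi\<^sup>2 * \<alpha>\<^sup>2))" for k
    using p by (intro mult_left_mono) auto
  then show "(\<Sum>k\<in>K. (ksq k)\<^sup>2 * (norm (u k))\<^sup>2) \<le> enstrophy \<alpha> K u / (4 * pi\<^sup>2 * \<alpha>\<^sup>2)"
    unfolding enstrophy_def sum_divide_distrib by (intro sum_mono) (simp add: power2_eq_square mult.assoc)
qed

definition sk :: real where "sk = enn2real SK"

lemma sk: "SK = ennreal sk" "sk \<ge> 0"
  using SK_finite by (auto simp: sk_def)

lemma advect_bound:
  assumes K: "finite K" "0 \<notin> K" and u: "admissible K u" and \<alpha>: "\<alpha> \<noteq> 0"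
  shows "(\<Sum>k\<in>K. (norm (advect u k))\<^sup>2) \<le> sk / (4 * pi\<^sup>2 * \<alpha>^4) * (energy \<alpha> K u * enstrophy \<alpha> K u)"
proof -
  have z: "u k = 0" if "k \<notin> K" for k using u that by (auto simp: admissible_def)
  let ?a = "\<Sum>k\<in>K. ksq k * (norm (u k))\<^sup>2" and ?b = "\<Sum>k\<in>K. (ksq k)\<^sup>2 * (norm (u k))\<^sup>2"
  have "nns (\<lambda>k. ennreal (ksq k * (norm (u k))\<^sup>2)) = ennreal ?a" "h2sq u = ennreal ?b"
    using z by (subst nns_finite_support[OF K(1)]; auto)+
  moreover have "ennreal (\<Sum>k\<in>K. (norm (advect u k))\<^sup>2) \<le> l2sq (advect u)"
    using nns_finite_sum_le[OF K(1), of "\<lambda>k. ennreal ((norm (advect u k))\<^sup>2)"] by simp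
  ultimately have "ennreal (\<Sum>k\<in>K. (norm (advect u k))\<^sup>2) \<le> ennreal (4 * pi\<^sup>2) * (ennreal sk * (ennreal ?a * ennreal ?b))"
    using nns_advect_sq[of u] z[OF K(2)] by (simp add: sk(1))
  also have "\<dots> = ennreal (4 * pi\<^sup>2 * (sk * (?a * ?b)))"
    using sk(2) by (simp add: ennreal_mult sum_nonneg)
  finally have "(\<Sum>k\<in>K. (norm (advect u k))\<^sup>2) \<le> 4 * pi\<^sup>2 * (sk * (?a * ?b))"
    using sk(2) by (subst (asm) ennreal_le_iff) (auto intro!: mult_nonneg_nonneg sum_nonneg)
  also have "\<dots> \<le> 4 * pi\<^sup>2 * (sk * ((energy \<alpha> K u / (4 * pi\<^sup>2 * \<alpha>\<^sup>2)) * (enstrophy \<alpha> K u / (4 * pi\<^sup>2 * \<alpha>\<^sup>2))))"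
    using sk(2) energy_nonneg[of \<alpha> K u] by (intro mult_left_mono mult_mono H1_le_energy[OF \<alpha>]) (auto intro!: sum_nonneg)
  also have "\<dots> = sk / (4 * pi\<^sup>2 * \<alpha>^4) * (energy \<alpha> K u * enstrophy \<alpha> K u)"
    using \<alpha> by (simp add: field_simps power2_eq_square power4_eq_xxxx)
  finally show ?thesis .
qed

text \<open>\<open>gr_a\<close> and \<open>gr_b\<close> are the coefficients of the inequality Y'
  \<le> gr_b Y + gr_a for the enstrophy while the energy is at most R. They contain neither the set
  of modes nor the mesh.\<close>

definition gr_a :: "real \<Rightarrow> real \<Rightarrow> real" where
  "gr_a \<alpha> M = (1 + 1 / (4 * pi\<^sup>2 * \<alpha>\<^sup>2)) * (8 * M)"

definition gr_b :: "real \<Rightarrow> real \<Rightarrow> real" where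
  "gr_b \<alpha> R = (1 + 1 / (4 * pi\<^sup>2 * \<alpha>\<^sup>2)) * (8 * (sk / (4 * pi\<^sup>2 * \<alpha>^4)) * R) + 1 / (4 * pi\<^sup>2 * \<alpha>\<^sup>2)"

text \<open>There is no cancellation of advection at this level. Instead the force is estimated in
  L^2, where advection costs energy times enstrophy, which is linear in the enstrophy once the
  energy is at most R.\<close>

lemma enstrophy_step:
  assumes K: "finite K" "0 \<notin> K" and u: "admissible K u" and \<alpha>: "\<alpha> \<noteq> 0"
    and c: "(\<Sum>k\<in>K. (cmod (c k))\<^sup>2) \<le> M" and tau: "0 \<le> \<tau>" "\<tau> \<le> 1" and R: "energy \<alpha> K u \<le> R"
  shows "enstrophy \<alpha> K (ustep \<alpha> \<tau> K u c) \<le> (1 + \<tau> * gr_b \<alpha> R) * enstrophy \<alpha> K u + \<tau> * gr_a \<alpha> M"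
proof -
  let ?q = "1 / (4 * pi\<^sup>2 * \<alpha>\<^sup>2)" and ?Y = "enstrophy \<alpha> K u" and ?s = "sk / (4 * pi\<^sup>2 * \<alpha>^4)"
  define S where "S = (\<Sum>k\<in>K. (norm (force u c k))\<^sup>2)"
  have q: "?q \<ge> 0" by simp
  have S0: "S \<ge> 0" unfolding S_def by (intro sum_nonneg) auto
  have "S \<le> (\<Sum>k\<in>K. 8 * (cmod (c k))\<^sup>2 + 8 * (norm (advect u k))\<^sup>2)" unfolding S_def by (intro sum_mono norm_force_sq)
  also have "\<dots> = 8 * (\<Sum>k\<in>K. (cmod (c k))\<^sup>2) + 8 * (\<Sum>k\<in>K. (norm (advect u k))\<^sup>2)"
    by (simp add: sum.distrib sum_distrib_left)
  also have "\<dots> \<le> 8 * M + 8 * (?s * (energy \<alpha> K u * ?Y))"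
    using c advect_bound[OF K u \<alpha>] by linarith
  also have "\<dots> \<le> 8 * M + 8 * (?s * (R * ?Y))"
    using R sk(2) enstrophy_nonneg[of \<alpha> K u] by (intro add_left_mono mult_left_mono mult_right_mono) auto
  finally have S: "S \<le> 8 * M + 8 * ?s * R * ?Y" by (simp only: mult.assoc)
  have e: "enstrophy \<alpha> K (ustep \<alpha> \<tau> K u c) = ?Y + \<tau> * (\<Sum>k\<in>K. 2 * inner (force u c k) (ksq k *\<^sub>R u k))
      + \<tau>\<^sup>2 * (\<Sum>k\<in>K. ksq k * ((norm (force u c k))\<^sup>2 / (1 + \<alpha>\<^sup>2 * symA k)))"
    unfolding enstrophy_def sum_distrib_left sum.distrib[symmetric]
    by (intro sum.cong refl) (simp only: ustep_norm, simp add: algebra_simps)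
  have "(\<Sum>k\<in>K. 2 * inner (force u c k) (ksq k *\<^sub>R u k)) \<le> (\<Sum>k\<in>K. (norm (force u c k))\<^sup>2 + (ksq k)\<^sup>2 * (norm (u k))\<^sup>2)"
  proof (rule sum_mono)
    fix k
    have "2 * inner (force u c k) (ksq k *\<^sub>R u k) \<le> 2 * (norm (force u c k) * norm (ksq k *\<^sub>R u k))"
      using norm_cauchy_schwarz[of "force u c k" "ksq k *\<^sub>R u k"] by linarith
    also have "\<dots> \<le> (norm (force u c k))\<^sup>2 + (norm (ksq k *\<^sub>R u k))\<^sup>2"
      using sum_squares_bound[of "norm (force u c k)" "norm (ksq k *\<^sub>R u k)"] by simp
    finally show "2 * inner (force u c k) (ksq k *\<^sub>R u k) \<le> (norm (force u c k))\<^sup>2 + (ksq k)\<^sup>2 * (norm (u k))\<^sup>2"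
      by (simp add: power_mult_distrib)
  qed
  also have "\<dots> \<le> S + ?q * ?Y"
    using H1_le_energy(2)[OF \<alpha>, of u K] by (simp add: sum.distrib S_def)
  finally have 1: "(\<Sum>k\<in>K. 2 * inner (force u c k) (ksq k *\<^sub>R u k)) \<le> S + ?q * ?Y" .
  have 2: "(\<Sum>k\<in>K. ksq k * ((norm (force u c k))\<^sup>2 / (1 + \<alpha>\<^sup>2 * symA k))) \<le> ?q * S"
    unfolding S_def sum_distrib_left
  proof (rule sum_mono)
    fix k
    have "ksq k / (1 + \<alpha>\<^sup>2 * symA k) \<le> ?q"
      using ksq_le_weight[OF \<alpha>, of k] one_plus_symA_pos[of \<alpha> k] \<alpha> by (simp add: field_simps)
    then show "ksq k * ((norm (force u c k))\<^sup>2 / (1 + \<alpha>\<^sup>2 * symA k)) \<le> ?q * (norm (force u c k))\<^sup>2"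
      using mult_right_mono[of "ksq k / (1 + \<alpha>\<^sup>2 * symA k)" ?q "(norm (force u c k))\<^sup>2"] by simp
  qed
  \<comment> \<open>Unlike in the energy step, the Euler remainder is bounded uniformly in the set
    of modes: the weight in its denominator absorbs the factor \<open>ksq k\<close>, and one \<tau>
    is given away.\<close>
  have "\<tau>\<^sup>2 \<le> \<tau>" using tau by (simp add: power2_eq_square mult_left_le)
  then have "\<tau>\<^sup>2 * (\<Sum>k\<in>K. ksq k * ((norm (force u c k))\<^sup>2 / (1 + \<alpha>\<^sup>2 * symA k))) \<le> \<tau> * (?q * S)"
    using 2 tau by (intro mult_mono) (auto intro!: sum_nonneg mult_nonneg_nonneg divide_nonneg_nonneg)
  moreover have "\<tau> * (\<Sum>k\<in>K. 2 * inner (force u c k) (ksq k *\<^sub>R u k)) \<le> \<tau> * (S + ?q * ?Y)"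
    using 1 tau by (intro mult_left_mono) auto
  ultimately have "enstrophy \<alpha> K (ustep \<alpha> \<tau> K u c) \<le> ?Y + \<tau> * ((1 + ?q) * S + ?q * ?Y)"
    unfolding e by (simp add: algebra_simps)
  also have "\<dots> \<le> ?Y + \<tau> * ((1 + ?q) * (8 * M + 8 * ?s * R * ?Y) + ?q * ?Y)"
    using S tau q by (intro add_left_mono mult_left_mono add_right_mono) auto
  also have "\<dots> = (1 + \<tau> * gr_b \<alpha> R) * ?Y + \<tau> * gr_a \<alpha> M"
    unfolding gr_a_def gr_b_def by (simp only: distrib_left distrib_right mult_1_left mult.assoc add.assoc)
  finally show ?thesis .
qed

lemma discrete_gronwall:
  fixes x :: "nat \<Rightarrow> real"
  assumes "\<And>n. n < L \<Longrightarrow> x (Suc n) \<le> (1 + \<tau> * b) * x n + \<tau> * a" "0 \<le> \<tau>" "0 \<le> a" "0 \<le> b" "0 \<le> x 0"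
  shows "n \<le> L \<Longrightarrow> x n \<le> exp (b * (real n * \<tau>)) * (x 0 + real n * \<tau> * a)"
proof (induction n)
  case (Suc n)
  have "x (Suc n) \<le> (1 + \<tau> * b) * x n + \<tau> * a" using assms(1) Suc.prems by simp
  also have "\<dots> \<le> (1 + \<tau> * b) * (exp (b * (real n * \<tau>)) * (x 0 + real n * \<tau> * a)) + \<tau> * a"
    using Suc assms by (intro add_right_mono mult_left_mono) auto
  also have "\<dots> \<le> exp (\<tau> * b) * (exp (b * (real n * \<tau>)) * (x 0 + real n * \<tau> * a)) + exp (b * (real (Suc n) * \<tau>)) * (\<tau> * a)"
  proof (intro add_mono mult_right_mono exp_ge_add_one_self)
    have "1 \<le> exp (b * (real (Suc n) * \<tau>))" using assms by simp
    then have "1 * (\<tau> * a) \<le> exp (b * (real (Suc n) * \<tau>)) * (\<tau> * a)" using assms by (intro mult_right_mono) auto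
    then show "\<tau> * a \<le> exp (b * (real (Suc n) * \<tau>)) * (\<tau> * a)" by simp
  qed (use assms in auto)
  also have "\<dots> = exp (b * (real (Suc n) * \<tau>)) * (x 0 + real (Suc n) * \<tau> * a)"
    by (simp add: exp_add[symmetric] mult.assoc[symmetric]) (simp add: algebra_simps)
  finally show ?case .
qed simp

lemma coeff_sum_le:
  assumes "sqint g" "(\<integral>x. (g x)\<^sup>2 \<partial>Q) \<le> B" "finite F"
  shows "(\<Sum>k\<in>F. (cmod (fourier_coeff g k))\<^sup>2) \<le> B"
proof -
  have "(\<Sum>k\<in>F. (cmod (fcc (\<lambda>x. complex_of_real (g x)) k))\<^sup>2) \<le> (\<integral>x. (cmod (complex_of_real (g x)))\<^sup>2 \<partial>Q)"
    using assms by (intro bessel) (auto simp: sqint_def)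
  then show ?thesis using assms by (simp add: fourier_coeff_fcc sqint_def)
qed

text \<open>R is fixed beforehand as the value of a discrete Gronwall bound in which the Euler error
  is replaced by the summand 1. \<open>tau_R\<close> then says that the error really is below this
  1, \<open>h_R\<close> that the transporting velocity has a small cell Peclet number, and
  \<open>hK\<close> that the mesh resolves all modes, so that the bound by R and the steps sustain
  each other.\<close>

locale scheme =
  fixes \<alpha> \<kappa> h \<tau> R Y :: real and K :: "wn set" and v0 :: vfield and f :: "real^3 \<Rightarrow> real" and L :: nat
  assumes alpha: "\<alpha> \<noteq> 0" and kappa: "\<kappa> > 0" and h: "0 < h" "h \<le> 1"
    and tau: "0 < \<tau>" "\<tau> \<le> 1" "12 * \<tau> * \<kappa> \<le> h\<^sup>2"
    and K: "finite K" "\<And>k. - k \<in> K \<longleftrightarrow> k \<in> K" "0 \<notin> K"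
    and v0: "admissible K v0" and f: "sqint f" "periodic f" "fourier_coeff f 0 = 0"
    and hK: "\<And>k j. k \<in> K \<Longrightarrow> 8 * \<bar>h * kreal k $ j\<bar> \<le> 1"
    and R: "exp (real L * \<tau>) * (energy \<alpha> K v0 + real L * \<tau> * ((\<integral>x. (f x)\<^sup>2 \<partial>Q) + 1)) \<le> R"
    and Y: "enstrophy \<alpha> K v0 \<le> Y"
    and tau_R: "\<tau> * (8 * (\<integral>x. (f x)\<^sup>2 \<partial>Q) + crude K * R\<^sup>2) \<le> 1"
    and h_R: "h * (2 * real (card K) * sqrt R) \<le> \<kappa>"
begin

definition "M = (\<integral>x. (f x)\<^sup>2 \<partial>Q)"

lemma M_nonneg: "M \<ge> 0"
  by (simp add: M_def)

primrec sol :: "nat \<Rightarrow> vfield \<times> (real^3 \<Rightarrow> real)" where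
  "sol 0 = (v0, f)"
| "sol (Suc n) = (ustep \<alpha> \<tau> K (fst (sol n)) (fourier_coeff (snd (sol n))),
                  thstep \<kappa> h \<tau> (utl h K (fst (sol n))) (snd (sol n)))"

abbreviation "u n \<equiv> fst (sol n)"
abbreviation "\<theta> n \<equiv> snd (sol n)"
abbreviation "c n \<equiv> fourier_coeff (\<theta> n)"

lemma utl_complex:
  assumes "admissible K w"
  shows "complex_of_real (utl h K w j x) = (\<Sum>k\<in>K. utc h w j k * ek k x)"
  unfolding utl_def
proof (rule real_trig_sum[symmetric, OF K(1,2)])
  fix k
  have "w (- k) = cconj3 (w k)" using assms by (auto simp: admissible_def real_vf_iff)
  then show "utc h w j (- k) = cnj (utc h w j k)"
    by (simp add: utc_def cconj3_def)
qed

lemma transport: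
  assumes w: "admissible K w" and E: "energy \<alpha> K w \<le> R"
  shows "transport_step \<kappa> h \<tau> (utl h K w)"
proof
  show "utl h K w j \<in> borel_measurable borel" for j unfolding utl_def[abs_def] by measurable
  show "periodic (utl h K w j)" for j
    using periodic_ek by (simp add: periodic_def utl_def)
  show "h * \<bar>utl h K w j x\<bar> \<le> \<kappa>" for j x
  proof -
    have nw: "norm (w k) \<le> sqrt R" for k
      using norm_le_energy[OF K(1) w, of k \<alpha>] E by (intro real_le_rsqrt) linarith
    have "\<bar>utl h K w j x\<bar> \<le> cmod (\<Sum>k\<in>K. utc h w j k * ek k x)" unfolding utl_def by (rule abs_Re_le_cmod)
    also have "\<dots> \<le> (\<Sum>k\<in>K. 2 * sqrt R)"
    proof (rule sum_norm_le)
      fix k assume k: "k \<in> K"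
      have "\<bar>rho (h * kreal k $ j)\<bar> * cmod (w k $ j) \<le> 2 * sqrt R"
        using rho_bound(1)[OF hK[OF k]] order_trans[OF Finite_Cartesian_Product.norm_nth_le nw, of k j]
        by (intro mult_mono) auto
      then show "cmod (utc h w j k * ek k x) \<le> 2 * sqrt R" by (simp add: utc_def norm_mult)
    qed
    finally have "\<bar>utl h K w j x\<bar> \<le> 2 * real (card K) * sqrt R" by simp
    then have "h * \<bar>utl h K w j x\<bar> \<le> h * (2 * real (card K) * sqrt R)" using h by (intro mult_left_mono) auto
    then show ?thesis using h_R by linarith
  qed
  show "(\<Sum>j\<in>UNIV. utl h K w j (x + axis j h) - utl h K w j (x + axis j (- h))) = 0" for x
  proof -
    \<comment> \<open>The central difference acts on a mode as 2 i sin(2 \<pi> h k_j), and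
      \<open>rho\<close> restores the exact symbol. Summed over the axes, the result is a multiple
      of the divergence of w in each mode.\<close>
    have diff: "utl h K w j (x + axis j h) - utl h K w j (x + axis j (- h))
        = Re (\<Sum>k\<in>K. (4 * pi * h * \<i>) * (of_real (kreal k $ j) * w k $ j) * ek k x)" for j
    proof -
      have "utl h K w j (x + axis j h) - utl h K w j (x + axis j (- h))
         = Re (\<Sum>k\<in>K. utc h w j k * (cis (2 * pi * h * kreal k $ j) - cis (2 * pi * (- h) * kreal k $ j)) * ek k x)"
        unfolding utl_def minus_complex.sel[symmetric] sum_subtractf[symmetric] by (simp add: ek_axis algebra_simps)
      also have "(\<Sum>k\<in>K. utc h w j k * (cis (2 * pi * h * kreal k $ j) - cis (2 * pi * (- h) * kreal k $ j)) * ek k x)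
         = (\<Sum>k\<in>K. (4 * pi * h * \<i>) * (of_real (kreal k $ j) * w k $ j) * ek k x)"
      proof (rule sum.cong[OF refl])
        fix k assume k: "k \<in> K"
        define y where "y = h * kreal k $ j"
        have a: "2 * pi * h * kreal k $ j = 2 * pi * y" "2 * pi * (- h) * kreal k $ j = - (2 * pi * y)" by (auto simp: y_def)
        have "cis (2 * pi * h * kreal k $ j) - cis (2 * pi * (- h) * kreal k $ j) = 2 * \<i> * of_real (sin (2 * pi * y))"
          unfolding a by (auto simp: complex_eq_iff)
        moreover have "complex_of_real (rho y) * of_real (sin (2 * pi * y)) = of_real (2 * pi * y)"
          using rho_bound(2)[OF hK[OF k], of j] by (metis of_real_mult y_def)
        then have "(of_real (rho y) * w k $ j) * (2 * \<i> * of_real (sin (2 * pi * y))) = 2 * \<i> * of_real (2 * pi * y) * w k $ j"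
          by (metis (no_types, lifting) mult.assoc mult.commute)
        ultimately show "utc h w j k * (cis (2 * pi * h * kreal k $ j) - cis (2 * pi * (- h) * kreal k $ j)) * ek k x
          = (4 * pi * h * \<i>) * (of_real (kreal k $ j) * w k $ j) * ek k x"
          by (simp add: utc_def y_def[symmetric]) (simp add: y_def)
      qed
      finally show ?thesis .
    qed
    have "(\<Sum>j\<in>UNIV. \<Sum>k\<in>K. (4 * pi * h * \<i>) * (of_real (kreal k $ j) * w k $ j) * ek k x)
        = (\<Sum>k\<in>K. (4 * pi * h * \<i>) * cdot (kvec k) (w k) * ek k x)"
      by (subst sum.swap) (simp add: cdot_def kvec_nth sum_distrib_left sum_distrib_right mult.assoc)
    also have "\<dots> = 0" using w by (simp add: admissible_def divfree_def)
    finally show ?thesis unfolding diff Re_sum[symmetric] by simp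
  qed
qed (use kappa h tau in auto)

definition inv where
  "inv n \<longleftrightarrow> admissible K (u n) \<and> sqint (\<theta> n) \<and> periodic (\<theta> n) \<and> (\<integral>x. (\<theta> n x)\<^sup>2 \<partial>Q) \<le> M \<and> c n 0 = 0
     \<and> energy \<alpha> K (u n) \<le> exp (real n * \<tau>) * (energy \<alpha> K v0 + real n * \<tau> * (M + 1))"

lemma inv_R:
  assumes "inv n" "n \<le> L"
  shows "energy \<alpha> K (u n) \<le> R"
proof -
  have "exp (real n * \<tau>) * (energy \<alpha> K v0 + real n * \<tau> * (M + 1)) \<le> exp (real L * \<tau>) * (energy \<alpha> K v0 + real L * \<tau> * (M + 1))"
    using assms(2) tau M_nonneg energy_nonneg[of \<alpha> K v0]
    by (intro mult_mono add_mono mult_right_mono) (auto intro!: add_nonneg_nonneg mult_nonneg_nonneg)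
  then show ?thesis using assms(1) R by (simp add: inv_def M_def)
qed

lemma invariant: "n \<le> L \<Longrightarrow> inv n"
proof (induction n)
  case 0
  show ?case using v0 f by (simp add: inv_def M_def)
next
  case (Suc n)
  then have I: "inv n" and n: "n \<le> L" by auto
  then have w: "admissible K (u n)" and s: "sqint (\<theta> n)" and p: "periodic (\<theta> n)" and m: "(\<integral>x. (\<theta> n x)\<^sup>2 \<partial>Q) \<le> M"
    and z: "c n 0 = 0" and e: "energy \<alpha> K (u n) \<le> exp (real n * \<tau>) * (energy \<alpha> K v0 + real n * \<tau> * (M + 1))"
    by (auto simp: inv_def)
  have ER: "energy \<alpha> K (u n) \<le> R" using I n by (rule inv_R)
  interpret T: transport_step \<kappa> h \<tau> "utl h K (u n)" using w ER by (rule transport)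
  have re: "real_sf (c n)" using real_fcc[of "\<theta> n"] s by (simp add: fourier_coeff_fcc sqint_def)
  have a: "admissible K (u (Suc n))" using admissible_ustep[OF K(2) w re] by simp
  have s': "sqint (\<theta> (Suc n))" using T.thstep_sqint(1)[OF s p] by simp
  have m': "(\<integral>x. (\<theta> (Suc n) x)\<^sup>2 \<partial>Q) \<le> M" using T.thstep_dissipation[OF s p, of "{}"] m by simp
  have z': "c (Suc n) 0 = 0" using T.thstep_fourier[OF s p, of 0] z by (simp add: lam_def)
  have "energy \<alpha> K (u (Suc n)) \<le> (1 + \<tau>) * energy \<alpha> K (u n) + \<tau> * M + \<tau>\<^sup>2 * (8 * M + crude K * (energy \<alpha> K (u n))\<^sup>2)"
    using energy_step[OF K w coeff_sum_le[OF s m K(1)]] tau by simp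
  \<comment> \<open>The Euler error is at most \<tau> as long as the energy is at most R; this is
    the 1 in M + 1.\<close>
  also have "\<tau>\<^sup>2 * (8 * M + crude K * (energy \<alpha> K (u n))\<^sup>2) \<le> \<tau> * 1"
  proof -
    have "crude K \<ge> 0" by (simp add: crude_def)
    then have "8 * M + crude K * (energy \<alpha> K (u n))\<^sup>2 \<le> 8 * M + crude K * R\<^sup>2"
      using ER energy_nonneg[of \<alpha> K "u n"] by (intro add_left_mono mult_left_mono power_mono) auto
    then have "\<tau> * (8 * M + crude K * (energy \<alpha> K (u n))\<^sup>2) \<le> \<tau> * (8 * M + crude K * R\<^sup>2)"
      using tau by (intro mult_left_mono) auto
    also have "\<dots> \<le> 1" using tau_R by (simp add: M_def)
    finally have "\<tau> * (\<tau> * (8 * M + crude K * (energy \<alpha> K (u n))\<^sup>2)) \<le> \<tau> * 1" using tau by (intro mult_left_mono) auto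
    then show ?thesis by (simp add: power2_eq_square mult.assoc)
  qed
  also have "(1 + \<tau>) * energy \<alpha> K (u n) + \<tau> * M + \<tau> * 1 \<le> exp \<tau> * energy \<alpha> K (u n) + \<tau> * (M + 1)"
  proof -
    have "(1 + \<tau>) * energy \<alpha> K (u n) \<le> exp \<tau> * energy \<alpha> K (u n)"
      using energy_nonneg[of \<alpha> K "u n"] by (intro mult_right_mono exp_ge_add_one_self)
    then show ?thesis by (simp add: algebra_simps)
  qed
  also have "\<dots> \<le> exp \<tau> * (exp (real n * \<tau>) * (energy \<alpha> K v0 + real n * \<tau> * (M + 1))) + exp (real (Suc n) * \<tau>) * (\<tau> * (M + 1))"
  proof (intro add_mono mult_left_mono e)
    have "1 \<le> exp (real (Suc n) * \<tau>)" using tau by simp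
    then have "1 * (\<tau> * (M + 1)) \<le> exp (real (Suc n) * \<tau>) * (\<tau> * (M + 1))" using tau M_nonneg by (intro mult_right_mono) auto
    then show "\<tau> * (M + 1) \<le> exp (real (Suc n) * \<tau>) * (\<tau> * (M + 1))" by simp
  qed auto
  also have "\<dots> = exp (real (Suc n) * \<tau>) * (energy \<alpha> K v0 + real (Suc n) * \<tau> * (M + 1))"
    by (simp add: exp_add[symmetric] mult.assoc[symmetric]) (simp add: algebra_simps)
  finally show ?case using a s' m' z' T.thstep_per[OF p] by (simp add: inv_def)
qed

lemma transport_n: "n \<le> L \<Longrightarrow> transport_step \<kappa> h \<tau> (utl h K (u n))"
  using invariant[of n] inv_R[of n] by (intro transport) (auto simp: inv_def)

lemma convex_bound:
  assumes "convex_on UNIV \<phi>" "\<And>x. \<phi> x \<ge> 0"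
  shows "n \<le> L \<Longrightarrow> (\<integral>\<^sup>+x. ennreal (\<phi> (\<theta> n x)) \<partial>Q) \<le> (\<integral>\<^sup>+x. ennreal (\<phi> (f x)) \<partial>Q)"
proof (induction n)
  case (Suc n)
  interpret T: transport_step \<kappa> h \<tau> "utl h K (u n)" using Suc.prems by (intro transport_n) simp
  have "(\<integral>\<^sup>+x. ennreal (\<phi> (\<theta> (Suc n) x)) \<partial>Q) \<le> (\<integral>\<^sup>+x. ennreal (\<phi> (\<theta> n x)) \<partial>Q)"
    using T.thstep_convex[OF _ _ assms, of "\<theta> n"] invariant[of n] Suc.prems by (auto simp: inv_def sqint_def)
  then show ?case using Suc by (meson Suc_leD order_trans)
qed simp

lemma enstrophy_bound:
  assumes "n \<le> L"
  shows "enstrophy \<alpha> K (u n) \<le> exp (gr_b \<alpha> R * (real L * \<tau>)) * (Y + real L * \<tau> * gr_a \<alpha> M)"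
proof -
  have a: "gr_a \<alpha> M \<ge> 0" using M_nonneg by (simp add: gr_a_def)
  have "energy \<alpha> K v0 \<le> R" using inv_R[OF invariant, of 0] by simp
  then have R0: "R \<ge> 0" using energy_nonneg[of \<alpha> K v0] by linarith
  then have b: "gr_b \<alpha> R \<ge> 0" using sk(2) by (simp add: gr_b_def)
  have "enstrophy \<alpha> K (u n) \<le> exp (gr_b \<alpha> R * (real n * \<tau>)) * (enstrophy \<alpha> K (u 0) + real n * \<tau> * gr_a \<alpha> M)"
  proof (rule discrete_gronwall[OF _ _ a b _ assms])
    fix m assume m: "m < L"
    then have i: "inv m" by (intro invariant) simp
    show "enstrophy \<alpha> K (u (Suc m)) \<le> (1 + \<tau> * gr_b \<alpha> R) * enstrophy \<alpha> K (u m) + \<tau> * gr_a \<alpha> M"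
      using enstrophy_step[OF K(1,3) _ alpha coeff_sum_le[OF _ _ K(1)], of "u m" "\<theta> m" M \<tau> R] inv_R[OF i] i m tau
      by (simp add: inv_def)
  qed (use tau enstrophy_nonneg in auto)
  also have "\<dots> \<le> exp (gr_b \<alpha> R * (real L * \<tau>)) * (Y + real L * \<tau> * gr_a \<alpha> M)"
    using assms tau a b Y enstrophy_nonneg[of \<alpha> K v0]
    by (intro mult_mono add_mono mult_right_mono) (auto intro!: mult_left_mono mult_right_mono add_nonneg_nonneg mult_nonneg_nonneg)
  finally show ?thesis .
qed

text \<open>The transporting velocity is a trigonometric polynomial, so its product with the
  temperature has coefficients given by a finite convolution. From here on the scheme is a recursion
  for coefficients alone.\<close>

lemma theta_rec:
  assumes "n \<le> L"
  shows "c (Suc n) k = c n k - of_real \<tau> * (of_real (lam h \<kappa> k) * c n k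
     + (\<Sum>j\<in>UNIV. \<i> * of_real (sin (2 * pi * h * kreal k $ j) / h) * (\<Sum>m\<in>K. utc h (u n) j m * c n (k - m))))"
proof -
  interpret T: transport_step \<kappa> h \<tau> "utl h K (u n)" using assms by (rule transport_n)
  have i: "sqint (\<theta> n)" "periodic (\<theta> n)" "admissible K (u n)" using invariant[OF assms] by (auto simp: inv_def)
  have [measurable]: "\<theta> n \<in> borel_measurable borel" using i by (simp add: sqint_def)
  have "integrable Q (\<lambda>x. complex_of_real (\<theta> n x))" using sqint_integrable[OF i(1)] by simp
  then have "fcc (\<lambda>x. complex_of_real (utl h K (u n) j x) * complex_of_real (\<theta> n x)) k = (\<Sum>m\<in>K. utc h (u n) j m * c n (k - m))" for j
    by (simp add: utl_complex[OF i(3)] fcc_trig_mult fourier_coeff_fcc)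
  then show ?thesis using T.thstep_fourier[OF i(1,2), of k] by simp
qed

text \<open>The losses of the single steps telescope against the initial L^2 norm. This is the
  discrete form of the bound of \<theta> in L^2 in time with values in H^1.\<close>

lemma dissipation:
  assumes F: "finite F"
  shows "(\<Sum>n<L. \<tau> * (\<Sum>k\<in>F. lam h \<kappa> k * (cmod (c n k))\<^sup>2)) \<le> 2 * M"
proof -
  have "n \<le> L \<Longrightarrow> (\<integral>x. (\<theta> n x)\<^sup>2 \<partial>Q) + (\<Sum>i<n. \<tau> / 2 * (\<Sum>k\<in>F. lam h \<kappa> k * (cmod (c i k))\<^sup>2)) \<le> M" for n
  proof (induction n)
    case (Suc n)
    interpret T: transport_step \<kappa> h \<tau> "utl h K (u n)" using Suc.prems by (intro transport_n) simp
    have "(\<integral>x. (\<theta> (Suc n) x)\<^sup>2 \<partial>Q) + \<tau> / 2 * (\<Sum>k\<in>F. lam h \<kappa> k * (cmod (c n k))\<^sup>2) \<le> (\<integral>x. (\<theta> n x)\<^sup>2 \<partial>Q)"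
      using T.thstep_dissipation[OF _ _ F, of "\<theta> n"] invariant[of n] Suc.prems by (simp add: inv_def)
    then show ?case using Suc by simp
  qed (simp add: M_def)
  from this[OF order_refl] have "(\<Sum>i<L. \<tau> / 2 * (\<Sum>k\<in>F. lam h \<kappa> k * (cmod (c i k))\<^sup>2)) \<le> M"
  proof (rule order_trans[rotated])
    have "0 \<le> (\<integral>x. (\<theta> L x)\<^sup>2 \<partial>Q)" by simp
    then show "(\<Sum>i<L. \<tau> / 2 * (\<Sum>k\<in>F. lam h \<kappa> k * (cmod (c i k))\<^sup>2))
        \<le> (\<integral>x. (\<theta> L x)\<^sup>2 \<partial>Q) + (\<Sum>i<L. \<tau> / 2 * (\<Sum>k\<in>F. lam h \<kappa> k * (cmod (c i k))\<^sup>2))" by linarith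
  qed
  moreover have "(\<Sum>n<L. \<tau> * (\<Sum>k\<in>F. lam h \<kappa> k * (cmod (c n k))\<^sup>2)) = 2 * (\<Sum>i<L. \<tau> / 2 * (\<Sum>k\<in>F. lam h \<kappa> k * (cmod (c i k))\<^sup>2))"
    by (subst sum_distrib_left) simp
  ultimately show ?thesis by linarith
qed

end

text \<open>All that the limit needs to know about a run of the scheme at resolution N, detached
  from the locale. The initial temperature is recorded by its coefficients only, since the run
  starts from a periodic modification of f.\<close>

definition approx :: "real \<Rightarrow> real \<Rightarrow> real \<Rightarrow> vfield \<Rightarrow> (real^3 \<Rightarrow> real) \<Rightarrow> real \<Rightarrow> nat \<Rightarrow> real \<Rightarrow> nat
    \<Rightarrow> (nat \<Rightarrow> vfield) \<Rightarrow> (nat \<Rightarrow> real^3 \<Rightarrow> real) \<Rightarrow> bool" where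
  "approx \<alpha> \<kappa> T u0 f B N h L u \<theta> \<longleftrightarrow> 0 < h \<and> 8 * (real (Suc N) * h) \<le> 1 \<and> 0 < L \<and> T / real L \<le> 1 / real (Suc N) \<and>
     u 0 = (\<lambda>k. if k \<in> boxk N - {0} then u0 k else 0) \<and> fourier_coeff (\<theta> 0) = fourier_coeff f \<and>
     (\<forall>n\<le>L. admissible (boxk N - {0}) (u n) \<and> (\<Sum>k\<in>boxk N - {0}. (ksq k)\<^sup>2 * (norm (u n k))\<^sup>2) \<le> B \<and>
        sqint (\<theta> n) \<and> (\<integral>x. (\<theta> n x)\<^sup>2 \<partial>Q) \<le> (\<integral>x. (f x)\<^sup>2 \<partial>Q) \<and> fourier_coeff (\<theta> n) 0 = 0 \<and>
        (\<forall>\<phi>. convex_on UNIV \<phi> \<longrightarrow> (\<forall>x. \<phi> x \<ge> 0) \<longrightarrow>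
           (\<integral>\<^sup>+x. ennreal (\<phi> (\<theta> n x)) \<partial>Q) \<le> (\<integral>\<^sup>+x. ennreal (\<phi> (f x)) \<partial>Q))) \<and>
     (\<forall>n<L. \<forall>k. u (Suc n) k = u n k + (T / real L) *\<^sub>R
          (if k \<in> boxk N - {0} then (1 / (1 + \<alpha>\<^sup>2 * symA k)) *\<^sub>R force (u n) (fourier_coeff (\<theta> n)) k else 0)) \<and>
     (\<forall>n<L. \<forall>k. fourier_coeff (\<theta> (Suc n)) k = fourier_coeff (\<theta> n) k - (T / real L) *\<^sub>R
          (of_real (lam h \<kappa> k) * fourier_coeff (\<theta> n) k + (\<Sum>j\<in>UNIV. \<i> * of_real (sin (2 * pi * h * kreal k $ j) / h) *
             (\<Sum>m\<in>boxk N - {0}. utc h (u n) j m * fourier_coeff (\<theta> n) (k - m))))) \<and>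
     (\<forall>F. finite F \<longrightarrow> (\<Sum>n<L. (T / real L) * (\<Sum>k\<in>F. lam h \<kappa> k * (cmod (fourier_coeff (\<theta> n) k))\<^sup>2))
          \<le> 2 * (\<integral>x. (f x)\<^sup>2 \<partial>Q))"

lemma hsv_sq_3: "u 0 = 0 \<Longrightarrow> hsv_sq 3 u = nns (\<lambda>k. ennreal ((ksq k)^3 * (norm (u k))\<^sup>2))"
  unfolding hsv_sq_def
proof (rule nn_integral_cong)
  fix k assume "u 0 = 0"
  then show "ennreal (ksq k powr 3 * (norm (u k))\<^sup>2) = ennreal ((ksq k)^3 * (norm (u k))\<^sup>2)"
    using ksq_pos[of k] by (cases "k = 0") (auto simp: powr_numeral)
qed

text \<open>The order of choices is essential: R and B depend on the data only, the set of modes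
  then determines h, and the number of steps is chosen last. Hence one B serves all N.\<close>

lemma approx_exists:
  assumes \<alpha>: "\<alpha> > 0" and \<kappa>: "\<kappa> > 0" and T: "T > 0" and u0: "u0 \<in> VH3" and f: "sqint f" "fourier_coeff f 0 = 0"
  shows "\<exists>B. \<forall>N. \<exists>h L u \<theta>. approx \<alpha> \<kappa> T u0 f B N h L u \<theta>"
proof -
  \<comment> \<open>The scheme translates its argument, hence needs a periodic function; integrals
    and coefficients see only the values on the cube.\<close>
  define f' where "f' x = f (wrap x)" for x
  have fm [measurable]: "f \<in> borel_measurable borel" using f by (simp add: sqint_def)
  have [measurable]: "f' \<in> borel_measurable borel" unfolding f'_def[abs_def] by measurable
  have f'_eq: "x \<in> qube \<Longrightarrow> f' x = f x" for x by (simp add: f'_def wrap_id)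
  have M_eq: "(\<integral>x. (f' x)\<^sup>2 \<partial>Q) = (\<integral>x. (f x)\<^sup>2 \<partial>Q)"
    by (rule Bochner_Integration.integral_cong) (auto simp: f'_eq)
  have phi_eq: "(\<integral>\<^sup>+x. ennreal (\<phi> (f' x)) \<partial>Q) = (\<integral>\<^sup>+x. ennreal (\<phi> (f x)) \<partial>Q)" for \<phi>
    by (rule nn_integral_cong) (auto simp: f'_eq)
  have "integrable Q (\<lambda>x. (f' x)\<^sup>2) \<longleftrightarrow> integrable Q (\<lambda>x. (f x)\<^sup>2)"
    by (rule Bochner_Integration.integrable_cong) (auto simp: f'_eq)
  then have sf': "sqint f'" using f by (simp add: sqint_def)
  have fc_eq: "fourier_coeff f' = fourier_coeff f"
    by (rule ext) (auto simp: fourier_coeff_fcc fcc_def f'_eq intro!: Bochner_Integration.integral_cong)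
  have pf': "periodic f'" unfolding f'_def[abs_def] by (rule periodic_comp_wrap)
  define M where "M = (\<integral>x. (f x)\<^sup>2 \<partial>Q)"
  have M0: "M \<ge> 0" by (simp add: M_def)
  have u00: "u0 0 = 0" and ur: "real_vf u0" and ud: "u0 \<in> divfree" and uf: "hsv_sq 3 u0 < \<infinity>"
    using u0 by (auto simp: VH3_def Hsv_def zero_wn)
  define H where "H = enn2real (hsv_sq 3 u0)"
  have H: "hsv_sq 3 u0 = ennreal H" "H \<ge> 0" using uf by (auto simp: H_def)
  \<comment> \<open>For k \<noteq> 0 the weight \<open>1 + \<alpha>\<^sup>2 * symA k\<close> is at
    most \<open>q * ksq k\<close>, so energy and enstrophy of the truncated initial velocity are
    bounded by its H^3 norm.\<close>
  define q where "q = 1 + 4 * pi\<^sup>2 * \<alpha>\<^sup>2"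
  have q0: "q \<ge> 1" by (simp add: q_def)
  define R where "R = exp T * (q * H + T * (M + 1))"
  have R0: "R \<ge> 0" using q0 H(2) T M0 by (simp add: R_def)
  define B where "B = exp (gr_b \<alpha> R * T) * (q * H + T * gr_a \<alpha> M) / (4 * pi\<^sup>2 * \<alpha>\<^sup>2)"
  have "\<exists>h L u \<theta>. approx \<alpha> \<kappa> T u0 f B N h L u \<theta>" for N
  proof -
    define K where "K = boxk N - {0}"
    define v0 where "v0 k = (if k \<in> K then u0 k else 0)" for k
    have K: "finite K" "\<And>k. - k \<in> K \<longleftrightarrow> k \<in> K" "0 \<notin> K" by (auto simp: K_def boxk_uminus)
    have v0: "admissible K v0"
      using ur ud K by (auto simp: admissible_def v0_def real_vf_iff divfree_def cconj3_simps cdot_simps)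
    have Hs: "(\<Sum>k\<in>K. (ksq k)^3 * (norm (v0 k))\<^sup>2) \<le> H"
    proof -
      have "ennreal (\<Sum>k\<in>K. (ksq k)^3 * (norm (u0 k))\<^sup>2) \<le> nns (\<lambda>k. ennreal ((ksq k)^3 * (norm (u0 k))\<^sup>2))"
        using nns_finite_sum_le[OF K(1), of "\<lambda>k. ennreal ((ksq k)^3 * (norm (u0 k))\<^sup>2)"] by simp
      then have "ennreal (\<Sum>k\<in>K. (ksq k)^3 * (norm (u0 k))\<^sup>2) \<le> ennreal H" using hsv_sq_3[of u0, OF u00] H by simp
      then show ?thesis using H(2) by (simp add: v0_def)
    qed
    have wt: "ksq k * (1 + \<alpha>\<^sup>2 * symA k) \<le> q * (ksq k)^3" "1 + \<alpha>\<^sup>2 * symA k \<le> q * (ksq k)^3" if "k \<in> K" for k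
    proof -
      have s: "ksq k \<ge> 1" using that K(3) by (intro ksq_ge_1) auto
      have s2: "(ksq k)\<^sup>2 \<ge> 1" using s by (simp add: one_le_power)
      have a: "1 + \<alpha>\<^sup>2 * symA k \<le> q * ksq k" using s by (simp add: q_def symA_def distrib_right power_mult_distrib)
      have "ksq k * (1 + \<alpha>\<^sup>2 * symA k) \<le> ksq k * (q * ksq k)" using a by (intro mult_left_mono) auto
      also have "\<dots> = (q * (ksq k * ksq k)) * 1" by simp
      also have "\<dots> \<le> (q * (ksq k * ksq k)) * ksq k" using s q0 by (intro mult_left_mono) auto
      finally show "ksq k * (1 + \<alpha>\<^sup>2 * symA k) \<le> q * (ksq k)^3" by (simp add: power3_eq_cube mult.assoc)
      have "q * ksq k * 1 \<le> q * ksq k * (ksq k)\<^sup>2" using s2 q0 by (intro mult_left_mono) auto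
      then show "1 + \<alpha>\<^sup>2 * symA k \<le> q * (ksq k)^3" using a by (simp add: power3_eq_cube power2_eq_square mult.assoc)
    qed
    have E0: "energy \<alpha> K v0 \<le> q * H"
    proof -
      have "energy \<alpha> K v0 \<le> (\<Sum>k\<in>K. q * (ksq k)^3 * (norm (v0 k))\<^sup>2)"
        unfolding energy_def using wt by (intro sum_mono mult_right_mono) auto
      also have "\<dots> \<le> q * H" using Hs q0 by (simp add: sum_distrib_left[symmetric] mult.assoc)
      finally show ?thesis .
    qed
    have Y0: "enstrophy \<alpha> K v0 \<le> q * H"
    proof -
      have "enstrophy \<alpha> K v0 \<le> (\<Sum>k\<in>K. q * (ksq k)^3 * (norm (v0 k))\<^sup>2)"
        unfolding enstrophy_def mult.assoc[symmetric] using wt by (intro sum_mono mult_right_mono) auto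
      also have "\<dots> \<le> q * H" using Hs q0 by (simp add: sum_distrib_left[symmetric] mult.assoc)
      finally show ?thesis .
    qed
    \<comment> \<open>The summand 1 keeps the divisor positive: for N = 0 there are no modes at
      all.\<close>
    define X1 where "X1 = 1 + 2 * real (card K) * sqrt R"
    have X1: "X1 \<ge> 1" using R0 by (simp add: X1_def)
    \<comment> \<open>The first entry makes the mesh resolve the modes, the second bounds the
      transport speed by \<kappa>/h.\<close>
    define h where "h = min (1 / (8 * real (Suc N))) (\<kappa> / X1)"
    have h0: "h > 0" using \<kappa> X1 by (simp add: h_def)
    have h1: "h \<le> 1 / (8 * real (Suc N))" and h2: "h \<le> \<kappa> / X1" by (auto simp: h_def)
    have hN: "8 * (real (Suc N) * h) \<le> 1" using h1 by (simp add: field_simps)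
    have hX: "h * X1 \<le> \<kappa>" using h2 X1 by (simp add: field_simps)
    \<comment> \<open>All restrictions on the time step have the form \<tau> z \<le> 1; X dominates
      every z that occurs, so \<tau> X \<le> 1 settles them together.\<close>
    define X where "X = real (Suc N) + 12 * \<kappa> / h\<^sup>2 + 8 * M + crude K * R\<^sup>2"
    have cr: "crude K * R\<^sup>2 \<ge> 0" by (simp add: crude_def)
    have kh: "12 * \<kappa> / h\<^sup>2 \<ge> 0" using \<kappa> by simp
    have X0: "X \<ge> 1" "X \<ge> real (Suc N)" "X \<ge> 12 * \<kappa> / h\<^sup>2" "X \<ge> 8 * M + crude K * R\<^sup>2" unfolding X_def using M0 cr kh by auto
    obtain L :: nat where L: "T * X < real L" using reals_Archimedean2 by blast
    have "0 < T * X" using T X0(1) by simp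
    then have Lpos: "real L > 0" using L by linarith
    define \<tau> where "\<tau> = T / real L"
    have tp: "\<tau> > 0" using T Lpos by (simp add: \<tau>_def)
    have tX: "\<tau> * X \<le> 1" using L Lpos by (simp add: \<tau>_def field_simps)
    have tY: "\<tau> * z \<le> 1" if "z \<le> X" for z
      using mult_left_mono[OF that, of \<tau>] tp tX by linarith
    have LT: "real L * \<tau> = T" using Lpos by (simp add: \<tau>_def)
    have "(1::real) \<le> real (Suc N)" by simp
    then have "8 * (1 * h) \<le> 8 * (real (Suc N) * h)" using h0 by (intro mult_left_mono mult_right_mono) auto
    then have hle: "h \<le> 1" using hN h0 by linarith
    interpret S: scheme \<alpha> \<kappa> h \<tau> R "q * H" K v0 f' L
    proof
      show "12 * \<tau> * \<kappa> \<le> h\<^sup>2" using tY[OF X0(3)] h0 by (simp add: field_simps)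
      show "8 * \<bar>h * kreal k $ j\<bar> \<le> 1" if "k \<in> K" for k j
      proof -
        have "\<bar>kreal k $ j\<bar> \<le> real N" using that by (intro abs_kreal_boxk) (simp add: K_def)
        then have "h * \<bar>kreal k $ j\<bar> \<le> h * real (Suc N)" using h0 by (intro mult_left_mono) auto
        then have "h * \<bar>kreal k $ j\<bar> \<le> real (Suc N) * h" by (simp only: mult.commute)
        moreover have "\<bar>h * kreal k $ j\<bar> = h * \<bar>kreal k $ j\<bar>" using h0 by (simp add: abs_mult)
        ultimately show ?thesis using hN by linarith
      qed
      show "exp (real L * \<tau>) * (energy \<alpha> K v0 + real L * \<tau> * ((\<integral>x. (f' x)\<^sup>2 \<partial>Q) + 1)) \<le> R"
        unfolding LT M_eq R_def M_def using E0 by simp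
      show "\<tau> * (8 * (\<integral>x. (f' x)\<^sup>2 \<partial>Q) + crude K * R\<^sup>2) \<le> 1" using tY[OF X0(4)] by (simp add: M_eq M_def)
      have "h * (2 * real (card K) * sqrt R) \<le> h * X1" using h0 by (intro mult_left_mono) (auto simp: X1_def)
      then show "h * (2 * real (card K) * sqrt R) \<le> \<kappa>" using hX by linarith
    qed (use \<alpha> \<kappa> h0 hle tp tY[OF X0(1)] K v0 sf' pf' f fc_eq Y0 in auto)
    have SM: "S.M = M" by (simp add: S.M_def M_eq M_def)
    have bd: "(\<Sum>k\<in>K. (ksq k)\<^sup>2 * (norm (S.u n k))\<^sup>2) \<le> B" if "n \<le> L" for n
    proof -
      have "(\<Sum>k\<in>K. (ksq k)\<^sup>2 * (norm (S.u n k))\<^sup>2) \<le> enstrophy \<alpha> K (S.u n) / (4 * pi\<^sup>2 * \<alpha>\<^sup>2)"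
        using \<alpha> by (intro H1_le_energy(2)) auto
      also have "\<dots> \<le> B"
        unfolding B_def using S.enstrophy_bound[OF that] by (intro divide_right_mono) (simp_all add: LT SM)
      finally show ?thesis .
    qed
    have "approx \<alpha> \<kappa> T u0 f B N h L S.u S.\<theta>"
      unfolding approx_def K_def[symmetric] \<tau>_def[symmetric]
    proof (intro conjI allI impI)
      show "\<tau> \<le> 1 / real (Suc N)" using tY[OF X0(2)] by (simp add: field_simps)
      show "S.u 0 = (\<lambda>k. if k \<in> K then u0 k else 0)" by (auto simp: v0_def)
      show "S.u (Suc n) k = S.u n k + \<tau> *\<^sub>R (if k \<in> K then (1 / (1 + \<alpha>\<^sup>2 * symA k)) *\<^sub>R force (S.u n) (S.c n) k else 0)" for n k
        by (simp add: ustep_def)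
      show "S.c (Suc n) k = S.c n k - \<tau> *\<^sub>R (of_real (lam h \<kappa> k) * S.c n k + (\<Sum>j\<in>UNIV. \<i> * of_real (sin (2 * pi * h * kreal k $ j) / h) *
             (\<Sum>m\<in>K. utc h (S.u n) j m * S.c n (k - m))))" if "n < L" for n k
        using S.theta_rec[of n k] that unfolding scaleR_conv_of_real by simp
      show "(\<Sum>n<L. \<tau> * (\<Sum>k\<in>F. lam h \<kappa> k * (cmod (S.c n k))\<^sup>2)) \<le> 2 * (\<integral>x. (f x)\<^sup>2 \<partial>Q)" if "finite F" for F
        using S.dissipation[OF that] by (simp add: SM M_def)
      show "(\<integral>\<^sup>+x. ennreal (\<phi> (S.\<theta> n x)) \<partial>Q) \<le> (\<integral>\<^sup>+x. ennreal (\<phi> (f x)) \<partial>Q)"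
        if "n \<le> L" "convex_on UNIV \<phi>" "\<forall>x. \<phi> x \<ge> 0" for n \<phi>
        using S.convex_bound[OF that(2) _ that(1)] that(3) by (simp add: phi_eq)
      fix n assume n: "n \<le> L"
      have i: "S.inv n" using S.invariant[OF n] .
      show "admissible K (S.u n)" "sqint (S.\<theta> n)" "(\<integral>x. (S.\<theta> n x)\<^sup>2 \<partial>Q) \<le> (\<integral>x. (f x)\<^sup>2 \<partial>Q)" "S.c n 0 = 0"
        using i by (auto simp: S.inv_def SM M_def)
      show "(\<Sum>k\<in>K. (ksq k)\<^sup>2 * (norm (S.u n k))\<^sup>2) \<le> B" by (rule bd[OF n])
    qed (use h0 hN Lpos in \<open>auto simp: fc_eq\<close>)
    then show ?thesis by blast
  qed
  then show ?thesis by blast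
qed

section \<open>Passage to the limit\<close>

lemma tendsto_fun_nth:
  fixes f :: "nat \<Rightarrow> 'i \<Rightarrow> 'a::topological_space"
  assumes "f \<longlonglongrightarrow> l"
  shows "(\<lambda>n. f n i) \<longlonglongrightarrow> l i"
proof -
  have "continuous_on UNIV (\<lambda>x :: 'i \<Rightarrow> 'a. x i)"
    by (rule continuous_on_product_then_coordinatewise) (rule continuous_on_id)
  then show ?thesis
    using assms by (rule continuous_on_tendsto_compose) auto
qed

text \<open>A variant of the Arzela-Ascoli theorem for functions with jumps: equicontinuity holds
  only up to an error e N that disappears. Compactness of a product of balls, indexed by modes and
  rational times, provides the subsequence, and the Lipschitz estimate extends convergence from
  rational times to all times.\<close>

lemma diagonal_limit:
  fixes X :: "nat \<Rightarrow> wn \<Rightarrow> real \<Rightarrow> 'a::euclidean_space"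
  assumes T: "T > 0" and bound: "\<And>N k t. 0 \<le> t \<Longrightarrow> t \<le> T \<Longrightarrow> norm (X N k t) \<le> Bd k"
    and lip: "\<And>N k s t. 0 \<le> s \<Longrightarrow> s \<le> T \<Longrightarrow> 0 \<le> t \<Longrightarrow> t \<le> T \<Longrightarrow> norm (X N k t - X N k s) \<le> D k * (\<bar>t - s\<bar> + e N)"
    and e: "e \<longlonglongrightarrow> 0" and D: "\<And>k. D k \<ge> 0"
  shows "\<exists>r Y. strict_mono r \<and> (\<forall>k t. 0 \<le> t \<longrightarrow> t \<le> T \<longrightarrow> (\<lambda>N. X (r N) k t) \<longlonglongrightarrow> Y k t)"
proof -
  \<comment> \<open>Rational numbers clamped to [0, T], so that every rational is a legitimate
    time.\<close>
  define cl where "cl q = max 0 (min T (real_of_rat q))" for q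
  have cl: "0 \<le> cl q" "cl q \<le> T" for q using T by (auto simp: cl_def)
  define F where "F N = (\<lambda>(k,q). X N k (cl q))" for N
  define S :: "(wn \<times> rat \<Rightarrow> 'a) set" where "S = PiE UNIV (\<lambda>(k,q). cball 0 (Bd k))"
  have "compactin (product_topology (\<lambda>i. euclidean) UNIV) S"
    unfolding S_def compactin_PiE by (auto simp: compactin_euclidean_iff)
  then have "compact S" by (simp add: euclidean_product_topology)
  \<comment> \<open>The index set is countable, hence the product is metrizable and compactness
    gives convergent subsequences.\<close>
  then have sc: "seq_compact S" by (simp add: compact_eq_seq_compact_metric)
  have "\<forall>N. F N \<in> S" unfolding S_def F_def using bound[OF cl] by auto
  then obtain l r where r: "strict_mono r" and Fl: "(F \<circ> r) \<longlonglongrightarrow> l"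
    by (rule seq_compactE[OF sc])
  from Fl have lim: "(\<lambda>N. (F \<circ> r) N (k,q)) \<longlonglongrightarrow> l (k,q)" for k q by (rule tendsto_fun_nth)
  have "convergent (\<lambda>N. X (r N) k t)" if t: "0 \<le> t" "t \<le> T" for k t
  proof -
    have "Cauchy (\<lambda>N. X (r N) k t)"
    proof (rule metric_CauchyI)
      fix \<epsilon> :: real assume eps: "\<epsilon> > 0"
      \<comment> \<open>The error at one time is D k times (\<delta> + \<delta>), one share for the
        distance to a rational time and one for e N. The summand 1 covers D k = 0.\<close>
      define \<delta> where "\<delta> = \<epsilon> / (8 * (D k + 1))"
      have d: "\<delta> > 0" using eps D[of k] by (simp add: \<delta>_def)
      obtain q where q: "t - \<delta> < real_of_rat q" "real_of_rat q < t + \<delta>"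
        using of_rat_dense[of "t - \<delta>" "t + \<delta>"] d by auto
      have tq: "\<bar>t - cl q\<bar> \<le> \<delta>" using q t by (auto simp: cl_def)
      have "Cauchy (\<lambda>N. X (r N) k (cl q))"
        using lim[of k q] by (auto simp: F_def intro: LIMSEQ_imp_Cauchy)
      then obtain N1 where N1: "\<And>m n. m \<ge> N1 \<Longrightarrow> n \<ge> N1 \<Longrightarrow> dist (X (r m) k (cl q)) (X (r n) k (cl q)) < \<epsilon> / 2"
        using eps by (meson Cauchy_def half_gt_zero)
      have "(\<lambda>N. e (r N)) \<longlonglongrightarrow> 0" using LIMSEQ_subseq_LIMSEQ[OF e r] by (simp add: comp_def)
      then have "\<forall>\<^sub>F N in sequentially. e (r N) < \<delta>" using d by (rule order_tendstoD)
      then obtain N2 where N2: "\<And>N. N \<ge> N2 \<Longrightarrow> e (r N) < \<delta>" by (auto simp: eventually_sequentially)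
      have near: "dist (X (r N) k t) (X (r N) k (cl q)) \<le> \<epsilon> / 4" if "N \<ge> N2" for N
      proof -
        have "dist (X (r N) k t) (X (r N) k (cl q)) \<le> D k * (\<bar>t - cl q\<bar> + e (r N))"
          unfolding dist_norm by (intro lip cl t)
        also have "\<dots> \<le> (D k + 1) * (\<delta> + \<delta>)"
        proof (rule order_trans[OF mult_left_mono mult_right_mono])
          show "\<bar>t - cl q\<bar> + e (r N) \<le> \<delta> + \<delta>" using tq N2[OF that] by linarith
        qed (use D d in auto)
        also have "\<dots> = \<epsilon> / 4" using D[of k] by (simp add: \<delta>_def divide_simps)
        finally show ?thesis .
      qed
      show "\<exists>M. \<forall>m\<ge>M. \<forall>n\<ge>M. dist (X (r m) k t) (X (r n) k t) < \<epsilon>"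
      proof (intro exI allI impI)
        fix m n assume "m \<ge> max N1 N2" "n \<ge> max N1 N2"
        then have "dist (X (r m) k t) (X (r m) k (cl q)) \<le> \<epsilon> / 4" "dist (X (r n) k t) (X (r n) k (cl q)) \<le> \<epsilon> / 4"
          "dist (X (r m) k (cl q)) (X (r n) k (cl q)) < \<epsilon> / 2" using near N1 by auto
        then show "dist (X (r m) k t) (X (r n) k t) < \<epsilon>"
          using dist_triangle[of "X (r m) k t" "X (r n) k t" "X (r m) k (cl q)"]
            dist_triangle[of "X (r m) k (cl q)" "X (r n) k t" "X (r n) k (cl q)"]
          by (simp add: dist_commute)
      qed
    qed
    then show ?thesis by (rule Cauchy_convergent)
  qed
  then show ?thesis
    using r by (intro exI[of _ r] exI[of _ "\<lambda>k t. lim (\<lambda>N. X (r N) k t)"]) (auto simp: convergent_LIMSEQ_iff)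
qed

section \<open>Step functions in time and the integral equation\<close>

definition idx :: "real \<Rightarrow> real \<Rightarrow> nat" where
  "idx \<tau> s = nat \<lfloor>s / \<tau>\<rfloor>"

lemma idx_bounds:
  assumes "\<tau> > 0" "s \<ge> 0"
  shows "real (idx \<tau> s) * \<tau> \<le> s" "s < real (idx \<tau> s) * \<tau> + \<tau>"
proof -
  have e: "real (idx \<tau> s) = of_int \<lfloor>s / \<tau>\<rfloor>" using assms by (simp add: idx_def)
  have "real (idx \<tau> s) \<le> s / \<tau>" "s / \<tau> < real (idx \<tau> s) + 1"
    unfolding e by linarith+
  then show "real (idx \<tau> s) * \<tau> \<le> s" "s < real (idx \<tau> s) * \<tau> + \<tau>"
    using assms by (simp_all add: field_simps)
qed

lemma idx_eq: "\<tau> > 0 \<Longrightarrow> real n * \<tau> \<le> s \<Longrightarrow> s < real (Suc n) * \<tau> \<Longrightarrow> idx \<tau> s = n"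
proof -
  assume a: "\<tau> > 0" "real n * \<tau> \<le> s" "s < real (Suc n) * \<tau>"
  have "\<lfloor>s / \<tau>\<rfloor> = int n"
    by (rule floor_unique) (use a in \<open>auto simp: field_simps\<close>)
  then show ?thesis by (simp add: idx_def)
qed

lemma measurable_idx [measurable]: "idx \<tau> \<in> measurable borel (count_space UNIV)"
  unfolding idx_def[abs_def] by measurable

lemma step_measurable [measurable]: "(\<lambda>s. g (idx \<tau> s)) \<in> borel_measurable borel"
  using measurable_compose[OF measurable_idx, of g borel \<tau>] by simp

text \<open>An Euler sum is the integral of a step function. Half-open intervals keep consecutive
  steps disjoint, with \<open>idx\<close> constant on each of them.\<close>

lemma step_integral:
  fixes g :: "nat \<Rightarrow> 'a::{banach,second_countable_topology}"
  assumes tau: "\<tau> > 0"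
  shows "set_integrable lborel {0..<real n * \<tau>} (\<lambda>s. g (idx \<tau> s)) \<and>
    (LINT s:{0..<real n * \<tau>}|lborel. g (idx \<tau> s)) = (\<Sum>i<n. \<tau> *\<^sub>R g i)"
proof (induction n)
  case (Suc n)
  let ?I = "{real n * \<tau>..<real (Suc n) * \<tau>}"
  have "0 \<le> real n * \<tau>" using tau by simp
  then have eq: "{0..<real (Suc n) * \<tau>} = {0..<real n * \<tau>} \<union> ?I"
    using tau by (intro ivl_disj_un_two(3)[symmetric]) (auto simp: algebra_simps)
  have c: "indicator ?I s *\<^sub>R g (idx \<tau> s) = indicator ?I s *\<^sub>R g n" for s
    using idx_eq[OF tau, of n s] by (auto split: split_indicator)
  have em: "emeasure lborel ?I = ennreal \<tau>" using tau by (simp add: algebra_simps)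
  have i: "set_integrable lborel ?I (\<lambda>s. g (idx \<tau> s))"
    unfolding set_integrable_def c by (rule integrable_scaleR_left, rule integrable_real_indicator) (simp_all only: em, simp_all)
  have v: "(LINT s:?I|lborel. g (idx \<tau> s)) = \<tau> *\<^sub>R g n"
    unfolding set_lebesgue_integral_def c using tau by (simp add: algebra_simps)
  have d: "{0..<real n * \<tau>} \<inter> ?I = {}" by auto
  show ?case
    unfolding eq using Suc i v set_integral_Un[OF d conjunct1[OF Suc] i]
    by (auto intro!: set_integrable_Un)
qed (simp add: set_integrable_def set_lebesgue_integral_def)

text \<open>The recursion is a telescoping sum, hence an integral of a step function that converges
  pointwise and stays bounded; dominated convergence yields the integral equation.\<close>

lemma limit_integral:
  fixes x g :: "nat \<Rightarrow> nat \<Rightarrow> 'a::{banach,second_countable_topology}"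
  assumes T: "T > 0" and L: "\<And>N. L N > 0" and tau: "(\<lambda>N. T / real (L N)) \<longlonglongrightarrow> 0"
    and rec: "\<And>N n. n < L N \<Longrightarrow> x N (Suc n) = x N n + (T / real (L N)) *\<^sub>R g N n"
    and bd: "\<And>N n. n \<le> L N \<Longrightarrow> norm (g N n) \<le> C"
    and x: "\<And>t. 0 \<le> t \<Longrightarrow> t \<le> T \<Longrightarrow> (\<lambda>N. x N (idx (T / real (L N)) t)) \<longlonglongrightarrow> X t"
    and g: "\<And>t. 0 \<le> t \<Longrightarrow> t \<le> T \<Longrightarrow> (\<lambda>N. g N (idx (T / real (L N)) t)) \<longlonglongrightarrow> G t"
    and t: "0 \<le> t" "t \<le> T"
  shows "set_integrable lborel {0..t} G" "X t = X 0 + (LINT s:{0..t}|lborel. G s)"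
proof -
  let ?\<tau> = "\<lambda>N. T / real (L N)"
  have tp: "?\<tau> N > 0" for N using T L[of N] by simp
  have idx_le: "real (idx (?\<tau> N) s) \<le> real (L N)" if "0 \<le> s" "s \<le> T" for N s
  proof -
    have "real (idx (?\<tau> N) s) * ?\<tau> N \<le> real (L N) * ?\<tau> N" using idx_bounds(1)[OF tp that(1), of N] that L[of N] by simp
    then show ?thesis using tp[of N] by (rule mult_right_le_imp_le)
  qed
  have C0: "C \<ge> 0" using bd[of 0 0] by (metis le0 norm_ge_zero order_trans)
  have xs: "n \<le> L N \<Longrightarrow> x N n = x N 0 + (\<Sum>i<n. ?\<tau> N *\<^sub>R g N i)" for N n
    by (induction n) (auto simp: rec)
  \<comment> \<open>The integrand is cut off at the last grid time before t, because
    \<open>x N (idx t)\<close> contains completed steps only. The missing interval is shorter than a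
    time step, so the cutoff tends to t.\<close>
  define f where "f N s = indicator {0..<real (idx (?\<tau> N) t) * ?\<tau> N} s *\<^sub>R g N (idx (?\<tau> N) s)" for N s
  have fint: "(\<integral>s. f N s \<partial>lborel) = x N (idx (?\<tau> N) t) - x N 0" for N
    using step_integral[OF tp[of N], of "idx (?\<tau> N) t" "g N"] xs[of "idx (?\<tau> N) t" N] idx_le[OF t, of N]
    unfolding f_def set_lebesgue_integral_def by simp
  have bound: "norm (f N s) \<le> indicator {0..T} s * C" for N s
  proof (cases "0 \<le> s \<and> s < real (idx (?\<tau> N) t) * ?\<tau> N")
    case True
    then have "0 \<le> s" "s \<le> T" using idx_bounds(1)[OF tp t(1), of N] t by auto
    then show ?thesis using bd[of "idx (?\<tau> N) s" N] idx_le[of s N] True by (simp add: f_def)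
  qed (use C0 in \<open>auto simp: f_def split: split_indicator\<close>)
  have lim: "(\<lambda>N. f N s) \<longlonglongrightarrow> indicator {0..<t} s *\<^sub>R G s" for s
  proof (cases "0 \<le> s \<and> s < t")
    case True
    have "\<forall>\<^sub>F N in sequentially. ?\<tau> N < t - s" using tau True by (intro order_tendstoD) auto
    then have "\<forall>\<^sub>F N in sequentially. g N (idx (?\<tau> N) s) = f N s"
    proof (rule eventually_mono)
      fix N assume "?\<tau> N < t - s"
      then have "s < real (idx (?\<tau> N) t) * ?\<tau> N" using idx_bounds(2)[OF tp t(1), of N] by linarith
      then show "g N (idx (?\<tau> N) s) = f N s" using True by (simp add: f_def)
    qed
    then show ?thesis using g[of s] True t by (auto intro: Lim_transform_eventually)
  next
    case False
    have "f N s = 0" for N using False idx_bounds(1)[OF tp t(1), of N] by (auto simp: f_def split: split_indicator)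
    then show ?thesis using False by (auto split: split_indicator)
  qed
  have fm: "f N \<in> borel_measurable lborel" for N unfolding f_def[abs_def] by measurable
  have Gm: "(\<lambda>s. indicator {0..<t} s *\<^sub>R G s) \<in> borel_measurable lborel"
    by (rule borel_measurable_LIMSEQ_metric[OF fm lim])
  have wi: "integrable lborel (\<lambda>s. indicator {0..T} s * C :: real)"
    using T by (intro integrable_mult_left impI integrable_real_indicator) auto
  have dc: "integrable lborel (\<lambda>s. indicator {0..<t} s *\<^sub>R G s)"
      "(\<lambda>N. \<integral>s. f N s \<partial>lborel) \<longlonglongrightarrow> (\<integral>s. indicator {0..<t} s *\<^sub>R G s \<partial>lborel)"
  proof -
    have l: "AE s in lborel. (\<lambda>N. f N s) \<longlonglongrightarrow> indicator {0..<t} s *\<^sub>R G s" by (simp add: lim)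
    have b: "AE s in lborel. norm (f N s) \<le> indicator {0..T} s * C" for N by (simp add: bound)
    show "integrable lborel (\<lambda>s. indicator {0..<t} s *\<^sub>R G s)"
      by (rule integrable_dominated_convergence[OF Gm fm wi l b])
    show "(\<lambda>N. \<integral>s. f N s \<partial>lborel) \<longlonglongrightarrow> (\<integral>s. indicator {0..<t} s *\<^sub>R G s \<partial>lborel)"
      by (rule integral_dominated_convergence[OF Gm fm wi l b])
  qed
  have ae: "AE s in lborel. indicator {0..<t} s *\<^sub>R G s = indicator {0..t} s *\<^sub>R G s"
    by (rule AE_mp[OF AE_lborel_singleton[of t]]) (auto split: split_indicator)
  have Gm': "(\<lambda>s. indicator {0..t} s *\<^sub>R G s) \<in> borel_measurable lborel"
  proof -
    have "(\<lambda>s. indicator {0..<t} s *\<^sub>R G s + indicator {t} s *\<^sub>R G t) \<in> borel_measurable lborel"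
      using Gm by measurable
    moreover have "(\<lambda>s. indicator {0..<t} s *\<^sub>R G s + indicator {t} s *\<^sub>R G t) = (\<lambda>s. indicator {0..t} s *\<^sub>R G s)"
      using t by (auto simp: fun_eq_iff split: split_indicator)
    ultimately show ?thesis by simp
  qed
  show "set_integrable lborel {0..t} G"
    unfolding set_integrable_def using dc(1) integrable_cong_AE[OF Gm Gm' ae] by simp
  have "(\<lambda>N. x N (idx (?\<tau> N) t) - x N 0) \<longlonglongrightarrow> X t - X 0"
    using x[OF t] x[of 0] T by (intro tendsto_diff) (auto simp: idx_def)
  then have "X t - X 0 = (\<integral>s. indicator {0..<t} s *\<^sub>R G s \<partial>lborel)"
    using dc(2) unfolding fint by (rule LIMSEQ_unique)
  also have "\<dots> = (LINT s:{0..t}|lborel. G s)"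
    unfolding set_lebesgue_integral_def by (rule integral_cong_AE[OF Gm Gm' ae])
  finally show "X t = X 0 + (LINT s:{0..t}|lborel. G s)" by (simp add: algebra_simps)
qed

section \<open>Limits of sums and of products of coefficient sequences\<close>

lemma nns_tendsto_le:
  assumes c: "\<And>m. ((\<lambda>i. c i m) \<longlongrightarrow> c' m) F" and b: "\<forall>\<^sub>F i in F. nns (\<lambda>m. ennreal (c i m)) \<le> B" and F: "F \<noteq> bot"
  shows "nns (\<lambda>m. ennreal (c' m)) \<le> B"
proof (rule nns_le_finite_sums)
  fix A :: "wn set" assume A: "finite A"
  have "((\<lambda>i. \<Sum>m\<in>A. ennreal (c i m)) \<longlongrightarrow> (\<Sum>m\<in>A. ennreal (c' m))) F"
    by (intro tendsto_sum tendsto_ennrealI c)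
  then show "(\<Sum>m\<in>A. ennreal (c' m)) \<le> B"
  proof (rule tendsto_upperbound[OF _ _ F])
    show "\<forall>\<^sub>F i in F. (\<Sum>m\<in>A. ennreal (c i m)) \<le> B"
      using b by (rule eventually_mono) (rule order_trans[OF nns_finite_sum_le[OF A]])
  qed
qed

lemma infsum_tail_le:
  fixes f :: "wn \<Rightarrow> 'a::banach"
  assumes "nns (mag f) < \<infinity>" and A: "finite A"
  shows "ennreal (norm (infsum f UNIV - sum f A)) \<le> nns (\<lambda>m. ennreal (norm (f m)) * indicator (- A) m)"
proof -
  define g where "g m = (if m \<in> A then 0 else f m)" for m
  have le: "nns (mag g) \<le> nns (mag f)" by (rule nns_mono) (simp add: g_def)
  then have sg: "g summable_on UNIV" using assms(1) by (intro summable_of_nns(2)) (rule le_less_trans)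
  have sf: "(\<lambda>m. if m \<in> A then f m else 0) summable_on UNIV"
  proof -
    have "f summable_on A" using A by simp
    moreover have "(\<lambda>m. if m \<in> A then f m else 0) summable_on UNIV \<longleftrightarrow> f summable_on A"
      by (rule summable_on_cong_neutral) auto
    ultimately show ?thesis by simp
  qed
  have "infsum f UNIV = infsum (\<lambda>m. (if m \<in> A then f m else 0) + g m) UNIV"
    by (rule infsum_cong) (simp add: g_def)
  also have "\<dots> = infsum (\<lambda>m. if m \<in> A then f m else 0) UNIV + infsum g UNIV"
    by (rule infsum_add[OF sf sg])
  also have "infsum (\<lambda>m. if m \<in> A then f m else 0) UNIV = infsum f A"
    by (rule infsum_cong_neutral) auto
  finally have "infsum f UNIV - sum f A = infsum g UNIV" using A by simp
  then have "ennreal (norm (infsum f UNIV - sum f A)) \<le> nns (mag g)"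
    using norm_infsum_le_nns[of g] by simp
  also have "\<dots> = nns (\<lambda>m. ennreal (norm (f m)) * indicator (- A) m)"
    by (rule nn_integral_cong) (simp add: g_def)
  finally show ?thesis .
qed

lemma ennreal_le_of_power2_le:
  assumes "x\<^sup>2 \<le> (ennreal c)\<^sup>2" "c \<ge> 0"
  shows "x \<le> ennreal c"
proof (cases x)
  case (real z)
  then have "z\<^sup>2 \<le> c\<^sup>2" using assms by (simp add: ennreal_power)
  then show ?thesis using real assms(2) by (auto intro!: ennreal_leI power2_le_imp_le)
next
  case top
  have "(top::ennreal)\<^sup>2 = top" by (simp add: power2_eq_square ennreal_mult_top)
  moreover have "(ennreal c)\<^sup>2 = ennreal (c\<^sup>2)" using assms(2) by (simp add: ennreal_power)
  ultimately show ?thesis using assms(1) top by (simp add: top_unique)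
qed

text \<open>A strongly convergent factor against a weakly convergent one: uniformly small l^2 tails
  of a and an l^2 bound of b make the tail of the product small by Cauchy-Schwarz, and the remaining
  finite sum converges. The filter is arbitrary because the lemma serves both the sequence of
  approximations and weak continuity in time.\<close>

lemma infsum_product_tendsto:
  fixes a b :: "'i \<Rightarrow> wn \<Rightarrow> complex"
  assumes a: "\<And>m. ((\<lambda>i. a i m) \<longlongrightarrow> a' m) F" and b: "\<And>m. ((\<lambda>i. b i m) \<longlongrightarrow> b' m) F" and F: "F \<noteq> bot"
    and B: "\<forall>\<^sub>F i in F. l2sq (b i) \<le> ennreal B"
    and tight: "\<And>\<epsilon>. \<epsilon> > 0 \<Longrightarrow> \<exists>A. finite A \<and> (\<forall>\<^sub>F i in F. nns (\<lambda>m. ennreal ((cmod (a i m))\<^sup>2) * indicator (- A) m) \<le> ennreal \<epsilon>)"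
  shows "((\<lambda>i. \<Sum>\<^sub>\<infinity>m. a i m * b i m) \<longlongrightarrow> (\<Sum>\<^sub>\<infinity>m. a' m * b' m)) F"
proof (rule tendstoI)
  fix e :: real assume e: "e > 0"
  \<comment> \<open>Chosen so that \<epsilon> times (|B| + 1) is the square of e/4; the summand 1
    makes the divisor positive whatever B is.\<close>
  define \<epsilon> where "\<epsilon> = (e / 4)\<^sup>2 / (\<bar>B\<bar> + 1)"
  have eps: "\<epsilon> > 0" using e by (simp add: \<epsilon>_def)
  obtain A where A: "finite A" and tA: "\<forall>\<^sub>F i in F. nns (\<lambda>m. ennreal ((cmod (a i m))\<^sup>2) * indicator (- A) m) \<le> ennreal \<epsilon>"
    using tight[OF eps] by blast
  have tail: "cmod ((\<Sum>\<^sub>\<infinity>m. x m * y m) - (\<Sum>m\<in>A. x m * y m)) \<le> e / 4"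
    if x: "nns (\<lambda>m. ennreal ((cmod (x m))\<^sup>2) * indicator (- A) m) \<le> ennreal \<epsilon>"
      and y: "l2sq y \<le> ennreal B" for x y
  proof -
    have ind: "indicator (- A) m * indicator (- A) m = (indicator (- A) m :: ennreal)" for m by (simp split: split_indicator)
    have "(nns (\<lambda>m. ennreal (cmod (x m * y m)) * indicator (- A) m))\<^sup>2
        = (nns (\<lambda>m. (ennreal (cmod (x m)) * indicator (- A) m) * ennreal (cmod (y m))))\<^sup>2"
      by (simp add: norm_mult ennreal_mult ac_simps)
    also have "\<dots> \<le> nns (\<lambda>m. (ennreal (cmod (x m)) * indicator (- A) m)\<^sup>2) * nns (\<lambda>m. (ennreal (cmod (y m)))\<^sup>2)"
      by (rule CS_nns)
    also have "\<dots> = nns (\<lambda>m. ennreal ((cmod (x m))\<^sup>2) * indicator (- A) m) * l2sq y"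
      by (simp add: power_mult_distrib ennreal_power power2_eq_square[of "indicator _ _"] ind)
    also have "\<dots> \<le> ennreal \<epsilon> * ennreal B" using x y by (intro mult_mono) auto
    also have "\<dots> \<le> ennreal \<epsilon> * ennreal (\<bar>B\<bar> + 1)" by (intro mult_left_mono ennreal_leI) auto
    also have "\<dots> = (ennreal (e / 4))\<^sup>2"
    proof -
      have "ennreal \<epsilon> * ennreal (\<bar>B\<bar> + 1) = ennreal (\<epsilon> * (\<bar>B\<bar> + 1))"
        by (rule ennreal_mult[symmetric]) (use eps in auto)
      also have "\<epsilon> * (\<bar>B\<bar> + 1) = (e / 4)\<^sup>2" by (simp add: \<epsilon>_def)
      finally show ?thesis using e by (simp add: ennreal_power)
    qed
    finally have sq: "(nns (\<lambda>m. ennreal (cmod (x m * y m)) * indicator (- A) m))\<^sup>2 \<le> (ennreal (e / 4))\<^sup>2" .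
    have t: "nns (\<lambda>m. ennreal (cmod (x m * y m)) * indicator (- A) m) \<le> ennreal (e / 4)"
      using sq e by (intro ennreal_le_of_power2_le) auto
    have "nns (\<lambda>m. ennreal (cmod (x m * y m))) = (\<Sum>m\<in>A. ennreal (cmod (x m * y m))) + nns (\<lambda>m. ennreal (cmod (x m * y m)) * indicator (- A) m)"
    proof -
      have "nns (\<lambda>m. ennreal (cmod (x m * y m))) = nns (\<lambda>m. ennreal (cmod (x m * y m)) * indicator A m + ennreal (cmod (x m * y m)) * indicator (- A) m)"
        by (rule nn_integral_cong) (auto split: split_indicator)
      moreover have "nns (\<lambda>m. ennreal (cmod (x m * y m)) * indicator A m) = (\<Sum>m\<in>A. ennreal (cmod (x m * y m)))"
        using A by (subst nns_finite_support[of A]) auto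
      ultimately show ?thesis by (simp only: nns_add)
    qed
    also have "\<dots> < \<infinity>" using t by (auto simp: less_top[symmetric] top_unique)
    finally have "ennreal (cmod ((\<Sum>\<^sub>\<infinity>m. x m * y m) - (\<Sum>m\<in>A. x m * y m))) \<le> ennreal (e / 4)"
      using infsum_tail_le[OF _ A, of "\<lambda>m. x m * y m"] t by (auto intro: order_trans)
    then show ?thesis using e by simp
  qed
  have lim: "nns (\<lambda>m. ennreal ((cmod (a' m))\<^sup>2) * indicator (- A) m) \<le> ennreal \<epsilon>"
  proof -
    have "nns (\<lambda>m. ennreal ((cmod (a' m))\<^sup>2 * indicator (- A) m)) \<le> ennreal \<epsilon>"
      by (rule nns_tendsto_le[where c="\<lambda>i m. (cmod (a i m))\<^sup>2 * indicator (- A) m", OF _ _ F])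
         (auto intro!: tendsto_intros a eventually_mono[OF tA] simp: ennreal_mult ennreal_indicator)
    then show ?thesis by (simp add: ennreal_mult ennreal_indicator)
  qed
  have limb: "l2sq b' \<le> ennreal B"
    by (rule nns_tendsto_le[where c="\<lambda>i m. (cmod (b i m))\<^sup>2", OF _ B F]) (intro tendsto_intros b)
  have "((\<lambda>i. \<Sum>m\<in>A. a i m * b i m) \<longlongrightarrow> (\<Sum>m\<in>A. a' m * b' m)) F" by (intro tendsto_intros a b)
  then have "\<forall>\<^sub>F i in F. dist (\<Sum>m\<in>A. a i m * b i m) (\<Sum>m\<in>A. a' m * b' m) < e / 4"
    using e by (intro tendstoD) auto
  then show "\<forall>\<^sub>F i in F. dist (\<Sum>\<^sub>\<infinity>m. a i m * b i m) (\<Sum>\<^sub>\<infinity>m. a' m * b' m) < e"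
    using tA B
  proof eventually_elim
    case (elim i)
    have 1: "dist (\<Sum>\<^sub>\<infinity>m. a i m * b i m) (\<Sum>m\<in>A. a i m * b i m) \<le> e / 4" unfolding dist_norm by (rule tail[OF elim(2,3)])
    have 2: "dist (\<Sum>\<^sub>\<infinity>m. a' m * b' m) (\<Sum>m\<in>A. a' m * b' m) \<le> e / 4" unfolding dist_norm by (rule tail[OF lim limb])
    show ?case
      using 1 2 elim(1) e dist_triangle[of "\<Sum>\<^sub>\<infinity>m. a i m * b i m" "\<Sum>\<^sub>\<infinity>m. a' m * b' m" "\<Sum>m\<in>A. a i m * b i m"]
        dist_triangle[of "\<Sum>m\<in>A. a i m * b i m" "\<Sum>\<^sub>\<infinity>m. a' m * b' m" "\<Sum>m\<in>A. a' m * b' m"]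
      by (simp add: dist_commute)
  qed
qed

lemma ksq_outside_boxk: "k \<notin> boxk n \<Longrightarrow> ksq k \<ge> real n"
proof -
  assume k: "k \<notin> boxk n"
  obtain a b c where abc: "k = (a,b,c)" by (cases k)
  have sq: "real n \<le> (real_of_int z)\<^sup>2" if "\<bar>z\<bar> > int n" for z
  proof -
    have "real n + 1 \<le> \<bar>real_of_int z\<bar>" using that by linarith
    then have "(real n + 1)\<^sup>2 \<le> \<bar>real_of_int z\<bar>\<^sup>2" by (intro power_mono) auto
    moreover have "real n \<le> (real n + 1)\<^sup>2" by (simp add: power2_eq_square algebra_simps)
    ultimately show ?thesis by simp
  qed
  have s: "ksq k = (real_of_int a)\<^sup>2 + (real_of_int b)\<^sup>2 + (real_of_int c)\<^sup>2" by (simp add: ksq_def abc)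
  consider "\<bar>a\<bar> > int n" | "\<bar>b\<bar> > int n" | "\<bar>c\<bar> > int n" using k abc by (auto simp: boxk_def)
  then show ?thesis
    unfolding s using zero_le_power2[of "real_of_int a"] zero_le_power2[of "real_of_int b"] zero_le_power2[of "real_of_int c"]
    by cases (use sq[of a] sq[of b] sq[of c] in linarith)+
qed

text \<open>Outside \<open>boxk n\<close> the weight of H^2 is at least n, so the tail is at most
  B/n. One finite set serves all fields with the same bound, which is the uniformity required for
  products.\<close>

lemma tight_of_H2:
  assumes B: "B \<ge> 0" and \<epsilon>: "\<epsilon> > 0"
  shows "\<exists>A. finite A \<and> (\<forall>w. nns (\<lambda>k. ennreal ((ksq k)\<^sup>2 * (w k)\<^sup>2)) \<le> ennreal B \<longrightarrow>
     nns (\<lambda>m. ennreal ((w m)\<^sup>2) * indicator (- A) m) \<le> ennreal \<epsilon>)"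
proof -
  obtain n :: nat where n: "B / \<epsilon> + 1 < real n" using reals_Archimedean2 by blast
  then have n1: "real n \<ge> 1" using B \<epsilon> by (smt (verit) divide_nonneg_pos)
  have nB: "B \<le> real n * \<epsilon>" using n \<epsilon> B by (simp add: field_simps)
  show ?thesis
  proof (intro exI[of _ "boxk n"] conjI allI impI)
    fix w assume w: "nns (\<lambda>k. ennreal ((ksq k)\<^sup>2 * (w k)\<^sup>2)) \<le> ennreal B"
    have "nns (\<lambda>m. ennreal ((w m)\<^sup>2) * indicator (- boxk n) m) \<le> nns (\<lambda>m. ennreal (1 / real n) * ennreal ((ksq m)\<^sup>2 * (w m)\<^sup>2))"
    proof (rule nns_mono)
      fix m
      show "ennreal ((w m)\<^sup>2) * indicator (- boxk n) m \<le> ennreal (1 / real n) * ennreal ((ksq m)\<^sup>2 * (w m)\<^sup>2)"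
      proof (cases "m \<in> boxk n")
        case False
        then have k: "ksq m \<ge> real n" by (rule ksq_outside_boxk)
        have "real n * 1 \<le> ksq m * ksq m" using k n1 by (intro mult_mono) auto
        then have "1 \<le> (1 / real n) * (ksq m)\<^sup>2" using n1 by (simp add: field_simps power2_eq_square)
        then have "1 * (w m)\<^sup>2 \<le> ((1 / real n) * (ksq m)\<^sup>2) * (w m)\<^sup>2" by (intro mult_right_mono) auto
        then have "ennreal ((w m)\<^sup>2) \<le> ennreal ((1 / real n) * ((ksq m)\<^sup>2 * (w m)\<^sup>2))" by (intro ennreal_leI) simp
        then show ?thesis using False by (simp add: ennreal_mult[symmetric])
      qed simp
    qed
    also have "\<dots> = ennreal (1 / real n) * nns (\<lambda>m. ennreal ((ksq m)\<^sup>2 * (w m)\<^sup>2))" by (rule nns_cmult)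
    also have "\<dots> \<le> ennreal (1 / real n) * ennreal B" using w by (intro mult_left_mono) auto
    also have "\<dots> = ennreal (B / real n)" using B by (simp add: ennreal_mult[symmetric])
    also have "\<dots> \<le> ennreal \<epsilon>"
    proof (rule ennreal_leI)
      show "B / real n \<le> \<epsilon>" using nB n1 by (simp add: field_simps)
    qed
    finally show "nns (\<lambda>m. ennreal ((w m)\<^sup>2) * indicator (- boxk n) m) \<le> ennreal \<epsilon>" .
  qed simp
qed

lemma nns_ksq_mono:
  assumes "u 0 = 0" "h2sq u \<le> B"
  shows "nns (\<lambda>k. ennreal (ksq k * (norm (u k))\<^sup>2)) \<le> B" "l2sq u \<le> B"
proof -
  have k: "ksq k * (norm (u k))\<^sup>2 \<le> (ksq k)\<^sup>2 * (norm (u k))\<^sup>2 \<and> (norm (u k))\<^sup>2 \<le> (ksq k)\<^sup>2 * (norm (u k))\<^sup>2" for k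
  proof (cases "k = 0")
    case False
    then have s: "1 \<le> ksq k" by (rule ksq_ge_1)
    then have "ksq k * 1 \<le> ksq k * ksq k" by (intro mult_left_mono) auto
    then have "ksq k \<le> (ksq k)\<^sup>2" "1 \<le> (ksq k)\<^sup>2" using s one_le_power[OF s, of 2] by (auto simp: power2_eq_square)
    then show ?thesis using mult_right_mono[of 1 "(ksq k)\<^sup>2" "(norm (u k))\<^sup>2"] by (auto intro: mult_right_mono)
  qed (use assms in simp)
  show "nns (\<lambda>k. ennreal (ksq k * (norm (u k))\<^sup>2)) \<le> B"
    by (rule order_trans[OF nns_mono assms(2)]) (use k in \<open>auto intro: ennreal_leI\<close>)
  show "l2sq u \<le> B"
    by (rule order_trans[OF nns_mono assms(2)]) (use k in \<open>auto intro: ennreal_leI\<close>)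
qed

lemma cnv_finite:
  assumes "nns (\<lambda>m. (a m)\<^sup>2) < \<infinity>" "nns (\<lambda>m. (b m)\<^sup>2) < \<infinity>"
  shows "cnv a b k < \<infinity>"
proof -
  have "(cnv a b k)\<^sup>2 < \<infinity>"
    using cnv_pointwise[of a b k] by (rule le_less_trans) (use assms in \<open>simp add: ennreal_mult_less_top\<close>)
  then show ?thesis by (simp add: power_less_top_ennreal)
qed

lemma sqrt_ksq_norm_sq: "(ennreal (sqrt (ksq k) * norm (v :: complex^3)))\<^sup>2 = ennreal (ksq k * (norm v)\<^sup>2)"
  by (simp add: ennreal_power power_mult_distrib)

text \<open>Splitting the vector series into scalar convolutions, one for each component of the
  transporting field, makes the scalar limit theorem applicable.\<close>

lemma advect_nth:
  assumes u: "l2sq u < \<infinity>" "nns (\<lambda>k. ennreal (ksq k * (norm (u k))\<^sup>2)) < \<infinity>"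
  shows "advect u k $ l = (\<Sum>j\<in>UNIV. \<Sum>\<^sub>\<infinity>m. (u (k - m) $ j) * (2 * pi * \<i> * of_real (kreal m $ j) * u m $ l))"
proof -
  let ?f = "\<lambda>m. (2 * pi * \<i> * cdot (u (k - m)) (kvec m)) *s u m"
  let ?g = "\<lambda>j m. (u (k - m) $ j) * (2 * pi * \<i> * of_real (kreal m $ j) * u m $ l)"
  have fin: "ennreal (2 * pi) * cnv (mag u) (\<lambda>k. ennreal (sqrt (ksq k) * norm (u k))) k < \<infinity>"
    using cnv_finite[of "\<lambda>k. ennreal (norm (u k))" "\<lambda>k. ennreal (sqrt (ksq k) * norm (u k))" k] u
    by (simp add: sqrt_ksq_norm_sq ennreal_power ennreal_mult_less_top)
  then have f: "?f summable_on UNIV"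
    using advect_terms_le[of u k] by (intro summable_of_nns(2)) (rule le_less_trans)
  have g: "?g j summable_on UNIV" for j
  proof (rule summable_of_nns(2), rule le_less_trans[OF _ fin])
    show "nns (\<lambda>m. ennreal (norm (?g j m))) \<le> ennreal (2 * pi) * cnv (mag u) (\<lambda>k. ennreal (sqrt (ksq k) * norm (u k))) k"
      unfolding cnv_def nns_cmult[symmetric]
    proof (rule nns_mono)
      fix m
      have "cmod (u (k - m) $ j) * (2 * pi * \<bar>kreal m $ j\<bar> * cmod (u m $ l)) \<le> norm (u (k - m)) * (2 * pi * sqrt (ksq m) * norm (u m))"
        by (intro mult_mono Finite_Cartesian_Product.norm_nth_le abs_kreal_le) auto
      then have "ennreal (norm (?g j m)) \<le> ennreal (2 * pi * (norm (u (k - m)) * (sqrt (ksq m) * norm (u m))))"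
        by (intro ennreal_leI) (simp add: norm_mult ac_simps)
      then show "ennreal (norm (?g j m)) \<le> ennreal (2 * pi) * (ennreal (norm (u (k - m))) * ennreal (sqrt (ksq m) * norm (u m)))"
        by (simp add: ennreal_mult)
    qed
  qed
  have bl: "bounded_linear (\<lambda>v :: complex^3. v $ l)" by (rule bounded_linear_vec_nth)
  have "advect u k $ l = (\<Sum>\<^sub>\<infinity>m. ?f m $ l)"
    unfolding advect_eq using f summable_on_bounded_linear[OF bl f]
    by (intro infsum_bounded_linear_strong[OF _ bl, symmetric]) auto
  also have "\<dots> = (\<Sum>\<^sub>\<infinity>m. ?g 1 m + (?g 2 m + ?g 3 m))"
    by (rule infsum_cong) (simp add: cdot_def sum_3 kvec_nth algebra_simps)
  also have "\<dots> = infsum (?g 1) UNIV + (infsum (?g 2) UNIV + infsum (?g 3) UNIV)"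
    by (simp only: infsum_add[OF g summable_on_add[OF g g]] infsum_add[OF g g])
  finally show ?thesis by (simp add: sum_3)
qed

text \<open>Reindexing puts the velocity at m and the temperature at k - m, so that the factor with
  uniformly small tails carries the plain index.\<close>

lemma div_flux_eq:
  assumes u: "l2sq u < \<infinity>" and c: "l2sq c < \<infinity>"
  shows "div_flux u c k = (\<Sum>j\<in>UNIV. \<i> * of_real (2 * pi * kreal k $ j) * (\<Sum>\<^sub>\<infinity>m. u m $ j * c (k - m)))"
proof -
  let ?f = "\<lambda>m. c m *s u (k - m)"
  have "nns (\<lambda>m. ennreal (norm (?f m))) = cnv (mag u) (mag c) k"
    by (simp add: cnv_def ennreal_mult mult.commute)
  also have "\<dots> < \<infinity>" using u c by (intro cnv_finite) (simp_all add: ennreal_power)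
  finally have f: "?f summable_on UNIV" by (rule summable_of_nns(2))
  have bij: "bij_betw (\<lambda>m. k - m) (UNIV::wn set) UNIV" by (rule bij_betwI[where g="\<lambda>m. k - m"]) auto
  have "infsum ?f UNIV $ j = (\<Sum>\<^sub>\<infinity>m. u m $ j * c (k - m))" for j
  proof -
    have bl: "bounded_linear (\<lambda>v :: complex^3. v $ j)" by (rule bounded_linear_vec_nth)
    have "infsum ?f UNIV $ j = (\<Sum>\<^sub>\<infinity>m. ?f m $ j)"
      using f summable_on_bounded_linear[OF bl f] by (intro infsum_bounded_linear_strong[OF _ bl, symmetric]) auto
    also have "\<dots> = (\<Sum>\<^sub>\<infinity>m. ?f (k - m) $ j)" by (rule infsum_reindex_bij_betw[OF bij, symmetric])
    finally show ?thesis by (simp add: mult.commute)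
  qed
  then show ?thesis by (simp add: div_flux_def subk_eq cdot_def kvec_nth ac_simps)
qed

lemma infsum_product_tendsto_H2:
  fixes a b :: "'i \<Rightarrow> wn \<Rightarrow> complex"
  assumes a: "\<And>m. ((\<lambda>i. a i m) \<longlongrightarrow> a' m) F" and b: "\<And>m. ((\<lambda>i. b i m) \<longlongrightarrow> b' m) F" and F: "F \<noteq> bot"
    and B: "\<forall>\<^sub>F i in F. l2sq (b i) \<le> ennreal B"
    and A: "\<forall>\<^sub>F i in F. nns (\<lambda>m. ennreal ((ksq m)\<^sup>2 * (cmod (a i m))\<^sup>2)) \<le> ennreal A" and A0: "A \<ge> 0"
  shows "((\<lambda>i. \<Sum>\<^sub>\<infinity>m. a i m * b i m) \<longlongrightarrow> (\<Sum>\<^sub>\<infinity>m. a' m * b' m)) F"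
proof (rule infsum_product_tendsto[OF a b F B])
  fix \<epsilon> :: real assume "\<epsilon> > 0"
  from tight_of_H2[OF A0 this] obtain S where S: "finite S"
    "\<And>w. nns (\<lambda>k. ennreal ((ksq k)\<^sup>2 * (w k)\<^sup>2)) \<le> ennreal A \<Longrightarrow> nns (\<lambda>m. ennreal ((w m)\<^sup>2) * indicator (- S) m) \<le> ennreal \<epsilon>"
    by blast
  show "\<exists>S. finite S \<and> (\<forall>\<^sub>F i in F. nns (\<lambda>m. ennreal ((cmod (a i m))\<^sup>2) * indicator (- S) m) \<le> ennreal \<epsilon>)"
    using S by (intro exI[of _ S] conjI eventually_mono[OF A]) auto
qed

lemma advect_tendsto:
  assumes u: "\<And>k. ((\<lambda>i. U i k) \<longlongrightarrow> u k) F" and F: "F \<noteq> bot" and z: "\<And>i. U i 0 = 0" and B0: "B \<ge> 0"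
    and B: "\<And>i. h2sq (U i) \<le> ennreal B"
  shows "((\<lambda>i. advect (U i) k) \<longlongrightarrow> advect u k) F"
proof -
  have uB: "h2sq u \<le> ennreal B"
    by (rule nns_tendsto_le[where c="\<lambda>i k. (ksq k)\<^sup>2 * (norm (U i k))\<^sup>2", OF _ _ F]) (auto intro!: tendsto_intros u always_eventually B)
  have uz: "u 0 = 0" using tendsto_unique[OF F u[of 0]] z by (simp add: tendsto_const_iff)
  have fin: "l2sq w < \<infinity>" "nns (\<lambda>k. ennreal (ksq k * (norm (w k))\<^sup>2)) < \<infinity>"
    if "w 0 = 0" "h2sq w \<le> ennreal B" for w :: vfield
    using nns_ksq_mono[OF that] by (auto intro: le_less_trans)
  have nn: "cmod ((v :: complex^3) $ j) \<le> norm v" for v j by (rule Finite_Cartesian_Product.norm_nth_le)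
  have "((\<lambda>i. \<Sum>\<^sub>\<infinity>m. U i (k - m) $ j * (2 * pi * \<i> * of_real (kreal m $ j) * U i m $ l))
      \<longlongrightarrow> (\<Sum>\<^sub>\<infinity>m. u (k - m) $ j * (2 * pi * \<i> * of_real (kreal m $ j) * u m $ l))) F" for j l
  proof -
    have bij: "bij_betw (\<lambda>m. k - m) (UNIV::wn set) UNIV" by (rule bij_betwI[where g="\<lambda>m. k - m"]) auto
    \<comment> \<open>After reindexing, the undifferentiated velocity carries the index m and
      supplies the small tails; the gradient factor is only required to be bounded in l^2.\<close>
    have re: "(\<Sum>\<^sub>\<infinity>m. w (k - m) $ j * (2 * pi * \<i> * of_real (kreal m $ j) * w m $ l))
       = (\<Sum>\<^sub>\<infinity>m. w m $ j * (2 * pi * \<i> * of_real (kreal (k - m) $ j) * w (k - m) $ l))" for w :: vfield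
      using infsum_reindex_bij_betw[OF bij, of "\<lambda>m. w (k - m) $ j * (2 * pi * \<i> * of_real (kreal m $ j) * w m $ l)"]
      by simp
    show ?thesis unfolding re
    proof (rule infsum_product_tendsto_H2[OF _ _ F _ _ B0])
      show "((\<lambda>i. U i m $ j) \<longlongrightarrow> u m $ j) F" for m by (intro tendsto_vec_nth u)
      show "((\<lambda>i. 2 * pi * \<i> * of_real (kreal (k - m) $ j) * U i (k - m) $ l) \<longlongrightarrow> 2 * pi * \<i> * of_real (kreal (k - m) $ j) * u (k - m) $ l) F" for m
        by (intro tendsto_intros u)
      have "nns (\<lambda>m. ennreal ((ksq m)\<^sup>2 * (cmod (U i m $ j))\<^sup>2)) \<le> ennreal B" for i
        by (rule order_trans[OF nns_mono B[of i]]) (auto intro!: ennreal_leI mult_left_mono power_mono nn)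
      then show "\<forall>\<^sub>F i in F. nns (\<lambda>m. ennreal ((ksq m)\<^sup>2 * (cmod (U i m $ j))\<^sup>2)) \<le> ennreal B" by simp
      have "nns (\<lambda>m. ennreal ((cmod (2 * pi * \<i> * of_real (kreal (k - m) $ j) * U i (k - m) $ l))\<^sup>2)) \<le> ennreal ((2 * pi)\<^sup>2 * B)" for i
      proof -
        have "nns (\<lambda>m. ennreal ((cmod (2 * pi * \<i> * of_real (kreal (k - m) $ j) * U i (k - m) $ l))\<^sup>2))
          = nns (\<lambda>m. ennreal ((cmod (2 * pi * \<i> * of_real (kreal m $ j) * U i m $ l))\<^sup>2))"
          by (rule nns_reflect[of "\<lambda>m. ennreal ((cmod (2 * pi * \<i> * of_real (kreal m $ j) * U i m $ l))\<^sup>2)"])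
        also have "\<dots> \<le> nns (\<lambda>m. ennreal ((2 * pi)\<^sup>2) * ennreal (ksq m * (norm (U i m))\<^sup>2))"
        proof (rule nns_mono)
          fix m
          have "(kreal m $ j)\<^sup>2 \<le> (sqrt (ksq m))\<^sup>2" using power_mono[OF abs_kreal_le[of m j], of 2] by simp
          then have "(kreal m $ j)\<^sup>2 * (cmod (U i m $ l))\<^sup>2 \<le> ksq m * (norm (U i m))\<^sup>2"
            by (intro mult_mono power_mono nn) auto
          then have "(2 * pi)\<^sup>2 * ((kreal m $ j)\<^sup>2 * (cmod (U i m $ l))\<^sup>2) \<le> (2 * pi)\<^sup>2 * (ksq m * (norm (U i m))\<^sup>2)"
            by (intro mult_left_mono) auto
          then have "ennreal ((cmod (2 * pi * \<i> * of_real (kreal m $ j) * U i m $ l))\<^sup>2) \<le> ennreal ((2 * pi)\<^sup>2 * (ksq m * (norm (U i m))\<^sup>2))"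
            by (intro ennreal_leI) (simp add: norm_mult power_mult_distrib mult.assoc)
          then show "ennreal ((cmod (2 * pi * \<i> * of_real (kreal m $ j) * U i m $ l))\<^sup>2) \<le> ennreal ((2 * pi)\<^sup>2) * ennreal (ksq m * (norm (U i m))\<^sup>2)"
            by (simp add: ennreal_mult)
        qed
        also have "\<dots> \<le> ennreal ((2 * pi)\<^sup>2) * ennreal B"
          unfolding nns_cmult by (intro mult_left_mono nns_ksq_mono(1)[OF z B]) auto
        finally show ?thesis using B0 by (simp add: ennreal_mult)
      qed
      then show "\<forall>\<^sub>F i in F. nns (\<lambda>m. ennreal ((cmod (2 * pi * \<i> * of_real (kreal (k - m) $ j) * U i (k - m) $ l))\<^sup>2)) \<le> ennreal ((2 * pi)\<^sup>2 * B)"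
        by simp
    qed
  qed
  then have "((\<lambda>i. advect (U i) k $ l) \<longlongrightarrow> advect u k $ l) F" for l
    unfolding advect_nth[OF fin[OF z B]] advect_nth[OF fin[OF uz uB]] by (intro tendsto_sum)
  then show ?thesis by (rule vec_tendstoI)
qed

lemma leray_tendsto:
  assumes "((\<lambda>i. v i k) \<longlongrightarrow> w k) F"
  shows "((\<lambda>i. leray (v i) k) \<longlongrightarrow> leray w k) F"
proof (cases "k = 0")
  case False
  show ?thesis
    unfolding leray_eq[OF False] cdot_def
    by (intro vec_tendstoI) (simp add: divide_inverse, intro tendsto_intros assms)
qed simp

lemma force_tendsto:
  assumes "((\<lambda>i. advect (U i) k) \<longlongrightarrow> advect u k) F" "((\<lambda>i. c i k) \<longlongrightarrow> c' k) F"
  shows "((\<lambda>i. force (U i) (c i) k) \<longlongrightarrow> force u c' k) F"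
  unfolding force_def by (rule leray_tendsto, rule vec_tendstoI, simp, intro tendsto_intros assms)

section \<open>Consistency of the discrete symbols\<close>

lemma sin_quotient_tendsto:
  assumes h: "(h :: nat \<Rightarrow> real) \<longlonglongrightarrow> 0" "\<And>n. h n \<noteq> 0"
  shows "(\<lambda>n. sin (a * h n) / h n) \<longlonglongrightarrow> a"
proof -
  have "((\<lambda>x. sin (a * x)) has_real_derivative a) (at 0)" by (auto intro!: derivative_eq_intros)
  then have "((\<lambda>x. sin (a * x) / x) \<longlongrightarrow> a) (at 0)" by (simp add: DERIV_def)
  moreover have "filterlim h (at 0) sequentially" using h by (simp add: filterlim_at)
  ultimately show ?thesis by (rule filterlim_compose)
qed

lemma lam_tendsto:
  assumes h: "h \<longlonglongrightarrow> 0" "\<And>n. h n \<noteq> 0"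
  shows "(\<lambda>n. lam (h n) \<kappa> k) \<longlonglongrightarrow> \<kappa> * symA k"
proof -
  have "lam (h n) \<kappa> k = \<kappa> * (\<Sum>j\<in>UNIV. (2 * (sin ((pi * kreal k $ j) * h n) / h n))\<^sup>2)" for n
  proof -
    have "2 - 2 * cos (2 * pi * h n * kreal k $ j) = 4 * (sin ((pi * kreal k $ j) * h n))\<^sup>2" for j
      using cos_double_sin[of "(pi * kreal k $ j) * h n"] by (simp add: ac_simps)
    then show ?thesis by (simp add: lam_def power_mult_distrib power_divide sum_divide_distrib[symmetric])
  qed
  moreover have "(\<lambda>n. \<kappa> * (\<Sum>j\<in>UNIV. (2 * (sin ((pi * kreal k $ j) * h n) / h n))\<^sup>2)) \<longlonglongrightarrow> \<kappa> * (\<Sum>j\<in>UNIV. (2 * (pi * kreal k $ j))\<^sup>2)"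
    by (intro tendsto_intros sin_quotient_tendsto h)
  moreover have "(\<Sum>j\<in>UNIV. (2 * (pi * kreal k $ j))\<^sup>2) = symA k"
    by (simp add: symA_def ksq_norm norm_vec_def L2_set_def sum_nonneg power_mult_distrib sum_distrib_left mult.assoc)
  ultimately show ?thesis by simp
qed

lemma lam_bounds:
  assumes "\<kappa> > 0" "h > 0"
  shows "0 \<le> lam h \<kappa> k" "lam h \<kappa> k \<le> \<kappa> * symA k"
proof -
  have p: "2 - 2 * cos a \<le> a\<^sup>2" for a :: real
  proof -
    have "\<bar>sin (a / 2)\<bar>\<^sup>2 \<le> \<bar>a / 2\<bar>\<^sup>2" by (intro power_mono abs_sin_x_le_abs_x) auto
    then show ?thesis using cos_double_sin[of "a / 2"] by (simp add: power_divide)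
  qed
  show "0 \<le> lam h \<kappa> k" unfolding lam_def using assms by (intro mult_nonneg_nonneg sum_nonneg) auto
  have "lam h \<kappa> k \<le> (\<kappa> / h\<^sup>2) * (\<Sum>j\<in>UNIV. (2 * pi * h * kreal k $ j)\<^sup>2)"
    unfolding lam_def using assms by (intro mult_left_mono sum_mono p) auto
  also have "\<dots> = \<kappa> * symA k"
    using assms by (simp add: symA_def ksq_norm norm_vec_def L2_set_def sum_nonneg power_mult_distrib sum_distrib_left[symmetric])
  finally show "lam h \<kappa> k \<le> \<kappa> * symA k" .
qed

lemma rho_tendsto:
  assumes h: "h \<longlonglongrightarrow> 0" "\<And>n. h n \<noteq> 0"
  shows "(\<lambda>n. rho (h n * a)) \<longlonglongrightarrow> 1"
proof (cases "a = 0")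
  case False
  have "(\<lambda>n. sin ((2 * pi * a) * h n) / h n) \<longlonglongrightarrow> 2 * pi * a" by (rule sin_quotient_tendsto[OF h])
  then have "(\<lambda>n. (2 * pi * a) / (sin ((2 * pi * a) * h n) / h n)) \<longlonglongrightarrow> (2 * pi * a) / (2 * pi * a)"
    using False by (intro tendsto_intros) auto
  moreover have "(2 * pi * a) / (sin ((2 * pi * a) * h n) / h n) = rho (h n * a)" for n
    using False h(2)[of n] by (simp add: rho_def ac_simps)
  ultimately show ?thesis using False by simp
qed (simp add: rho_def)

text \<open>Minus the rate of change of coefficient k in the temperature scheme; its limit is
  diffusion plus divergence of the flux.\<close>

definition flux_h :: "real \<Rightarrow> real \<Rightarrow> wn set \<Rightarrow> vfield \<Rightarrow> sfield \<Rightarrow> sfield" where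
  "flux_h \<kappa> h K u c k = of_real (lam h \<kappa> k) * c k + (\<Sum>j\<in>UNIV. \<i> * of_real (sin (2 * pi * h * kreal k $ j) / h) *
      (\<Sum>m\<in>K. utc h u j m * c (k - m)))"

lemma utc_bound:
  assumes "8 * \<bar>h * kreal m $ j\<bar> \<le> 1"
  shows "cmod (utc h u j m) \<le> 2 * norm (u m)"
proof -
  have "\<bar>rho (h * kreal m $ j)\<bar> * cmod (u m $ j) \<le> 2 * norm (u m)"
    using rho_bound(1)[OF assms] Finite_Cartesian_Product.norm_nth_le[of "u m" j] by (intro mult_mono) auto
  then show ?thesis by (simp add: utc_def norm_mult)
qed

text \<open>The bound grows with k, which suffices because each mode needs its own Lipschitz
  constant only. The factor 2 of \<open>utc_bound\<close> is the one in 2 a b \<le> a^2 + b^2,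
  whence B + M.\<close>

lemma flux_h_bound:
  assumes \<kappa>: "\<kappa> > 0" and h: "h > 0" and K: "finite K" and hK: "\<And>m j. m \<in> K \<Longrightarrow> 8 * \<bar>h * kreal m $ j\<bar> \<le> 1"
    and u: "(\<Sum>m\<in>K. (norm (u m))\<^sup>2) \<le> B" and c: "\<And>A. finite A \<Longrightarrow> (\<Sum>m\<in>A. (cmod (c m))\<^sup>2) \<le> M"
  shows "cmod (flux_h \<kappa> h K u c k) \<le> \<kappa> * symA k * sqrt M + 3 * (2 * pi * sqrt (ksq k) * (B + M))"
proof -
  have s: "\<bar>sin (2 * pi * h * kreal k $ j) / h\<bar> \<le> 2 * pi * sqrt (ksq k)" for j
  proof -
    have "\<bar>sin (2 * pi * h * kreal k $ j)\<bar> \<le> \<bar>2 * pi * h * kreal k $ j\<bar>" by (rule abs_sin_x_le_abs_x)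
    also have "\<dots> = h * (2 * pi * \<bar>kreal k $ j\<bar>)" using h by (simp add: abs_mult)
    also have "\<dots> \<le> h * (2 * pi * sqrt (ksq k))" using h by (intro mult_left_mono abs_kreal_le) auto
    finally show ?thesis using h by (simp add: abs_divide field_simps)
  qed
  have cv: "cmod (\<Sum>m\<in>K. utc h u j m * c (k - m)) \<le> B + M" for j
  proof -
    have "cmod (\<Sum>m\<in>K. utc h u j m * c (k - m)) \<le> (\<Sum>m\<in>K. (norm (u m))\<^sup>2 + (cmod (c (k - m)))\<^sup>2)"
    proof (rule sum_norm_le)
      fix m assume m: "m \<in> K"
      have "cmod (utc h u j m * c (k - m)) \<le> 2 * norm (u m) * cmod (c (k - m))"
        unfolding norm_mult by (intro mult_right_mono utc_bound hK m) auto
      then show "cmod (utc h u j m * c (k - m)) \<le> (norm (u m))\<^sup>2 + (cmod (c (k - m)))\<^sup>2"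
        using sum_squares_bound[of "norm (u m)" "cmod (c (k - m))"] by linarith
    qed
    also have "(\<Sum>m\<in>K. (cmod (c (k - m)))\<^sup>2) = (\<Sum>m\<in>(\<lambda>m. k - m) ` K. (cmod (c m))\<^sup>2)"
      by (subst sum.reindex) (auto intro: inj_onI)
    then have "(\<Sum>m\<in>K. (norm (u m))\<^sup>2 + (cmod (c (k - m)))\<^sup>2) \<le> B + M"
      using u c[of "(\<lambda>m. k - m) ` K"] K by (simp add: sum.distrib)
    finally show ?thesis .
  qed
  have BM: "0 \<le> B + M" using order_trans[OF norm_ge_zero cv] by blast
  have ck: "cmod (c k) \<le> sqrt M" using c[of "{k}"] by (intro real_le_rsqrt) simp
  have "cmod (flux_h \<kappa> h K u c k) \<le> \<bar>lam h \<kappa> k\<bar> * cmod (c k) + cmod (\<Sum>j\<in>UNIV. \<i> * of_real (sin (2 * pi * h * kreal k $ j) / h) * (\<Sum>m\<in>K. utc h u j m * c (k - m)))"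
    unfolding flux_h_def by (rule order_trans[OF norm_triangle_ineq]) (simp add: norm_mult)
  also have "\<dots> \<le> (\<kappa> * symA k) * sqrt M + (\<Sum>j\<in>(UNIV::3 set). 2 * pi * sqrt (ksq k) * (B + M))"
  proof (intro add_mono mult_mono ck sum_norm_le)
    show "\<bar>lam h \<kappa> k\<bar> \<le> \<kappa> * symA k" using lam_bounds[OF \<kappa> h, of k] by simp
    show "cmod (\<i> * of_real (sin (2 * pi * h * kreal k $ j) / h) * (\<Sum>m\<in>K. utc h u j m * c (k - m))) \<le> 2 * pi * sqrt (ksq k) * (B + M)" for j
      unfolding norm_mult norm_ii norm_of_real mult_1_left by (intro mult_mono s cv) auto
  qed (use \<kappa> in auto)
  finally show ?thesis by simp
qed

text \<open>The symbols of diffusion, difference and correction converge in each mode. The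
  truncation leaves no trace: U i vanishes outside K i, so the finite convolutions are full
  sums.\<close>

lemma flux_h_tendsto:
  assumes h: "h \<longlonglongrightarrow> 0" "\<And>i. h i > 0" and K: "\<And>i. finite (K i)" "\<And>i k. k \<notin> K i \<Longrightarrow> U i k = 0"
    and hK: "\<And>i m j. m \<in> K i \<Longrightarrow> 8 * \<bar>h i * kreal m $ j\<bar> \<le> 1"
    and u: "\<And>k. (\<lambda>i. U i k) \<longlonglongrightarrow> u k" and c: "\<And>k. (\<lambda>i. C i k) \<longlonglongrightarrow> c k" and z: "\<And>i. U i 0 = 0"
    and B: "\<And>i. h2sq (U i) \<le> ennreal B" "B \<ge> 0"
    and M: "\<And>i. l2sq (C i) \<le> ennreal M"
  shows "(\<lambda>i. flux_h \<kappa> (h i) (K i) (U i) (C i) k) \<longlonglongrightarrow> of_real (\<kappa> * symA k) * c k + div_flux u c k"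
proof -
  have hn: "\<And>i. h i \<noteq> 0" using h(2) by (metis less_irrefl)
  have uB: "h2sq u \<le> ennreal B"
    by (rule nns_tendsto_le[where c="\<lambda>i k. (ksq k)\<^sup>2 * (norm (U i k))\<^sup>2" and F=sequentially]) (auto intro!: tendsto_intros u always_eventually B)
  have cM: "l2sq c \<le> ennreal M"
    by (rule nns_tendsto_le[where c="\<lambda>i k. (cmod (C i k))\<^sup>2" and F=sequentially]) (auto intro!: tendsto_intros c always_eventually M)
  have uz: "u 0 = 0" using LIMSEQ_unique[OF u[of 0]] z by simp
  have "l2sq u < \<infinity>" using nns_ksq_mono(2)[OF uz uB] by (rule le_less_trans) simp
  moreover have "l2sq c < \<infinity>" using cM by (rule le_less_trans) simp
  ultimately have df: "div_flux u c k = (\<Sum>j\<in>UNIV. \<i> * of_real (2 * pi * kreal k $ j) * (\<Sum>\<^sub>\<infinity>m. u m $ j * c (k - m)))"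
    by (rule div_flux_eq)
  have fin: "(\<Sum>m\<in>K i. utc (h i) (U i) j m * C i (k - m)) = (\<Sum>\<^sub>\<infinity>m. utc (h i) (U i) j m * C i (k - m))" for i j
    unfolding infsum_finite[OF K(1), symmetric] by (rule infsum_cong_neutral) (auto simp: utc_def K(2))
  have cv: "(\<lambda>i. \<Sum>\<^sub>\<infinity>m. utc (h i) (U i) j m * C i (k - m)) \<longlonglongrightarrow> (\<Sum>\<^sub>\<infinity>m. u m $ j * c (k - m))" for j
  proof (rule infsum_product_tendsto_H2[where B=M and A="4 * B"])
    have "(\<lambda>i. of_real (rho (h i * kreal m $ j)) * U i m $ j) \<longlonglongrightarrow> of_real 1 * u m $ j" for m
      by (intro tendsto_intros rho_tendsto h hn u)
    then show "(\<lambda>i. utc (h i) (U i) j m) \<longlonglongrightarrow> u m $ j" for m by (simp add: utc_def)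
    show "(\<lambda>i. C i (k - m)) \<longlonglongrightarrow> c (k - m)" for m by (rule c)
    show "\<forall>\<^sub>F i in sequentially. nns (\<lambda>m. ennreal ((cmod (C i (k - m)))\<^sup>2)) \<le> ennreal M"
      using M by (simp add: nns_reflect[of "\<lambda>m. ennreal ((cmod (C _ m))\<^sup>2)"])
    have "nns (\<lambda>m. ennreal ((ksq m)\<^sup>2 * (cmod (utc (h i) (U i) j m))\<^sup>2)) \<le> ennreal (4 * B)" for i
    proof -
      have "nns (\<lambda>m. ennreal ((ksq m)\<^sup>2 * (cmod (utc (h i) (U i) j m))\<^sup>2)) \<le> nns (\<lambda>m. ennreal 4 * ennreal ((ksq m)\<^sup>2 * (norm (U i m))\<^sup>2))"
      proof (rule nns_mono)
        fix m
        have "cmod (utc (h i) (U i) j m) \<le> 2 * norm (U i m)"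
          using utc_bound[OF hK[of m i j], of "U i"] K(2)[of m i] by (cases "m \<in> K i") (auto simp: utc_def)
        then have "(cmod (utc (h i) (U i) j m))\<^sup>2 \<le> (2 * norm (U i m))\<^sup>2" by (intro power_mono) auto
        then have "(ksq m)\<^sup>2 * (cmod (utc (h i) (U i) j m))\<^sup>2 \<le> 4 * ((ksq m)\<^sup>2 * (norm (U i m))\<^sup>2)"
          using mult_left_mono[of "(cmod (utc (h i) (U i) j m))\<^sup>2" "(2 * norm (U i m))\<^sup>2" "(ksq m)\<^sup>2"] by (simp add: power_mult_distrib)
        then have "ennreal ((ksq m)\<^sup>2 * (cmod (utc (h i) (U i) j m))\<^sup>2) \<le> ennreal (4 * ((ksq m)\<^sup>2 * (norm (U i m))\<^sup>2))"
          by (rule ennreal_leI)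
        then show "ennreal ((ksq m)\<^sup>2 * (cmod (utc (h i) (U i) j m))\<^sup>2) \<le> ennreal 4 * ennreal ((ksq m)\<^sup>2 * (norm (U i m))\<^sup>2)"
          by (simp only: ennreal_mult[of 4, OF zero_le_numeral mult_nonneg_nonneg[OF zero_le_power2 zero_le_power2]])
      qed
      also have "\<dots> \<le> ennreal 4 * ennreal B" unfolding nns_cmult by (intro mult_left_mono B) auto
      also have "\<dots> = ennreal (4 * B)" using B(2) by (rule ennreal_mult[symmetric, OF zero_le_numeral])
      finally show ?thesis .
    qed
    then show "\<forall>\<^sub>F i in sequentially. nns (\<lambda>m. ennreal ((ksq m)\<^sup>2 * (cmod (utc (h i) (U i) j m))\<^sup>2)) \<le> ennreal (4 * B)" by simp
  qed (use B(2) in auto)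
  have "(\<lambda>i. sin (2 * pi * h i * kreal k $ j) / h i) \<longlonglongrightarrow> 2 * pi * kreal k $ j" for j
    using sin_quotient_tendsto[OF h(1) hn, of "2 * pi * kreal k $ j"] by (simp add: ac_simps)
  then show ?thesis
    unfolding flux_h_def df fin by (intro tendsto_intros lam_tendsto h hn c cv)
qed

section \<open>Equations solved for the time derivatives, and the limit of the scheme\<close>

definition ut_rhs :: "real \<Rightarrow> vfield \<Rightarrow> sfield \<Rightarrow> vfield" where
  "ut_rhs \<alpha> u c k = (1 / (1 + \<alpha>\<^sup>2 * symA k)) *\<^sub>R force u c k"

definition tt_rhs :: "real \<Rightarrow> vfield \<Rightarrow> sfield \<Rightarrow> sfield" where
  "tt_rhs \<kappa> u c k = - (of_real (\<kappa> * symA k) * c k + div_flux u c k)"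

definition regular_state :: "real \<Rightarrow> real \<Rightarrow> vfield \<Rightarrow> sfield \<Rightarrow> bool" where
  "regular_state B M u c \<longleftrightarrow> real_vf u \<and> u \<in> divfree \<and> u 0 = 0 \<and> h2sq u \<le> ennreal B
     \<and> real_sf c \<and> c 0 = 0 \<and> l2sq c \<le> ennreal M"

lemma force_norm_bound:
  assumes u0: "u 0 = 0" and B: "h2sq u \<le> ennreal B" "B \<ge> 0"
    and c: "cmod (c k) \<le> sqrt M" "M \<ge> 0"
  shows "norm (force u c k) \<le> sqrt (8 * M + 8 * (4 * pi\<^sup>2 * (sk * (B * B))))"
proof -
  have "ennreal ((norm (advect u k))\<^sup>2) \<le> l2sq (advect u)"
    by (rule nns_ge[of "\<lambda>k. ennreal ((norm (advect u k))\<^sup>2)"])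
  also have "\<dots> \<le> ennreal (4 * pi\<^sup>2) * (SK * (ennreal B * ennreal B))"
    by (rule order_trans[OF nns_advect_sq[where u=u, OF u0]]) (intro mult_left_mono mult_mono nns_ksq_mono(1)[where u=u, OF u0 B(1)] B(1), auto)
  also have "\<dots> = ennreal (4 * pi\<^sup>2 * (sk * (B * B)))"
    using sk B(2) by (simp add: ennreal_mult)
  finally have "(norm (advect u k))\<^sup>2 \<le> 4 * pi\<^sup>2 * (sk * (B * B))"
    using sk B(2) by (subst (asm) ennreal_le_iff) auto
  moreover have "(cmod (c k))\<^sup>2 \<le> M" using power_mono[OF c(1) norm_ge_zero, of 2] c(2) by simp
  ultimately have "(norm (force u c k))\<^sup>2 \<le> 8 * M + 8 * (4 * pi\<^sup>2 * (sk * (B * B)))"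
    using norm_force_sq[of u c k] by linarith
  then show ?thesis by (rule real_le_rsqrt)
qed

text \<open>The number of steps between two times exceeds their distance divided by \<tau> by at
  most one, because times are rounded down to the grid; this is the extra \<tau>.\<close>

lemma step_lipschitz:
  fixes x :: "nat \<Rightarrow> 'a::real_normed_vector"
  assumes \<tau>: "\<tau> > 0" and rec: "\<And>n. n < L \<Longrightarrow> x (Suc n) = x n + \<tau> *\<^sub>R g n" and g: "\<And>n. n < L \<Longrightarrow> norm (g n) \<le> C" and C: "C \<ge> 0"
    and s: "0 \<le> s" "s \<le> real L * \<tau>" and t: "0 \<le> t" "t \<le> real L * \<tau>"
  shows "norm (x (idx \<tau> t) - x (idx \<tau> s)) \<le> C * (\<bar>t - s\<bar> + \<tau>)"
proof -
  have le: "idx \<tau> r \<le> L" if "0 \<le> r" "r \<le> real L * \<tau>" for r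
  proof -
    have "real (idx \<tau> r) * \<tau> \<le> real L * \<tau>" using idx_bounds(1)[OF \<tau> that(1)] that(2) by linarith
    then show ?thesis using \<tau> by simp
  qed
  have *: "norm (x n - x m) \<le> real (n - m) * (\<tau> * C)" if "m \<le> n" "n \<le> L" for m n
    using that
  proof (induction n rule: dec_induct)
    case (step n)
    have "norm (x (Suc n) - x m) \<le> norm (x n - x m) + norm (\<tau> *\<^sub>R g n)"
      using step norm_triangle_ineq[of "x n - x m" "\<tau> *\<^sub>R g n"] by (simp add: rec algebra_simps)
    also have "\<dots> \<le> real (n - m) * (\<tau> * C) + \<tau> * C"
      using step g[of n] \<tau> by (intro add_mono) auto
    also have "\<dots> = real (Suc n - m) * (\<tau> * C)" using step by (simp add: Suc_diff_le algebra_simps)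
    finally show ?case .
  qed simp
  have main: "norm (x (idx \<tau> b) - x (idx \<tau> a)) \<le> C * (\<bar>b - a\<bar> + \<tau>)"
    if ab: "0 \<le> a" "a \<le> real L * \<tau>" "0 \<le> b" "b \<le> real L * \<tau>" "idx \<tau> a \<le> idx \<tau> b" for a b
  proof -
    have "real (idx \<tau> b - idx \<tau> a) * \<tau> = real (idx \<tau> b) * \<tau> - real (idx \<tau> a) * \<tau>"
      using ab(5) by (simp add: of_nat_diff left_diff_distrib)
    also have "\<dots> \<le> \<bar>b - a\<bar> + \<tau>" using idx_bounds[OF \<tau> ab(1)] idx_bounds[OF \<tau> ab(3)] by linarith
    finally have "C * (real (idx \<tau> b - idx \<tau> a) * \<tau>) \<le> C * (\<bar>b - a\<bar> + \<tau>)" using C by (rule mult_left_mono)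
    then show ?thesis using *[OF ab(5) le[OF ab(3,4)]] by (simp add: ac_simps)
  qed
  show ?thesis
    using main[OF s t] main[OF t s] by (cases "idx \<tau> s \<le> idx \<tau> t") (auto simp: norm_minus_commute abs_minus_commute)
qed

theorem limit_exists:
  fixes \<alpha> \<kappa> T :: real
  assumes \<alpha>: "\<alpha> > 0" and \<kappa>: "\<kappa> > 0" and T: "T > 0" and u0: "u0 \<in> VH3" and f: "sqint f" "fourier_coeff f 0 = 0"
  shows "\<exists>u \<theta> B M. B \<ge> 0 \<and> M \<ge> 0 \<and> u 0 = u0 \<and> \<theta> 0 = fourier_coeff f \<and>
    (\<forall>t. 0 \<le> t \<longrightarrow> t \<le> T \<longrightarrow> regular_state B M (u t) (\<theta> t)) \<and>
    (\<forall>t \<phi>. 0 \<le> t \<longrightarrow> t \<le> T \<longrightarrow> convex_on UNIV \<phi> \<longrightarrow> (\<forall>x. \<phi> x \<ge> 0) \<longrightarrow>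
       (\<exists>g. sqint g \<and> fourier_coeff g = \<theta> t \<and> (\<integral>\<^sup>+x. ennreal (\<phi> (g x)) \<partial>Q) \<le> (\<integral>\<^sup>+x. ennreal (\<phi> (f x)) \<partial>Q))) \<and>
    (\<forall>t k. 0 \<le> t \<longrightarrow> t \<le> T \<longrightarrow> set_integrable lborel {0..t} (\<lambda>s. ut_rhs \<alpha> (u s) (\<theta> s) k) \<and>
       u t k = u 0 k + (LINT s:{0..t}|lborel. ut_rhs \<alpha> (u s) (\<theta> s) k)) \<and>
    (\<forall>t k. 0 \<le> t \<longrightarrow> t \<le> T \<longrightarrow> set_integrable lborel {0..t} (\<lambda>s. tt_rhs \<kappa> (u s) (\<theta> s) k) \<and>
       \<theta> t k = \<theta> 0 k + (LINT s:{0..t}|lborel. tt_rhs \<kappa> (u s) (\<theta> s) k)) \<and>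
    (\<forall>k. (\<lambda>s. indicator {0..T} s *\<^sub>R \<theta> s k) \<in> borel_measurable borel) \<and>
    (\<forall>F. finite F \<longrightarrow> (\<integral>\<^sup>+s\<in>{0..T}. ennreal (\<Sum>k\<in>F. \<kappa> * symA k * (cmod (\<theta> s k))\<^sup>2) \<partial>lborel) \<le> ennreal (2 * M))"
proof -
  obtain B where "\<forall>N. \<exists>h L u \<theta>. approx \<alpha> \<kappa> T u0 f B N h L u \<theta>" using approx_exists[OF \<alpha> \<kappa> T u0 f] by blast
  then have "\<forall>N. \<exists>z. approx \<alpha> \<kappa> T u0 f B N (fst z) (fst (snd z)) (fst (snd (snd z))) (snd (snd (snd z)))" by (simp add: split_paired_Ex)
  from choice[OF this] obtain z where z: "\<forall>N. approx \<alpha> \<kappa> T u0 f B N (fst (z N)) (fst (snd (z N))) (fst (snd (snd (z N)))) (snd (snd (snd (z N))))" ..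
  define h where "h N = fst (z N)" for N
  define L where "L N = fst (snd (z N))" for N
  define v where "v N = fst (snd (snd (z N)))" for N
  define \<eta> where "\<eta> N = snd (snd (snd (z N)))" for N
  define K where "K N = boxk N - {0::wn}" for N
  define \<tau> where "\<tau> N = T / real (L N)" for N
  define c where "c N n = fourier_coeff (\<eta> N n)" for N n
  define M where "M = (\<integral>x. (f x)\<^sup>2 \<partial>Q)"
  have ap: "approx \<alpha> \<kappa> T u0 f B N (h N) (L N) (v N) (\<eta> N)" for N using spec[OF z, of N] by (simp add: h_def L_def v_def \<eta>_def)
  note ap' = ap[unfolded approx_def K_def[symmetric] \<tau>_def[symmetric] c_def[symmetric] M_def[symmetric] flux_h_def[symmetric]]
  have h0: "h N > 0" and h8: "8 * (real (Suc N) * h N) \<le> 1" and L0: "L N > 0" and tN: "\<tau> N \<le> 1 / real (Suc N)"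
    and v0: "v N 0 = (\<lambda>k. if k \<in> K N then u0 k else 0)" and c0: "c N 0 = fourier_coeff f" for N
    using ap'[of N] by (simp_all add: c_def)
  have adm: "admissible (K N) (v N n)" and BB: "(\<Sum>k\<in>K N. (ksq k)\<^sup>2 * (norm (v N n k))\<^sup>2) \<le> B"
    and sq: "sqint (\<eta> N n)" "(\<integral>x. (\<eta> N n x)\<^sup>2 \<partial>Q) \<le> M" and cz: "c N n 0 = 0" if "n \<le> L N" for N n
    using ap'[of N] that by (auto simp: c_def)
  have cvx: "(\<integral>\<^sup>+x. ennreal (\<phi> (\<eta> N n x)) \<partial>Q) \<le> (\<integral>\<^sup>+x. ennreal (\<phi> (f x)) \<partial>Q)"
    if "n \<le> L N" "convex_on UNIV \<phi>" "\<forall>x. \<phi> x \<ge> 0" for N n \<phi>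
    using ap'[of N] that by blast
  have vrec: "v N (Suc n) k = v N n k + \<tau> N *\<^sub>R (if k \<in> K N then ut_rhs \<alpha> (v N n) (c N n) k else 0)" if "n < L N" for N n k
    using ap'[of N] that by (simp add: ut_rhs_def c_def)
  have crec: "c N (Suc n) k = c N n k + \<tau> N *\<^sub>R (- flux_h \<kappa> (h N) (K N) (v N n) (c N n) k)" if "n < L N" for N n k
  proof -
    have "c N (Suc n) k = c N n k - \<tau> N *\<^sub>R flux_h \<kappa> (h N) (K N) (v N n) (c N n) k" using ap'[of N] that by blast
    then show ?thesis by simp
  qed
  have diss: "(\<Sum>n<L N. \<tau> N * (\<Sum>k\<in>F. lam (h N) \<kappa> k * (cmod (c N n k))\<^sup>2)) \<le> 2 * M" if "finite F" for N F
    using ap'[of N] that by (simp add: c_def)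
  have tp: "\<tau> N > 0" for N using T L0[of N] by (simp add: \<tau>_def)
  have LT: "real (L N) * \<tau> N = T" for N using L0[of N] by (simp add: \<tau>_def)
  have finK: "finite (K N)" for N by (simp add: K_def)
  have M0: "M \<ge> 0" by (simp add: M_def)
  have B0: "B \<ge> 0" by (rule order_trans[OF _ BB[of 0 0]]) (auto intro!: sum_nonneg)
  have inv_lim: "(\<lambda>N. 1 / real (Suc N)) \<longlonglongrightarrow> 0" using lim_1_over_n by (rule LIMSEQ_Suc)
  have tau_lim: "\<tau> \<longlonglongrightarrow> 0"
  proof (rule tendsto_sandwich[OF _ _ tendsto_const inv_lim])
    show "\<forall>\<^sub>F N in sequentially. 0 \<le> \<tau> N" by (intro always_eventually allI less_imp_le tp)
    show "\<forall>\<^sub>F N in sequentially. \<tau> N \<le> 1 / real (Suc N)" by (intro always_eventually allI tN)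
  qed
  have h_lim: "h \<longlonglongrightarrow> 0"
  proof (rule tendsto_sandwich[OF _ _ tendsto_const inv_lim])
    have "h N \<le> 1 / real (Suc N)" for N
    proof -
      have "real (Suc N) * h N \<ge> 0" using h0[of N] by (intro mult_nonneg_nonneg) auto
      then have "real (Suc N) * h N \<le> 1" using h8[of N] by linarith
      then show ?thesis by (simp add: field_simps)
    qed
    then show "\<forall>\<^sub>F N in sequentially. h N \<le> 1 / real (Suc N)" by (intro always_eventually allI)
    show "\<forall>\<^sub>F N in sequentially. 0 \<le> h N" by (intro always_eventually allI less_imp_le h0)
  qed
  have hK: "8 * \<bar>h N * kreal m $ j\<bar> \<le> 1" if "m \<in> K N" for N m j
  proof -
    have "\<bar>kreal m $ j\<bar> \<le> real (Suc N)" using abs_kreal_boxk[of m N j] that by (simp add: K_def)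
    then have "h N * \<bar>kreal m $ j\<bar> \<le> h N * real (Suc N)" using h0[of N] by (intro mult_left_mono) auto
    moreover have "\<bar>h N * kreal m $ j\<bar> = h N * \<bar>kreal m $ j\<bar>" using h0[of N] by (simp add: abs_mult)
    ultimately show ?thesis using h8[of N] by (simp only: mult.commute)
  qed
  have vz: "v N n k = 0" if "n \<le> L N" "k \<notin> K N" for N n k using adm[OF that(1)] that(2) by (auto simp: admissible_def)
  have v00: "v N n 0 = 0" if "n \<le> L N" for N n using vz[OF that, of 0] by (simp add: K_def)
  have vB: "h2sq (v N n) \<le> ennreal B" if "n \<le> L N" for N n
    using BB[OF that] vz[OF that] finK by (subst nns_finite_support[of "K N"]) (auto intro: ennreal_leI)
  have cM: "(\<Sum>k\<in>A. (cmod (c N n k))\<^sup>2) \<le> M" if "n \<le> L N" "finite A" for N n A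
    unfolding c_def by (rule coeff_sum_le[OF sq[OF that(1)] that(2)])
  have cMn: "l2sq (c N n) \<le> ennreal M" if "n \<le> L N" for N n
    using cM[OF that] by (intro nns_le_finite_sums) (auto intro: ennreal_leI)
  have csq: "cmod (c N n k) \<le> sqrt M" if "n \<le> L N" for N n k
    using cM[OF that, of "{k}"] by (intro real_le_rsqrt) simp
  have vsq: "(\<Sum>k\<in>K N. (norm (v N n k))\<^sup>2) \<le> B" if "n \<le> L N" for N n
  proof -
    have "ennreal (\<Sum>k\<in>K N. (norm (v N n k))\<^sup>2) \<le> l2sq (v N n)"
      using nns_finite_sum_le[OF finK, of "\<lambda>k. ennreal ((norm (v N n k))\<^sup>2)" N] by simp
    also have "\<dots> \<le> ennreal B" by (rule nns_ksq_mono(2)[where u="v N n", OF v00[OF that] vB[OF that]])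
    finally show ?thesis using B0 by simp
  qed
  have vn: "norm (v N n k) \<le> sqrt B" if "n \<le> L N" for N n k
  proof (cases "k \<in> K N")
    case True
    have "(norm (v N n k))\<^sup>2 \<le> (\<Sum>k\<in>K N. (norm (v N n k))\<^sup>2)" using True finK by (intro member_le_sum) auto
    then show ?thesis using vsq[OF that] by (intro real_le_rsqrt) linarith
  qed (use vz[OF that] B0 in auto)
  \<comment> \<open>The speed of a velocity mode is bounded uniformly in k, that of a temperature
    mode grows like |k|^2 through diffusion. \<open>diagonal_limit\<close> admits a constant for
    each mode.\<close>
  define CU where "CU = sqrt (8 * M + 8 * (4 * pi\<^sup>2 * (sk * (B * B))))"
  define CT where "CT k = \<kappa> * symA k * sqrt M + 3 * (2 * pi * sqrt (ksq k) * (B + M))" for k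
  have CU0: "CU \<ge> 0" using M0 B0 sk(2) by (simp add: CU_def)
  have CT0: "CT k \<ge> 0" for k using M0 B0 \<kappa> by (simp add: CT_def)
  define gu where "gu N n k = (if k \<in> K N then ut_rhs \<alpha> (v N n) (c N n) k else 0)" for N n k
  define gt where "gt N n k = - flux_h \<kappa> (h N) (K N) (v N n) (c N n) k" for N n k
  have gu: "norm (gu N n k) \<le> CU" if "n \<le> L N" for N n k
  proof (cases "k \<in> K N")
    case True
    have "norm (ut_rhs \<alpha> (v N n) (c N n) k) \<le> 1 * norm (force (v N n) (c N n) k)"
      unfolding ut_rhs_def norm_scaleR using one_plus_symA_pos[of \<alpha> k] by (intro mult_right_mono) auto
    also have "\<dots> \<le> CU" unfolding CU_def mult_1 by (rule force_norm_bound[OF v00[OF that] vB[OF that] B0 csq[OF that] M0])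
    finally show ?thesis using True by (simp add: gu_def)
  qed (use CU0 in \<open>simp add: gu_def\<close>)
  have gt: "norm (gt N n k) \<le> CT k" if "n \<le> L N" for N n k
    unfolding gt_def norm_minus_cancel CT_def using that
    by (intro flux_h_bound[OF \<kappa> h0 finK hK vsq cM]) auto
  have idx_le: "idx (\<tau> N) t \<le> L N" if "0 \<le> t" "t \<le> T" for N t
  proof -
    have "real (idx (\<tau> N) t) * \<tau> N \<le> real (L N) * \<tau> N" using idx_bounds(1)[OF tp that(1), of N] that LT[of N] by linarith
    then show ?thesis using tp[of N] by simp
  qed
  \<comment> \<open>Pairing both coefficients lets one subsequence serve velocity and
    temperature.\<close>
  define X where "X N k t = (v N (idx (\<tau> N) t) k, c N (idx (\<tau> N) t) k)" for N k t
  obtain r Y where r: "strict_mono r" and Y: "\<And>k t. 0 \<le> t \<Longrightarrow> t \<le> T \<Longrightarrow> (\<lambda>N. X (r N) k t) \<longlonglongrightarrow> Y k t"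
  proof -
    have "\<exists>r Y. strict_mono r \<and> (\<forall>k t. 0 \<le> t \<longrightarrow> t \<le> T \<longrightarrow> (\<lambda>N. X (r N) k t) \<longlonglongrightarrow> Y k t)"
    proof (rule diagonal_limit[OF T, where Bd="\<lambda>k. sqrt B + sqrt M" and D="\<lambda>k. CU + CT k" and e=\<tau>])
      fix N k t assume t: "0 \<le> t" "t \<le> T"
      show "norm (X N k t) \<le> sqrt B + sqrt M"
        unfolding X_def by (rule order_trans[OF norm_Pair_le]) (intro add_mono vn csq idx_le t)
      fix s assume s: "0 \<le> s" "s \<le> T"
      have "norm (X N k t - X N k s) \<le> norm (v N (idx (\<tau> N) t) k - v N (idx (\<tau> N) s) k) + norm (c N (idx (\<tau> N) t) k - c N (idx (\<tau> N) s) k)"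
        unfolding X_def by (simp add: norm_Pair_le)
      also have "\<dots> \<le> CU * (\<bar>t - s\<bar> + \<tau> N) + CT k * (\<bar>t - s\<bar> + \<tau> N)"
      proof (rule add_mono)
        show "norm (v N (idx (\<tau> N) t) k - v N (idx (\<tau> N) s) k) \<le> CU * (\<bar>t - s\<bar> + \<tau> N)"
          using s t by (intro step_lipschitz[where L="L N" and g="\<lambda>n. gu N n k" and x="\<lambda>n. v N n k"] tp CU0)
            (auto simp: vrec gu_def[symmetric] LT intro!: gu)
        show "norm (c N (idx (\<tau> N) t) k - c N (idx (\<tau> N) s) k) \<le> CT k * (\<bar>t - s\<bar> + \<tau> N)"
          using s t by (intro step_lipschitz[where L="L N" and g="\<lambda>n. gt N n k" and x="\<lambda>n. c N n k"] tp CT0)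
            (auto simp: crec gt_def[symmetric] LT intro!: gt)
      qed
      finally show "norm (X N k t - X N k s) \<le> (CU + CT k) * (\<bar>t - s\<bar> + \<tau> N)" by (simp add: distrib_right)
    qed (use tau_lim CU0 CT0 in auto)
    then show ?thesis using that by blast
  qed
  define u where "u t k = fst (Y k t)" for t k
  define \<theta> where "\<theta> t k = snd (Y k t)" for t k
  define VV where "VV N t = v (r N) (idx (\<tau> (r N)) t)" for N t
  define CC where "CC N t = c (r N) (idx (\<tau> (r N)) t)" for N t
  have ul: "(\<lambda>N. VV N t k) \<longlonglongrightarrow> u t k" and tl: "(\<lambda>N. CC N t k) \<longlonglongrightarrow> \<theta> t k" if "0 \<le> t" "t \<le> T" for t k
    using tendsto_fst[OF Y[OF that, of k]] tendsto_snd[OF Y[OF that, of k]] by (simp_all add: X_def u_def \<theta>_def VV_def CC_def)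
  note VB = vB[OF idx_le] and CMn = cMn[OF idx_le]
  have trl: "(\<lambda>N. \<tau> (r N)) \<longlonglongrightarrow> 0" and hrl: "(\<lambda>N. h (r N)) \<longlonglongrightarrow> 0"
    using LIMSEQ_subseq_LIMSEQ[OF tau_lim r] LIMSEQ_subseq_LIMSEQ[OF h_lim r] by (simp_all add: comp_def)
  have inK: "\<forall>\<^sub>F N in sequentially. k \<in> K (r N)" if k: "k \<noteq> 0" for k
  proof -
    obtain N0 where "\<forall>N\<ge>N0. k \<in> boxk N" using boxk_exhaust by blast
    then have "k \<in> K (r N)" if "N \<ge> N0" for N using k that seq_suble[OF r, of N] by (auto simp: K_def)
    then show ?thesis by (auto simp: eventually_sequentially)
  qed
  have u_init: "u 0 = u0"
  proof
    fix k
    have "\<forall>\<^sub>F N in sequentially. VV N 0 k = u0 k"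
    proof (cases "k = 0")
      case True
      have "u0 0 = 0" using u0 by (auto simp: VH3_def Hsv_def zero_wn)
      then show ?thesis using True by (simp add: VV_def idx_def v0 K_def)
    next
      case False
      show ?thesis by (rule eventually_mono[OF inK[OF False]]) (simp add: VV_def idx_def v0)
    qed
    then have "(\<lambda>N. VV N 0 k) \<longlonglongrightarrow> u0 k" by (rule tendsto_eventually)
    then show "u 0 k = u0 k" using ul[of 0 k] T by (auto intro: LIMSEQ_unique)
  qed
  have t_init: "\<theta> 0 = fourier_coeff f"
  proof
    fix k
    have "CC N 0 k = fourier_coeff f k" for N by (simp add: CC_def idx_def c0)
    then show "\<theta> 0 k = fourier_coeff f k" using tl[of 0 k] T by (auto intro: LIMSEQ_unique)
  qed
  have reg: "regular_state B M (u t) (\<theta> t)" if t: "0 \<le> t" "t \<le> T" for t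
  proof -
    note a = adm[OF idx_le[OF t]]
    have "u t (- k) = cconj3 (u t k)" for k
    proof -
      have "(\<lambda>N. cconj3 (VV N t k)) \<longlonglongrightarrow> cconj3 (u t k)"
        by (rule bounded_linear.tendsto[OF bounded_linear_cconj3 ul[OF t]])
      moreover have "cconj3 (VV N t k) = VV N t (- k)" for N using a[of "r N"] by (auto simp: VV_def admissible_def real_vf_iff)
      ultimately show ?thesis using ul[OF t, of "- k"] by (auto intro: LIMSEQ_unique)
    qed
    moreover have "cdot (kvec k) (u t k) = 0" for k
    proof -
      have "(\<lambda>N. cdot (kvec k) (VV N t k)) \<longlonglongrightarrow> cdot (kvec k) (u t k)"
        unfolding cdot_def by (intro tendsto_intros ul[OF t])
      moreover have "cdot (kvec k) (VV N t k) = 0" for N using a[of "r N"] by (auto simp: VV_def admissible_def divfree_def)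
      ultimately show ?thesis by (simp add: LIMSEQ_const_iff)
    qed
    moreover have "u t 0 = 0" using ul[OF t, of 0] v00[OF idx_le[OF t]] by (simp add: VV_def LIMSEQ_const_iff)
    moreover have "h2sq (u t) \<le> ennreal B"
    proof (rule nns_tendsto_le[where c="\<lambda>N k. (ksq k)\<^sup>2 * (norm (VV N t k))\<^sup>2" and F=sequentially])
      show "(\<lambda>N. (ksq k)\<^sup>2 * (norm (VV N t k))\<^sup>2) \<longlonglongrightarrow> (ksq k)\<^sup>2 * (norm (u t k))\<^sup>2" for k
        by (intro tendsto_intros ul t)
      show "\<forall>\<^sub>F N in sequentially. h2sq (VV N t) \<le> ennreal B"
        unfolding VV_def by (intro always_eventually allI VB t)
    qed simp
    moreover have "\<theta> t (- k) = cnj (\<theta> t k)" for k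
    proof -
      have "(\<lambda>N. cnj (CC N t k)) \<longlonglongrightarrow> cnj (\<theta> t k)" by (intro tendsto_intros tl t)
      moreover have "cnj (CC N t k) = CC N t (- k)" for N
        using real_fcc[of "\<eta> (r N) (idx (\<tau> (r N)) t)"] sq(1)[OF idx_le[OF t], of "r N"]
        by (simp add: CC_def c_def fourier_coeff_fcc sqint_def real_sf_def negk_eq)
      ultimately show ?thesis using tl[OF t, of "- k"] by (auto intro: LIMSEQ_unique)
    qed
    moreover have "\<theta> t 0 = 0" using tl[OF t, of 0] cz[OF idx_le[OF t]] by (simp add: CC_def LIMSEQ_const_iff)
    moreover have "l2sq (\<theta> t) \<le> ennreal M"
    proof (rule nns_tendsto_le[where c="\<lambda>N k. (cmod (CC N t k))\<^sup>2" and F=sequentially])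
      show "(\<lambda>N. (cmod (CC N t k))\<^sup>2) \<longlonglongrightarrow> (cmod (\<theta> t k))\<^sup>2" for k
        by (intro tendsto_intros tl t)
      show "\<forall>\<^sub>F N in sequentially. l2sq (CC N t) \<le> ennreal M"
        unfolding CC_def by (intro always_eventually allI CMn t)
    qed simp
    ultimately show ?thesis by (simp add: regular_state_def real_vf_iff divfree_def real_sf_def negk_eq)
  qed
  \<comment> \<open>The function g may depend on \<phi>: for each convex function the weak limit is
    formed within its own bound, and only the coefficients are common to all choices.\<close>
  have cx: "\<exists>g. sqint g \<and> fourier_coeff g = \<theta> t \<and> (\<integral>\<^sup>+x. ennreal (\<phi> (g x)) \<partial>Q) \<le> (\<integral>\<^sup>+x. ennreal (\<phi> (f x)) \<partial>Q)"
    if t: "0 \<le> t" "t \<le> T" and p: "convex_on UNIV \<phi>" "\<forall>x. \<phi> x \<ge> 0" for t \<phi>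
  proof (rule weak_limit[where g="\<lambda>N. \<eta> (r N) (idx (\<tau> (r N)) t)", OF sq(1)[OF idx_le[OF t]] sq(2)[OF idx_le[OF t]] _ p(1) _ cvx[OF idx_le[OF t] p]])
    show "(\<lambda>N. fourier_coeff (\<eta> (r N) (idx (\<tau> (r N)) t)) k) \<longlonglongrightarrow> \<theta> t k" for k
      using tl[OF t, of k] by (simp add: CC_def c_def)
  qed (use p in auto)
  have gul: "(\<lambda>N. gu (r N) (idx (\<tau> (r N)) t) k) \<longlonglongrightarrow> ut_rhs \<alpha> (u t) (\<theta> t) k" if t: "0 \<le> t" "t \<le> T" for t k
  proof (cases "k = 0")
    case False
    have "(\<lambda>N. advect (VV N t) k) \<longlonglongrightarrow> advect (u t) k"
    proof (rule advect_tendsto[OF ul[OF t] _ _ B0])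
      show "VV N t 0 = 0" for N unfolding VV_def by (intro v00 idx_le t)
      show "h2sq (VV N t) \<le> ennreal B" for N unfolding VV_def by (rule VB[OF t])
    qed simp
    then have "(\<lambda>N. ut_rhs \<alpha> (VV N t) (CC N t) k) \<longlonglongrightarrow> ut_rhs \<alpha> (u t) (\<theta> t) k"
      unfolding ut_rhs_def by (intro tendsto_intros force_tendsto tl[OF t])
    then show ?thesis
      by (rule Lim_transform_eventually)
         (rule eventually_mono[OF inK[OF False]], simp add: gu_def VV_def CC_def)
  qed (simp add: gu_def K_def ut_rhs_def)
  have gtl: "(\<lambda>N. gt (r N) (idx (\<tau> (r N)) t) k) \<longlonglongrightarrow> tt_rhs \<kappa> (u t) (\<theta> t) k" if t: "0 \<le> t" "t \<le> T" for t k
  proof -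
    have "(\<lambda>N. flux_h \<kappa> (h (r N)) (K (r N)) (VV N t) (CC N t) k) \<longlonglongrightarrow> of_real (\<kappa> * symA k) * \<theta> t k + div_flux (u t) (\<theta> t) k"
    proof (rule flux_h_tendsto[OF hrl h0 finK _ hK ul[OF t] tl[OF t] _ _ B0])
      show "k \<notin> K (r N) \<Longrightarrow> VV N t k = 0" for N k unfolding VV_def by (intro vz idx_le t)
      show "VV N t 0 = 0" for N unfolding VV_def by (intro v00 idx_le t)
      show "h2sq (VV N t) \<le> ennreal B" for N unfolding VV_def by (rule VB[OF t])
      show "l2sq (CC N t) \<le> ennreal M" for N unfolding CC_def by (rule CMn[OF t])
    qed
    then show ?thesis unfolding gt_def tt_rhs_def VV_def CC_def by (rule tendsto_minus)
  qed
  have uint: "set_integrable lborel {0..t} (\<lambda>s. ut_rhs \<alpha> (u s) (\<theta> s) k)"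
      "u t k = u 0 k + (LINT s:{0..t}|lborel. ut_rhs \<alpha> (u s) (\<theta> s) k)" if t: "0 \<le> t" "t \<le> T" for t k
  proof -
    note * = limit_integral[where L="\<lambda>N. L (r N)" and x="\<lambda>N n. v (r N) n k" and g="\<lambda>N n. gu (r N) n k" and C=CU
        and X="\<lambda>t. u t k" and G="\<lambda>s. ut_rhs \<alpha> (u s) (\<theta> s) k" and T=T, folded \<tau>_def, OF T L0 trl _ gu _ gul t]
    show "set_integrable lborel {0..t} (\<lambda>s. ut_rhs \<alpha> (u s) (\<theta> s) k)"
      "u t k = u 0 k + (LINT s:{0..t}|lborel. ut_rhs \<alpha> (u s) (\<theta> s) k)"
      by (rule *; use vrec ul in \<open>simp add: gu_def VV_def\<close>)+
  qed
  have tint: "set_integrable lborel {0..t} (\<lambda>s. tt_rhs \<kappa> (u s) (\<theta> s) k)"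
      "\<theta> t k = \<theta> 0 k + (LINT s:{0..t}|lborel. tt_rhs \<kappa> (u s) (\<theta> s) k)" if t: "0 \<le> t" "t \<le> T" for t k
  proof -
    note * = limit_integral[where L="\<lambda>N. L (r N)" and x="\<lambda>N n. c (r N) n k" and g="\<lambda>N n. gt (r N) n k" and C="CT k"
        and X="\<lambda>t. \<theta> t k" and G="\<lambda>s. tt_rhs \<kappa> (u s) (\<theta> s) k" and T=T, folded \<tau>_def, OF T L0 trl _ gt _ gtl t]
    show "set_integrable lborel {0..t} (\<lambda>s. tt_rhs \<kappa> (u s) (\<theta> s) k)"
      "\<theta> t k = \<theta> 0 k + (LINT s:{0..t}|lborel. tt_rhs \<kappa> (u s) (\<theta> s) k)"
      by (rule *; use crec tl in \<open>simp add: gt_def CC_def\<close>)+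
  qed
  have meas: "(\<lambda>s. indicator {0..T} s *\<^sub>R \<theta> s k) \<in> borel_measurable borel" for k
  proof (rule borel_measurable_LIMSEQ_metric[where f="\<lambda>N s. indicator {0..T} s *\<^sub>R CC N s k"])
    show "(\<lambda>s. indicator {0..T} s *\<^sub>R CC N s k) \<in> borel_measurable borel" for N
      unfolding CC_def by measurable
    show "(\<lambda>N. indicator {0..T} s *\<^sub>R CC N s k) \<longlonglongrightarrow> indicator {0..T} s *\<^sub>R \<theta> s k" for s
      using tl[of s k] by (cases "s \<in> {0..T}") auto
  qed
  have dis: "(\<integral>\<^sup>+s\<in>{0..T}. ennreal (\<Sum>k\<in>F. \<kappa> * symA k * (cmod (\<theta> s k))\<^sup>2) \<partial>lborel) \<le> ennreal (2 * M)" if F: "finite F" for F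
  proof (rule nn_integral_lim_le[where start=0])
    let ?g = "\<lambda>N n. \<Sum>k\<in>F. lam (h (r N)) \<kappa> k * (cmod (c (r N) n k))\<^sup>2"
    \<comment> \<open>The final time is left out because the dissipation sum covers the completed
      steps n < L, while at s = T the index is already L.\<close>
    let ?u = "\<lambda>N s. ennreal (?g N (idx (\<tau> (r N)) s)) * indicator {0..<T} s"
    show "?u N \<in> borel_measurable lborel" for N by measurable
    show "AE s in lborel. (\<lambda>N. ?u N s) \<longlonglongrightarrow> ennreal (\<Sum>k\<in>F. \<kappa> * symA k * (cmod (\<theta> s k))\<^sup>2) * indicator {0..T} s"
    proof (rule AE_mp[OF AE_lborel_singleton[of T]], intro AE_I2 impI)
      fix s assume "s \<noteq> T"
      show "(\<lambda>N. ?u N s) \<longlonglongrightarrow> ennreal (\<Sum>k\<in>F. \<kappa> * symA k * (cmod (\<theta> s k))\<^sup>2) * indicator {0..T} s"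
      proof (cases "0 \<le> s \<and> s < T")
        case True
        then have s: "0 \<le> s" "s \<le> T" by auto
        have "\<And>n. h (r n) \<noteq> 0" using h0 by (metis less_irrefl)
        then have "(\<lambda>N. ?g N (idx (\<tau> (r N)) s)) \<longlonglongrightarrow> (\<Sum>k\<in>F. \<kappa> * symA k * (cmod (\<theta> s k))\<^sup>2)"
          by (intro tendsto_intros lam_tendsto hrl tl[OF s, unfolded CC_def])
        then show ?thesis using True by (simp add: tendsto_ennrealI)
      qed (use \<open>s \<noteq> T\<close> in auto)
    qed
    fix N :: nat
    have gn: "?g N n \<ge> 0" for n using lam_bounds(1)[OF \<kappa> h0] by (intro sum_nonneg mult_nonneg_nonneg) auto
    have si: "set_integrable lborel {0..<T} (\<lambda>s. ?g N (idx (\<tau> (r N)) s))"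
      "(LINT s:{0..<T}|lborel. ?g N (idx (\<tau> (r N)) s)) = (\<Sum>i<L (r N). \<tau> (r N) *\<^sub>R ?g N i)"
      using step_integral[OF tp[of "r N"], of "L (r N)" "?g N"] by (simp_all add: LT)
    have "(\<integral>\<^sup>+s. ?u N s \<partial>lborel) = (\<integral>\<^sup>+s. ennreal (indicator {0..<T} s *\<^sub>R ?g N (idx (\<tau> (r N)) s)) \<partial>lborel)"
      by (rule nn_integral_cong) (auto split: split_indicator)
    also have "\<dots> = ennreal (LINT s:{0..<T}|lborel. ?g N (idx (\<tau> (r N)) s))"
      unfolding set_lebesgue_integral_def using si(1) gn
      by (intro nn_integral_eq_integral) (auto simp: set_integrable_def)
    also have "\<dots> \<le> ennreal (2 * M)" unfolding si(2) using diss[OF F, of "r N"] by (intro ennreal_leI) simp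
    finally show "(\<integral>\<^sup>+s. ?u N s \<partial>lborel) \<le> ennreal (2 * M)" .
  qed
  show ?thesis
    by (intro exI[of _ u] exI[of _ \<theta>] exI[of _ B] exI[of _ M] conjI allI impI;
        (rule B0 M0 u_init t_init reg cx uint tint meas dis; assumption))
qed

section \<open>Regularity of the limit\<close>

lemma LINT_split:
  fixes g :: "real \<Rightarrow> 'a::{banach,second_countable_topology}"
  assumes i: "set_integrable lborel {0..t} g" and s: "0 \<le> s" "s \<le> t"
  shows "(LINT x:{0..t}|lborel. g x) - (LINT x:{0..s}|lborel. g x) = (LINT x:{s..t}|lborel. g x)"
    and "set_integrable lborel {s..t} g" "set_integrable lborel {0..s} g"
proof -
  show 1: "set_integrable lborel {s..t} g" "set_integrable lborel {0..s} g"
    using i s by (auto intro: set_integrable_subset)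
  have "{0..t} = {0..s} \<union> {s..t}" using s by auto
  then have "(LINT x:{0..t}|lborel. g x) = (LINT x:{0..s} \<union> {s..t}|lborel. g x)" by simp
  also have "\<dots> = (LINT x:{0..s}|lborel. g x) + (LINT x:{s..t}|lborel. g x)"
    by (rule set_integral_Un_AE[OF AE_mp[OF AE_lborel_singleton[of s]] _ _ 1(2,1)]) auto
  finally show "(LINT x:{0..t}|lborel. g x) - (LINT x:{0..s}|lborel. g x) = (LINT x:{s..t}|lborel. g x)" by simp
qed

text \<open>Cauchy-Schwarz in time; the factor t - s later becomes continuity in H^3 and, in the
  uniqueness proof, a factor T.\<close>

lemma increment_bound:
  fixes g :: "real \<Rightarrow> 'a::{banach,second_countable_topology}"
  assumes i: "set_integrable lborel {s..t} g" and s: "s \<le> t"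
  shows "ennreal ((norm (LINT x:{s..t}|lborel. g x))\<^sup>2) \<le> ennreal (t - s) * (\<integral>\<^sup>+x\<in>{s..t}. ennreal ((norm (g x))\<^sup>2) \<partial>lborel)"
proof -
  let ?I = "indicator {s..t} :: real \<Rightarrow> ennreal"
  have m: "(\<lambda>x. indicator {s..t} x *\<^sub>R g x) \<in> borel_measurable lborel"
    using i by (auto simp: set_integrable_def)
  have m': "(\<lambda>x. ennreal (norm (indicator {s..t} x *\<^sub>R g x))) \<in> borel_measurable lborel" using m by measurable
  have "ennreal (norm (LINT x:{s..t}|lborel. g x)) \<le> (\<integral>\<^sup>+x. ennreal (norm (indicator {s..t} x *\<^sub>R g x)) \<partial>lborel)"
    unfolding set_lebesgue_integral_def by (rule integral_norm_bound_ennreal) (use i in \<open>simp add: set_integrable_def\<close>)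
  also have "\<dots> = (\<integral>\<^sup>+x. ?I x * ennreal (norm (indicator {s..t} x *\<^sub>R g x)) \<partial>lborel)"
    by (rule nn_integral_cong) (auto split: split_indicator)
  finally have "(ennreal (norm (LINT x:{s..t}|lborel. g x)))\<^sup>2 \<le> (\<integral>\<^sup>+x. ?I x * ennreal (norm (indicator {s..t} x *\<^sub>R g x)) \<partial>lborel)\<^sup>2"
    by (rule power_mono) simp
  also have "\<dots> \<le> (\<integral>\<^sup>+x. (?I x)\<^sup>2 \<partial>lborel) * (\<integral>\<^sup>+x. (ennreal (norm (indicator {s..t} x *\<^sub>R g x)))\<^sup>2 \<partial>lborel)"
    by (rule Cauchy_Schwarz_nn_integral[OF _ m']) measurable
  also have "(\<integral>\<^sup>+x. (?I x)\<^sup>2 \<partial>lborel) = ennreal (t - s)"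
  proof -
    have "(?I x)\<^sup>2 = ?I x" for x by (simp add: power2_eq_square split: split_indicator)
    then show ?thesis using s by simp
  qed
  also have "(\<integral>\<^sup>+x. (ennreal (norm (indicator {s..t} x *\<^sub>R g x)))\<^sup>2 \<partial>lborel) = (\<integral>\<^sup>+x\<in>{s..t}. ennreal ((norm (g x))\<^sup>2) \<partial>lborel)"
    by (rule nn_integral_cong) (auto simp: ennreal_power split: split_indicator)
  finally show ?thesis by (simp add: ennreal_power)
qed

lemma weighted_increment_bound:
  fixes g :: "real \<Rightarrow> wn \<Rightarrow> 'a::{banach,second_countable_topology}"
  assumes i: "\<And>k. set_integrable lborel {s..t} (\<lambda>x. g x k)" and s: "s \<le> t" and w: "\<And>k. w k \<ge> 0"
  shows "nns (\<lambda>k. ennreal (w k * (norm (LINT x:{s..t}|lborel. g x k))\<^sup>2))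
     \<le> ennreal (t - s) * (\<integral>\<^sup>+x\<in>{s..t}. nns (\<lambda>k. ennreal (w k * (norm (g x k))\<^sup>2)) \<partial>lborel)"
proof -
  let ?h = "\<lambda>k x. ennreal (w k * (norm (indicator {s..t} x *\<^sub>R g x k))\<^sup>2)"
  have m: "?h k \<in> borel_measurable lborel" for k
  proof -
    have "(\<lambda>x. indicator {s..t} x *\<^sub>R g x k) \<in> borel_measurable lborel" using i[of k] by (auto simp: set_integrable_def)
    then show ?thesis by measurable
  qed
  have c: "(\<integral>\<^sup>+x. ?h k x \<partial>lborel) = ennreal (w k) * (\<integral>\<^sup>+x\<in>{s..t}. ennreal ((norm (g x k))\<^sup>2) \<partial>lborel)" for k
  proof -
    have "(\<lambda>x. indicator {s..t} x *\<^sub>R g x k) \<in> borel_measurable lborel" using i[of k] by (auto simp: set_integrable_def)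
    then have "(\<lambda>x. ennreal ((norm (indicator {s..t} x *\<^sub>R g x k))\<^sup>2)) \<in> borel_measurable lborel" by measurable
    then have "(\<integral>\<^sup>+x. ?h k x \<partial>lborel) = ennreal (w k) * (\<integral>\<^sup>+x. ennreal ((norm (indicator {s..t} x *\<^sub>R g x k))\<^sup>2) \<partial>lborel)"
      using w by (simp add: ennreal_mult nn_integral_cmult)
    also have "(\<integral>\<^sup>+x. ennreal ((norm (indicator {s..t} x *\<^sub>R g x k))\<^sup>2) \<partial>lborel) = (\<integral>\<^sup>+x\<in>{s..t}. ennreal ((norm (g x k))\<^sup>2) \<partial>lborel)"
      by (rule nn_integral_cong) (auto split: split_indicator)
    finally show ?thesis .
  qed
  have "nns (\<lambda>k. ennreal (w k * (norm (LINT x:{s..t}|lborel. g x k))\<^sup>2)) \<le> nns (\<lambda>k. ennreal (t - s) * (\<integral>\<^sup>+x. ?h k x \<partial>lborel))"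
  proof (rule nns_mono)
    fix k
    have "ennreal (w k * (norm (LINT x:{s..t}|lborel. g x k))\<^sup>2) = ennreal (w k) * ennreal ((norm (LINT x:{s..t}|lborel. g x k))\<^sup>2)"
      using w by (simp add: ennreal_mult)
    also have "\<dots> \<le> ennreal (w k) * (ennreal (t - s) * (\<integral>\<^sup>+x\<in>{s..t}. ennreal ((norm (g x k))\<^sup>2) \<partial>lborel))"
      by (intro mult_left_mono increment_bound i s) simp
    finally show "ennreal (w k * (norm (LINT x:{s..t}|lborel. g x k))\<^sup>2) \<le> ennreal (t - s) * (\<integral>\<^sup>+x. ?h k x \<partial>lborel)"
      unfolding c by (simp only: mult.left_commute)
  qed
  also have "\<dots> = ennreal (t - s) * (\<integral>\<^sup>+x. nns (\<lambda>k. ?h k x) \<partial>lborel)"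
    unfolding nns_cmult nns_integral_swap[OF m] ..
  also have "(\<integral>\<^sup>+x. nns (\<lambda>k. ?h k x) \<partial>lborel) = (\<integral>\<^sup>+x\<in>{s..t}. nns (\<lambda>k. ennreal (w k * (norm (g x k))\<^sup>2)) \<partial>lborel)"
    by (rule nn_integral_cong) (auto split: split_indicator)
  finally show ?thesis .
qed

lemma powr_ksq: "u 0 = 0 \<Longrightarrow> ksq k powr real n * (norm (u k))\<^sup>2 = (ksq k)^n * (norm (u k))\<^sup>2"
  using ksq_pos[of k] by (cases "k = 0") (auto simp: powr_realpow)

text \<open>At the origin \<open>0 powr 0 = 0\<close>, so the defining sums ignore the mean; the
  vanishing mean reconciles them with plain sums of squares.\<close>

lemma hs_sq_simps:
  "c 0 = 0 \<Longrightarrow> hs_sq 0 c = l2sq c"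
  "hs_sq 1 c = nns (\<lambda>k. ennreal (ksq k * (cmod (c k))\<^sup>2))"
  "hs_sq (-1) c = nns (\<lambda>k. ennreal ((cmod (c k))\<^sup>2 / ksq k))"
  "hsv_sq 1 u = nns (\<lambda>k. ennreal (ksq k * (norm (u k))\<^sup>2))"
  "u 0 = 0 \<Longrightarrow> hsv_sq 2 u = h2sq u"
  unfolding hs_sq_def hsv_sq_def
  using powr_ksq[of c _ 0] powr_ksq[of u _ 2]
  by (auto intro!: nn_integral_cong simp: powr_minus_divide)

text \<open>One derivative of a product is distributed by |k| \<le> |k - m| + |m|. The term with two
  gradients is a product of H^1 functions, the term with two derivatives on one factor pairs
  summable coefficients with square-summable ones; both cost the H^2 norm twice.\<close>

lemma advect_H1:
  assumes u0: "u 0 = 0" and B: "h2sq u \<le> ennreal B" "B \<ge> 0"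
  shows "nns (\<lambda>k. ennreal (ksq k * (norm (advect u k))\<^sup>2)) \<le> ennreal (16 * pi\<^sup>2 * (sk * (B * B)))"
proof -
  define a where "a k = ennreal (norm (u k))" for k
  define b where "b k = ennreal (sqrt (ksq k) * norm (u k))" for k
  define d where "d k = ennreal (ksq k * norm (u k))" for k
  have pt: "ennreal (sqrt (ksq k)) * cnv a b k \<le> cnv b b k + cnv a d k" for k
  proof -
    have "ennreal (sqrt (ksq k)) * cnv a b k = nns (\<lambda>m. ennreal (sqrt (ksq k) * (norm (u (k - m)) * (sqrt (ksq m) * norm (u m)))))"
      unfolding cnv_def nns_cmult[symmetric] by (simp add: a_def b_def ennreal_mult)
    also have "\<dots> \<le> nns (\<lambda>m. b (k - m) * b m + a (k - m) * d m)"
    proof (rule nns_mono)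
      fix m
      let ?z = "norm (u (k - m)) * (sqrt (ksq m) * norm (u m))"
      have "sqrt (ksq k) \<le> sqrt (ksq (k - m)) + sqrt (ksq m)" using sqrt_ksq_triangle[of "k - m" m] by simp
      then have "sqrt (ksq k) * ?z \<le> (sqrt (ksq (k - m)) + sqrt (ksq m)) * ?z" by (intro mult_right_mono) auto
      also have "\<dots> = (sqrt (ksq (k - m)) * norm (u (k - m))) * (sqrt (ksq m) * norm (u m)) + norm (u (k - m)) * ((sqrt (ksq m) * sqrt (ksq m)) * norm (u m))"
      proof -
        have "(x + y) * (p * (y * q)) = (x * p) * (y * q) + p * ((y * y) * q)" for x y p q :: real
          by (simp add: algebra_simps)
        then show ?thesis .
      qed
      also have "sqrt (ksq m) * sqrt (ksq m) = ksq m" by simp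
      finally have "ennreal (sqrt (ksq k) * ?z) \<le> ennreal ((sqrt (ksq (k - m)) * norm (u (k - m))) * (sqrt (ksq m) * norm (u m)) + norm (u (k - m)) * (ksq m * norm (u m)))"
        by (rule ennreal_leI)
      also have "\<dots> = b (k - m) * b m + a (k - m) * d m"
        by (subst ennreal_plus) (auto simp: a_def b_def d_def ennreal_mult[symmetric])
      finally show "ennreal (sqrt (ksq k) * ?z) \<le> b (k - m) * b m + a (k - m) * d m" .
    qed
    finally show ?thesis by (simp add: nns_add cnv_def)
  qed
  have sq2: "(x + y)\<^sup>2 \<le> 2 * x\<^sup>2 + 2 * y\<^sup>2" for x y :: ennreal
  proof (cases x; cases y)
    fix p q assume x: "x = ennreal p" "p \<ge> 0" and y: "y = ennreal q" "q \<ge> 0"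
    have "(p + q)\<^sup>2 \<le> 2 * p\<^sup>2 + 2 * q\<^sup>2" using zero_le_power2[of "p - q"] by (simp add: power2_eq_square algebra_simps)
    then have "ennreal ((p + q)\<^sup>2) \<le> ennreal (2 * p\<^sup>2 + 2 * q\<^sup>2)" by (rule ennreal_leI)
    then show ?thesis using x y by (simp add: ennreal_power[symmetric] ennreal_mult)
  qed (auto simp: power2_eq_square ennreal_mult_top ennreal_top_mult)
  have bb: "nns (\<lambda>k. (cnv b b k)\<^sup>2) \<le> ennreal (sk * (B * B))"
  proof -
    have e: "ennreal (ksq k) * (b k)\<^sup>2 = ennreal ((ksq k)\<^sup>2 * (norm (u k))\<^sup>2)" for k
      by (simp add: b_def sqrt_ksq_norm_sq ennreal_mult[symmetric] power2_eq_square mult.assoc)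
    have "nns (\<lambda>k. (cnv b b k)\<^sup>2) \<le> SK * (nns (\<lambda>k. ennreal (ksq k) * (b k)\<^sup>2) * nns (\<lambda>k. ennreal (ksq k) * (b k)\<^sup>2))"
      by (rule cnv_H1) (auto simp: b_def)
    also have "\<dots> \<le> SK * (ennreal B * ennreal B)" unfolding e by (intro mult_left_mono mult_mono B) auto
    finally show ?thesis using sk B(2) by (simp add: ennreal_mult)
  qed
  have ad: "nns (\<lambda>k. (cnv a d k)\<^sup>2) \<le> ennreal (sk * (B * B))"
  proof -
    have e: "ennreal ((ksq k)\<^sup>2) * (a k)\<^sup>2 = ennreal ((ksq k)\<^sup>2 * (norm (u k))\<^sup>2)" "(d k)\<^sup>2 = ennreal ((ksq k)\<^sup>2 * (norm (u k))\<^sup>2)" for k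
      by (simp_all add: a_def d_def ennreal_power ennreal_mult power_mult_distrib)
    have "nns (\<lambda>k. (cnv a d k)\<^sup>2) \<le> (nns a)\<^sup>2 * nns (\<lambda>k. (d k)\<^sup>2)" by (rule cnv_l1_l2)
    also have "\<dots> \<le> (SK * ennreal B) * ennreal B"
    proof (rule mult_mono)
      have "(nns a)\<^sup>2 \<le> SK * nns (\<lambda>k. ennreal ((ksq k)\<^sup>2) * (a k)\<^sup>2)" by (rule l1_H2) (simp add: a_def u0)
      also have "\<dots> \<le> SK * ennreal B" unfolding e by (intro mult_left_mono B) auto
      finally show "(nns a)\<^sup>2 \<le> SK * ennreal B" .
    qed (use B(1) in \<open>auto simp: e\<close>)
    finally show ?thesis using sk B(2) by (simp add: ennreal_mult mult.assoc)
  qed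
  have "nns (\<lambda>k. ennreal (ksq k * (norm (advect u k))\<^sup>2)) \<le> nns (\<lambda>k. ennreal (4 * pi\<^sup>2) * (2 * (cnv b b k)\<^sup>2 + 2 * (cnv a d k)\<^sup>2))"
  proof (rule nns_mono)
    fix k
    have "ennreal (ksq k * (norm (advect u k))\<^sup>2) = (ennreal (sqrt (ksq k)) * ennreal (norm (advect u k)))\<^sup>2"
      by (simp add: power_mult_distrib ennreal_power ennreal_mult)
    also have "\<dots> \<le> (ennreal (sqrt (ksq k)) * (ennreal (2 * pi) * cnv a b k))\<^sup>2"
      unfolding a_def b_def by (intro power_mono mult_left_mono nns_advect_le) auto
    also have "\<dots> = (ennreal (2 * pi))\<^sup>2 * (ennreal (sqrt (ksq k)) * cnv a b k)\<^sup>2" by (simp only: power_mult_distrib ac_simps)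
    also have "\<dots> \<le> (ennreal (2 * pi))\<^sup>2 * (2 * (cnv b b k)\<^sup>2 + 2 * (cnv a d k)\<^sup>2)"
      by (intro mult_left_mono order_trans[OF power_mono[OF pt] sq2]) auto
    also have "(ennreal (2 * pi))\<^sup>2 = ennreal (4 * pi\<^sup>2)" by (simp add: ennreal_power power_mult_distrib)
    finally show "ennreal (ksq k * (norm (advect u k))\<^sup>2) \<le> ennreal (4 * pi\<^sup>2) * (2 * (cnv b b k)\<^sup>2 + 2 * (cnv a d k)\<^sup>2)" .
  qed
  also have "\<dots> \<le> ennreal (4 * pi\<^sup>2) * (2 * ennreal (sk * (B * B)) + 2 * ennreal (sk * (B * B)))"
    unfolding nns_cmult nns_add by (intro mult_left_mono add_mono bb ad) auto
  also have "\<dots> = ennreal (16 * pi\<^sup>2 * (sk * (B * B)))"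
  proof -
    have "(2::ennreal) * ennreal (sk * (B * B)) + 2 * ennreal (sk * (B * B)) = ennreal (4 * (sk * (B * B)))"
    proof -
      have "(2::ennreal) = ennreal 2" by simp
      then show ?thesis using sk B(2) by (simp only: ennreal_mult[symmetric] ennreal_plus[symmetric] zero_le_numeral mult_nonneg_nonneg) simp
    qed
    then show ?thesis using sk B(2) by (simp only: ennreal_mult[symmetric] mult_nonneg_nonneg zero_le_numeral zero_le_power2) (simp add: ac_simps)
  qed
  finally show ?thesis .
qed

lemma div_flux_le:
  "ennreal (cmod (div_flux u c k)) \<le> ennreal (2 * pi * sqrt (ksq k)) * cnv (mag u) (mag c) k"
proof -
  let ?S = "\<Sum>\<^sub>\<infinity>m. c m *s u (subk k m)"
  have "cmod (div_flux u c k) \<le> norm ((2 * pi * \<i>) *s kvec k) * norm ?S"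
    unfolding div_flux_def by (rule norm_cdot_le)
  then have "ennreal (cmod (div_flux u c k)) \<le> ennreal (2 * pi * sqrt (ksq k) * norm ?S)"
    by (intro ennreal_leI) (simp add: norm_mult norm_kvec)
  also have "\<dots> = ennreal (2 * pi * sqrt (ksq k)) * ennreal (norm ?S)" by (rule ennreal_mult) auto
  also have "\<dots> \<le> ennreal (2 * pi * sqrt (ksq k)) * nns (\<lambda>m. ennreal (norm (c m *s u (subk k m))))"
    by (intro mult_left_mono norm_infsum_le_nns) simp
  also have "nns (\<lambda>m. ennreal (norm (c m *s u (subk k m)))) = cnv (mag u) (mag c) k"
    unfolding cnv_def by (rule nn_integral_cong) (simp add: subk_eq ennreal_mult mult.commute)
  finally show ?thesis .
qed

text \<open>The velocity enters with summable coefficients and the temperature only with its L^2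
  norm, so the product u \<theta> is in L^2 at every time.\<close>

lemma flux_conv_bound:
  fixes c :: sfield
  assumes u0: "u 0 = 0" and B: "h2sq u \<le> B"
    and M: "l2sq c \<le> M"
  shows "nns (\<lambda>k. (cnv (mag u) (mag c) k)\<^sup>2) \<le> SK * B * M"
proof -
  have "nns (\<lambda>k. (cnv (mag u) (mag c) k)\<^sup>2)
     \<le> (nns (mag u))\<^sup>2 * nns (\<lambda>k. (ennreal (cmod (c k)))\<^sup>2)" by (rule cnv_l1_l2)
  also have "\<dots> \<le> SK * B * M"
  proof (rule mult_mono)
    have "(nns (mag u))\<^sup>2 \<le> SK * nns (\<lambda>k. ennreal ((ksq k)\<^sup>2) * (ennreal (norm (u k)))\<^sup>2)"
      by (rule l1_H2) (simp add: u0)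
    also have "\<dots> \<le> SK * B" using B by (intro mult_left_mono) (simp_all add: ennreal_power ennreal_mult)
    finally show "(nns (mag u))\<^sup>2 \<le> SK * B" .
  qed (use M in \<open>auto simp: ennreal_power\<close>)
  finally show ?thesis .
qed

lemma real_div_flux:
  assumes u: "l2sq u < \<infinity>" "real_vf u" and c: "l2sq c < \<infinity>" "real_sf c"
  shows "div_flux u c (- k) = cnj (div_flux u c k)"
proof -
  have bij: "bij_betw uminus (UNIV::wn set) UNIV" by (rule bij_betwI[where g=uminus]) auto
  have "(\<Sum>\<^sub>\<infinity>m. u m $ j * c (- k - m)) = cnj (\<Sum>\<^sub>\<infinity>m. u m $ j * c (k - m))" for j
  proof -
    have "(\<Sum>\<^sub>\<infinity>m. u m $ j * c (- k - m)) = (\<Sum>\<^sub>\<infinity>m. u (- m) $ j * c (- k - (- m)))"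
      by (rule infsum_reindex_bij_betw[OF bij, symmetric])
    also have "\<dots> = (\<Sum>\<^sub>\<infinity>m. cnj (u m $ j * c (k - m)))"
    proof (rule infsum_cong)
      fix m
      have "c (- (k - m)) = cnj (c (k - m))" "u (- m) = cconj3 (u m)" using assms by (auto simp: real_sf_def real_vf_def negk_eq simp del: minus_diff_eq)
      then show "u (- m) $ j * c (- k - (- m)) = cnj (u m $ j * c (k - m))" by (simp add: cconj3_def)
    qed
    finally show ?thesis by (simp only: infsum_cnj)
  qed
  then show ?thesis unfolding div_flux_eq[OF u(1) c(1)] by (simp add: sum_negf)
qed

lemma continuous_LINT:
  fixes g :: "real \<Rightarrow> 'a::euclidean_space"
  assumes i: "set_integrable lborel {0..T} g"
  shows "continuous_on {0..T} (\<lambda>t. LINT x:{0..t}|lborel. g x)"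
proof -
  have "g integrable_on {0..T}" by (rule set_borel_integral_eq_integral(1)[OF i])
  then have "continuous_on {0..T} (\<lambda>t. integral {0..t} g)" by (rule indefinite_integral_continuous_1)
  moreover have "(LINT x:{0..t}|lborel. g x) = integral {0..t} g" if "t \<in> {0..T}" for t
    using that by (intro set_borel_integral_eq_integral(2) set_integrable_subset[OF i]) auto
  ultimately show ?thesis using continuous_on_eq[of "{0..T}" "\<lambda>t. integral {0..t} g" "\<lambda>t. LINT x:{0..t}|lborel. g x"] by metis
qed

lemma borel_measurable_of_set_integrable:
  fixes g :: "real \<Rightarrow> 'a::{banach,second_countable_topology}"
  shows "set_integrable lborel {0..T} g \<Longrightarrow> g \<in> borel_measurable (restrict_space lborel {0..T})"
  by (simp add: borel_measurable_restrict_space_iff set_integrable_def borel_measurable_integrable)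

lemma real_force_state:
  assumes "regular_state B M u c"
  shows "real_vf (ut_rhs \<alpha> u c)" "ut_rhs \<alpha> u c \<in> divfree" "ut_rhs \<alpha> u c 0 = 0"
proof -
  have "real_vf (force u c)" using assms by (intro real_force) (auto simp: regular_state_def)
  moreover have "symA (- k) = symA k" for k by (simp add: symA_def)
  ultimately show "real_vf (ut_rhs \<alpha> u c)" by (simp add: real_vf_iff ut_rhs_def cconj3_simps)
  have "cdot a (s *\<^sub>R b) = of_real s * cdot a b" for a b :: "complex^3" and s :: real
    by (simp add: cdot_def sum_distrib_left) (simp add: scaleR_conv_of_real ac_simps)
  then show "ut_rhs \<alpha> u c \<in> divfree" by (simp add: divfree_def ut_rhs_def force_divfree)
  show "ut_rhs \<alpha> u c 0 = 0" by (simp add: ut_rhs_def)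
qed

lemma ut_rhs_sq:
  assumes \<alpha>: "\<alpha> > 0"
  shows "(ksq k)\<^sup>2 * (norm (ut_rhs \<alpha> u c k))\<^sup>2 \<le> (1 / (4 * pi\<^sup>2 * \<alpha>\<^sup>2))\<^sup>2 * (norm (force u c k))\<^sup>2"
proof -
  have a: "ksq k * (1 / (1 + \<alpha>\<^sup>2 * symA k)) \<le> 1 / (4 * pi\<^sup>2 * \<alpha>\<^sup>2)"
    using ksq_le_weight[of \<alpha> k] \<alpha> one_plus_symA_pos[of \<alpha> k] by (simp add: field_simps)
  have "(ksq k * norm (ut_rhs \<alpha> u c k))\<^sup>2 \<le> ((1 / (4 * pi\<^sup>2 * \<alpha>\<^sup>2)) * norm (force u c k))\<^sup>2"
  proof (rule power_mono)
    have "ksq k * norm (ut_rhs \<alpha> u c k) = (ksq k * (1 / (1 + \<alpha>\<^sup>2 * symA k))) * norm (force u c k)"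
      using one_plus_symA_pos[of \<alpha> k] by (simp add: ut_rhs_def)
    also have "\<dots> \<le> (1 / (4 * pi\<^sup>2 * \<alpha>\<^sup>2)) * norm (force u c k)" by (intro mult_right_mono a) simp
    finally show "ksq k * norm (ut_rhs \<alpha> u c k) \<le> (1 / (4 * pi\<^sup>2 * \<alpha>\<^sup>2)) * norm (force u c k)" .
  qed simp
  then show ?thesis by (simp only: power_mult_distrib)
qed

text \<open>The inverse weight gains two derivatives over the force. The force is bounded in L^2 at
  all times, but it is in H^1 only where \<theta> is; therefore the time derivative is bounded in
  H^2 and merely square integrable in H^3.\<close>

lemma ut_rhs_bounds:
  assumes \<alpha>: "\<alpha> > 0" and s: "regular_state B M u c" and B0: "B \<ge> 0" and M0: "M \<ge> 0"
  shows "hsv_sq 2 (ut_rhs \<alpha> u c) \<le> ennreal ((1 / (4 * pi\<^sup>2 * \<alpha>\<^sup>2))\<^sup>2 * (8 * M + 8 * (4 * pi\<^sup>2 * (sk * (B * B)))))"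
    and "hsv_sq 3 (ut_rhs \<alpha> u c) \<le> ennreal ((1 / (4 * pi\<^sup>2 * \<alpha>\<^sup>2))\<^sup>2 * 8) * hs_sq 1 c
        + ennreal ((1 / (4 * pi\<^sup>2 * \<alpha>\<^sup>2))\<^sup>2 * 8 * (16 * pi\<^sup>2 * (sk * (B * B))))"
proof -
  let ?q = "(1 / (4 * pi\<^sup>2 * \<alpha>\<^sup>2))\<^sup>2"
  have q: "?q \<ge> 0" by simp
  have u0: "u 0 = 0" and uB: "h2sq u \<le> ennreal B"
    and cM: "l2sq c \<le> ennreal M" using s by (auto simp: regular_state_def)
  have z: "ut_rhs \<alpha> u c 0 = 0" by (simp add: ut_rhs_def)
  have pt: "(ksq k)\<^sup>2 * (norm (ut_rhs \<alpha> u c k))\<^sup>2 \<le> ?q * 8 * (cmod (c k))\<^sup>2 + ?q * 8 * (norm (advect u k))\<^sup>2" for k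
  proof -
    have "?q * (norm (force u c k))\<^sup>2 \<le> ?q * (8 * (cmod (c k))\<^sup>2 + 8 * (norm (advect u k))\<^sup>2)"
      by (intro mult_left_mono norm_force_sq q)
    then show ?thesis using ut_rhs_sq[OF \<alpha>, of k u c] by (simp only: distrib_left mult.assoc)
  qed
  have split: "nns (\<lambda>k. ennreal (w k * ((ksq k)\<^sup>2 * (norm (ut_rhs \<alpha> u c k))\<^sup>2)))
     \<le> ennreal (?q * 8) * nns (\<lambda>k. ennreal (w k * (cmod (c k))\<^sup>2)) + ennreal (?q * 8) * nns (\<lambda>k. ennreal (w k * (norm (advect u k))\<^sup>2))"
    if w: "\<And>k. w k \<ge> 0" for w
    unfolding nns_cmult[symmetric] nns_add[symmetric]
  proof (rule nns_mono)
    fix k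
    have "w k * ((ksq k)\<^sup>2 * (norm (ut_rhs \<alpha> u c k))\<^sup>2) \<le> w k * (?q * 8 * (cmod (c k))\<^sup>2 + ?q * 8 * (norm (advect u k))\<^sup>2)"
      by (intro mult_left_mono pt w)
    also have "\<dots> = (?q * 8) * (w k * (cmod (c k))\<^sup>2) + (?q * 8) * (w k * (norm (advect u k))\<^sup>2)"
      by (simp only: distrib_left ac_simps)
    finally have "ennreal (w k * ((ksq k)\<^sup>2 * (norm (ut_rhs \<alpha> u c k))\<^sup>2)) \<le> ennreal ((?q * 8) * (w k * (cmod (c k))\<^sup>2) + (?q * 8) * (w k * (norm (advect u k))\<^sup>2))"
      by (rule ennreal_leI)
    also have "\<dots> = ennreal (?q * 8) * ennreal (w k * (cmod (c k))\<^sup>2) + ennreal (?q * 8) * ennreal (w k * (norm (advect u k))\<^sup>2)"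
    proof -
      have n: "0 \<le> ?q * 8" "0 \<le> w k * (cmod (c k))\<^sup>2" "0 \<le> w k * (norm (advect u k))\<^sup>2" using w by auto
      show ?thesis
        unfolding ennreal_plus[OF mult_nonneg_nonneg[OF n(1,2)] mult_nonneg_nonneg[OF n(1,3)]] ennreal_mult[OF n(1,2)] ennreal_mult[OF n(1,3)] ..
    qed
    finally show "ennreal (w k * ((ksq k)\<^sup>2 * (norm (ut_rhs \<alpha> u c k))\<^sup>2)) \<le> ennreal (?q * 8) * ennreal (w k * (cmod (c k))\<^sup>2) + ennreal (?q * 8) * ennreal (w k * (norm (advect u k))\<^sup>2)" .
  qed
  have sk2: "0 \<le> sk * (B * B)" using sk(2) B0 by simp
  have adv: "l2sq (advect u) \<le> ennreal (4 * pi\<^sup>2 * (sk * (B * B)))"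
  proof -
    have "l2sq (advect u) \<le> ennreal (4 * pi\<^sup>2) * (SK * (ennreal B * ennreal B))"
      by (rule order_trans[OF nns_advect_sq[where u=u, OF u0]])
         (intro mult_left_mono mult_mono nns_ksq_mono(1)[where u=u, OF u0 uB] uB, auto)
    then show ?thesis using sk B0 by (simp add: ennreal_mult)
  qed
  have "hsv_sq 2 (ut_rhs \<alpha> u c) = nns (\<lambda>k. ennreal (1 * ((ksq k)\<^sup>2 * (norm (ut_rhs \<alpha> u c k))\<^sup>2)))"
    by (simp add: hs_sq_simps(5)[of "ut_rhs \<alpha> u c", OF z])
  also have "\<dots> \<le> ennreal (?q * 8) * nns (\<lambda>k. ennreal (1 * (cmod (c k))\<^sup>2)) + ennreal (?q * 8) * nns (\<lambda>k. ennreal (1 * (norm (advect u k))\<^sup>2))"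
    by (rule split) simp
  also have "\<dots> \<le> ennreal (?q * 8) * ennreal M + ennreal (?q * 8) * ennreal (4 * pi\<^sup>2 * (sk * (B * B)))"
    using cM adv by (intro add_mono mult_left_mono) auto
  also have "\<dots> = ennreal (?q * 8 * M + ?q * 8 * (4 * pi\<^sup>2 * (sk * (B * B))))"
    using M0 sk2 by (simp add: ennreal_mult[symmetric] ennreal_plus[symmetric] del: ennreal_plus)
  finally show "hsv_sq 2 (ut_rhs \<alpha> u c) \<le> ennreal (?q * (8 * M + 8 * (4 * pi\<^sup>2 * (sk * (B * B)))))"
    by (simp only: distrib_left mult.assoc)
  have "hsv_sq 3 (ut_rhs \<alpha> u c) = nns (\<lambda>k. ennreal (ksq k * ((ksq k)\<^sup>2 * (norm (ut_rhs \<alpha> u c k))\<^sup>2)))"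
    unfolding hsv_sq_3[of "ut_rhs \<alpha> u c", OF z] by (simp add: power3_eq_cube power2_eq_square mult.assoc)
  also have "\<dots> \<le> ennreal (?q * 8) * nns (\<lambda>k. ennreal (ksq k * (cmod (c k))\<^sup>2)) + ennreal (?q * 8) * nns (\<lambda>k. ennreal (ksq k * (norm (advect u k))\<^sup>2))"
    by (rule split) simp
  also have "\<dots> \<le> ennreal (?q * 8) * hs_sq 1 c + ennreal (?q * 8) * ennreal (16 * pi\<^sup>2 * (sk * (B * B)))"
    unfolding hs_sq_simps(2) by (intro add_mono mult_left_mono advect_H1[where u=u, OF u0 uB B0]) auto
  also have "ennreal (?q * 8) * ennreal (16 * pi\<^sup>2 * (sk * (B * B))) = ennreal (?q * 8 * (16 * pi\<^sup>2 * (sk * (B * B))))"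
    using sk2 by (intro ennreal_mult[symmetric]) auto
  finally show "hsv_sq 3 (ut_rhs \<alpha> u c) \<le> ennreal (?q * 8) * hs_sq 1 c + ennreal (?q * 8 * (16 * pi\<^sup>2 * (sk * (B * B))))" .
qed

lemma tt_rhs_state:
  assumes s: "regular_state B M u c"
  shows "real_sf (tt_rhs \<kappa> u c)" "tt_rhs \<kappa> u c 0 = 0"
proof -
  have u: "real_vf u" "u 0 = 0" "h2sq u \<le> ennreal B"
    and c: "real_sf c" "l2sq c \<le> ennreal M" using s by (auto simp: regular_state_def)
  have "l2sq u < \<infinity>" using nns_ksq_mono(2)[where u=u, OF u(2,3)] by (rule le_less_trans) simp
  moreover have "l2sq c < \<infinity>" using c(2) by (rule le_less_trans) simp
  ultimately have "div_flux u c (- k) = cnj (div_flux u c k)" for k by (intro real_div_flux u(1) c(1))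
  moreover have "symA (- k) = symA k" for k by (simp add: symA_def)
  ultimately show "real_sf (tt_rhs \<kappa> u c)" using c(1) by (simp add: real_sf_def negk_eq tt_rhs_def)
  show "tt_rhs \<kappa> u c 0 = 0" by (simp add: tt_rhs_def symA_def div_flux_def cdot_simps)
qed

text \<open>Diffusion takes H^1 to H^(-1), and the flux is one derivative of a product in L^2;
  dividing by |k|^2 removes exactly that derivative.\<close>

lemma tt_rhs_bound:
  assumes \<kappa>: "\<kappa> > 0" and s: "regular_state B M u c" and B0: "B \<ge> 0" and M0: "M \<ge> 0"
  shows "hs_sq (-1) (tt_rhs \<kappa> u c) \<le> ennreal (2 * (4 * pi\<^sup>2 * \<kappa>)\<^sup>2) * hs_sq 1 c + ennreal (8 * pi\<^sup>2 * (sk * B * M))"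
proof -
  have u: "u 0 = 0" "h2sq u \<le> ennreal B"
    and c: "l2sq c \<le> ennreal M" using s by (auto simp: regular_state_def)
  let ?v = "cnv (mag u) (mag c)"
  have "hs_sq (-1) (tt_rhs \<kappa> u c) \<le> nns (\<lambda>k. ennreal (2 * (4 * pi\<^sup>2 * \<kappa>)\<^sup>2) * ennreal (ksq k * (cmod (c k))\<^sup>2) + ennreal (8 * pi\<^sup>2) * (?v k)\<^sup>2)"
    unfolding hs_sq_simps(3)
  proof (rule nns_mono)
    fix k
    show "ennreal ((cmod (tt_rhs \<kappa> u c k))\<^sup>2 / ksq k) \<le> ennreal (2 * (4 * pi\<^sup>2 * \<kappa>)\<^sup>2) * ennreal (ksq k * (cmod (c k))\<^sup>2) + ennreal (8 * pi\<^sup>2) * (?v k)\<^sup>2"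
    proof (cases "k = 0")
      case False
      then have p: "ksq k > 0" by (rule ksq_pos)
      let ?d = "cmod (div_flux u c k)"
      have "cmod (tt_rhs \<kappa> u c k) \<le> \<kappa> * symA k * cmod (c k) + ?d"
        unfolding tt_rhs_def norm_minus_cancel using \<kappa>
        by (intro order_trans[OF norm_triangle_ineq]) (simp add: norm_mult)
      then have "(cmod (tt_rhs \<kappa> u c k))\<^sup>2 \<le> (\<kappa> * symA k * cmod (c k) + ?d)\<^sup>2" by (intro power_mono) auto
      also have "\<dots> \<le> 2 * (\<kappa> * symA k * cmod (c k))\<^sup>2 + 2 * ?d\<^sup>2"
        using sum_squares_bound[of "\<kappa> * symA k * cmod (c k)" ?d] by (simp add: power2_eq_square algebra_simps)
      finally have "(cmod (tt_rhs \<kappa> u c k))\<^sup>2 / ksq k \<le> (2 * (\<kappa> * symA k * cmod (c k))\<^sup>2 + 2 * ?d\<^sup>2) / ksq k"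
        using p by (intro divide_right_mono) auto
      also have "\<dots> = 2 * (4 * pi\<^sup>2 * \<kappa>)\<^sup>2 * (ksq k * (cmod (c k))\<^sup>2) + 2 / ksq k * ?d\<^sup>2"
      proof -
        have "(2 * (\<kappa> * symA k * cmod (c k))\<^sup>2) / ksq k = 2 * (4 * pi\<^sup>2 * \<kappa>)\<^sup>2 * (ksq k * (cmod (c k))\<^sup>2)"
          using p by (simp add: symA_def power2_eq_square)
        then show ?thesis by (simp add: add_divide_distrib)
      qed
      finally have "ennreal ((cmod (tt_rhs \<kappa> u c k))\<^sup>2 / ksq k) \<le> ennreal (2 * (4 * pi\<^sup>2 * \<kappa>)\<^sup>2 * (ksq k * (cmod (c k))\<^sup>2) + 2 / ksq k * ?d\<^sup>2)"
        by (rule ennreal_leI)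
      also have "\<dots> = ennreal (2 * (4 * pi\<^sup>2 * \<kappa>)\<^sup>2) * ennreal (ksq k * (cmod (c k))\<^sup>2) + ennreal (2 / ksq k) * (ennreal ?d)\<^sup>2"
      proof -
        have n: "0 \<le> 2 * (4 * pi\<^sup>2 * \<kappa>)\<^sup>2" "0 \<le> ksq k * (cmod (c k))\<^sup>2" "0 \<le> 2 / ksq k" "0 \<le> ?d\<^sup>2" using p by auto
        show ?thesis
          unfolding ennreal_plus[OF mult_nonneg_nonneg[OF n(1,2)] mult_nonneg_nonneg[OF n(3,4)]] ennreal_mult[OF n(1,2)] ennreal_mult[OF n(3,4)]
          by (simp add: ennreal_power)
      qed
      also have "\<dots> \<le> ennreal (2 * (4 * pi\<^sup>2 * \<kappa>)\<^sup>2) * ennreal (ksq k * (cmod (c k))\<^sup>2) + ennreal (8 * pi\<^sup>2) * (?v k)\<^sup>2"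
      proof (rule add_left_mono)
        have "ennreal (2 / ksq k) * (ennreal ?d)\<^sup>2 \<le> ennreal (2 / ksq k) * (ennreal (2 * pi * sqrt (ksq k)) * ?v k)\<^sup>2"
          by (intro mult_left_mono power_mono div_flux_le) auto
        also have "\<dots> = (ennreal (2 / ksq k) * (ennreal (2 * pi * sqrt (ksq k)))\<^sup>2) * (?v k)\<^sup>2"
          by (simp only: power_mult_distrib mult.assoc)
        also have "ennreal (2 / ksq k) * (ennreal (2 * pi * sqrt (ksq k)))\<^sup>2 = ennreal (8 * pi\<^sup>2)"
          using p False by (simp add: ennreal_power ennreal_mult[symmetric] power_mult_distrib)
        finally show "ennreal (2 / ksq k) * (ennreal ?d)\<^sup>2 \<le> ennreal (8 * pi\<^sup>2) * (?v k)\<^sup>2" .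
      qed
      finally show ?thesis .
    qed simp
  qed
  also have "\<dots> = ennreal (2 * (4 * pi\<^sup>2 * \<kappa>)\<^sup>2) * hs_sq 1 c + ennreal (8 * pi\<^sup>2) * nns (\<lambda>k. (?v k)\<^sup>2)"
    unfolding nns_add nns_cmult hs_sq_simps(2) ..
  also have "\<dots> \<le> ennreal (2 * (4 * pi\<^sup>2 * \<kappa>)\<^sup>2) * hs_sq 1 c + ennreal (8 * pi\<^sup>2) * (SK * ennreal B * ennreal M)"
    by (intro add_left_mono mult_left_mono flux_conv_bound u c) auto
  also have "ennreal (8 * pi\<^sup>2) * (SK * ennreal B * ennreal M) = ennreal (8 * pi\<^sup>2 * (sk * B * M))"
    using sk B0 M0 by (simp add: ennreal_mult)
  finally show ?thesis .
qed

theorem solution_exists: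
  fixes \<alpha> \<kappa> T :: real
  assumes \<alpha>: "\<alpha> > 0" and \<kappa>: "\<kappa> > 0" and T: "T > 0" and u0: "u0 \<in> VH3" and f: "sqint f" "fourier_coeff f 0 = 0"
  shows "\<exists>u \<theta> M. bv_solution \<alpha> \<kappa> u0 (fourier_coeff f) T u \<theta> \<and>
    (\<forall>t\<in>{0..T}. l2sq (\<theta> t) \<le> ennreal M) \<and>
    (\<forall>t\<in>{0..T}. \<forall>\<phi>. convex_on UNIV \<phi> \<longrightarrow> (\<forall>x. \<phi> x \<ge> 0) \<longrightarrow>
       (\<exists>g. sqint g \<and> fourier_coeff g = \<theta> t \<and> (\<integral>\<^sup>+x. ennreal (\<phi> (g x)) \<partial>Q) \<le> (\<integral>\<^sup>+x. ennreal (\<phi> (f x)) \<partial>Q)))"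
proof -
  from limit_exists[OF \<alpha> \<kappa> T u0 f] obtain u \<theta> B M where L: "B \<ge> 0 \<and> M \<ge> 0 \<and> u 0 = u0 \<and> \<theta> 0 = fourier_coeff f \<and>
    (\<forall>t. 0 \<le> t \<longrightarrow> t \<le> T \<longrightarrow> regular_state B M (u t) (\<theta> t)) \<and>
    (\<forall>t \<phi>. 0 \<le> t \<longrightarrow> t \<le> T \<longrightarrow> convex_on UNIV \<phi> \<longrightarrow> (\<forall>x. \<phi> x \<ge> 0) \<longrightarrow>
       (\<exists>g. sqint g \<and> fourier_coeff g = \<theta> t \<and> (\<integral>\<^sup>+x. ennreal (\<phi> (g x)) \<partial>Q) \<le> (\<integral>\<^sup>+x. ennreal (\<phi> (f x)) \<partial>Q))) \<and>
    (\<forall>t k. 0 \<le> t \<longrightarrow> t \<le> T \<longrightarrow> set_integrable lborel {0..t} (\<lambda>s. ut_rhs \<alpha> (u s) (\<theta> s) k) \<and>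
       u t k = u 0 k + (LINT s:{0..t}|lborel. ut_rhs \<alpha> (u s) (\<theta> s) k)) \<and>
    (\<forall>t k. 0 \<le> t \<longrightarrow> t \<le> T \<longrightarrow> set_integrable lborel {0..t} (\<lambda>s. tt_rhs \<kappa> (u s) (\<theta> s) k) \<and>
       \<theta> t k = \<theta> 0 k + (LINT s:{0..t}|lborel. tt_rhs \<kappa> (u s) (\<theta> s) k)) \<and>
    (\<forall>k. (\<lambda>s. indicator {0..T} s *\<^sub>R \<theta> s k) \<in> borel_measurable borel) \<and>
    (\<forall>F. finite F \<longrightarrow> (\<integral>\<^sup>+s\<in>{0..T}. ennreal (\<Sum>k\<in>F. \<kappa> * symA k * (cmod (\<theta> s k))\<^sup>2) \<partial>lborel) \<le> ennreal (2 * M))"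
    by (elim exE) (rule that)
  note L1 = conjunct2[OF conjunct2[OF L]]
  note L2 = conjunct2[OF conjunct2[OF L1]]
  note L3 = conjunct2[OF conjunct2[OF L2]]
  note L4 = conjunct2[OF L3]
  have B0: "B \<ge> 0" and M0: "M \<ge> 0" using L by - (erule conjunct1, rule conjunct1[OF conjunct2[OF L]])
  have init: "u 0 = u0" "\<theta> 0 = fourier_coeff f" by - (rule conjunct1[OF L1], rule conjunct1[OF conjunct2[OF L1]])
  have reg: "regular_state B M (u t) (\<theta> t)" if "0 \<le> t" "t \<le> T" for t using conjunct1[OF L2] that by simp
  note cx = conjunct1[OF conjunct2[OF L2]]
  have ui: "set_integrable lborel {0..t} (\<lambda>s. ut_rhs \<alpha> (u s) (\<theta> s) k)"
      "u t k = u 0 k + (LINT s:{0..t}|lborel. ut_rhs \<alpha> (u s) (\<theta> s) k)" if "0 \<le> t" "t \<le> T" for t k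
    using conjunct1[OF L3, rule_format, OF that, of k] by - (erule conjunct1, erule conjunct2)
  have ti: "set_integrable lborel {0..t} (\<lambda>s. tt_rhs \<kappa> (u s) (\<theta> s) k)"
      "\<theta> t k = \<theta> 0 k + (LINT s:{0..t}|lborel. tt_rhs \<kappa> (u s) (\<theta> s) k)" if "0 \<le> t" "t \<le> T" for t k
    using conjunct1[OF L4, rule_format, OF that, of k] by - (erule conjunct1, erule conjunct2)
  note meas = conjunct1[OF conjunct2[OF L4], rule_format]
  note dis = conjunct2[OF conjunct2[OF L4], rule_format]
  \<comment> \<open>The time derivatives are the right-hand sides themselves, so both equations hold
    in every mode at every time by construction. What remains is regularity.\<close>
  define ut where "ut t = ut_rhs \<alpha> (u t) (\<theta> t)" for t
  define tt where "tt t = tt_rhs \<kappa> (u t) (\<theta> t)" for t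
  have TT: "0 \<le> T" "T \<le> T" using T by auto
  note st = reg[unfolded regular_state_def]
  have tM: "l2sq (\<theta> t) \<le> ennreal M" if "t \<in> {0..T}" for t using st[of t] that by auto
  have tmeas: "meas_s T \<theta>" using meas by (simp add: meas_s_def borel_measurable_restrict_space_iff)
  have H1m: "(\<lambda>s. hs_sq 1 (\<theta> s) * indicator {0..T} s) \<in> borel_measurable lborel"
  proof -
    have "(\<lambda>s. nns (\<lambda>k. ennreal (ksq k * (cmod (indicator {0..T} s *\<^sub>R \<theta> s k))\<^sup>2))) \<in> borel_measurable lborel"
      by (rule borel_measurable_nns) (use meas in measurable)
    moreover have "(\<lambda>s. nns (\<lambda>k. ennreal (ksq k * (cmod (indicator {0..T} s *\<^sub>R \<theta> s k))\<^sup>2))) = (\<lambda>s. hs_sq 1 (\<theta> s) * indicator {0..T} s)"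
      unfolding hs_sq_simps(2) by (rule ext) (auto split: split_indicator)
    ultimately show ?thesis by simp
  qed
  have H1: "(\<integral>\<^sup>+s\<in>{0..T}. hs_sq 1 (\<theta> s) \<partial>lborel) < \<infinity>"
  proof -
    \<comment> \<open>The limit provides the dissipation bound for finite sets of modes; Tonelli and
      the supremum over finite sets extend it to all, and 1/(4 \<pi>^2 \<kappa>) converts the symbol
      of diffusion into the H^1 weight.\<close>
    let ?w = "\<lambda>k s. ennreal (\<kappa> * symA k * (cmod (indicator {0..T} s *\<^sub>R \<theta> s k))\<^sup>2)"
    have wm: "?w k \<in> borel_measurable lborel" for k using meas[of k] by measurable
    have le: "ksq k * x \<le> 1 / (4 * pi\<^sup>2 * \<kappa>) * (\<kappa> * symA k * x)" for k x using \<kappa> by (simp add: symA_def power_mult_distrib)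
    have "(\<integral>\<^sup>+s\<in>{0..T}. hs_sq 1 (\<theta> s) \<partial>lborel) \<le> (\<integral>\<^sup>+s. nns (\<lambda>k. ennreal (1 / (4 * pi\<^sup>2 * \<kappa>)) * ?w k s) \<partial>lborel)"
    proof (rule nn_integral_mono)
      fix s
      have "nns (\<lambda>k. ennreal (ksq k * (cmod (\<theta> s k))\<^sup>2)) \<le> nns (\<lambda>k. ennreal (1 / (4 * pi\<^sup>2 * \<kappa>)) * ennreal (\<kappa> * symA k * (cmod (\<theta> s k))\<^sup>2))"
        using le \<kappa> by (intro nns_mono) (simp add: ennreal_mult[symmetric] ennreal_leI)
      then show "hs_sq 1 (\<theta> s) * indicator {0..T} s \<le> nns (\<lambda>k. ennreal (1 / (4 * pi\<^sup>2 * \<kappa>)) * ?w k s)"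
        unfolding hs_sq_simps(2) by (auto split: split_indicator)
    qed
    also have "\<dots> = ennreal (1 / (4 * pi\<^sup>2 * \<kappa>)) * nns (\<lambda>k. \<integral>\<^sup>+s. ?w k s \<partial>lborel)"
      unfolding nns_cmult
    proof (subst nn_integral_cmult)
      show "(\<lambda>s. nns (\<lambda>k. ?w k s)) \<in> borel_measurable lborel" by (rule borel_measurable_nns) (rule wm)
      show "ennreal (1 / (4 * pi\<^sup>2 * \<kappa>)) * (\<integral>\<^sup>+s. nns (\<lambda>k. ?w k s) \<partial>lborel) = ennreal (1 / (4 * pi\<^sup>2 * \<kappa>)) * nns (\<lambda>k. \<integral>\<^sup>+s. ?w k s \<partial>lborel)"
        by (subst nns_integral_swap[OF wm]) (rule refl)
    qed
    also have "\<dots> \<le> ennreal (1 / (4 * pi\<^sup>2 * \<kappa>)) * ennreal (2 * M)"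
    proof (intro mult_left_mono nns_le_finite_sums)
      fix F :: "wn set" assume F: "finite F"
      have "(\<Sum>k\<in>F. \<integral>\<^sup>+s. ?w k s \<partial>lborel) = (\<integral>\<^sup>+s. (\<Sum>k\<in>F. ?w k s) \<partial>lborel)"
        by (rule nn_integral_sum[symmetric]) (rule wm)
      also have "\<dots> = (\<integral>\<^sup>+s\<in>{0..T}. ennreal (\<Sum>k\<in>F. \<kappa> * symA k * (cmod (\<theta> s k))\<^sup>2) \<partial>lborel)"
        by (rule nn_integral_cong) (use \<kappa> in \<open>auto split: split_indicator intro!: sum_ennreal\<close>)
      also have "\<dots> \<le> ennreal (2 * M)" by (rule dis[OF F])
      finally show "(\<Sum>k\<in>F. \<integral>\<^sup>+s. ?w k s \<partial>lborel) \<le> ennreal (2 * M)" .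
    qed simp
    also have "\<dots> < \<infinity>" by (simp add: ennreal_mult_less_top)
    finally show ?thesis .
  qed
  have H1ae: "AE s in lborel. s \<in> {0..T} \<longrightarrow> hs_sq 1 (\<theta> s) < \<infinity>"
  proof -
    have "AE s in lborel. hs_sq 1 (\<theta> s) * indicator {0..T} s \<noteq> \<infinity>"
      by (rule nn_integral_PInf_AE[OF H1m]) (use H1 in simp)
    then show ?thesis by (rule AE_mp) (auto simp: less_top)
  qed
  have lin: "(\<integral>\<^sup>+s\<in>{0..T}. (ennreal a * hs_sq 1 (\<theta> s) + ennreal b) \<partial>lborel) < \<infinity>" for a b
  proof -
    have "(\<integral>\<^sup>+s\<in>{0..T}. (ennreal a * hs_sq 1 (\<theta> s) + ennreal b) \<partial>lborel)
       = (\<integral>\<^sup>+s. ennreal a * (hs_sq 1 (\<theta> s) * indicator {0..T} s) + ennreal b * indicator {0..T} s \<partial>lborel)"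
      by (rule nn_integral_cong) (simp add: distrib_right mult.assoc)
    also have "\<dots> = ennreal a * (\<integral>\<^sup>+s\<in>{0..T}. hs_sq 1 (\<theta> s) \<partial>lborel) + ennreal b * ennreal T"
      using H1m T by (subst nn_integral_add) (auto simp: nn_integral_cmult)
    also have "\<dots> < \<infinity>" using H1 by (simp add: ennreal_mult_less_top)
    finally show ?thesis .
  qed
  note utb = ut_rhs_bounds[OF \<alpha> reg B0 M0]
  have ut3: "(\<integral>\<^sup>+s\<in>{0..T}. hsv_sq 3 (ut s) \<partial>lborel) < \<infinity>"
  proof (rule le_less_trans[OF nn_integral_mono lin])
    fix s :: real
    show "hsv_sq 3 (ut s) * indicator {0..T} s \<le> (ennreal ((1 / (4 * pi\<^sup>2 * \<alpha>\<^sup>2))\<^sup>2 * 8) * hs_sq 1 (\<theta> s)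
        + ennreal ((1 / (4 * pi\<^sup>2 * \<alpha>\<^sup>2))\<^sup>2 * 8 * (16 * pi\<^sup>2 * (sk * (B * B))))) * indicator {0..T} s"
      using utb(2)[of s] by (cases "s \<in> {0..T}") (auto simp: ut_def)
  qed
  have tt1: "(\<integral>\<^sup>+s\<in>{0..T}. hs_sq (-1) (tt s) \<partial>lborel) < \<infinity>"
  proof (rule le_less_trans[OF nn_integral_mono lin])
    fix s :: real
    show "hs_sq (-1) (tt s) * indicator {0..T} s \<le> (ennreal (2 * (4 * pi\<^sup>2 * \<kappa>)\<^sup>2) * hs_sq 1 (\<theta> s) + ennreal (8 * pi\<^sup>2 * (sk * B * M))) * indicator {0..T} s"
      using tt_rhs_bound[OF \<kappa> reg B0 M0, of s] by (cases "s \<in> {0..T}") (auto simp: tt_def)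
  qed
  have utS: "ut t \<in> Hsv r \<inter> divfree" if "t \<in> {0..T}" "hsv_sq r (ut t) < \<infinity>" for t r
    using real_force_state[OF reg, of t \<alpha>] that by (auto simp: Hsv_def ut_def zero_wn)
  have ut_int: "set_integrable lborel {0..T} (\<lambda>s. ut s k)" for k using ui(1)[OF TT] by (simp add: ut_def)
  have tt_int: "set_integrable lborel {0..T} (\<lambda>s. tt s k)" for k using ti(1)[OF TT] by (simp add: tt_def)
  \<comment> \<open>The squared H^3 distance is linear in the time difference, so u is Hoelder
    continuous of order 1/2 in H^3; membership in H^3 follows from the increment since time
    0.\<close>
  have inc: "hsv_sq 3 (\<lambda>k. u t k - u s k) \<le> ennreal (\<bar>t - s\<bar>) * (\<integral>\<^sup>+x\<in>{0..T}. hsv_sq 3 (ut x) \<partial>lborel)"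
    if "s \<in> {0..T}" "t \<in> {0..T}" for s t
  proof -
    have main: "hsv_sq 3 (\<lambda>k. u b k - u a k) \<le> ennreal (b - a) * (\<integral>\<^sup>+x\<in>{0..T}. hsv_sq 3 (ut x) \<partial>lborel)"
      if ab: "0 \<le> a" "a \<le> b" "b \<le> T" for a b
    proof -
      have b0: "0 \<le> b" and aT: "a \<le> T" using ab by auto
      have d: "u b k - u a k = (LINT x:{a..b}|lborel. ut x k)" for k
        using ui(2)[OF b0 ab(3), of k] ui(2)[OF ab(1) aT, of k] LINT_split(1)[OF ui(1)[OF b0 ab(3), of k] ab(1,2)]
        by (simp add: ut_def)
      have i: "set_integrable lborel {a..b} (\<lambda>x. ut x k)" for k
        using LINT_split(2)[OF ui(1)[OF b0 ab(3), of k] ab(1,2)] by (simp add: ut_def)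
      have z: "(\<lambda>k. u b k - u a k) 0 = 0" using st[of a] st[of b] ab by auto
      have uz: "ut x 0 = 0" for x by (simp add: ut_def ut_rhs_def)
      have "hsv_sq 3 (\<lambda>k. u b k - u a k) = nns (\<lambda>k. ennreal ((ksq k)^3 * (norm (LINT x:{a..b}|lborel. ut x k))\<^sup>2))"
        by (subst hsv_sq_3[of "\<lambda>k. u b k - u a k", OF z]) (simp only: d)
      also have "\<dots> \<le> ennreal (b - a) * (\<integral>\<^sup>+x\<in>{a..b}. nns (\<lambda>k. ennreal ((ksq k)^3 * (norm (ut x k))\<^sup>2)) \<partial>lborel)"
        by (rule weighted_increment_bound[OF i ab(2)]) simp
      also have "\<dots> \<le> ennreal (b - a) * (\<integral>\<^sup>+x\<in>{0..T}. hsv_sq 3 (ut x) \<partial>lborel)"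
        using ab by (intro mult_left_mono nn_integral_mono) (auto simp: hsv_sq_3[of "ut _", OF uz] split: split_indicator)
      finally show ?thesis .
    qed
    have sym: "hsv_sq 3 (\<lambda>k. u t k - u s k) = hsv_sq 3 (\<lambda>k. u s k - u t k)" by (simp add: hsv_sq_def norm_minus_commute)
    show ?thesis
      using main[of s t] main[of t s] that sym by (cases "s \<le> t") (auto simp: abs_minus_commute)
  qed
  have CT: "CT_v T 3 VH3 u"
    unfolding CT_v_def
  proof (intro ballI conjI)
    fix t assume t: "t \<in> {0..T}"
    obtain D where D: "(\<integral>\<^sup>+x\<in>{0..T}. hsv_sq 3 (ut x) \<partial>lborel) = ennreal D" "D \<ge> 0"
      using ut3 by (cases "\<integral>\<^sup>+x\<in>{0..T}. hsv_sq 3 (ut x) \<partial>lborel") auto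
    have uz: "u s 0 = 0" if "s \<in> {0..T}" for s using st[of s] that by auto
    have "hsv_sq 3 (u t) \<le> 2 * hsv_sq 3 u0 + 2 * hsv_sq 3 (\<lambda>k. u t k - u 0 k)"
    proof -
      have "nns (\<lambda>k. ennreal ((ksq k)^3 * (norm (u 0 k + (u t k - u 0 k)))\<^sup>2))
         \<le> 2 * nns (\<lambda>k. ennreal ((ksq k)^3 * (norm (u 0 k))\<^sup>2)) + 2 * nns (\<lambda>k. ennreal ((ksq k)^3 * (norm (u t k - u 0 k))\<^sup>2))"
        by (rule nns_weighted_add) simp
      then show ?thesis
        using uz[OF t] uz[of 0] T init by (simp add: hsv_sq_3)
    qed
    also have "\<dots> < \<infinity>"
    proof -
      have "hsv_sq 3 (\<lambda>k. u t k - u 0 k) < \<infinity>"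
        using inc[of 0 t] t T by (rule_tac le_less_trans) (auto simp: D ennreal_mult_less_top)
      moreover have "hsv_sq 3 u0 < \<infinity>" using u0 by (simp add: VH3_def Hsv_def)
      ultimately show ?thesis by (simp add: ennreal_mult_less_top)
    qed
    finally show "u t \<in> VH3" using st[of t] t by (auto simp: VH3_def Hsv_def zero_wn)
    have "((\<lambda>s. ennreal (\<bar>s - t\<bar> * D)) \<longlongrightarrow> ennreal (\<bar>t - t\<bar> * D)) (at t within {0..T})"
      by (intro tendsto_ennrealI tendsto_intros)
    then have up: "((\<lambda>s. ennreal (\<bar>s - t\<bar> * D)) \<longlongrightarrow> 0) (at t within {0..T})" by simp
    show "((\<lambda>s. hsv_sq 3 (\<lambda>k. u s k - u t k)) \<longlongrightarrow> 0) (at t within {0..T})"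
    proof (rule tendsto_sandwich[OF _ _ tendsto_const up])
      show "\<forall>\<^sub>F s in at t within {0..T}. hsv_sq 3 (\<lambda>k. u s k - u t k) \<le> ennreal (\<bar>s - t\<bar> * D)"
        unfolding eventually_at_filter using inc[OF t] by (intro always_eventually) (auto simp: D ennreal_mult)
    qed simp
  qed
  have Cw: "CwT_L2 T \<theta>"
    unfolding CwT_L2_def
  proof (intro conjI ballI)
    fix t assume t: "t \<in> {0..T}"
    show "\<theta> t \<in> Hs 0" using st[of t] t tM[OF t] by (auto simp: Hs_def zero_wn hs_sq_simps intro: le_less_trans)
  next
    fix \<phi> assume "\<phi> \<in> Hs 0"
    then have p: "l2sq \<phi> < \<infinity>" by (auto simp: Hs_def zero_wn hs_sq_simps)
    show "continuous_on {0..T} (\<lambda>t. \<Sum>\<^sub>\<infinity>k. \<theta> t k * cnj (\<phi> k))"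
      unfolding continuous_on_def
    proof
      fix t assume t: "t \<in> {0..T}"
      show "((\<lambda>t. \<Sum>\<^sub>\<infinity>k. \<theta> t k * cnj (\<phi> k)) \<longlongrightarrow> (\<Sum>\<^sub>\<infinity>k. \<theta> t k * cnj (\<phi> k))) (at t within {0..T})"
      proof (cases "at t within {0..T} = bot")
        case False
        \<comment> \<open>Here the test function, constant in time, is the factor with small tails,
          and the temperature is the bounded factor with continuous coefficients.\<close>
        have "((\<lambda>t. \<Sum>\<^sub>\<infinity>k. cnj (\<phi> k) * \<theta> t k) \<longlongrightarrow> (\<Sum>\<^sub>\<infinity>k. cnj (\<phi> k) * \<theta> t k)) (at t within {0..T})"
        proof (rule infsum_product_tendsto[OF tendsto_const _ False])
          fix k
          have "continuous_on {0..T} (\<lambda>t. \<theta> 0 k + (LINT s:{0..t}|lborel. tt s k))"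
            by (intro continuous_intros continuous_LINT tt_int)
          then have "continuous_on {0..T} (\<lambda>t. \<theta> t k)"
          proof (rule continuous_on_eq)
            fix t assume "t \<in> {0..T}"
            then show "\<theta> 0 k + (LINT s:{0..t}|lborel. tt s k) = \<theta> t k" using ti(2)[of t k] unfolding tt_def by simp
          qed
          then show "((\<lambda>t. \<theta> t k) \<longlongrightarrow> \<theta> t k) (at t within {0..T})" using t by (auto simp: continuous_on_def)
        next
          show "\<forall>\<^sub>F s in at t within {0..T}. l2sq (\<theta> s) \<le> ennreal M"
            unfolding eventually_at_filter using tM by (intro always_eventually) auto
        next
          fix \<epsilon> :: real assume "\<epsilon> > 0"
          from nns_tail[OF p this] obtain F where F: "finite F" "nns (\<lambda>k. ennreal ((cmod (\<phi> k))\<^sup>2) * indicator (- F) k) \<le> ennreal \<epsilon>" by blast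
          show "\<exists>A. finite A \<and> (\<forall>\<^sub>F s in at t within {0..T}. nns (\<lambda>m. ennreal ((cmod (cnj (\<phi> m)))\<^sup>2) * indicator (- A) m) \<le> ennreal \<epsilon>)"
            using F by (intro exI[of _ F] conjI always_eventually allI) simp_all
        qed
        then show ?thesis by (simp only: mult.commute)
      qed simp
    qed
  qed
  have "bv_solution \<alpha> \<kappa> u0 (fourier_coeff f) T u \<theta>"
    unfolding bv_solution_def
  proof (intro exI[of _ ut] exI[of _ tt] conjI CT Cw init)
    show "tderiv_v T u ut" unfolding tderiv_v_def ut_def
    proof (intro allI ballI conjI)
      fix k t assume "t \<in> {0..T}"
      then have t: "0 \<le> t" "t \<le> T" by auto
      show "set_integrable lborel {0..t} (\<lambda>s. ut_rhs \<alpha> (u s) (\<theta> s) k)" by (rule ui(1)[OF t])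
      show "u t k = u 0 k + (LINT s:{0..t}|lborel. ut_rhs \<alpha> (u s) (\<theta> s) k)" by (rule ui(2)[OF t])
    qed
    show "tderiv_s T \<theta> tt" unfolding tderiv_s_def tt_def
    proof (intro allI ballI conjI)
      fix k t assume "t \<in> {0..T}"
      then have t: "0 \<le> t" "t \<le> T" by auto
      show "set_integrable lborel {0..t} (\<lambda>s. tt_rhs \<kappa> (u s) (\<theta> s) k)" by (rule ti(1)[OF t])
      show "\<theta> t k = \<theta> 0 k + (LINT s:{0..t}|lborel. tt_rhs \<kappa> (u s) (\<theta> s) k)" by (rule ti(2)[OF t])
    qed
    have mv: "meas_v T ut" unfolding meas_v_def using borel_measurable_of_set_integrable[OF ut_int] by blast
    show "LinfT_v T 2 DA ut"
      unfolding LinfT_v_def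
    proof (intro conjI mv exI AE_I2 impI)
      fix t assume t: "t \<in> {0..T}"
      show b: "hsv_sq 2 (ut t) \<le> ennreal ((1 / (4 * pi\<^sup>2 * \<alpha>\<^sup>2))\<^sup>2 * (8 * M + 8 * (4 * pi\<^sup>2 * (sk * (B * B)))))"
        using utb(1)[of t] t by (simp add: ut_def)
      have "hsv_sq 2 (ut t) < \<infinity>" using b by (rule le_less_trans) simp
      then show "ut t \<in> DA" using utS[OF t, of 2] by (simp add: DA_def)
    qed
    show "L2T_v T 3 VH3 ut"
      unfolding L2T_v_def
    proof (intro conjI mv ut3)
      show "AE t in lborel. t \<in> {0..T} \<longrightarrow> ut t \<in> VH3"
      proof (rule AE_mp[OF H1ae], intro AE_I2 impI)
        fix t assume a: "t \<in> {0..T} \<longrightarrow> hs_sq 1 (\<theta> t) < \<infinity>" and t: "t \<in> {0..T}"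
        have "hsv_sq 3 (ut t) < \<infinity>"
          unfolding ut_def using t a by (intro le_less_trans[OF utb(2)[of t]]) (auto simp: ennreal_mult_less_top)
        then show "ut t \<in> VH3" using utS[OF t, of 3] by (simp add: VH3_def)
      qed
    qed
    show "L2T_s T 1 (Hs 1) \<theta>"
      unfolding L2T_s_def
    proof (intro conjI tmeas H1)
      show "AE t in lborel. t \<in> {0..T} \<longrightarrow> \<theta> t \<in> Hs 1"
        by (rule AE_mp[OF H1ae]) (use st in \<open>auto simp: Hs_def zero_wn\<close>)
    qed
    show "L2T_s T (-1) (Hs (-1)) tt"
      unfolding L2T_s_def
    proof (intro conjI tt1)
      show "meas_s T tt" unfolding meas_s_def using borel_measurable_of_set_integrable[OF tt_int] by blast
      show "AE t in lborel. t \<in> {0..T} \<longrightarrow> tt t \<in> Hs (-1)"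
      proof (rule AE_mp[OF H1ae], intro AE_I2 impI)
        fix t assume a: "t \<in> {0..T} \<longrightarrow> hs_sq 1 (\<theta> t) < \<infinity>" and t: "t \<in> {0..T}"
        have "hs_sq (-1) (tt t) < \<infinity>"
          unfolding tt_def using t a by (intro le_less_trans[OF tt_rhs_bound[OF \<kappa> reg B0 M0, of t]]) (auto simp: ennreal_mult_less_top)
        then show "tt t \<in> Hs (-1)" using tt_rhs_state[OF reg, of t \<kappa>] t by (auto simp: Hs_def tt_def zero_wn)
      qed
    qed
    have "(1 + \<alpha>\<^sup>2 * symA k) *\<^sub>R ut t k + leray (advect (u t)) k = leray (\<lambda>m. \<theta> t m *s e3) k" for t k
      using one_plus_symA_pos[of \<alpha> k] by (simp add: ut_def ut_rhs_def force_def leray_diff)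
    then show "AE t in lborel. t \<in> {0..T} \<longrightarrow> (\<forall>k. (1 + \<alpha>\<^sup>2 * symA k) *\<^sub>R ut t k + leray (advect (u t)) k = leray (\<lambda>m. \<theta> t m *s e3) k)"
      by simp
    have "tt t k + div_flux (u t) (\<theta> t) k = - (\<kappa> * symA k) *\<^sub>R \<theta> t k" for t k
      by (simp add: tt_def tt_rhs_def scaleR_conv_of_real)
    then show "AE t in lborel. t \<in> {0..T} \<longrightarrow> (\<forall>k. tt t k + div_flux (u t) (\<theta> t) k = - (\<kappa> * symA k) *\<^sub>R \<theta> t k)"
      by simp
  qed
  then show ?thesis using tM cx by (intro exI[of _ u] exI[of _ \<theta>] exI[of _ M]) auto
qed

section \<open>Uniqueness\<close>

text \<open>Since f is only absolutely continuous, Fubini's theorem replaces the product rule: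
  |f(t)|^2 is the integral of cnj (g r) g s over a square. The diagonal cuts it into two triangles,
  and on each of them the inner integral is f again.\<close>

lemma energy_identity:
  fixes g :: "real \<Rightarrow> complex"
  assumes i: "set_integrable lborel {0..t} g" and f: "\<And>s. s \<in> {0..t} \<Longrightarrow> f s = (LINT r:{0..s}|lborel. g r)" and t: "t \<ge> 0"
  shows "set_integrable lborel {0..t} (\<lambda>s. 2 * Re (cnj (f s) * g s))"
    and "(cmod (f t))\<^sup>2 = (LINT s:{0..t}|lborel. 2 * Re (cnj (f s) * g s))"
proof -
  define G where "G s = indicator {0..t} s *\<^sub>R g s" for s
  have Gi: "integrable lborel G" using i by (simp add: set_integrable_def G_def[abs_def])
  have Gm [measurable]: "G \<in> borel_measurable borel" using borel_measurable_integrable[OF Gi] by simp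
  have [measurable]: "G \<in> borel_measurable lborel" using Gm by simp
  have [measurable]: "cnj \<in> borel_measurable borel" by (intro borel_measurable_continuous_onI continuous_intros)
  let ?K = "\<lambda>(r, s). cnj (G r) * G s"
  have Ki: "integrable (lborel \<Otimes>\<^sub>M lborel) ?K"
  proof (rule lborel_pair.Fubini_integrable)
    show "?K \<in> borel_measurable (lborel \<Otimes>\<^sub>M lborel)" by measurable
    show "integrable lborel (\<lambda>x. \<integral>y. norm (?K (x, y)) \<partial>lborel)"
      using Gi by (simp add: norm_mult)
    show "AE x in lborel. integrable lborel (\<lambda>y. ?K (x, y))" using Gi by simp
  qed
  \<comment> \<open>The diagonal belongs to the first triangle only; as a null set it makes no
    difference in \<open>GB\<close>.\<close>
  let ?A = "{z::real \<times> real. fst z \<le> snd z}" and ?B = "{z::real \<times> real. snd z < fst z}"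
  have mA: "?A \<in> sets (lborel \<Otimes>\<^sub>M lborel)" and mB: "?B \<in> sets (lborel \<Otimes>\<^sub>M lborel)"
  proof -
    have "sets (lborel \<Otimes>\<^sub>M lborel) = sets (borel \<Otimes>\<^sub>M borel :: (real \<times> real) measure)"
      by (rule sets_pair_measure_cong) simp_all
    then have S: "sets (lborel \<Otimes>\<^sub>M lborel) = sets (borel :: (real \<times> real) measure)" unfolding borel_prod .
    show "?A \<in> sets (lborel \<Otimes>\<^sub>M lborel)" unfolding S by (intro borel_closed closed_Collect_le continuous_intros)
    show "?B \<in> sets (lborel \<Otimes>\<^sub>M lborel)" unfolding S by (intro borel_open open_Collect_less continuous_intros)
  qed
  have iA: "integrable (lborel \<Otimes>\<^sub>M lborel) (\<lambda>(r, s). indicator ?A (r, s) *\<^sub>R (cnj (G r) * G s))"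
    using integrable_mult_indicator[OF mA Ki] by (simp add: case_prod_beta')
  have iB: "integrable (lborel \<Otimes>\<^sub>M lborel) (\<lambda>(r, s). indicator ?B (r, s) *\<^sub>R (cnj (G r) * G s))"
    using integrable_mult_indicator[OF mB Ki] by (simp add: case_prod_beta')
  have ft: "f t = (\<integral>s. G s \<partial>lborel)" using f[of t] t by (simp add: set_lebesgue_integral_def G_def)
  have GA: "(\<integral>r. indicator ?A (r, s) *\<^sub>R (cnj (G r) * G s) \<partial>lborel) = cnj (f s) * G s" for s
  proof (cases "s \<in> {0..t}")
    case True
    have "(\<integral>r. indicator ?A (r, s) *\<^sub>R (cnj (G r) * G s) \<partial>lborel) = (\<integral>r. cnj (indicator {0..s} r *\<^sub>R g r) * G s \<partial>lborel)"
      by (rule Bochner_Integration.integral_cong) (use True in \<open>auto simp: G_def split: split_indicator\<close>)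
    also have "\<dots> = cnj (f s) * G s"
      unfolding f[OF True] set_lebesgue_integral_def by (simp only: integral_mult_left_zero Bochner_Integration.integral_cnj)
    finally show ?thesis .
  qed (simp add: G_def)
  have GB: "(\<integral>s. indicator ?B (r, s) *\<^sub>R (cnj (G r) * G s) \<partial>lborel) = cnj (G r) * f r" for r
  proof (cases "r \<in> {0..t}")
    case True
    have m: "(\<lambda>s. indicator {0..r} s *\<^sub>R g s) \<in> borel_measurable lborel"
    proof -
      have "(\<lambda>s. indicator {0..r} s *\<^sub>R G s) \<in> borel_measurable lborel" by measurable
      moreover have "(\<lambda>s. indicator {0..r} s *\<^sub>R G s) = (\<lambda>s. indicator {0..r} s *\<^sub>R g s)"
        using True by (auto simp: G_def split: split_indicator)
      ultimately show ?thesis by (simp only:)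
    qed
    have "(\<integral>s. indicator ?B (r, s) *\<^sub>R (cnj (G r) * G s) \<partial>lborel) = (\<integral>s. cnj (G r) * (indicator {0..r} s *\<^sub>R g s) \<partial>lborel)"
    proof (rule integral_cong_AE)
      show "AE s in lborel. indicator ?B (r, s) *\<^sub>R (cnj (G r) * G s) = cnj (G r) * (indicator {0..r} s *\<^sub>R g s)"
        using AE_lborel_singleton[of r] by eventually_elim (use True in \<open>auto simp: G_def split: split_indicator\<close>)
      show "(\<lambda>s. cnj (G r) * (indicator {0..r} s *\<^sub>R g s)) \<in> borel_measurable lborel"
        by (rule borel_measurable_times[OF borel_measurable_const m])
      have "(\<lambda>s. indicator {..<r} s *\<^sub>R (cnj (G r) * G s)) \<in> borel_measurable lborel" by measurable
      moreover have "(\<lambda>s. indicator ?B (r, s) *\<^sub>R (cnj (G r) * G s)) = (\<lambda>s. indicator {..<r} s *\<^sub>R (cnj (G r) * G s))"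
        by (rule ext) (simp add: indicator_def)
      ultimately show "(\<lambda>s. indicator ?B (r, s) *\<^sub>R (cnj (G r) * G s)) \<in> borel_measurable lborel"
        by (simp only:)
    qed
    also have "\<dots> = cnj (G r) * f r" unfolding f[OF True] set_lebesgue_integral_def by (rule integral_mult_right_zero)
    finally show ?thesis .
  qed (simp add: G_def)
  have I1: "integrable lborel (\<lambda>s. cnj (f s) * G s)"
    using lborel_pair.integrable_snd[OF iA] unfolding GA .
  have I2: "integrable lborel (\<lambda>s. cnj (G s) * f s)"
    using lborel_pair.integrable_fst[OF iB] unfolding GB .
  have re: "indicator {0..t} s *\<^sub>R (2 * Re (cnj (f s) * g s)) = Re (cnj (f s) * G s + cnj (G s) * f s)" for s
    by (simp add: G_def split: split_indicator)
  show "set_integrable lborel {0..t} (\<lambda>s. 2 * Re (cnj (f s) * g s))"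
    unfolding set_integrable_def re by (intro integrable_Re Bochner_Integration.integrable_add I1 I2)
  have "cnj (f t) * f t = (\<integral>s. cnj (f t) * G s \<partial>lborel)" by (simp add: ft)
  also have "\<dots> = (\<integral>s. cnj (f s) * G s + (\<integral>r. indicator ?B (r, s) *\<^sub>R (cnj (G r) * G s) \<partial>lborel) \<partial>lborel)"
  proof (rule Bochner_Integration.integral_cong[OF refl])
    fix s
    have a: "integrable lborel (\<lambda>r. indicator {..s} r *\<^sub>R (cnj (G r) * G s))"
      using Gi by (intro integrable_mult_indicator) auto
    have b: "integrable lborel (\<lambda>r. indicator {s<..} r *\<^sub>R (cnj (G r) * G s))"
      using Gi by (intro integrable_mult_indicator) auto
    have "cnj (f t) * G s = (\<integral>r. cnj (G r) * G s \<partial>lborel)" by (simp add: ft)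
    also have "\<dots> = (\<integral>r. indicator {..s} r *\<^sub>R (cnj (G r) * G s) + indicator {s<..} r *\<^sub>R (cnj (G r) * G s) \<partial>lborel)"
      by (rule Bochner_Integration.integral_cong) (auto split: split_indicator)
    also have "\<dots> = (\<integral>r. indicator {..s} r *\<^sub>R (cnj (G r) * G s) \<partial>lborel) + (\<integral>r. indicator {s<..} r *\<^sub>R (cnj (G r) * G s) \<partial>lborel)"
      by (rule Bochner_Integration.integral_add[OF a b])
    finally show "cnj (f t) * G s = cnj (f s) * G s + (\<integral>r. indicator ?B (r, s) *\<^sub>R (cnj (G r) * G s) \<partial>lborel)"
      unfolding GA[symmetric] by (simp add: indicator_def)
  qed
  also have "\<dots> = (\<integral>s. cnj (f s) * G s \<partial>lborel) + (\<integral>s. (\<integral>r. indicator ?B (r, s) *\<^sub>R (cnj (G r) * G s) \<partial>lborel) \<partial>lborel)"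
    by (rule Bochner_Integration.integral_add[OF I1 lborel_pair.integrable_snd[OF iB]])
  also have "(\<integral>s. (\<integral>r. indicator ?B (r, s) *\<^sub>R (cnj (G r) * G s) \<partial>lborel) \<partial>lborel) = (\<integral>r. cnj (G r) * f r \<partial>lborel)"
    unfolding lborel_pair.Fubini_integral[OF iB] GB ..
  also have "(\<integral>s. cnj (f s) * G s \<partial>lborel) + (\<integral>r. cnj (G r) * f r \<partial>lborel) = (\<integral>s. cnj (f s) * G s + cnj (G s) * f s \<partial>lborel)"
    by (rule Bochner_Integration.integral_add[OF I1 I2, symmetric])
  finally have "Re (cnj (f t) * f t) = Re (\<integral>s. cnj (f s) * G s + cnj (G s) * f s \<partial>lborel)" by simp
  also have "\<dots> = (\<integral>s. Re (cnj (f s) * G s + cnj (G s) * f s) \<partial>lborel)"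
    by (rule integral_Re[symmetric]) (intro Bochner_Integration.integrable_add I1 I2)
  finally have R: "Re (cnj (f t) * f t) = (\<integral>s. Re (cnj (f s) * G s + cnj (G s) * f s) \<partial>lborel)" .
  show "(cmod (f t))\<^sup>2 = (LINT s:{0..t}|lborel. 2 * Re (cnj (f s) * g s))"
  proof -
    have "Re (cnj z * z) = (cmod z)\<^sup>2" for z :: complex by (simp add: cmod_power2) (simp add: power2_eq_square)
    then show ?thesis using R unfolding set_lebesgue_integral_def re by (simp only:)
  qed
qed

text \<open>The integrand of the energy identity changes sign; \<open>ennreal\<close> cuts off its
  negative part, so the extended integral is that of the positive part.\<close>

lemma ennreal_LINT_le:
  fixes h :: "real \<Rightarrow> real"
  assumes "set_integrable lborel A h"
  shows "ennreal (LINT s:A|lborel. h s) \<le> (\<integral>\<^sup>+s\<in>A. ennreal (h s) \<partial>lborel)"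
proof -
  let ?h = "\<lambda>s. indicator A s *\<^sub>R h s"
  have i: "integrable lborel ?h" using assms by (simp add: set_integrable_def)
  have "ennreal (\<integral>s. ?h s \<partial>lborel) \<le> ennreal (\<integral>s. max 0 (?h s) \<partial>lborel)"
    by (intro ennreal_leI integral_mono i integrable_max) auto
  also have "\<dots> = (\<integral>\<^sup>+s. ennreal (max 0 (?h s)) \<partial>lborel)"
    by (intro nn_integral_eq_integral[symmetric] integrable_max i) auto
  also have "\<dots> = (\<integral>\<^sup>+s\<in>A. ennreal (h s) \<partial>lborel)"
    by (intro nn_integral_cong) (auto simp: max_def ennreal_neg split: split_indicator)
  finally show ?thesis by (simp add: set_lebesgue_integral_def)
qed

text \<open>Iterating the integral inequality on the constant bound produces the terms of an
  exponential series, which tend to zero.\<close>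

lemma gronwall_zero:
  fixes X :: "real \<Rightarrow> ennreal"
  assumes le: "\<And>t. 0 \<le> t \<Longrightarrow> t \<le> T \<Longrightarrow> X t \<le> ennreal c * (\<integral>\<^sup>+s\<in>{0..t}. X s \<partial>lborel)" and c: "c \<ge> 0"
    and bd: "\<And>t. 0 \<le> t \<Longrightarrow> t \<le> T \<Longrightarrow> X t \<le> ennreal C" and C: "C \<ge> 0" and t: "0 \<le> t" "t \<le> T"
  shows "X t = 0"
proof -
  have ind: "X t \<le> ennreal (C * ((c * t)^n / fact n))" if "0 \<le> t" "t \<le> T" for t n
    using that
  proof (induction n arbitrary: t)
    case 0
    then show ?case using bd by simp
  next
    case (Suc n)
    let ?F = "\<lambda>s. C * (c^n * s^Suc n / fact (Suc n))"
    have "(\<integral>\<^sup>+s\<in>{0..t}. X s \<partial>lborel) \<le> (\<integral>\<^sup>+s. ennreal (C * ((c * s)^n / fact n)) * indicator {0..t} s \<partial>lborel)"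
      by (rule nn_integral_mono) (use Suc in \<open>auto split: split_indicator\<close>)
    also have "\<dots> = ennreal (?F t - ?F 0)"
    proof (rule nn_integral_FTC_Icc)
      show "(\<lambda>s. C * ((c * s)^n / fact n)) \<in> borel_measurable borel" by measurable
      fix s :: real assume "s \<in> {0..t}"
      then show "0 \<le> C * ((c * s)^n / fact n)" using C c by auto
      have "((\<lambda>s. s^Suc n) has_real_derivative real (Suc n) * s^n) (at s)"
        using DERIV_pow[of "Suc n" s] by (simp del: of_nat_Suc power_Suc)
      then have "((\<lambda>s. (C * c^n / fact (Suc n)) * s^Suc n) has_real_derivative (C * c^n / fact (Suc n)) * (real (Suc n) * s^n)) (at s)"
        by (rule DERIV_cmult)
      moreover have "(\<lambda>s. (C * c^n / fact (Suc n)) * s^Suc n) = ?F" by (simp add: fun_eq_iff)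
      ultimately show "DERIV ?F s :> C * ((c * s)^n / fact n)"
        by (simp add: power_mult_distrib del: of_nat_Suc)
    qed (use Suc in auto)
    finally have "ennreal c * (\<integral>\<^sup>+s\<in>{0..t}. X s \<partial>lborel) \<le> ennreal c * ennreal (?F t)" by (intro mult_left_mono) auto
    also have "\<dots> = ennreal (C * ((c * t)^Suc n / fact (Suc n)))"
      using c by (simp add: ennreal_mult'[symmetric] power_mult_distrib ac_simps)
    finally show ?case using le[OF Suc.prems] by (rule order_trans[rotated])
  qed
  have "(\<lambda>n. C * ((c * t)^n / fact n)) \<longlonglongrightarrow> C * 0"
    using summable_LIMSEQ_zero[OF summable_exp[of "c * t"]] by (intro tendsto_intros) (simp add: divide_inverse mult.commute)
  then have "(\<lambda>n. ennreal (C * ((c * t)^n / fact n))) \<longlonglongrightarrow> ennreal (C * 0)" by (rule tendsto_ennrealI)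
  then have "X t \<le> ennreal (C * 0)" by (rule tendsto_lowerbound) (use ind[OF t] in auto)
  then show ?thesis by simp
qed

text \<open>The flux loses one derivative, which diffusion absorbs within the same mode: with x = 2
  \<pi> |k| |\<eta>| one has -2 \<kappa> x^2 + 2 x v \<le> v^2 / (2 \<kappa>), the difference being
  a complete square. The remainder contains no factor |k|.\<close>

lemma young_flux:
  fixes g \<eta> F :: complex
  assumes \<kappa>: "\<kappa> > 0" and g: "g = - (of_real (\<kappa> * symA k) * \<eta>) - F"
    and F: "ennreal (cmod F) \<le> ennreal (2 * pi * sqrt (ksq k)) * v"
  shows "ennreal (2 * Re (cnj \<eta> * g)) \<le> ennreal (1 / (2 * \<kappa>)) * v\<^sup>2"
proof (cases v)
  case (real r)
  let ?s = "sqrt (ksq k)" and ?e = "cmod \<eta>"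
  have F': "cmod F \<le> 2 * pi * ?s * r" using F real by (simp add: ennreal_mult[symmetric])
  have "Re (cnj \<eta> * g) = - (\<kappa> * symA k * ?e\<^sup>2) - Re (cnj \<eta> * F)"
  proof -
    have "Re (cnj \<eta> * (of_real c * \<eta>)) = c * ?e\<^sup>2" for c
      by (simp add: cmod_power2) (simp add: power2_eq_square algebra_simps)
    then show ?thesis unfolding g right_diff_distrib mult_minus_right minus_complex.sel uminus_complex.sel by (simp only:)
  qed
  moreover have "- Re (cnj \<eta> * F) \<le> ?e * (2 * pi * ?s * r)"
  proof -
    have "- Re (cnj \<eta> * F) \<le> cmod (cnj \<eta> * F)" using abs_Re_le_cmod[of "cnj \<eta> * F"] by linarith
    also have "\<dots> \<le> ?e * (2 * pi * ?s * r)" using mult_left_mono[OF F', of ?e] by (simp add: norm_mult)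
    finally show ?thesis .
  qed
  moreover have "1 / (2 * \<kappa>) * r\<^sup>2 + 2 * (\<kappa> * symA k * ?e\<^sup>2) - 2 * (?e * (2 * pi * ?s * r)) = (r - 4 * pi * \<kappa> * ?s * ?e)\<^sup>2 / (2 * \<kappa>)"
  proof -
    have alg: "1 / (2 * \<kappa>) * r\<^sup>2 + 2 * (\<kappa> * (4 * pi\<^sup>2 * (s * s)) * e\<^sup>2) - 2 * (e * (2 * pi * s * r)) = (r - 4 * pi * \<kappa> * s * e)\<^sup>2 / (2 * \<kappa>)" for s e :: real
      using \<kappa> by (simp add: field_simps power2_eq_square)
    have s: "?s * ?s = ksq k" by simp
    have "symA k = 4 * pi\<^sup>2 * (?s * ?s)" unfolding s by (simp add: symA_def power_mult_distrib)
    then show ?thesis by (simp only: alg)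
  qed
  moreover have "(r - 4 * pi * \<kappa> * ?s * ?e)\<^sup>2 / (2 * \<kappa>) \<ge> 0" using \<kappa> by simp
  ultimately have "2 * Re (cnj \<eta> * g) \<le> 1 / (2 * \<kappa>) * r\<^sup>2" by linarith
  then have "ennreal (2 * Re (cnj \<eta> * g)) \<le> ennreal (1 / (2 * \<kappa>) * r\<^sup>2)" by (rule ennreal_leI)
  also have "\<dots> = ennreal (1 / (2 * \<kappa>)) * ennreal (r\<^sup>2)" using \<kappa> by (intro ennreal_mult) auto
  also have "\<dots> = ennreal (1 / (2 * \<kappa>)) * v\<^sup>2" using real by (simp only: ennreal_power)
  finally show ?thesis .
qed (use \<kappa> in \<open>simp add: ennreal_mult_top power2_eq_square ennreal_top_mult\<close>)

section \<open>Differences of the nonlinear terms of two solutions\<close>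

lemma norm_sq_ennreal: "(ennreal (norm x))\<^sup>2 = ennreal ((norm x)\<^sup>2)"
  by (simp add: ennreal_power)

lemma l1_norm_H2:
  fixes u :: vfield
  assumes "u 0 = 0" "h2sq u \<le> B"
  shows "(nns (mag u))\<^sup>2 \<le> SK * B"
proof -
  have "(nns (mag u))\<^sup>2 \<le> SK * nns (\<lambda>k. ennreal ((ksq k)\<^sup>2) * (ennreal (norm (u k)))\<^sup>2)"
    by (rule l1_H2) (simp add: assms)
  also have "\<dots> \<le> SK * B"
    using assms(2) by (intro mult_left_mono) (simp_all add: norm_sq_ennreal ennreal_mult)
  finally show ?thesis .
qed

text \<open>Bilinear splitting with w = u - v into w . grad u + v . grad w. In both terms the
  undifferentiated factor has summable coefficients and the gradient is in L^2, so the difference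
  enters through its H^2 norm.\<close>

lemma advect_difference_bound:
  fixes u v :: vfield
  assumes u: "u 0 = 0" "h2sq u \<le> ennreal B"
    and v: "v 0 = 0" "h2sq v \<le> ennreal B" and B: "B \<ge> 0"
  shows "nns (\<lambda>k. ennreal ((norm (advect u k - advect v k))\<^sup>2))
    \<le> ennreal (16 * pi\<^sup>2 * (sk * B)) * nns (\<lambda>k. ennreal ((ksq k)\<^sup>2 * (norm (u k - v k))\<^sup>2))"
proof -
  define w where "w k = u k - v k" for k
  define W where "W = h2sq w"
  have w0: "w 0 = 0" using u v by (simp add: w_def)
  have Wle: "h2sq w \<le> W" by (simp add: W_def)
  have fin: "W < \<infinity>"
  proof -
    have "W \<le> 2 * ennreal B + 2 * ennreal B"
      unfolding W_def w_def by (rule order_trans[OF nns_weighted_diff]) (auto intro!: add_mono mult_left_mono u v)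
    then show ?thesis by (rule le_less_trans) (simp add: ennreal_mult_less_top)
  qed
  define adv where "adv a b k m = (2 * pi * \<i> * cdot (a (k - m)) (kvec m)) *s b m" for a b :: vfield and k m
  define x where "x a b k = cnv (mag a) (\<lambda>k. ennreal (sqrt (ksq k) * norm (b k))) k" for a b :: vfield and k
  have le: "nns (mag (adv a b k)) \<le> ennreal (2 * pi) * x a b k" for a b k
    unfolding adv_def x_def by (rule advect_terms_le)
  have s: "adv a b k summable_on UNIV"
    if "a 0 = 0" "b 0 = 0" "h2sq a < \<infinity>" "h2sq b < \<infinity>" for a b k
  proof -
    have "x a b k < \<infinity>" unfolding x_def
    proof (rule cnv_finite)
      show "nns (\<lambda>m. (ennreal (norm (a m)))\<^sup>2) < \<infinity>"
        using nns_ksq_mono(2)[where u=a, OF that(1) order_refl] that(3) unfolding norm_sq_ennreal by (rule le_less_trans)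
      show "nns (\<lambda>m. (ennreal (sqrt (ksq m) * norm (b m)))\<^sup>2) < \<infinity>"
        using nns_ksq_mono(1)[where u=b, OF that(2) order_refl] that(4) unfolding sqrt_ksq_norm_sq by (rule le_less_trans)
    qed
    then have "nns (mag (adv a b k)) < \<infinity>"
      by (intro le_less_trans[OF le]) (simp add: ennreal_mult_less_top)
    then show ?thesis by (rule summable_of_nns(2))
  qed
  have uf: "h2sq u < \<infinity>" and vf: "h2sq v < \<infinity>"
    using u(2) v(2) by (auto intro: le_less_trans)
  have split: "advect u k - advect v k = infsum (adv w u k) UNIV + infsum (adv v w k) UNIV" for k
  proof -
    have "advect u k - advect v k = infsum (\<lambda>m. adv u u k m - adv v v k m) UNIV"
      unfolding advect_eq adv_def[symmetric]
      by (rule infsum_diff_banach[symmetric]) (rule s[OF u(1) u(1) uf uf] s[OF v(1) v(1) vf vf])+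
    also have "(\<lambda>m. adv u u k m - adv v v k m) = (\<lambda>m. adv w u k m + adv v w k m)"
      by (rule ext) (simp add: adv_def w_def cdot_simps vec_eq_iff algebra_simps)
    also have "infsum (\<lambda>m. adv w u k m + adv v w k m) UNIV = infsum (adv w u k) UNIV + infsum (adv v w k) UNIV"
      by (rule infsum_add) (rule s[OF w0 u(1) fin[unfolded W_def] uf] s[OF v(1) w0 vf fin[unfolded W_def]])+
    finally show ?thesis .
  qed
  have pt: "ennreal ((norm (advect u k - advect v k))\<^sup>2) \<le> ennreal (8 * pi\<^sup>2) * ((x w u k)\<^sup>2 + (x v w k)\<^sup>2)" for k
  proof -
    have "ennreal (norm (advect u k - advect v k)) \<le> ennreal (norm (infsum (adv w u k) UNIV)) + ennreal (norm (infsum (adv v w k) UNIV))"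
      unfolding split by (simp add: ennreal_plus[symmetric] norm_triangle_ineq ennreal_leI del: ennreal_plus)
    also have "\<dots> \<le> ennreal (2 * pi) * x w u k + ennreal (2 * pi) * x v w k"
      by (intro add_mono order_trans[OF norm_infsum_le_nns le])
    finally have "(ennreal (norm (advect u k - advect v k)))\<^sup>2 \<le> (ennreal (2 * pi) * x w u k + ennreal (2 * pi) * x v w k)\<^sup>2"
      by (rule power_mono) simp
    also have "\<dots> \<le> 2 * (ennreal (2 * pi) * x w u k)\<^sup>2 + 2 * (ennreal (2 * pi) * x v w k)\<^sup>2" by (rule ennreal_sq_add_le)
    also have "\<dots> = (2 * (ennreal (2 * pi))\<^sup>2) * ((x w u k)\<^sup>2 + (x v w k)\<^sup>2)"
      by (simp only: power_mult_distrib distrib_left mult.assoc)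
    also have "2 * (ennreal (2 * pi))\<^sup>2 = ennreal (8 * pi\<^sup>2)"
      by (simp add: ennreal_power power_mult_distrib numeral_mult_ennreal)
    finally show ?thesis unfolding norm_sq_ennreal .
  qed
  have 1: "nns (\<lambda>k. (x w u k)\<^sup>2) \<le> (SK * W) * ennreal B"
    unfolding x_def
    by (rule order_trans[OF cnv_l1_l2])
       (intro mult_mono l1_norm_H2[where u=w, OF w0 Wle], auto simp: sqrt_ksq_norm_sq intro!: nns_ksq_mono(1)[where u=u, OF u])
  have 2: "nns (\<lambda>k. (x v w k)\<^sup>2) \<le> (SK * ennreal B) * W"
    unfolding x_def
    by (rule order_trans[OF cnv_l1_l2])
       (intro mult_mono l1_norm_H2[where u=v, OF v], auto simp: sqrt_ksq_norm_sq intro!: nns_ksq_mono(1)[where u=w, OF w0 Wle])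
  have "nns (\<lambda>k. ennreal ((norm (advect u k - advect v k))\<^sup>2)) \<le> ennreal (8 * pi\<^sup>2) * (nns (\<lambda>k. (x w u k)\<^sup>2) + nns (\<lambda>k. (x v w k)\<^sup>2))"
    unfolding nns_add[symmetric] nns_cmult[symmetric] by (rule nns_mono) (rule pt)
  also have "\<dots> \<le> ennreal (8 * pi\<^sup>2) * ((SK * W) * ennreal B + (SK * ennreal B) * W)"
    by (intro mult_left_mono add_mono 1 2) simp
  also have "\<dots> = (ennreal (8 * pi\<^sup>2) * (2 * (SK * ennreal B))) * W"
    by (simp only: mult_2 distrib_left distrib_right ac_simps)
  also have "ennreal (8 * pi\<^sup>2) * (2 * (SK * ennreal B)) = ennreal (16 * pi\<^sup>2 * (sk * B))"
    unfolding sk(1) ennreal_mult[OF sk(2) B, symmetric] numeral_mult_ennreal[OF mult_nonneg_nonneg[OF sk(2) B]]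
    using sk(2) B by (subst ennreal_mult[symmetric]) auto
  finally show ?thesis unfolding W_def w_def .
qed

text \<open>The split is asymmetric: the velocity difference multiplies c, the temperature for which
  a uniform L^2 bound is known, and the temperature difference multiplies v, which is bounded in
  H^2.\<close>

lemma div_flux_difference:
  fixes u v :: vfield
  assumes u: "l2sq u < \<infinity>" and v: "l2sq v < \<infinity>"
    and c: "l2sq c < \<infinity>" and d: "l2sq d < \<infinity>"
  shows "div_flux u c k - div_flux v d k = div_flux (\<lambda>k. u k - v k) c k + div_flux v (\<lambda>k. c k - d k) k"
proof -
  have s: "(\<lambda>m. e m *s a (k - m)) summable_on UNIV"
    if "l2sq a < \<infinity>" "l2sq e < \<infinity>" for a :: vfield and e
  proof (rule summable_of_nns(2))
    have "cnv (mag a) (mag e) k < \<infinity>"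
      using that by (intro cnv_finite) (simp_all add: norm_sq_ennreal)
    then show "nns (\<lambda>m. ennreal (norm (e m *s a (k - m)))) < \<infinity>"
      by (simp add: cnv_def ennreal_mult mult.commute)
  qed
  have dif: "nns (\<lambda>k. ennreal ((norm (a k - b k))\<^sup>2)) < \<infinity>"
    if "l2sq a < \<infinity>" "l2sq b < \<infinity>" for a b :: "wn \<Rightarrow> 'x::real_normed_vector"
    using le_less_trans[OF nns_weighted_diff[of "\<lambda>_. 1" a b]] that by (simp add: ennreal_mult_less_top)
  have "(\<Sum>\<^sub>\<infinity>m. c m *s u (k - m)) - (\<Sum>\<^sub>\<infinity>m. d m *s v (k - m)) = (\<Sum>\<^sub>\<infinity>m. c m *s u (k - m) - d m *s v (k - m))"
    by (rule infsum_diff_banach[symmetric]) (rule s[OF u c] s[OF v d])+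
  also have "(\<lambda>m. c m *s u (k - m) - d m *s v (k - m)) = (\<lambda>m. c m *s (u (k - m) - v (k - m)) + (c m - d m) *s v (k - m))"
    by (rule ext) (simp add: vec_eq_iff algebra_simps)
  also have "(\<Sum>\<^sub>\<infinity>m. c m *s (u (k - m) - v (k - m)) + (c m - d m) *s v (k - m)) = (\<Sum>\<^sub>\<infinity>m. c m *s (u (k - m) - v (k - m))) + (\<Sum>\<^sub>\<infinity>m. (c m - d m) *s v (k - m))"
    by (rule infsum_add) (rule s[OF dif[OF u v] c] s[OF v dif[OF c d]])+
  finally show ?thesis unfolding div_flux_def subk_eq cdot_simps(2,4)[symmetric] by (rule arg_cong)
qed

lemma hsv_sq_2: "hsv_sq 2 v = h2sq v"
  by (simp add: hsv_sq_def)

text \<open>The bound uniform in time comes from integrating the derivative, which is bounded in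
  H^2, starting from the H^3 initial value. It applies to any solution, not only to the constructed
  one.\<close>

lemma velocity_bound:
  assumes T: "T > 0" and CT: "CT_v T 3 VH3 u" and d: "tderiv_v T u ut" and L: "LinfT_v T 2 DA ut"
  shows "\<exists>B\<ge>0. \<forall>t\<in>{0..T}. u t 0 = 0 \<and> h2sq (u t) \<le> ennreal B"
proof -
  have uV: "u t \<in> VH3" if "t \<in> {0..T}" for t using CT that by (simp add: CT_v_def)
  have z: "u t 0 = 0" if "t \<in> {0..T}" for t using uV[OF that] by (simp add: VH3_def Hsv_def zero_wn)
  obtain C where C: "AE t in lborel. t \<in> {0..T} \<longrightarrow> ut t \<in> DA \<and> hsv_sq 2 (ut t) \<le> ennreal C" using L by (auto simp: LinfT_v_def)
  have T0: "0 \<in> {0..T}" using T by simp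
  have "hsv_sq 2 (u 0) \<le> hsv_sq 3 (u 0)"
    unfolding hsv_sq_3[of "u 0", OF z[OF T0]] hsv_sq_2
  proof (rule nns_mono)
    fix k
    show "ennreal ((ksq k)\<^sup>2 * (norm (u 0 k))\<^sup>2) \<le> ennreal ((ksq k)^3 * (norm (u 0 k))\<^sup>2)"
      using ksq_ge_1[of k] by (cases "k = 0") (auto intro!: ennreal_leI mult_right_mono power_increasing)
  qed
  also have "\<dots> < \<infinity>" using uV[OF T0] by (simp add: VH3_def Hsv_def)
  finally have "hsv_sq 2 (u 0) < top" by simp
  then obtain b where b: "hsv_sq 2 (u 0) = ennreal b" "b \<ge> 0" unfolding less_top_ennreal by blast
  have "h2sq (u t) \<le> ennreal (2 * b + 2 * (T * (max 0 C * T)))" if t: "t \<in> {0..T}" for t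
  proof -
    have eq: "u t k = u 0 k + (LINT s:{0..t}|lborel. ut s k)" and i: "set_integrable lborel {0..t} (\<lambda>s. ut s k)" for k
      using d[unfolded tderiv_v_def, rule_format, OF t, of k] by blast+
    have "nns (\<lambda>k. ennreal ((ksq k)\<^sup>2 * (norm (LINT s:{0..t}|lborel. ut s k))\<^sup>2)) \<le> ennreal (t - 0) * (\<integral>\<^sup>+s\<in>{0..t}. h2sq (ut s) \<partial>lborel)"
      using t by (intro weighted_increment_bound i) auto
    also have "\<dots> \<le> ennreal T * (\<integral>\<^sup>+s. ennreal (max 0 C) * indicator {0..T} s \<partial>lborel)"
    proof (intro mult_mono nn_integral_mono_AE)
      show "AE s in lborel. h2sq (ut s) * indicator {0..t} s \<le> ennreal (max 0 C) * indicator {0..T} s"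
        using C by eventually_elim (use t in \<open>auto simp: hsv_sq_2 max_def ennreal_neg split: split_indicator intro: order_trans\<close>)
    qed (use t in \<open>auto intro: ennreal_leI\<close>)
    also have "\<dots> = ennreal (T * (max 0 C * T))"
      using T by (simp add: nn_integral_cmult_indicator ennreal_mult)
    finally have I: "nns (\<lambda>k. ennreal ((ksq k)\<^sup>2 * (norm (LINT s:{0..t}|lborel. ut s k))\<^sup>2)) \<le> ennreal (T * (max 0 C * T))" .
    have "h2sq (u t) \<le> 2 * ennreal b + 2 * ennreal (T * (max 0 C * T))"
      unfolding eq by (rule order_trans[OF nns_weighted_add], simp, intro add_mono mult_left_mono I) (simp_all add: b flip: hsv_sq_2)
    also have "\<dots> = ennreal (2 * b + 2 * (T * (max 0 C * T)))"
      using b T by (simp add: numeral_mult_ennreal ennreal_plus)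
    finally show ?thesis .
  qed
  then show ?thesis using z b T by (intro exI[of _ "2 * b + 2 * (T * (max 0 C * T))"]) auto
qed

text \<open>Squared distances for the uniqueness argument: H^2 here, where the velocity rate is
  controlled by L^2 of the force, and L^2 for temperatures in \<open>sdist\<close>.\<close>

definition vdist :: "vfield \<Rightarrow> vfield \<Rightarrow> ennreal" where
  "vdist u v = nns (\<lambda>k. ennreal ((ksq k)\<^sup>2 * (norm (u k - v k))\<^sup>2))"

definition sdist :: "sfield \<Rightarrow> sfield \<Rightarrow> ennreal" where
  "sdist c d = nns (\<lambda>k. ennreal ((cmod (c k - d k))\<^sup>2))"

text \<open>The inverse weight gains two derivatives, so the H^2 distance of the rates is bounded by
  the L^2 distance of the forces; buoyancy contributes \<open>sdist\<close> and advection
  \<open>vdist\<close>.\<close>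

lemma velocity_rate_difference:
  assumes \<alpha>: "\<alpha> > 0"
    and x: "\<And>k. (1 + \<alpha>\<^sup>2 * symA k) *\<^sub>R x k + leray (advect u) k = leray (\<lambda>m. c m *s e3) k"
    and y: "\<And>k. (1 + \<alpha>\<^sup>2 * symA k) *\<^sub>R y k + leray (advect v) k = leray (\<lambda>m. d m *s e3) k"
    and u: "u 0 = 0" "h2sq u \<le> ennreal B"
    and v: "v 0 = 0" "h2sq v \<le> ennreal B" and B: "B \<ge> 0"
  shows "vdist x y \<le> ennreal (8 * (1 / (4 * pi\<^sup>2 * \<alpha>\<^sup>2))\<^sup>2 * (1 + 16 * pi\<^sup>2 * (sk * B))) * (vdist u v + sdist c d)"
proof -
  let ?q = "1 / (4 * pi\<^sup>2 * \<alpha>\<^sup>2)"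
  let ?D = "\<lambda>k. advect u k - advect v k"
  have pt: "(ksq k)\<^sup>2 * (norm (x k - y k))\<^sup>2 \<le> 8 * ?q\<^sup>2 * (cmod (c k - d k))\<^sup>2 + 8 * ?q\<^sup>2 * (norm (?D k))\<^sup>2" for k
  proof -
    let ?F = "\<lambda>m. (c m *s e3 - d m *s e3) - ?D m"
    have p: "1 + \<alpha>\<^sup>2 * symA k > 0" by (rule one_plus_symA_pos)
    have "(1 + \<alpha>\<^sup>2 * symA k) *\<^sub>R (x k - y k) = leray ?F k"
      unfolding leray_diff x[symmetric] y[symmetric] scaleR_right_diff_distrib by (simp add: algebra_simps)
    then have "(1 + \<alpha>\<^sup>2 * symA k) * norm (x k - y k) = norm (leray ?F k)"
      using p by (metis abs_of_pos norm_scaleR)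
    also have "\<dots> \<le> 2 * norm (?F k)" by (rule norm_leray)
    also have "\<dots> \<le> 2 * (cmod (c k - d k) + norm (?D k))"
    proof -
      have "c k *s e3 - d k *s e3 = (c k - d k) *s e3" by (simp add: vec_eq_iff algebra_simps)
      then have "norm (c k *s e3 - d k *s e3) = cmod (c k - d k)" by (simp only: norm_smult norm_e3 mult_1_right)
      then have "norm (?F k) \<le> cmod (c k - d k) + norm (?D k)"
        using norm_triangle_ineq4[of "c k *s e3 - d k *s e3" "?D k"] by (simp only:)
      then show ?thesis by (rule mult_left_mono) simp
    qed
    finally have a: "(1 + \<alpha>\<^sup>2 * symA k) * norm (x k - y k) \<le> 2 * (cmod (c k - d k) + norm (?D k))" .
    have "ksq k * norm (x k - y k) \<le> ((1 + \<alpha>\<^sup>2 * symA k) / (4 * pi\<^sup>2 * \<alpha>\<^sup>2)) * norm (x k - y k)"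
      using \<alpha> by (intro mult_right_mono ksq_le_weight) auto
    also have "\<dots> = ?q * ((1 + \<alpha>\<^sup>2 * symA k) * norm (x k - y k))" by simp
    also have "\<dots> \<le> ?q * (2 * (cmod (c k - d k) + norm (?D k)))" by (intro mult_left_mono a) simp
    finally have "(ksq k * norm (x k - y k))\<^sup>2 \<le> (?q * (2 * (cmod (c k - d k) + norm (?D k))))\<^sup>2" by (intro power_mono) auto
    also have "\<dots> = 4 * ?q\<^sup>2 * (cmod (c k - d k) + norm (?D k))\<^sup>2"
    proof -
      have "(q * (2 * z))\<^sup>2 = 4 * q\<^sup>2 * z\<^sup>2" for q z :: real by (simp add: power_mult_distrib)
      then show ?thesis .
    qed
    also have "\<dots> \<le> 4 * ?q\<^sup>2 * (2 * (cmod (c k - d k))\<^sup>2 + 2 * (norm (?D k))\<^sup>2)"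
    proof (rule mult_left_mono)
      show "(cmod (c k - d k) + norm (?D k))\<^sup>2 \<le> 2 * (cmod (c k - d k))\<^sup>2 + 2 * (norm (?D k))\<^sup>2"
        using sum_squares_bound[of "cmod (c k - d k)" "norm (?D k)"] by (simp add: power2_eq_square algebra_simps)
    qed simp
    finally show ?thesis by (simp add: power_mult_distrib algebra_simps)
  qed
  have q: "8 * ?q\<^sup>2 \<ge> 0" by simp
  have "vdist x y \<le> nns (\<lambda>k. ennreal (8 * ?q\<^sup>2) * ennreal ((cmod (c k - d k))\<^sup>2) + ennreal (8 * ?q\<^sup>2) * ennreal ((norm (?D k))\<^sup>2))"
    unfolding vdist_def
  proof (rule nns_mono)
    fix k
    show "ennreal ((ksq k)\<^sup>2 * (norm (x k - y k))\<^sup>2) \<le> ennreal (8 * ?q\<^sup>2) * ennreal ((cmod (c k - d k))\<^sup>2) + ennreal (8 * ?q\<^sup>2) * ennreal ((norm (?D k))\<^sup>2)"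
      unfolding ennreal_mult[OF q zero_le_power2, symmetric]
        ennreal_plus[OF mult_nonneg_nonneg[OF q zero_le_power2] mult_nonneg_nonneg[OF q zero_le_power2], symmetric]
      by (rule ennreal_leI[OF pt])
  qed
  also have "\<dots> = ennreal (8 * ?q\<^sup>2) * (sdist c d + nns (\<lambda>k. ennreal ((norm (?D k))\<^sup>2)))"
    by (simp add: nns_add nns_cmult distrib_left sdist_def)
  also have "\<dots> \<le> ennreal (8 * ?q\<^sup>2) * (ennreal (1 + 16 * pi\<^sup>2 * (sk * B)) * (vdist u v + sdist c d))"
  proof (intro mult_left_mono)
    have "sdist c d + nns (\<lambda>k. ennreal ((norm (?D k))\<^sup>2)) \<le> 1 * sdist c d + ennreal (16 * pi\<^sup>2 * (sk * B)) * vdist u v"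
      unfolding vdist_def by (intro add_mono advect_difference_bound[where u=u and v=v, OF u v B]) simp
    also have "\<dots> \<le> ennreal (1 + 16 * pi\<^sup>2 * (sk * B)) * sdist c d + ennreal (1 + 16 * pi\<^sup>2 * (sk * B)) * vdist u v"
    proof (intro add_mono mult_right_mono)
      show "1 \<le> ennreal (1 + 16 * pi\<^sup>2 * (sk * B))" unfolding ennreal_1[symmetric] using sk(2) B by (intro ennreal_leI) simp
      show "ennreal (16 * pi\<^sup>2 * (sk * B)) \<le> ennreal (1 + 16 * pi\<^sup>2 * (sk * B))" by (intro ennreal_leI) simp
    qed simp_all
    finally show "sdist c d + nns (\<lambda>k. ennreal ((norm (?D k))\<^sup>2)) \<le> ennreal (1 + 16 * pi\<^sup>2 * (sk * B)) * (vdist u v + sdist c d)"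
      by (simp only: distrib_left add.commute)
  qed simp
  also have "\<dots> = ennreal (8 * ?q\<^sup>2 * (1 + 16 * pi\<^sup>2 * (sk * B))) * (vdist u v + sdist c d)"
    using sk(2) B by (simp only: mult.assoc[symmetric] ennreal_mult'[OF q])
  finally show ?thesis .
qed

lemma measurable_restrict_indicator:
  fixes f :: "real \<Rightarrow> ennreal"
  assumes "f \<in> borel_measurable (restrict_space lborel {0..T})" "t \<le> T"
  shows "(\<lambda>s. f s * indicator {0..t} s) \<in> borel_measurable lborel"
proof -
  have "(\<lambda>s. f s * indicator {0..T} s) \<in> borel_measurable lborel"
    using assms(1) by (simp add: borel_measurable_restrict_space_iff_ennreal)
  then have "(\<lambda>s. (f s * indicator {0..T} s) * indicator {0..t} s) \<in> borel_measurable lborel" by measurable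
  moreover have "(\<lambda>s. (f s * indicator {0..T} s) * indicator {0..t} s) = (\<lambda>s. f s * indicator {0..t} s)"
    using assms(2) by (auto split: split_indicator)
  ultimately show ?thesis by (simp only:)
qed

lemma nn_integral_restrict_cmult:
  fixes f :: "real \<Rightarrow> ennreal"
  assumes "f \<in> borel_measurable (restrict_space lborel {0..T})" "t \<le> T"
  shows "(\<integral>\<^sup>+s\<in>{0..t}. c * f s \<partial>lborel) = c * (\<integral>\<^sup>+s\<in>{0..t}. f s \<partial>lborel)"
  unfolding mult.assoc by (rule nn_integral_cmult[OF measurable_restrict_indicator[OF assms]])

text \<open>The energy identity is used in each mode separately, where all functions are scalar and
  absolutely continuous, and the modes are summed only after diffusion has absorbed the flux. This
  replaces a chain rule for the L^2 norm in the duality of H^1 and H^(-1).\<close>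

lemma temperature_difference:
  assumes \<kappa>: "\<kappa> > 0" and T: "T > 0" and B: "B \<ge> 0" and M: "M \<ge> 0"
    and u: "\<And>s. s \<in> {0..T} \<Longrightarrow> u s 0 = 0 \<and> h2sq (u s) \<le> ennreal B"
    and v: "\<And>s. s \<in> {0..T} \<Longrightarrow> v s 0 = 0 \<and> h2sq (v s) \<le> ennreal B"
    and c: "\<And>s. s \<in> {0..T} \<Longrightarrow> l2sq (c s) \<le> ennreal M"
    and d: "\<And>s. s \<in> {0..T} \<Longrightarrow> l2sq (d s) < \<infinity>"
    and m: "meas_v T u" "meas_v T v" "meas_s T c" "meas_s T d"
    and ct: "tderiv_s T c ct" and dt: "tderiv_s T d dt" and init: "c 0 = d 0"
    and ceq: "AE s in lborel. s \<in> {0..T} \<longrightarrow> (\<forall>k. ct s k + div_flux (u s) (c s) k = - (\<kappa> * symA k) *\<^sub>R c s k)"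
    and deq: "AE s in lborel. s \<in> {0..T} \<longrightarrow> (\<forall>k. dt s k + div_flux (v s) (d s) k = - (\<kappa> * symA k) *\<^sub>R d s k)"
    and t: "t \<in> {0..T}"
  shows "sdist (c t) (d t) \<le> ennreal (1 / (2 * \<kappa>)) * (\<integral>\<^sup>+s\<in>{0..t}. ennreal (2 * (sk * (M + B))) * (vdist (u s) (v s) + sdist (c s) (d s)) \<partial>lborel)"
proof -
  define w where "w s k = cnv (\<lambda>k. ennreal (norm (u s k - v s k))) (mag (c s)) k
     + cnv (mag (v s)) (\<lambda>k. ennreal (cmod (c s k - d s k))) k" for s k
  have [measurable]: "(\<lambda>s. u s k) \<in> borel_measurable (restrict_space lborel {0..T})" "(\<lambda>s. v s k) \<in> borel_measurable (restrict_space lborel {0..T})"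
    "(\<lambda>s. c s k) \<in> borel_measurable (restrict_space lborel {0..T})" "(\<lambda>s. d s k) \<in> borel_measurable (restrict_space lborel {0..T})" for k
    using m unfolding meas_v_def meas_s_def by blast+
  have wm: "(\<lambda>s. (w s k)\<^sup>2) \<in> borel_measurable (restrict_space lborel {0..T})" for k
    unfolding w_def cnv_def by (intro borel_measurable_power_ennreal borel_measurable_add borel_measurable_nns) measurable
  have flux: "ennreal (cmod (div_flux (u s) (c s) k - div_flux (v s) (d s) k)) \<le> ennreal (2 * pi * sqrt (ksq k)) * w s k"
    if s: "s \<in> {0..T}" for s k
  proof -
    have f: "l2sq (u s) < \<infinity>" "l2sq (v s) < \<infinity>" "l2sq (c s) < \<infinity>"
      using nns_ksq_mono(2)[where u="u s", OF conjunct1[OF u[OF s]] conjunct2[OF u[OF s]]]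
        nns_ksq_mono(2)[where u="v s", OF conjunct1[OF v[OF s]] conjunct2[OF v[OF s]]] c[OF s] by (auto intro: le_less_trans)
    have "ennreal (cmod (div_flux (u s) (c s) k - div_flux (v s) (d s) k))
       \<le> ennreal (cmod (div_flux (\<lambda>k. u s k - v s k) (c s) k)) + ennreal (cmod (div_flux (v s) (\<lambda>k. c s k - d s k) k))"
      unfolding div_flux_difference[OF f(1,2,3) d[OF s]]
      by (simp add: ennreal_plus[symmetric] norm_triangle_ineq ennreal_leI del: ennreal_plus)
    also have "\<dots> \<le> ennreal (2 * pi * sqrt (ksq k)) * w s k"
      unfolding w_def distrib_left by (intro add_mono div_flux_le)
    finally show ?thesis .
  qed
  have coeff: "ennreal ((cmod (c t k - d t k))\<^sup>2) \<le> ennreal (1 / (2 * \<kappa>)) * (\<integral>\<^sup>+s\<in>{0..t}. (w s k)\<^sup>2 \<partial>lborel)" for k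
  proof -
    let ?g = "\<lambda>s. ct s k - dt s k" and ?e = "\<lambda>s. c s k - d s k"
    have ic: "set_integrable lborel {0..s} (\<lambda>s. ct s k)" and id: "set_integrable lborel {0..s} (\<lambda>s. dt s k)"
      and ec: "c s k = c 0 k + (LINT s:{0..s}|lborel. ct s k)" and ed: "d s k = d 0 k + (LINT s:{0..s}|lborel. dt s k)"
      if "s \<in> {0..T}" for s
      using ct[unfolded tderiv_s_def, rule_format, OF that, of k] dt[unfolded tderiv_s_def, rule_format, OF that, of k] by blast+
    have g: "set_integrable lborel {0..t} ?g" by (rule set_integral_diff(1)[OF ic[OF t] id[OF t]])
    have e: "?e s = (LINT r:{0..s}|lborel. ?g r)" if "s \<in> {0..t}" for s
    proof -
      have s: "s \<in> {0..T}" using that t by auto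
      have "?e s = (LINT s:{0..s}|lborel. ct s k) - (LINT s:{0..s}|lborel. dt s k)"
        unfolding ec[OF s] ed[OF s] init by simp
      also have "\<dots> = (LINT r:{0..s}|lborel. ?g r)" by (rule set_integral_diff(2)[OF ic[OF s] id[OF s], symmetric])
      finally show ?thesis .
    qed
    have t0: "t \<ge> 0" using t by simp
    note en = energy_identity[where f="?e", OF g e t0]
    have E: "(cmod (?e t))\<^sup>2 = (LINT s:{0..t}|lborel. 2 * Re (cnj (?e s) * ?g s))" by (rule en(2))
    have "ennreal ((cmod (?e t))\<^sup>2) \<le> (\<integral>\<^sup>+s\<in>{0..t}. ennreal (2 * Re (cnj (?e s) * ?g s)) \<partial>lborel)"
      unfolding E by (rule ennreal_LINT_le[OF en(1)])
    also have "\<dots> \<le> (\<integral>\<^sup>+s\<in>{0..t}. ennreal (1 / (2 * \<kappa>)) * (w s k)\<^sup>2 \<partial>lborel)"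
    proof (rule nn_integral_mono_AE)
      show "AE s in lborel. ennreal (2 * Re (cnj (?e s) * ?g s)) * indicator {0..t} s \<le> ennreal (1 / (2 * \<kappa>)) * (w s k)\<^sup>2 * indicator {0..t} s"
        using ceq deq
      proof eventually_elim
        fix s
        assume a: "s \<in> {0..T} \<longrightarrow> (\<forall>k. ct s k + div_flux (u s) (c s) k = - (\<kappa> * symA k) *\<^sub>R c s k)"
          "s \<in> {0..T} \<longrightarrow> (\<forall>k. dt s k + div_flux (v s) (d s) k = - (\<kappa> * symA k) *\<^sub>R d s k)"
        show "ennreal (2 * Re (cnj (?e s) * ?g s)) * indicator {0..t} s \<le> ennreal (1 / (2 * \<kappa>)) * (w s k)\<^sup>2 * indicator {0..t} s"
        proof (cases "s \<in> {0..t}")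
          case True
          then have s: "s \<in> {0..T}" using t by auto
          have x: "ct s k + div_flux (u s) (c s) k = - (\<kappa> * symA k) *\<^sub>R c s k" and y: "dt s k + div_flux (v s) (d s) k = - (\<kappa> * symA k) *\<^sub>R d s k"
            using a s by blast+
          have "?g s = (ct s k + div_flux (u s) (c s) k) - (dt s k + div_flux (v s) (d s) k) - (div_flux (u s) (c s) k - div_flux (v s) (d s) k)"
            by simp
          also have "\<dots> = - (of_real (\<kappa> * symA k) * ?e s) - (div_flux (u s) (c s) k - div_flux (v s) (d s) k)"
            unfolding x y by (simp add: scaleR_conv_of_real algebra_simps)
          finally have "ennreal (2 * Re (cnj (?e s) * ?g s)) \<le> ennreal (1 / (2 * \<kappa>)) * (w s k)\<^sup>2"
            by (rule young_flux[OF \<kappa> _ flux[OF s]])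
          then show ?thesis using True by simp
        qed simp
      qed
    qed
    also have "\<dots> = ennreal (1 / (2 * \<kappa>)) * (\<integral>\<^sup>+s\<in>{0..t}. (w s k)\<^sup>2 \<partial>lborel)"
      by (rule nn_integral_restrict_cmult[OF wm]) (use t in auto)
    finally show ?thesis .
  qed
  have "sdist (c t) (d t) \<le> ennreal (1 / (2 * \<kappa>)) * nns (\<lambda>k. \<integral>\<^sup>+s\<in>{0..t}. (w s k)\<^sup>2 \<partial>lborel)"
    unfolding sdist_def nns_cmult[symmetric] by (rule nns_mono) (rule coeff)
  also have "nns (\<lambda>k. \<integral>\<^sup>+s\<in>{0..t}. (w s k)\<^sup>2 \<partial>lborel) = (\<integral>\<^sup>+s. nns (\<lambda>k. (w s k)\<^sup>2 * indicator {0..t} s) \<partial>lborel)"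
    by (rule nns_integral_swap[symmetric], rule measurable_restrict_indicator[OF wm]) (use t in auto)
  also have "\<dots> = (\<integral>\<^sup>+s\<in>{0..t}. nns (\<lambda>k. (w s k)\<^sup>2) \<partial>lborel)" by (simp only: nns_multc)
  also have "\<dots> \<le> (\<integral>\<^sup>+s\<in>{0..t}. ennreal (2 * (sk * (M + B))) * (vdist (u s) (v s) + sdist (c s) (d s)) \<partial>lborel)"
  proof (rule nn_integral_mono)
    fix s :: real
    show "nns (\<lambda>k. (w s k)\<^sup>2) * indicator {0..t} s \<le> ennreal (2 * (sk * (M + B))) * (vdist (u s) (v s) + sdist (c s) (d s)) * indicator {0..t} s"
    proof (cases "s \<in> {0..t}")
      case True
      then have s: "s \<in> {0..T}" using t by auto
      let ?a = "cnv (\<lambda>k. ennreal (norm (u s k - v s k))) (mag (c s))"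
      let ?b = "cnv (mag (v s)) (\<lambda>k. ennreal (cmod (c s k - d s k)))"
      have a: "nns (\<lambda>k. (?a k)\<^sup>2) \<le> SK * vdist (u s) (v s) * ennreal M"
        by (rule flux_conv_bound[where u="\<lambda>k. u s k - v s k"]) (use u[OF s] v[OF s] c[OF s] in \<open>auto simp: vdist_def\<close>)
      have b: "nns (\<lambda>k. (?b k)\<^sup>2) \<le> SK * ennreal B * sdist (c s) (d s)"
        by (rule flux_conv_bound[where u="v s" and c="\<lambda>k. c s k - d s k"]) (use v[OF s] in \<open>auto simp: sdist_def\<close>)
      have "nns (\<lambda>k. (w s k)\<^sup>2) \<le> 2 * nns (\<lambda>k. (?a k)\<^sup>2) + 2 * nns (\<lambda>k. (?b k)\<^sup>2)"
        unfolding w_def nns_cmult[symmetric] nns_add[symmetric] by (rule nns_mono) (rule ennreal_sq_add_le)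
      also have "\<dots> \<le> 2 * (SK * vdist (u s) (v s) * ennreal M) + 2 * (SK * ennreal B * sdist (c s) (d s))"
        by (intro add_mono mult_left_mono a b) auto
      also have "\<dots> = 2 * (SK * ennreal M) * vdist (u s) (v s) + 2 * (SK * ennreal B) * sdist (c s) (d s)"
        by (simp only: ac_simps)
      also have "\<dots> \<le> ennreal (2 * (sk * (M + B))) * vdist (u s) (v s) + ennreal (2 * (sk * (M + B))) * sdist (c s) (d s)"
      proof -
        have "2 * (SK * ennreal r) \<le> ennreal (2 * (sk * (M + B)))" if "0 \<le> r" "r \<le> M + B" for r
        proof -
          have "2 * (SK * ennreal r) = ennreal (2 * (sk * r))"
            unfolding sk(1) ennreal_mult[OF sk(2) that(1), symmetric] numeral_mult_ennreal[OF mult_nonneg_nonneg[OF sk(2) that(1)]] ..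
          also have "\<dots> \<le> ennreal (2 * (sk * (M + B)))" using that sk(2) by (intro ennreal_leI mult_left_mono) auto
          finally show ?thesis .
        qed
        then show ?thesis using M B by (intro add_mono mult_right_mono) auto
      qed
      finally show ?thesis using True by (simp add: distrib_left)
    qed simp
  qed
  finally show ?thesis by (simp add: mult_left_mono)
qed

lemma nns_eq_0:
  assumes "nns f = 0"
  shows "f k = 0"
  using nns_ge[of f k] assms by simp

text \<open>A solution records measurability of the velocity's derivative; that of the velocity
  follows because each coefficient is an indefinite integral and hence continuous.\<close>

lemma tderiv_v_meas:
  assumes "tderiv_v T u ut" "T > 0"
  shows "meas_v T u"
  unfolding meas_v_def
proof
  fix k
  have T: "T \<in> {0..T}" using assms(2) by simp
  have "continuous_on {0..T} (\<lambda>t. u 0 k + (LINT s:{0..t}|lborel. ut s k))"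
    using assms(1)[unfolded tderiv_v_def, rule_format, OF T, of k] by (intro continuous_intros continuous_LINT) blast
  then have "continuous_on {0..T} (\<lambda>t. u t k)"
  proof (rule continuous_on_eq)
    fix t assume "t \<in> {0..T}"
    from assms(1)[unfolded tderiv_v_def, rule_format, OF this, of k]
    show "u 0 k + (LINT s:{0..t}|lborel. ut s k) = u t k" by (rule conjE) (erule sym)
  qed
  then have "(\<lambda>t. u t k) \<in> borel_measurable (restrict_space borel {0..T})" by (rule borel_measurable_continuous_on_restrict)
  then show "(\<lambda>t. u t k) \<in> borel_measurable (restrict_space lborel {0..T})" by (simp add: borel_measurable_restrict_space_iff)
qed

text \<open>The sum of both distances satisfies a linear integral inequality with no initial term.
  The solution (u, c) is the one with an explicit L^2 bound of its temperature; the competitor (v,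
  d) is arbitrary.\<close>

theorem solution_unique:
  assumes \<alpha>: "\<alpha> > 0" and \<kappa>: "\<kappa> > 0" and T: "T > 0"
    and s1: "bv_solution \<alpha> \<kappa> u0 \<theta>0 T u c" and s2: "bv_solution \<alpha> \<kappa> u0 \<theta>0 T v d"
    and M: "\<And>t. t \<in> {0..T} \<Longrightarrow> l2sq (c t) \<le> ennreal M" "M \<ge> 0" and t: "t \<in> {0..T}"
  shows "v t = u t" "d t = c t"
proof -
  obtain ut ct where a1: "CT_v T 3 VH3 u" "tderiv_v T u ut" "LinfT_v T 2 DA ut" "L2T_s T 1 (Hs 1) c" "CwT_L2 T c" "tderiv_s T c ct"
    and a2: "AE t in lborel. t \<in> {0..T} \<longrightarrow> (\<forall>k. (1 + \<alpha>\<^sup>2 * symA k) *\<^sub>R ut t k + leray (advect (u t)) k = leray (\<lambda>m. c t m *s e3) k)"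
    and a3: "AE t in lborel. t \<in> {0..T} \<longrightarrow> (\<forall>k. ct t k + div_flux (u t) (c t) k = - (\<kappa> * symA k) *\<^sub>R c t k)"
    and a4: "u 0 = u0" "c 0 = \<theta>0"
    using s1 unfolding bv_solution_def by (elim exE conjE) (rule that)
  obtain vt dt where b1: "CT_v T 3 VH3 v" "tderiv_v T v vt" "LinfT_v T 2 DA vt" "L2T_s T 1 (Hs 1) d" "CwT_L2 T d" "tderiv_s T d dt"
    and b2: "AE t in lborel. t \<in> {0..T} \<longrightarrow> (\<forall>k. (1 + \<alpha>\<^sup>2 * symA k) *\<^sub>R vt t k + leray (advect (v t)) k = leray (\<lambda>m. d t m *s e3) k)"
    and b3: "AE t in lborel. t \<in> {0..T} \<longrightarrow> (\<forall>k. dt t k + div_flux (v t) (d t) k = - (\<kappa> * symA k) *\<^sub>R d t k)"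
    and b4: "v 0 = u0" "d 0 = \<theta>0"
    using s2 unfolding bv_solution_def by (elim exE conjE) (rule that)
  obtain B1 where B1: "B1 \<ge> 0" "\<forall>t\<in>{0..T}. u t 0 = 0 \<and> h2sq (u t) \<le> ennreal B1"
    using velocity_bound[OF T a1(1,2,3)] by blast
  obtain B2 where B2: "B2 \<ge> 0" "\<forall>t\<in>{0..T}. v t 0 = 0 \<and> h2sq (v t) \<le> ennreal B2"
    using velocity_bound[OF T b1(1,2,3)] by blast
  define B where "B = max B1 B2"
  have B: "B \<ge> 0" "ennreal B1 \<le> ennreal B" "ennreal B2 \<le> ennreal B" using B1(1) by (auto simp: B_def intro!: ennreal_leI)
  have uB: "u s 0 = 0 \<and> h2sq (u s) \<le> ennreal B" if "s \<in> {0..T}" for s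
    using B1(2) that B(2) by (blast intro: order_trans)
  have vB: "v s 0 = 0 \<and> h2sq (v s) \<le> ennreal B" if "s \<in> {0..T}" for s
    using B2(2) that B(3) by (blast intro: order_trans)
  have dH: "d s 0 = 0 \<and> l2sq (d s) < \<infinity>" if "s \<in> {0..T}" for s
  proof -
    have "d s \<in> Hs 0" using b1(5) that unfolding CwT_L2_def by blast
    then have "d s 0 = 0" "hs_sq 0 (d s) < \<infinity>" by (auto simp: Hs_def zero_wn)
    then show ?thesis using hs_sq_simps(1)[where c="d s"] by simp
  qed
  have m: "meas_v T u" "meas_v T v" "meas_s T c" "meas_s T d"
    using tderiv_v_meas[OF a1(2) T] tderiv_v_meas[OF b1(2) T] a1(4) b1(4) by (auto simp: L2T_s_def)
  define X where "X s = vdist (u s) (v s) + sdist (c s) (d s)" for s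
  have [measurable]: "(\<lambda>s. u s k) \<in> borel_measurable (restrict_space lborel {0..T})" "(\<lambda>s. v s k) \<in> borel_measurable (restrict_space lborel {0..T})"
    "(\<lambda>s. c s k) \<in> borel_measurable (restrict_space lborel {0..T})" "(\<lambda>s. d s k) \<in> borel_measurable (restrict_space lborel {0..T})" for k
    using m unfolding meas_v_def meas_s_def by blast+
  have Xm: "X \<in> borel_measurable (restrict_space lborel {0..T})"
    unfolding X_def[abs_def] vdist_def sdist_def by (intro borel_measurable_add borel_measurable_nns) measurable
  let ?c1 = "8 * (1 / (4 * pi\<^sup>2 * \<alpha>\<^sup>2))\<^sup>2 * (1 + 16 * pi\<^sup>2 * (sk * B))" and ?c2 = "2 * (sk * (M + B))"
  have c1: "?c1 \<ge> 0" and c2: "?c2 \<ge> 0" using sk(2) B M(2) by auto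
  have V: "vdist (u r) (v r) \<le> ennreal T * (ennreal ?c1 * (\<integral>\<^sup>+s\<in>{0..r}. X s \<partial>lborel))" if r: "r \<in> {0..T}" for r
  proof -
    have i: "set_integrable lborel {0..r} (\<lambda>s. ut s k)" "set_integrable lborel {0..r} (\<lambda>s. vt s k)"
      and e: "u r k = u 0 k + (LINT s:{0..r}|lborel. ut s k)" "v r k = v 0 k + (LINT s:{0..r}|lborel. vt s k)" for k
      using a1(2)[unfolded tderiv_v_def, rule_format, OF r, of k] b1(2)[unfolded tderiv_v_def, rule_format, OF r, of k] by blast+
    have dif: "u r k - v r k = (LINT s:{0..r}|lborel. ut s k - vt s k)" for k
    proof -
      have "u r k - v r k = (LINT s:{0..r}|lborel. ut s k) - (LINT s:{0..r}|lborel. vt s k)"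
        unfolding e a4(1) b4(1) by simp
      also have "\<dots> = (LINT s:{0..r}|lborel. ut s k - vt s k)" by (rule set_integral_diff(2)[OF i, symmetric])
      finally show ?thesis .
    qed
    have "vdist (u r) (v r) \<le> ennreal (r - 0) * (\<integral>\<^sup>+s\<in>{0..r}. vdist (ut s) (vt s) \<partial>lborel)"
      unfolding vdist_def dif
      by (rule weighted_increment_bound[OF set_integral_diff(1)[OF i]]) (use r in auto)
    also have "\<dots> \<le> ennreal T * (\<integral>\<^sup>+s\<in>{0..r}. ennreal ?c1 * X s \<partial>lborel)"
    proof (intro mult_mono nn_integral_mono_AE)
      show "AE s in lborel. vdist (ut s) (vt s) * indicator {0..r} s \<le> ennreal ?c1 * X s * indicator {0..r} s"
        using a2 b2
      proof eventually_elim
        fix s assume x: "s \<in> {0..T} \<longrightarrow> (\<forall>k. (1 + \<alpha>\<^sup>2 * symA k) *\<^sub>R ut s k + leray (advect (u s)) k = leray (\<lambda>m. c s m *s e3) k)"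
          and y: "s \<in> {0..T} \<longrightarrow> (\<forall>k. (1 + \<alpha>\<^sup>2 * symA k) *\<^sub>R vt s k + leray (advect (v s)) k = leray (\<lambda>m. d s m *s e3) k)"
        show "vdist (ut s) (vt s) * indicator {0..r} s \<le> ennreal ?c1 * X s * indicator {0..r} s"
        proof (cases "s \<in> {0..r}")
          case True
          then have s: "s \<in> {0..T}" using r by auto
          have "vdist (ut s) (vt s) \<le> ennreal ?c1 * X s"
            unfolding X_def
            by (rule velocity_rate_difference[where u="u s" and v="v s", OF \<alpha> x[rule_format, OF s] y[rule_format, OF s] conjunct1[OF uB[OF s]] conjunct2[OF uB[OF s]] conjunct1[OF vB[OF s]] conjunct2[OF vB[OF s]] B(1)])
          then show ?thesis using True by simp
        qed simp
      qed
    qed (use r in \<open>auto intro: ennreal_leI\<close>)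
    also have "(\<integral>\<^sup>+s\<in>{0..r}. ennreal ?c1 * X s \<partial>lborel) = ennreal ?c1 * (\<integral>\<^sup>+s\<in>{0..r}. X s \<partial>lborel)"
      by (rule nn_integral_restrict_cmult[OF Xm]) (use r in auto)
    finally show ?thesis .
  qed
  have S: "sdist (c r) (d r) \<le> ennreal (1 / (2 * \<kappa>)) * (ennreal ?c2 * (\<integral>\<^sup>+s\<in>{0..r}. X s \<partial>lborel))" if r: "r \<in> {0..T}" for r
  proof -
    have rT: "r \<le> T" using r by simp
    have "c 0 = d 0" using a4 b4 by simp
    from temperature_difference[OF \<kappa> T B(1) M(2) uB vB M(1) conjunct2[OF dH] m a1(6) b1(6) this a3 b3 r]
    show ?thesis unfolding X_def[symmetric] nn_integral_restrict_cmult[OF Xm rT] by simp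
  qed
  \<comment> \<open>The velocity part carries the factor T from Cauchy-Schwarz in time, the
    temperature part the factor 1/(2 \<kappa>) from Young's inequality.\<close>
  define C where "C = T * ?c1 + 1 / (2 * \<kappa>) * ?c2"
  have p: "0 \<le> T * ?c1" "0 \<le> 1 / (2 * \<kappa>) * ?c2" using T \<kappa> c1 c2 by simp_all
  then have C: "C \<ge> 0" unfolding C_def by (rule add_nonneg_nonneg)
  have XI: "X r \<le> ennreal C * (\<integral>\<^sup>+s\<in>{0..r}. X s \<partial>lborel)" if r: "0 \<le> r" "r \<le> T" for r
  proof -
    have rT: "r \<in> {0..T}" using r by simp
    have "ennreal C = ennreal T * ennreal ?c1 + ennreal (1 / (2 * \<kappa>)) * ennreal ?c2"
      unfolding C_def ennreal_plus[OF p] using T \<kappa> c1 c2 by (simp only: ennreal_mult less_imp_le divide_nonneg_nonneg)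
    then show ?thesis unfolding X_def[of r] using add_mono[OF V[OF rT] S[OF rT]] by (simp only: distrib_right mult.assoc)
  qed
  have Hm: "(\<lambda>s. hs_sq 1 (d s)) \<in> borel_measurable (restrict_space lborel {0..T})"
    unfolding hs_sq_simps(2) by (intro borel_measurable_nns) measurable
  \<comment> \<open>Gronwall's inequality asks for a bounded function, but no explicit uniform L^2
    bound of d is at hand. Square integrability of d in time with values in H^1 makes X integrable,
    and the integral inequality then bounds X itself.\<close>
  have "(\<integral>\<^sup>+s\<in>{0..T}. X s \<partial>lborel) \<le> (\<integral>\<^sup>+s. ennreal (4 * B + 2 * M) * indicator {0..T} s + 2 * (hs_sq 1 (d s) * indicator {0..T} s) \<partial>lborel)"
  proof (rule nn_integral_mono)
    fix s :: real
    show "X s * indicator {0..T} s \<le> ennreal (4 * B + 2 * M) * indicator {0..T} s + 2 * (hs_sq 1 (d s) * indicator {0..T} s)"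
    proof (cases "s \<in> {0..T}")
      case True
      have "vdist (u s) (v s) \<le> 2 * ennreal B + 2 * ennreal B"
        unfolding vdist_def by (rule order_trans[OF nns_weighted_diff]) (use uB[OF True] vB[OF True] in \<open>auto intro!: add_mono mult_left_mono\<close>)
      moreover have "sdist (c s) (d s) \<le> 2 * ennreal M + 2 * hs_sq 1 (d s)"
      proof -
        have "l2sq (d s) \<le> hs_sq 1 (d s)"
          unfolding hs_sq_simps(2)
        proof (rule nns_mono)
          fix k
          show "ennreal ((cmod (d s k))\<^sup>2) \<le> ennreal (ksq k * (cmod (d s k))\<^sup>2)"
            using ksq_ge_1[of k] dH[OF True] mult_right_mono[of 1 "ksq k" "(cmod (d s k))\<^sup>2"] by (cases "k = 0") (auto intro!: ennreal_leI)
        qed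
        then show ?thesis
          using nns_weighted_diff[of "\<lambda>_. 1" "c s" "d s"] M(1)[OF True]
          unfolding sdist_def by (simp add: add_mono mult_left_mono order_trans)
      qed
      ultimately have "X s \<le> (2 * ennreal B + 2 * ennreal B) + (2 * ennreal M + 2 * hs_sq 1 (d s))" unfolding X_def by (rule add_mono)
      also have "\<dots> = ennreal (4 * B + 2 * M) + 2 * hs_sq 1 (d s)"
        using B(1) M(2) by (simp add: numeral_mult_ennreal ennreal_plus[symmetric] add.assoc[symmetric] del: ennreal_plus)
      finally show ?thesis using True by simp
    qed simp
  qed
  also have "\<dots> = ennreal (4 * B + 2 * M) * ennreal T + 2 * (\<integral>\<^sup>+s\<in>{0..T}. hs_sq 1 (d s) \<partial>lborel)"
    using measurable_restrict_indicator[OF Hm order_refl] T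
    by (subst nn_integral_add) (auto simp: nn_integral_cmult)
  also have "\<dots> < top" using b1(4) by (simp add: L2T_s_def ennreal_mult_less_top)
  finally obtain I where I: "(\<integral>\<^sup>+s\<in>{0..T}. X s \<partial>lborel) = ennreal I" "I \<ge> 0" unfolding less_top_ennreal by blast
  have bd: "X r \<le> ennreal (C * I)" if r: "0 \<le> r" "r \<le> T" for r
  proof -
    have "X r \<le> ennreal C * (\<integral>\<^sup>+s\<in>{0..r}. X s \<partial>lborel)" by (rule XI[OF r])
    also have "\<dots> \<le> ennreal C * (\<integral>\<^sup>+s\<in>{0..T}. X s \<partial>lborel)"
      using r by (intro mult_left_mono nn_integral_mono) (auto split: split_indicator)
    also have "\<dots> = ennreal (C * I)" unfolding I using C I(2) by (simp add: ennreal_mult)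
    finally show ?thesis .
  qed
  have "X t = 0" by (rule gronwall_zero[OF XI C bd]) (use C I t in auto)
  then have 0: "vdist (u t) (v t) = 0" "sdist (c t) (d t) = 0" by (auto simp: X_def)
  have "v t k = u t k" for k
    using nns_eq_0[OF 0(1)[unfolded vdist_def], of k] uB[OF t] vB[OF t] by (cases "k = 0") auto
  then show "v t = u t" ..
  have "d t k = c t k" for k using nns_eq_0[OF 0(2)[unfolded sdist_def], of k] by simp
  then show "d t = c t" ..
qed

section \<open>Lebesgue bounds of the temperature\<close>

lemma abs_convex_combination_le:
  fixes t x y :: real
  assumes "t > 0" "t < 1"
  shows "\<bar>(1 - t) *\<^sub>R x + t *\<^sub>R y\<bar> \<le> (1 - t) * \<bar>x\<bar> + t * \<bar>y\<bar>"
  using abs_triangle_ineq[of "(1 - t) * x" "t * y"] assms by (simp add: abs_mult)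

text \<open>Convexity of the power is applied to nonzero absolute values; a vanishing argument is
  treated by (s a)^p \<le> s a^p for 0 < s < 1.\<close>

lemma convex_abs_powr:
  assumes p: "p \<ge> 1"
  shows "convex_on UNIV (\<lambda>x::real. \<bar>x\<bar> powr p)"
proof (rule convex_onI)
  fix t x y :: real assume t: "t > 0" "t < 1"
  have small: "(s * a) powr p \<le> s * a powr p" if "0 < s" "s < 1" "a \<ge> 0" for s a :: real
  proof -
    have "s powr p \<le> s powr 1" using that p by (intro powr_mono') auto
    then show ?thesis using that by (simp add: powr_mult mult_right_mono)
  qed
  have "\<bar>(1 - t) *\<^sub>R x + t *\<^sub>R y\<bar> powr p \<le> ((1 - t) * \<bar>x\<bar> + t * \<bar>y\<bar>) powr p"
    using p abs_convex_combination_le[OF t, of x y] by (intro powr_mono2) auto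
  also have "\<dots> \<le> (1 - t) * \<bar>x\<bar> powr p + t * \<bar>y\<bar> powr p"
  proof (cases "x = 0 \<or> y = 0")
    case True
    then show ?thesis using small[of "1 - t" "\<bar>x\<bar>"] small[of t "\<bar>y\<bar>"] t by auto
  next
    case False
    then show ?thesis using convex_onD[OF powr_convex[OF p], of t "\<bar>x\<bar>" "\<bar>y\<bar>"] t by simp
  qed
  finally show "\<bar>(1 - t) *\<^sub>R x + t *\<^sub>R y\<bar> powr p \<le> (1 - t) * \<bar>x\<bar> powr p + t * \<bar>y\<bar> powr p" .
qed simp

text \<open>The integral of the excess over C vanishes exactly when |f| \<le> C almost everywhere.
  So the bound in the supremum norm is one more convex bound, preserved with the same constant and
  without a limit of exponents.\<close>

lemma convex_abs_excess: "convex_on UNIV (\<lambda>x::real. max 0 (\<bar>x\<bar> - C))"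
proof (rule convex_onI)
  fix t x y :: real assume t: "t > 0" "t < 1"
  have "\<bar>(1 - t) *\<^sub>R x + t *\<^sub>R y\<bar> - C \<le> (1 - t) * (\<bar>x\<bar> - C) + t * (\<bar>y\<bar> - C)"
  proof -
    have "(1 - t) * (\<bar>x\<bar> - C) + t * (\<bar>y\<bar> - C) = (1 - t) * \<bar>x\<bar> + t * \<bar>y\<bar> - C" by (simp add: algebra_simps)
    then show ?thesis using abs_convex_combination_le[OF t, of x y] by linarith
  qed
  also have "\<dots> \<le> (1 - t) * max 0 (\<bar>x\<bar> - C) + t * max 0 (\<bar>y\<bar> - C)"
    using t by (intro add_mono mult_left_mono) auto
  finally show "max 0 (\<bar>(1 - t) *\<^sub>R x + t *\<^sub>R y\<bar> - C) \<le> (1 - t) * max 0 (\<bar>x\<bar> - C) + t * max 0 (\<bar>y\<bar> - C)"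
    using t by simp
qed simp

text \<open>For p at least 2 the inequality y^2 \<le> 1 + |y|^p and the unit volume of the cube
  suffice. A function that witnesses an L^p bound thereby qualifies as initial value of the
  scheme.\<close>

lemma sqint_of_powr:
  assumes f: "f \<in> borel_measurable borel" and p: "p \<ge> 2" and fin: "(\<integral>\<^sup>+x. ennreal (\<bar>f x\<bar> powr p) \<partial>Q) < \<infinity>"
  shows "sqint f"
  unfolding sqint_def
proof (intro conjI f integrableI_bounded)
  have sq: "(\<lambda>x. (f x)\<^sup>2) \<in> borel_measurable borel" using f by measurable
  show "(\<lambda>x. (f x)\<^sup>2) \<in> borel_measurable Q" by (rule meas_Q[OF sq])
  have pw: "(\<lambda>x. ennreal (\<bar>f x\<bar> powr p)) \<in> borel_measurable borel" using f by measurable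
  have le: "y\<^sup>2 \<le> 1 + \<bar>y\<bar> powr p" for y :: real
  proof (cases "\<bar>y\<bar> \<le> 1")
    case True
    then have "y\<^sup>2 \<le> 1" by (simp add: abs_square_le_1)
    then show ?thesis by (simp add: add_increasing2)
  next
    case False
    then have "\<bar>y\<bar> powr 2 \<le> \<bar>y\<bar> powr p" using p by (intro powr_mono) auto
    then show ?thesis using False by (simp add: powr_numeral)
  qed
  have "(\<integral>\<^sup>+x. ennreal (norm ((f x)\<^sup>2)) \<partial>Q) \<le> (\<integral>\<^sup>+x. 1 + ennreal (\<bar>f x\<bar> powr p) \<partial>Q)"
  proof (rule nn_integral_mono)
    fix x
    have "ennreal (norm ((f x)\<^sup>2)) \<le> ennreal (1 + \<bar>f x\<bar> powr p)" by (rule ennreal_leI) (simp add: le)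
    also have "\<dots> = 1 + ennreal (\<bar>f x\<bar> powr p)" by (subst ennreal_plus) simp_all
    finally show "ennreal (norm ((f x)\<^sup>2)) \<le> 1 + ennreal (\<bar>f x\<bar> powr p)" .
  qed
  also have "\<dots> = 1 * emeasure Q (space Q) + (\<integral>\<^sup>+x. ennreal (\<bar>f x\<bar> powr p) \<partial>Q)"
    unfolding nn_integral_add[OF borel_measurable_const meas_Q[OF pw]] nn_integral_const ..
  also have "\<dots> < \<infinity>" unfolding space_Q emeasure_Q using fin by simp
  finally show "(\<integral>\<^sup>+x. ennreal (norm ((f x)\<^sup>2)) \<partial>Q) < \<infinity>" .
qed

lemma Lp_bound_iff:
  "Lp_bound p c C \<longleftrightarrow> (\<exists>f. f \<in> borel_measurable borel \<and> (\<integral>\<^sup>+x. ennreal (\<bar>f x\<bar> powr p) \<partial>Q) \<le> ennreal C \<and> fourier_coeff f = c)"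
proof -
  have "(\<integral>\<^sup>+x\<in>cube. ennreal (\<bar>f x\<bar> powr p) \<partial>lborel) = (\<integral>\<^sup>+x. ennreal (\<bar>f x\<bar> powr p) \<partial>Q)"
    if "f \<in> borel_measurable borel" for f :: "real^3 \<Rightarrow> real"
    by (rule nn_integral_cube) (use that in measurable)
  then show ?thesis unfolding Lp_bound_def by (auto simp: fun_eq_iff)
qed

lemma Linf_bound_iff:
  "Linf_bound c C \<longleftrightarrow> (\<exists>f. f \<in> borel_measurable borel \<and> (AE x in Q. \<bar>f x\<bar> \<le> C) \<and> fourier_coeff f = c)"
proof -
  have "(AE x in lborel. x \<in> cube \<longrightarrow> \<bar>f x\<bar> \<le> C) \<longleftrightarrow> (AE x in Q. \<bar>f x\<bar> \<le> C)"
    if "f \<in> borel_measurable borel" for f :: "real^3 \<Rightarrow> real"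
    by (rule AE_cube) (use that in measurable)
  then show ?thesis unfolding Linf_bound_def by (auto simp: fun_eq_iff)
qed

theorem theorem6p3:
  fixes \<alpha> \<kappa> T :: real and u0 :: vfield and \<theta>0 :: sfield
  assumes "\<alpha> > 0" and "\<kappa> > 0" and "T > 0"
    and "u0 \<in> Vsp \<inter> VH3" and "\<theta>0 \<in> Hs 0"
  shows "\<exists>u \<theta>. bv_solution \<alpha> \<kappa> u0 \<theta>0 T u \<theta> \<and>
           (\<forall>p::real. 2 \<le> p \<longrightarrow> in_Lp p \<theta>0 \<longrightarrow> LinfT_Lp T p \<theta>) \<and>
           (in_Linf \<theta>0 \<longrightarrow> LinfT_Linf T \<theta>) \<and>
           (in_Linf \<theta>0 \<longrightarrow> (\<forall>u' \<theta>'. bv_solution \<alpha> \<kappa> u0 \<theta>0 T u' \<theta>' \<longrightarrow>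
                (\<forall>t\<in>{0..T}. u' t = u t \<and> \<theta>' t = \<theta> t)))"
proof -
  have z: "\<theta>0 0 = 0" and u0: "u0 \<in> VH3" using assms(4,5) by (auto simp: Hs_def zero_wn)
  from riesz_fischer[OF assms(5)] obtain f0 where f0: "sqint f0" "fourier_coeff f0 = \<theta>0" by blast
  have z0: "fourier_coeff f0 0 = 0" unfolding f0(2) by (rule z)
  from solution_exists[OF assms(1-3) u0 f0(1) z0] obtain u \<theta> M where
    L: "bv_solution \<alpha> \<kappa> u0 (fourier_coeff f0) T u \<theta> \<and> (\<forall>t\<in>{0..T}. l2sq (\<theta> t) \<le> ennreal M) \<and>
    (\<forall>t\<in>{0..T}. \<forall>\<phi>. convex_on UNIV \<phi> \<longrightarrow> (\<forall>x. \<phi> x \<ge> 0) \<longrightarrow>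
       (\<exists>g. sqint g \<and> fourier_coeff g = \<theta> t \<and> (\<integral>\<^sup>+x. ennreal (\<phi> (g x)) \<partial>Q) \<le> (\<integral>\<^sup>+x. ennreal (\<phi> (f0 x)) \<partial>Q)))"
    by (elim exE) (rule that)
  have sol: "bv_solution \<alpha> \<kappa> u0 \<theta>0 T u \<theta>" using L unfolding f0(2) by (rule conjunct1)
  have M: "l2sq (\<theta> t) \<le> ennreal (max 0 M)" if "t \<in> {0..T}" for t
    using bspec[OF conjunct1[OF conjunct2[OF L]] that] by (rule order_trans) (simp add: ennreal_leI)
  have uniq: "u' t = u t \<and> \<theta>' t = \<theta> t" if "bv_solution \<alpha> \<kappa> u0 \<theta>0 T u' \<theta>'" "t \<in> {0..T}" for u' \<theta>' t
    using solution_unique[OF assms(1-3) sol that(1) M max.cobounded1 that(2)] by blast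
  have convex: "\<exists>g. sqint g \<and> fourier_coeff g = \<theta> t \<and> (\<integral>\<^sup>+x. ennreal (\<phi> (g x)) \<partial>Q) \<le> (\<integral>\<^sup>+x. ennreal (\<phi> (f x)) \<partial>Q)"
    if f: "sqint f" "fourier_coeff f = \<theta>0" and \<phi>: "convex_on UNIV \<phi>" "\<And>x. \<phi> x \<ge> 0" and t: "t \<in> {0..T}" for f \<phi> t
  proof -
    have zf: "fourier_coeff f 0 = 0" unfolding f(2) by (rule z)
    from solution_exists[OF assms(1-3) u0 f(1) zf] obtain u' \<theta>' M' where
      L': "bv_solution \<alpha> \<kappa> u0 (fourier_coeff f) T u' \<theta>' \<and> (\<forall>t\<in>{0..T}. l2sq (\<theta>' t) \<le> ennreal M') \<and>
      (\<forall>t\<in>{0..T}. \<forall>\<phi>. convex_on UNIV \<phi> \<longrightarrow> (\<forall>x. \<phi> x \<ge> 0) \<longrightarrow>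
         (\<exists>g. sqint g \<and> fourier_coeff g = \<theta>' t \<and> (\<integral>\<^sup>+x. ennreal (\<phi> (g x)) \<partial>Q) \<le> (\<integral>\<^sup>+x. ennreal (\<phi> (f x)) \<partial>Q)))"
      by (elim exE) (rule that)
    have "bv_solution \<alpha> \<kappa> u0 \<theta>0 T u' \<theta>'" using L' unfolding f(2) by (rule conjunct1)
    then have "\<theta>' t = \<theta> t" using uniq t by blast
    moreover have "\<forall>x. \<phi> x \<ge> 0" using \<phi>(2) by blast
    ultimately show ?thesis using mp[OF mp[OF spec[OF bspec[OF conjunct2[OF conjunct2[OF L']] t], of \<phi>] \<phi>(1)]] by simp
  qed
  have Lp: "LinfT_Lp T p \<theta>" if p: "2 \<le> p" and in_p: "in_Lp p \<theta>0" for p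
  proof -
    obtain C f where f: "f \<in> borel_measurable borel" "(\<integral>\<^sup>+x. ennreal (\<bar>f x\<bar> powr p) \<partial>Q) \<le> ennreal C" "fourier_coeff f = \<theta>0"
      using in_p unfolding in_Lp_def Lp_bound_iff by blast
    have "sqint f" by (rule sqint_of_powr[OF f(1) p le_less_trans[OF f(2)]]) simp
    have "Lp_bound p (\<theta> t) C" if "t \<in> {0..T}" for t
    proof -
      have "convex_on UNIV (\<lambda>x::real. \<bar>x\<bar> powr p)" using p by (intro convex_abs_powr) simp
      from convex[OF \<open>sqint f\<close> f(3) this _ that] obtain g where "sqint g" "fourier_coeff g = \<theta> t"
        "(\<integral>\<^sup>+x. ennreal (\<bar>g x\<bar> powr p) \<partial>Q) \<le> (\<integral>\<^sup>+x. ennreal (\<bar>f x\<bar> powr p) \<partial>Q)" by auto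
      then show ?thesis unfolding Lp_bound_iff using f(2) by (intro exI[of _ g]) (simp add: sqint_def)
    qed
    then show ?thesis unfolding LinfT_Lp_def by (intro exI[of _ C] AE_I2 impI)
  qed
  have Linf: "LinfT_Linf T \<theta>" if in_inf: "in_Linf \<theta>0"
  proof -
    obtain C f where f: "f \<in> borel_measurable borel" "AE x in Q. \<bar>f x\<bar> \<le> C" "fourier_coeff f = \<theta>0"
      using in_inf unfolding in_Linf_def Linf_bound_iff by blast
    have "(\<integral>\<^sup>+x. ennreal (\<bar>f x\<bar> powr 2) \<partial>Q) \<le> (\<integral>\<^sup>+x. ennreal (\<bar>C\<bar> powr 2) \<partial>Q)"
    proof (rule nn_integral_mono_AE)
      show "AE x in Q. ennreal (\<bar>f x\<bar> powr 2) \<le> ennreal (\<bar>C\<bar> powr 2)"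
        using f(2) by eventually_elim (intro ennreal_leI powr_mono2, auto)
    qed
    also have "\<dots> < \<infinity>" by (simp only: nn_integral_const space_Q emeasure_Q) simp
    finally have "sqint f" by (rule sqint_of_powr[OF f(1) order_refl])
    have "AE x in Q. ennreal (max 0 (\<bar>f x\<bar> - C)) = 0" using f(2) by eventually_elim simp
    then have "(\<integral>\<^sup>+x. ennreal (max 0 (\<bar>f x\<bar> - C)) \<partial>Q) = (\<integral>\<^sup>+x. 0 \<partial>Q)" by (rule nn_integral_cong_AE)
    then have zero: "(\<integral>\<^sup>+x. ennreal (max 0 (\<bar>f x\<bar> - C)) \<partial>Q) = 0" by (simp only: nn_integral_const mult_zero_left)
    have "Linf_bound (\<theta> t) C" if "t \<in> {0..T}" for t
    proof -
      have "\<exists>g. sqint g \<and> fourier_coeff g = \<theta> t \<and> (\<integral>\<^sup>+x. ennreal (max 0 (\<bar>g x\<bar> - C)) \<partial>Q) \<le> 0"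
        unfolding zero[symmetric] by (rule convex[OF \<open>sqint f\<close> f(3) convex_abs_excess _ that]) (rule max.cobounded1)
      then obtain g where g: "sqint g" "fourier_coeff g = \<theta> t" "(\<integral>\<^sup>+x. ennreal (max 0 (\<bar>g x\<bar> - C)) \<partial>Q) = 0"
        unfolding le_zero_eq by blast
      have gm: "g \<in> borel_measurable borel" using g(1) by (simp add: sqint_def)
      then have "(\<lambda>x. ennreal (max 0 (\<bar>g x\<bar> - C))) \<in> borel_measurable borel" by measurable
      then have "AE x in Q. ennreal (max 0 (\<bar>g x\<bar> - C)) = 0"
        using g(3) by (subst (asm) nn_integral_0_iff_AE[OF meas_Q])
      then have "AE x in Q. \<bar>g x\<bar> \<le> C" by eventually_elim (simp add: ennreal_eq_0_iff)
      then show ?thesis unfolding Linf_bound_iff using gm g(2) by blast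
    qed
    then show ?thesis unfolding LinfT_Linf_def by (intro exI[of _ C] AE_I2 impI)
  qed
  show ?thesis using sol Lp Linf uniq by (intro exI[of _ u] exI[of _ \<theta>]) blast
qed

end
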